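(* Let $s > 0$ and $m\in\mathbf{R}$. If $u \in \mathscr{S}'(\mathbf{R}^d)$ and $a \in G^{m,s}$, then for any $m_1 \leq m$ $$\mathrm{WF}_{\mathrm g}^{s} (u) \subseteq \mathrm{WF}_{\mathrm g}^{s} ( a^w(x,D) u ) \cup \mathrm{char}_{s,m_1}(a).$$
   Context: Identify $T^*\mathbf{R}^d$ with $\mathbf{R}^{2d}$, and set $\mu_s(x,\xi)=1+|x|+|\xi|^{1/s}$ for $s>0$. Anisotropic Shubin symbols: for $s>0$, $m\in\mathbf{R}$, $G^{m,s}$ is the space of $a\in C^\infty(\mathbf{R}^{2d})$ such that for all $\alpha,\beta\in\mathbf{N}^d$ there is $C_{\alpha,\beta}>0$ with $|\partial_x^\alpha\partial_\xi^\beta a(x,\xi)|\leq C_{\alpha,\beta}\,\mu_s(x,\xi)^{m-|\alpha|-s|\beta|}$ for all $(x,\xi)\in\mathbf{R}^{2d}$. Projection: for $(x,\xi)\in\mathbf{R}^{2d}\setminus 0$ let $\lambda_s(x,\xi)>0$ be the unique number with $\lambda_s(x,\xi)^{-2}|x|^2+\lambda_s(x,\xi)^{-2s}|\xi|^2=1$, and let $p(x,\xi)=(\lambda_s(x,\xi)^{-1}x,\lambda_s(x,\xi)^{-s}\xi)\in\mathbf{S}^{2d-1}$ (unit sphere). For $w_0\in\mathbf{S}^{2d-1}$ and $\varepsilon>0$ let $\Gamma_{s,w_0,\varepsilon}=\{z\in\mathbf{R}^{2d}\setminus 0:\ |w_0-p(z)|<\varepsilon\}$. Characteristic set: let $a\in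 G^{m,s}$ and $m_1\leq m$. A point $z_0\in\mathbf{R}^{2d}\setminus 0$ is non-characteristic of order $m_1$, written $z_0\notin\mathrm{char}_{s,m_1}(a)$, if there exist $\varepsilon>0$ and $C,R>0$ such that with $\Gamma=\Gamma_{s,p(z_0),\varepsilon}$: (1) $|a(x,\xi)|\geq C\mu_s(x,\xi)^{m_1}$ for $(x,\xi)\in\Gamma$, $|x|+|\xi|^{1/s}\geq R$; and (2) for all $\alpha,\beta\in\mathbf{N}^d$ there is $C_{\alpha,\beta}>0$ with $|\partial_x^\alpha\partial_\xi^\beta a(x,\xi)|\leq C_{\alpha,\beta}|a(x,\xi)|\mu_s(x,\xi)^{-|\alpha|-s|\beta|}$ for $(x,\xi)\in\Gamma$, $|x|+|\xi|^{1/s}\geq R$. Thus $\mathrm{char}_{s,m_1}(a)\subseteq T^*\mathbf{R}^d\setminus 0$ is the set of points that are not non-characteristic of order $m_1$. Weyl quantization: $a^w(x,D)f(x) = (2\pi)^{-d}\int_{\mathbf{R}^{2d}} e^{i\langle x-y,\xi\rangle} a\left(\frac{x+y}{2},\xi\right) f(y)\,dy\,d\xi$ for $f\in\mathscr{S}(\mathbf{R}^d)$ (oscillatory integral). It acts continuously on $\mathscr{S}(\mathbf{R}^d)$ and extends by duality to $\mathscr{S}'(\mathbf{R}^d)$: $(a^w(x,D)u,f) = (u,\overline{a}^w(x,D)f)$ for $f\in\mathscr{S}(\mathbf{R}^d)$. Here $(u,f)$ is the action of $u\in\mathscr{S}'$ on $f\in\mathscr{S}$ that is conjugate linear in $f$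 and consistent with the $L^2$ inner product. Short-time Fourier transform: for $u \in \mathscr{S}'(\mathbf{R}^d)$ and $\varphi\in\mathscr{S}(\mathbf{R}^d)\setminus\{0\}$, $V_\varphi u(x,\xi) = (2\pi)^{-d/2}(u, M_\xi T_x\varphi)$, where $T_x f(y)=f(y-x)$ and $M_\xi f(y)=e^{i\langle y,\xi\rangle}f(y)$. Anisotropic $s$-Gabor wave front set: for $s>0$ and $u\in\mathscr{S}'(\mathbf{R}^d)$, $\mathrm{WF}_{\mathrm g}^s(u)\subseteq T^*\mathbf{R}^d\setminus 0$ is defined by: a point $z_0\in T^*\mathbf{R}^d\setminus 0$ satisfies $z_0\notin \mathrm{WF}_{\mathrm g}^s(u)$ if there is an open set $U\subseteq T^*\mathbf{R}^d$ with $z_0\in U$ and $\sup_{(x,\xi)\in U,\ \lambda>0}\lambda^N|V_\varphi u(\lambda x,\lambda^s\xi)|<\infty$ for all $N\geq 0$. Here $\varphi\in\mathscr{S}(\mathbf{R}^d)\setminus\{0\}$ is a fixed window; the set does not depend on the choice of $\varphi$. *)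

theory Defs
  imports "HOL-Analysis.Analysis"
begin

section \<open>Partial derivatives and smooth functions\<close>

definition partial_deriv :: "'a::euclidean_space \<Rightarrow> ('a \<Rightarrow> complex) \<Rightarrow> 'a \<Rightarrow> complex" where
  "partial_deriv b f x = vector_derivative (\<lambda>t. f (x + t *\<^sub>R b)) (at 0)"

text \<open>Smoothness: every iterated partial derivative, with the coordinates taken in any order, is
  (Frechet) differentiable. In particular all of them exist and are continuous.\<close>

definition smooth :: "('a::euclidean_space \<Rightarrow> complex) \<Rightarrow> bool" where
  "smooth f \<longleftrightarrow>
     (\<forall>bs. set bs \<subseteq> Basis \<longrightarrow> foldr partial_deriv bs f differentiable_on UNIV)"

text \<open>A multi-index on \<open>'a\<close> is a function \<open>\<alpha> :: 'a \<Rightarrow> nat\<close> of which only the values on \<open>Basis\<close>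
  matter. A type of class \<open>euclidean_space\<close> has no canonical order of its coordinates, so
  one is chosen to write \<open>\<partial>\<^sup>\<alpha>\<close> as an ordered composition. On smooth functions partial
  derivatives commute and the choice is irrelevant.\<close>

definition basis_list :: "'a::euclidean_space list" where
  "basis_list = (SOME bs. distinct bs \<and> set bs = Basis)"

definition multi_deriv ::
    "('a::euclidean_space \<Rightarrow> nat) \<Rightarrow> ('a \<Rightarrow> complex) \<Rightarrow> 'a \<Rightarrow> complex" where
  "multi_deriv \<alpha> f = foldr (\<lambda>b. partial_deriv b ^^ \<alpha> b) basis_list f"

definition multi_order :: "('a::euclidean_space \<Rightarrow> nat) \<Rightarrow> nat" where
  "multi_order \<alpha> = (\<Sum>b\<in>Basis. \<alpha> b)"

text \<open>The derivative \<open>\<partial>\<^sub>x\<^sup>\<alpha> \<partial>\<^sub>\<xi>\<^sup>\<beta> a\<close> of a function on phase space.\<close>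

definition phase_deriv ::
    "('a::euclidean_space \<Rightarrow> nat) \<Rightarrow> ('b::euclidean_space \<Rightarrow> nat) \<Rightarrow> ('a \<times> 'b \<Rightarrow> complex)
      \<Rightarrow> 'a \<times> 'b \<Rightarrow> complex" where
  "phase_deriv \<alpha> \<beta> a =
     (\<lambda>(x, \<xi>). multi_deriv \<alpha> (\<lambda>x'. multi_deriv \<beta> (\<lambda>\<xi>'. a (x', \<xi>')) \<xi>) x)"

section \<open>Schwartz functions and tempered distributions\<close>

definition schwartz :: "('a::euclidean_space \<Rightarrow> complex) \<Rightarrow> bool" where
  "schwartz f \<longleftrightarrow>
     smooth f \<and> (\<forall>(k::nat) \<alpha>. bdd_above (range (\<lambda>x. (1 + norm x) ^ k * norm (multi_deriv \<alpha> f x))))"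

definition schwartz_seminorm ::
    "nat \<Rightarrow> ('a::euclidean_space \<Rightarrow> nat) \<Rightarrow> ('a \<Rightarrow> complex) \<Rightarrow> real" where
  "schwartz_seminorm k \<alpha> f = (SUP x. (1 + norm x) ^ k * norm (multi_deriv \<alpha> f x))"

text \<open>The Frechet topology of the Schwartz space, whose carrier is the set of Schwartz functions:
  the open seminorm balls form a subbase.\<close>

definition schwartz_topology :: "('a::euclidean_space \<Rightarrow> complex) topology" where
  "schwartz_topology = topology_generated_by
     {{g. schwartz g \<and> schwartz_seminorm k \<alpha> (\<lambda>x. g x - f x) < e} | f k \<alpha> e. schwartz f \<and> 0 < e}"

text \<open>A tempered distribution \<open>u\<close> is represented by its conjugate linear action \<open>f \<mapsto> (u, f)\<close>, the one
  consistent with the inner product \<open>(u, f) = \<integral> u(x) cnj (f x) dx\<close>. Values of \<open>u\<close> on functions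
  that are not Schwartz functions are irrelevant.\<close>

definition tempered_distribution :: "(('a::euclidean_space \<Rightarrow> complex) \<Rightarrow> complex) \<Rightarrow> bool" where
  "tempered_distribution u \<longleftrightarrow>
     (\<forall>f g. schwartz f \<longrightarrow> schwartz g \<longrightarrow> u (\<lambda>x. f x + g x) = u f + u g) \<and>
     (\<forall>c f. schwartz f \<longrightarrow> u (\<lambda>x. c * f x) = cnj c * u f) \<and>
     continuous_map schwartz_topology euclidean u"

section \<open>Anisotropic Shubin symbols and characteristic sets\<close>

definition mu :: "real \<Rightarrow> (real^'d) \<times> (real^'d) \<Rightarrow> real" where
  "mu s = (\<lambda>(x, \<xi>). 1 + norm x + norm \<xi> powr (1 / s))"

definition shubin_symbols :: "real \<Rightarrow> real \<Rightarrow> ((real^'d) \<times> (real^'d) \<Rightarrow> complex) set" where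
  "shubin_symbols m s = {a. smooth a \<and>
     (\<forall>\<alpha> \<beta>. \<exists>C>0. \<forall>z. norm (phase_deriv \<alpha> \<beta> a z)
        \<le> C * mu s z powr (m - real (multi_order \<alpha>) - s * real (multi_order \<beta>)))}"

definition lambda_s :: "real \<Rightarrow> (real^'d) \<times> (real^'d) \<Rightarrow> real" where
  "lambda_s s = (\<lambda>(x, \<xi>). THE l. l > 0 \<and>
     l powr (- 2) * (norm x)\<^sup>2 + l powr (- 2 * s) * (norm \<xi>)\<^sup>2 = 1)"

definition sphere_proj :: "real \<Rightarrow> (real^'d) \<times> (real^'d) \<Rightarrow> (real^'d) \<times> (real^'d)" where
  "sphere_proj s = (\<lambda>(x, \<xi>).
     (lambda_s s (x, \<xi>) powr (- 1) *\<^sub>R x, lambda_s s (x, \<xi>) powr (- s) *\<^sub>R \<xi>))"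

definition aniso_cone ::
    "real \<Rightarrow> (real^'d) \<times> (real^'d) \<Rightarrow> real \<Rightarrow> ((real^'d) \<times> (real^'d)) set" where
  "aniso_cone s w0 \<epsilon> = {z. z \<noteq> 0 \<and> norm (w0 - sphere_proj s z) < \<epsilon>}"

definition noncharacteristic ::
    "real \<Rightarrow> real \<Rightarrow> ((real^'d) \<times> (real^'d) \<Rightarrow> complex) \<Rightarrow> (real^'d) \<times> (real^'d) \<Rightarrow> bool" where
  "noncharacteristic s m1 a z0 \<longleftrightarrow>
     (\<exists>\<epsilon> C R. \<epsilon> > 0 \<and> C > 0 \<and> R > 0 \<and>
       (\<forall>(x, \<xi>) \<in> aniso_cone s (sphere_proj s z0) \<epsilon>. norm x + norm \<xi> powr (1 / s) \<ge> R \<longrightarrow>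
          norm (a (x, \<xi>)) \<ge> C * mu s (x, \<xi>) powr m1) \<and>
       (\<forall>\<alpha> \<beta>. \<exists>C'>0. \<forall>(x, \<xi>) \<in> aniso_cone s (sphere_proj s z0) \<epsilon>.
          norm x + norm \<xi> powr (1 / s) \<ge> R \<longrightarrow>
          norm (phase_deriv \<alpha> \<beta> a (x, \<xi>))
            \<le> C' * norm (a (x, \<xi>)) * mu s (x, \<xi>) powr
                (- real (multi_order \<alpha>) - s * real (multi_order \<beta>))))"

definition char_set ::
    "real \<Rightarrow> real \<Rightarrow> ((real^'d) \<times> (real^'d) \<Rightarrow> complex) \<Rightarrow> ((real^'d) \<times> (real^'d)) set" where
  "char_set s m1 a = {z. z \<noteq> 0 \<and> \<not> noncharacteristic s m1 a z}"

section \<open>Weyl quantization\<close>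

text \<open>The oscillatory integral of \<open>F\<close> is the limit of the integrals of \<open>\<psi>(\<epsilon> z) F(z)\<close>
  as \<open>\<epsilon> \<rightarrow> 0\<close>, required to be the same for all Schwartz cut-offs \<open>\<psi>\<close> with \<open>\<psi>(0) = 1\<close>.\<close>

definition oscillatory_integral :: "('a::euclidean_space \<Rightarrow> complex) \<Rightarrow> complex" where
  "oscillatory_integral F = (THE L. \<forall>\<psi>. schwartz \<psi> \<longrightarrow> \<psi> 0 = 1 \<longrightarrow>
     ((\<lambda>\<epsilon>. integral\<^sup>L lborel (\<lambda>z. \<psi> (\<epsilon> *\<^sub>R z) * F z)) \<longlongrightarrow> L) (at_right 0))"

definition weyl_op ::
    "((real^'d) \<times> (real^'d) \<Rightarrow> complex) \<Rightarrow> (real^'d \<Rightarrow> complex) \<Rightarrow> real^'d \<Rightarrow> complex" where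
  "weyl_op a f x = of_real ((2 * pi) powr (- real CARD('d))) *
     oscillatory_integral (\<lambda>(y :: real^'d, \<xi>).
       exp (\<i> * of_real ((x - y) \<bullet> \<xi>)) * a ((x + y) /\<^sub>R 2, \<xi>) * f y)"

definition weyl_dist ::
    "((real^'d) \<times> (real^'d) \<Rightarrow> complex) \<Rightarrow> ((real^'d \<Rightarrow> complex) \<Rightarrow> complex)
      \<Rightarrow> (real^'d \<Rightarrow> complex) \<Rightarrow> complex" where
  "weyl_dist a u f = u (weyl_op (\<lambda>z. cnj (a z)) f)"

section \<open>Short-time Fourier transform and Gabor wave front set\<close>

definition translation :: "real^'d \<Rightarrow> (real^'d \<Rightarrow> complex) \<Rightarrow> real^'d \<Rightarrow> complex" where
  "translation x f = (\<lambda>y. f (y - x))"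

definition modulation :: "real^'d \<Rightarrow> (real^'d \<Rightarrow> complex) \<Rightarrow> real^'d \<Rightarrow> complex" where
  "modulation \<xi> f = (\<lambda>y. exp (\<i> * of_real (y \<bullet> \<xi>)) * f y)"

definition stft ::
    "(real^'d \<Rightarrow> complex) \<Rightarrow> ((real^'d \<Rightarrow> complex) \<Rightarrow> complex) \<Rightarrow> (real^'d) \<times> (real^'d) \<Rightarrow> complex" where
  "stft \<phi> u = (\<lambda>(x, \<xi>).
     of_real ((2 * pi) powr (- real CARD('d) / 2)) * u (modulation \<xi> (translation x \<phi>)))"

text \<open>The window \<open>\<phi>\<close> is kept as a parameter. It is meant to be a nonzero Schwartz function; the set
  is the same for all of them when \<open>u\<close> is a tempered distribution.\<close>

definition gabor_WF ::
    "(real^'d \<Rightarrow> complex) \<Rightarrow> real \<Rightarrow> ((real^'d \<Rightarrow> complex) \<Rightarrow> complex)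
      \<Rightarrow> ((real^'d) \<times> (real^'d)) set" where
  "gabor_WF \<phi> s u = {z0. z0 \<noteq> 0 \<and>
     \<not> (\<exists>U. open U \<and> z0 \<in> U \<and>
         (\<forall>N::real. N \<ge> 0 \<longrightarrow>
            (\<exists>B. \<forall>(x, \<xi>) \<in> U. \<forall>t>0. t powr N * norm (stft \<phi> u (t *\<^sub>R x, t powr s *\<^sub>R \<xi>)) \<le> B)))}"

end

theory Submission
  imports Defs "HOL-Probability.Probability"
begin

text \<open>Up to a constant, the short-time Fourier transform of \<open>u\<close> at \<open>z\<close> is \<open>u (phase_shift z \<phi>)\<close>,
  where \<open>phase_shift z\<close> is the time-frequency shift by \<open>z\<close>. A point \<open>z0\<close> therefore lies outside
  the wave front set of \<open>u\<close> when \<open>u (phase_shift (dilate s t z) \<phi>)\<close> decreases rapidly in \<open>t\<close>,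
  uniformly for \<open>z\<close> near \<open>z0\<close>. Suppose that this holds for the distribution \<open>weyl_dist a u\<close> and
  that \<open>z0\<close> is non-characteristic.

  The proof constructs neither a parametrix nor a composition of Weyl symbols. The distribution
  \<open>weyl_dist a u\<close> acts by applying the Weyl operator of the conjugate symbol to the test
  function, and Weyl operators are covariant: moving a time-frequency shift by \<open>z\<close> to the left
  through the operator translates the symbol by \<open>z\<close> (\<open>weyl_int_phase_shift\<close>). A Taylor expansion
  of the translated symbol around \<open>z\<close> gives (\<open>weyl_dist_expansion\<close>), up to powers of \<open>2 \<pi>\<close>,

    \<open>(a\<^sup>w u)(\<pi>(z) f) = a(z) u(\<pi>(z) f) + \<Sum>\<^sub>\<alpha> (1/\<alpha>!) \<partial>\<^sup>\<alpha>a(z) u(\<pi>(z) P\<^sub>\<alpha> f) + u(\<pi>(z) R\<^sub>z f)\<close>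

  where \<open>\<pi>(z)\<close> is \<open>phase_shift z\<close>, the sum is over \<open>0 < |\<alpha>| \<le> K\<close>, \<open>P\<^sub>\<alpha>\<close> is the Weyl operator
  with the monomial \<open>w\<^sup>\<alpha>\<close> as symbol and \<open>R\<^sub>z\<close> the one with the Taylor remainder. Now divide by
  \<open>a(z)\<close> at \<open>dilate s t z\<close>, for \<open>z\<close> near \<open>z0\<close> and \<open>t\<close> large. The lower bound on \<open>a\<close> costs a
  fixed power of \<open>t\<close>, which does not harm the rapidly decreasing left-hand side, nor the
  remainder if the expansion is long enough (\<open>taylor_rem_shubin\<close>). By the second condition in
  the definition of non-characteristic points, the quotients of \<open>\<partial>\<^sup>\<alpha> a\<close> by \<open>a\<close> are bounded by
  powers of \<open>t\<close> with exponent \<open>- min 1 s\<close> or less. So if \<open>u (phase_shift (dilate s t z) g)\<close> is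
  \<open>O(t powr q)\<close> for all functions \<open>g\<close> of a class that is stable under the operators \<open>P\<^sub>\<alpha>\<close>, it is
  even \<open>O(t powr (q - min 1 s))\<close> for them, on the same neighbourhood (\<open>elliptic_gain\<close>).
  Temperedness of \<open>u\<close> provides some \<open>q\<close> to begin with, and iteration proves the theorem.

  The operators \<open>P\<^sub>\<alpha>\<close> are differential operators with polynomial coefficients, so the class
  generated by \<open>\<phi>\<close> under differentiation and multiplication by coordinates is stable
  (\<open>window_class_weyl\<close>). The argument needs rapid decay of \<open>weyl_dist a u\<close> for every function of
  this class in place of \<open>\<phi>\<close>. It follows from the decay for \<open>\<phi>\<close>, because derivatives and
  coordinate multiples of \<open>\<phi>\<close> are limits of difference quotients of time-frequency shifts of \<open>\<phi>\<close>
  (\<open>rapid_decay_difference_quotient\<close>).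

  The Weyl operator itself is treated as the iterated integral \<open>weyl_int\<close>. The cut-offs of the
  oscillatory integral converge to 1 at a definite rate in the weighted norms that control the
  iterated integral, so both agree (\<open>weyl_op_eq\<close>). Its mapping properties rest on commutation
  relations with coordinates and derivatives. These are obtained by comparing the first order
  terms on both sides of an invariance of the integral under translations
  (\<open>bilinear_first_order_identity\<close>).\<close>

section \<open>Calculus of iterated partial derivatives\<close>

lemma partial_deriv_eqI:
  assumes "(f has_derivative f') (at x)"
  shows "partial_deriv b f x = f' b"
proof -
  have "((\<lambda>t. x + t *\<^sub>R b) has_derivative (\<lambda>t. t *\<^sub>R b)) (at (0::real))"
    by (auto intro!: derivative_eq_intros)
  then have "((\<lambda>t. f (x + t *\<^sub>R b)) has_derivative (\<lambda>t. f' (t *\<^sub>R b))) (at (0::real))"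
    using has_derivative_compose[of "\<lambda>t. x + t *\<^sub>R b" "\<lambda>t. t *\<^sub>R b" 0 UNIV f f'] assms by simp
  moreover have "f' (t *\<^sub>R b) = t *\<^sub>R f' b" for t
    using assms has_derivative_bounded_linear linear_simps(5) by blast
  ultimately have "((\<lambda>t. f (x + t *\<^sub>R b)) has_vector_derivative f' b) (at 0)"
    by (simp add: has_vector_derivative_def)
  then show ?thesis
    unfolding partial_deriv_def by (rule vector_derivative_at)
qed

lemma differentiable_has_derivative:
  fixes f :: "'a::euclidean_space \<Rightarrow> complex"
  assumes "f differentiable (at x)"
  shows "(f has_derivative (\<lambda>v. \<Sum>b\<in>Basis. of_real (v \<bullet> b) * partial_deriv b f x)) (at x)"
proof -
  obtain f' where f': "(f has_derivative f') (at x)"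
    using assms unfolding differentiable_def by blast
  have "f' v = (\<Sum>b\<in>Basis. of_real (v \<bullet> b) * partial_deriv b f x)" for v
  proof -
    have "f' v = f' (\<Sum>b\<in>Basis. (v \<bullet> b) *\<^sub>R b)"
      by (simp add: euclidean_representation)
    also have "\<dots> = (\<Sum>b\<in>Basis. (v \<bullet> b) *\<^sub>R f' b)"
      using has_derivative_bounded_linear[OF f'] by (simp add: linear_simps linear_sum bounded_linear.linear)
    finally show ?thesis
      using partial_deriv_eqI[OF f'] by (simp add: scaleR_conv_of_real)
  qed
  then have "f' = (\<lambda>v. \<Sum>b\<in>Basis. of_real (v \<bullet> b) * partial_deriv b f x)" by blast
  with f' show ?thesis by simp
qed

text \<open>The recursive description of smoothness, on which all inductions over derivatives are
  based: \<open>foldr\<close> applies the last list entry first, hence a first derivative splits off at the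
  end of the list.\<close>

lemma smooth_iff:
  "smooth f \<longleftrightarrow> f differentiable_on UNIV \<and> (\<forall>b\<in>Basis. smooth (partial_deriv b f))"
proof (intro iffI conjI ballI)
  assume f: "smooth f"
  show "f differentiable_on UNIV"
    using f unfolding smooth_def by (metis empty_iff foldr_Nil id_apply list.set(1) subsetI)
  show "smooth (partial_deriv b f)" if "b \<in> Basis" for b
    unfolding smooth_def
  proof (intro allI impI)
    fix bs :: "'a list" assume "set bs \<subseteq> Basis"
    then have "set (bs @ [b]) \<subseteq> Basis" using that by auto
    then have "foldr partial_deriv (bs @ [b]) f differentiable_on UNIV"
      using f unfolding smooth_def by blast
    then show "foldr partial_deriv bs (partial_deriv b f) differentiable_on UNIV" by simp
  qed
next
  assume f: "f differentiable_on UNIV \<and> (\<forall>b\<in>Basis. smooth (partial_deriv b f))"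
  show "smooth f"
    unfolding smooth_def
  proof (intro allI impI)
    fix bs :: "'a list" assume bs: "set bs \<subseteq> Basis"
    show "foldr partial_deriv bs f differentiable_on UNIV"
    proof (cases bs rule: rev_cases)
      case Nil then show ?thesis using f by simp
    next
      case (snoc cs c)
      then show ?thesis using f bs unfolding smooth_def by auto
    qed
  qed
qed

lemma smooth_partial_deriv: "smooth f \<Longrightarrow> b \<in> Basis \<Longrightarrow> smooth (partial_deriv b f)"
  using smooth_iff by blast

lemma smooth_differentiable: "smooth f \<Longrightarrow> f differentiable (at x)"
  using smooth_iff[of f] unfolding differentiable_on_def by auto

lemma smooth_has_derivative:
  "smooth f \<Longrightarrow> (f has_derivative (\<lambda>v. \<Sum>b\<in>Basis. of_real (v \<bullet> b) * partial_deriv b f x)) (at x)"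
  by (intro differentiable_has_derivative smooth_differentiable)

lemma smooth_continuous_on: "smooth f \<Longrightarrow> continuous_on S f"
  using smooth_iff[of f] differentiable_imp_continuous_on continuous_on_subset subset_UNIV by blast

lemma smooth_measurable: "smooth f \<Longrightarrow> f \<in> borel_measurable borel"
  by (intro borel_measurable_continuous_onI smooth_continuous_on)

text \<open>Closure properties of smoothness follow by induction on the number of derivatives, which
  needs smoothness of finite order as an intermediate notion.\<close>

primrec smooth_upto :: "nat \<Rightarrow> ('a::euclidean_space \<Rightarrow> complex) \<Rightarrow> bool" where
  "smooth_upto 0 f \<longleftrightarrow> f differentiable_on UNIV"
| "smooth_upto (Suc n) f \<longleftrightarrow>
     f differentiable_on UNIV \<and> (\<forall>b\<in>Basis. smooth_upto n (partial_deriv b f))"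

lemma smooth_upto_differentiable: "smooth_upto n f \<Longrightarrow> f differentiable (at x)"
  by (cases n) (auto simp: differentiable_on_def)

lemma smooth_upto_lessI: "smooth_upto (Suc n) f \<Longrightarrow> smooth_upto n f"
  by (induction n arbitrary: f) auto

lemma smooth_iff_upto: "smooth f \<longleftrightarrow> (\<forall>n. smooth_upto n f)"
proof
  assume "smooth f"
  have "smooth g \<Longrightarrow> smooth_upto n g" for n and g :: "'a \<Rightarrow> complex"
  proof (induction n arbitrary: g)
    case 0 then show ?case using smooth_iff by auto
  next
    case (Suc n) then show ?case using smooth_iff[of g] by auto
  qed
  with \<open>smooth f\<close> show "\<forall>n. smooth_upto n f" by blast
next
  assume f: "\<forall>n. smooth_upto n f"
  have "smooth_upto (length bs) g \<Longrightarrow> set bs \<subseteq> Basis \<Longrightarrow> foldr partial_deriv bs g differentiable_on UNIV"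
    for bs and g :: "'a \<Rightarrow> complex"
  proof (induction bs arbitrary: g rule: rev_induct)
    case Nil then show ?case by simp
  next
    case (snoc b bs) then show ?case by simp
  qed
  with f show "smooth f" unfolding smooth_def by blast
qed

lemma partial_deriv_add:
  assumes "f differentiable (at x)" "g differentiable (at x)"
  shows "partial_deriv b (\<lambda>x. f x + g x) x = partial_deriv b f x + partial_deriv b g x"
proof -
  obtain f' g' where d: "(f has_derivative f') (at x)" "(g has_derivative g') (at x)"
    using assms unfolding differentiable_def by blast
  show ?thesis
    using partial_deriv_eqI[OF has_derivative_add[OF d]] partial_deriv_eqI[OF d(1)] partial_deriv_eqI[OF d(2)]
    by simp
qed

lemma partial_deriv_mult:
  assumes "f differentiable (at x)" "g differentiable (at x)"
  shows "partial_deriv b (\<lambda>x. f x * g x) x = f x * partial_deriv b g x + partial_deriv b f x * g x"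
proof -
  obtain f' g' where d: "(f has_derivative f') (at x)" "(g has_derivative g') (at x)"
    using assms unfolding differentiable_def by blast
  show ?thesis
    using partial_deriv_eqI[OF has_derivative_mult[OF d]] partial_deriv_eqI[OF d(1)] partial_deriv_eqI[OF d(2)]
    by simp
qed

lemma partial_deriv_const [simp]: "partial_deriv b (\<lambda>x. c) = (\<lambda>x. 0)"
proof
  show "partial_deriv b (\<lambda>x. c) x = 0" for x :: 'a
    using partial_deriv_eqI[OF has_derivative_const[of c "at x"]] .
qed

lemma smooth_upto_add:
  "smooth_upto n f \<Longrightarrow> smooth_upto n g \<Longrightarrow> smooth_upto n (\<lambda>x. f x + g x)"
proof (induction n arbitrary: f g)
  case 0 then show ?case by simp
next
  case (Suc n)
  have "partial_deriv b (\<lambda>x. f x + g x) = (\<lambda>x. partial_deriv b f x + partial_deriv b g x)" for b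
    using Suc.prems by (intro ext partial_deriv_add smooth_upto_differentiable)
  with Suc show ?case by simp
qed

lemma smooth_upto_mult:
  "smooth_upto n f \<Longrightarrow> smooth_upto n g \<Longrightarrow> smooth_upto n (\<lambda>x. f x * g x)"
proof (induction n arbitrary: f g)
  case 0 then show ?case by (auto simp: differentiable_on_def intro: differentiable_mult)
next
  case (Suc n)
  have "partial_deriv b (\<lambda>x. f x * g x) = (\<lambda>x. f x * partial_deriv b g x + partial_deriv b f x * g x)" for b
    using Suc.prems by (intro ext partial_deriv_mult smooth_upto_differentiable)
  moreover have "smooth_upto n (\<lambda>x. f x * partial_deriv b g x + partial_deriv b f x * g x)" if "b \<in> Basis" for b
    using Suc.prems that
    by (intro smooth_upto_add Suc.IH) (auto intro: smooth_upto_lessI)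
  moreover have "(\<lambda>x. f x * g x) differentiable_on UNIV"
    using Suc.prems by (auto simp: differentiable_on_def intro: differentiable_mult)
  ultimately show ?case by simp
qed

lemma smooth_add: "smooth f \<Longrightarrow> smooth g \<Longrightarrow> smooth (\<lambda>x. f x + g x)"
  and smooth_mult: "smooth f \<Longrightarrow> smooth g \<Longrightarrow> smooth (\<lambda>x. f x * g x)"
  by (auto simp: smooth_iff_upto smooth_upto_add smooth_upto_mult)

lemma smooth_const [simp]: "smooth (\<lambda>x. c)"
proof -
  have "smooth_upto n (\<lambda>x::'a. c)" for n
  proof (induction n arbitrary: c)
    case 0 show ?case by simp
  next
    case (Suc n) show ?case using Suc[of 0] by (simp only: smooth_upto.simps partial_deriv_const) simp
  qed
  then show ?thesis unfolding smooth_iff_upto by blast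
qed

lemma smooth_cmult: "smooth f \<Longrightarrow> smooth (\<lambda>x. c * f x)"
  by (intro smooth_mult smooth_const)

lemma smooth_diff: "smooth f \<Longrightarrow> smooth g \<Longrightarrow> smooth (\<lambda>x. f x - g x)"
  using smooth_add[of f "\<lambda>x. (-1) * g x"] smooth_cmult[of g "-1"] by simp

lemma smooth_sum: "(\<And>i. i \<in> I \<Longrightarrow> smooth (f i)) \<Longrightarrow> smooth (\<lambda>x. \<Sum>i\<in>I. f i x)"
  by (induction I rule: infinite_finite_induct) (auto intro: smooth_add)

lemma partial_deriv_add_smooth:
  "smooth f \<Longrightarrow> smooth g \<Longrightarrow>
     partial_deriv b (\<lambda>x. f x + g x) = (\<lambda>x. partial_deriv b f x + partial_deriv b g x)"
  by (intro ext partial_deriv_add smooth_differentiable)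

lemma partial_deriv_mult_smooth:
  "smooth f \<Longrightarrow> smooth g \<Longrightarrow>
     partial_deriv b (\<lambda>x. f x * g x) = (\<lambda>x. f x * partial_deriv b g x + partial_deriv b f x * g x)"
  by (intro ext partial_deriv_mult smooth_differentiable)

lemma partial_deriv_cmult_smooth:
  "smooth f \<Longrightarrow> partial_deriv b (\<lambda>x. c * f x) = (\<lambda>x. c * partial_deriv b f x)"
  using partial_deriv_mult_smooth[of "\<lambda>x. c" f b] by simp

lemma partial_deriv_diff_smooth:
  assumes "smooth f" "smooth g"
  shows "partial_deriv b (\<lambda>x. f x - g x) = (\<lambda>x. partial_deriv b f x - partial_deriv b g x)"
  using partial_deriv_add_smooth[OF assms(1) smooth_cmult[OF assms(2), of "-1"], of b]
    partial_deriv_cmult_smooth[OF assms(2), of b "-1"] by simp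

lemma partial_deriv_sum_smooth:
  "(\<And>i. i \<in> I \<Longrightarrow> smooth (f i)) \<Longrightarrow>
     partial_deriv b (\<lambda>x. \<Sum>i\<in>I. f i x) = (\<lambda>x. \<Sum>i\<in>I. partial_deriv b (f i) x)"
  by (induction I rule: infinite_finite_induct) (auto simp: partial_deriv_add_smooth smooth_sum)

lemma partial_deriv_cnj:
  assumes "f differentiable (at x)"
  shows "partial_deriv b (\<lambda>x. cnj (f x)) x = cnj (partial_deriv b f x)"
proof -
  obtain f' where d: "(f has_derivative f') (at x)"
    using assms unfolding differentiable_def by blast
  have "((\<lambda>x. cnj (f x)) has_derivative (\<lambda>v. cnj (f' v))) (at x)"
    using d by (rule has_derivative_cnj)
  from partial_deriv_eqI[OF this] show ?thesis
    using partial_deriv_eqI[OF d] by simp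
qed

lemma partial_deriv_cnj_smooth:
  "smooth f \<Longrightarrow> partial_deriv b (\<lambda>x. cnj (f x)) = (\<lambda>x. cnj (partial_deriv b f x))"
  by (intro ext partial_deriv_cnj smooth_differentiable)

lemma smooth_cnj:
  assumes "smooth f" shows "smooth (\<lambda>x. cnj (f x))"
proof -
  have "smooth g \<Longrightarrow> smooth_upto n (\<lambda>x. cnj (g x))" for n and g :: "'a \<Rightarrow> complex"
  proof (induction n arbitrary: g)
    case 0 then show ?case
      using has_derivative_cnj[OF smooth_has_derivative[OF 0]]
      by (auto simp: differentiable_on_def differentiable_def)
  next
    case (Suc n)
    have "(\<lambda>x. cnj (g x)) differentiable_on UNIV"
      using has_derivative_cnj[OF smooth_has_derivative[OF Suc.prems]]
      by (auto simp: differentiable_on_def differentiable_def)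
    with Suc show ?case by (auto simp: partial_deriv_cnj_smooth smooth_partial_deriv)
  qed
  with assms show ?thesis by (simp add: smooth_iff_upto)
qed

text \<open>Composition with an affine map that scales each coordinate; it covers translations and the
  dilations used for cut-offs.\<close>

lemma partial_deriv_affine:
  assumes f: "f differentiable (at (T x))"
    and T: "(T has_derivative T') (at x)" and T': "T' b = of_real c *\<^sub>R b"
  shows "partial_deriv b (\<lambda>x. f (T x)) x = of_real c * partial_deriv b f (T x)"
proof -
  obtain f' where d: "(f has_derivative f') (at (T x))"
    using f unfolding differentiable_def by blast
  have "((\<lambda>x. f (T x)) has_derivative (\<lambda>v. f' (T' v))) (at x)"
    using has_derivative_compose[of T T' x UNIV f f'] T d by simp
  then have "partial_deriv b (\<lambda>x. f (T x)) x = f' (T' b)" by (rule partial_deriv_eqI)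
  also have "\<dots> = c *\<^sub>R f' b"
    using has_derivative_bounded_linear[OF d] T' by (simp add: linear_simps)
  finally show ?thesis
    using partial_deriv_eqI[OF d] by (simp add: scaleR_conv_of_real)
qed

lemma smooth_affine:
  assumes f: "smooth f" and T: "\<And>x. (T has_derivative T') (at x)"
    and T': "\<And>b. b \<in> Basis \<Longrightarrow> T' b = c b *\<^sub>R b"
  shows "smooth (\<lambda>x. f (T x))"
proof -
  have "smooth g \<Longrightarrow> smooth_upto n (\<lambda>x. k * g (T x))" for n k and g :: "'a \<Rightarrow> complex"
  proof (induction n arbitrary: g k)
    case 0
    have "(\<lambda>x. g (T x)) differentiable (at x)" for x
      using has_derivative_compose[OF T smooth_has_derivative[OF 0]]
      unfolding differentiable_def by blast
    then show ?case
      by (auto simp: differentiable_on_def intro: differentiable_mult)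
  next
    case (Suc n)
    have d: "(\<lambda>x. g (T x)) differentiable (at x)" for x
      using has_derivative_compose[OF T smooth_has_derivative[OF Suc.prems]]
      unfolding differentiable_def by blast
    then have "(\<lambda>x. k * g (T x)) differentiable_on UNIV"
      by (auto simp: differentiable_on_def intro: differentiable_mult)
    moreover have "partial_deriv b (\<lambda>x. k * g (T x)) = (\<lambda>x. (k * of_real (c b)) * partial_deriv b g (T x))"
      if "b \<in> Basis" for b
    proof
      fix x
      have "partial_deriv b (\<lambda>x. k * g (T x)) x = k * partial_deriv b (\<lambda>x. g (T x)) x"
        using d by (subst partial_deriv_mult) auto
      also have "partial_deriv b (\<lambda>x. g (T x)) x = of_real (c b) * partial_deriv b g (T x)"
        using T' that by (intro partial_deriv_affine[OF _ T] smooth_differentiable Suc.prems) auto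
      finally show "partial_deriv b (\<lambda>x. k * g (T x)) x = (k * of_real (c b)) * partial_deriv b g (T x)"
        by simp
    qed
    moreover have "smooth_upto n (\<lambda>x. (k * of_real (c b)) * partial_deriv b g (T x))" if "b \<in> Basis" for b
      using Suc.prems that by (intro Suc.IH smooth_partial_deriv)
    ultimately show ?case by simp
  qed
  from this[of f _ 1] f show ?thesis by (simp add: smooth_iff_upto)
qed

lemma partial_deriv_affine_smooth:
  assumes f: "smooth f" and T: "\<And>x. (T has_derivative T') (at x)"
    and T': "T' b = c *\<^sub>R b"
  shows "partial_deriv b (\<lambda>x. f (T x)) = (\<lambda>x. of_real c * partial_deriv b f (T x))"
  using T' by (intro ext partial_deriv_affine[OF _ T] smooth_differentiable f) auto

lemma has_derivative_translation: "((\<lambda>x. x + h) has_derivative (\<lambda>v. v)) (at x)"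
  by (auto intro!: derivative_eq_intros)

lemma smooth_translate: "smooth f \<Longrightarrow> smooth (\<lambda>x. f (x + h))"
  by (rule smooth_affine[OF _ has_derivative_translation, where c="\<lambda>_. 1"]) auto

lemma partial_deriv_translate:
  "smooth f \<Longrightarrow> partial_deriv b (\<lambda>x. f (x + h)) = (\<lambda>x. partial_deriv b f (x + h))"
  using partial_deriv_affine_smooth[OF _ has_derivative_translation, of f b 1 h] by simp

lemma smooth_has_vector_derivative:
  assumes "smooth f"
  shows "((\<lambda>t. f (x + t *\<^sub>R v)) has_vector_derivative
           (\<Sum>b\<in>Basis. of_real (v \<bullet> b) * partial_deriv b f (x + t *\<^sub>R v))) (at t)"
proof -
  have "((\<lambda>t. x + t *\<^sub>R v) has_derivative (\<lambda>t. t *\<^sub>R v)) (at t)"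
    by (auto intro!: derivative_eq_intros)
  from has_derivative_compose[OF this smooth_has_derivative[OF assms]]
  show ?thesis
    by (simp add: has_vector_derivative_def scaleR_conv_of_real sum_distrib_left mult.assoc)
qed

lemma smooth_has_vector_derivative_Basis:
  assumes "smooth f" "b \<in> Basis"
  shows "((\<lambda>t. f (x + t *\<^sub>R b)) has_vector_derivative partial_deriv b f (x + t *\<^sub>R b)) (at t)"
proof -
  have "(\<Sum>c\<in>Basis. complex_of_real (b \<bullet> c) * partial_deriv c f (x + t *\<^sub>R b))
      = (\<Sum>c\<in>Basis. if c = b then partial_deriv c f (x + t *\<^sub>R b) else 0)"
    using assms(2) by (intro sum.cong) (auto simp: inner_Basis)
  also have "\<dots> = partial_deriv b f (x + t *\<^sub>R b)" using assms(2) by simp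
  finally show ?thesis
    using smooth_has_vector_derivative[OF assms(1), of x b t] by simp
qed

text \<open>The mean value inequality in the one form used below, with the derivative given pointwise
  as a vector derivative.\<close>

lemma vector_mvt_ineq:
  fixes g :: "real \<Rightarrow> complex"
  assumes "0 \<le> h" and d: "\<And>t. 0 \<le> t \<Longrightarrow> t \<le> h \<Longrightarrow> (g has_vector_derivative g' t) (at t)"
    and B: "\<And>t. 0 \<le> t \<Longrightarrow> t \<le> h \<Longrightarrow> norm (g' t) \<le> B"
  shows "norm (g h - g 0) \<le> B * h"
proof -
  have "norm (g h - g 0) \<le> B * norm (h - 0)"
  proof (rule differentiable_bound[where S="{0..h}" and f'="\<lambda>t s. s *\<^sub>R g' t"])
    show "(g has_derivative (\<lambda>s. s *\<^sub>R g' t)) (at t within {0..h})" if "t \<in> {0..h}" for t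
      using d[of t] that by (auto simp: has_vector_derivative_def intro: has_derivative_at_withinI)
    show "onorm (\<lambda>s. s *\<^sub>R g' t) \<le> B" if "t \<in> {0..h}" for t
      using B[of t] that by (intro onorm_le) (auto simp: mult.commute[of B] intro!: mult_left_mono)
  qed (use assms in auto)
  with \<open>0 \<le> h\<close> show ?thesis by simp
qed

text \<open>The mixed second difference over a square of side \<open>h\<close> is symmetric in the two directions,
  and two applications of the mean value inequality compare it with \<open>h\<^sup>2\<close> times either of the
  mixed derivatives. Symmetry of second derivatives follows.\<close>

lemma mixed_difference_approx:
  assumes f: "smooth f" and b: "b \<in> Basis" and c: "c \<in> Basis" and "e > 0"
  shows "\<exists>\<delta>>0. \<forall>h. 0 < h \<longrightarrow> h < \<delta> \<longrightarrow>
    norm (f (x + h *\<^sub>R b + h *\<^sub>R c) - f (x + h *\<^sub>R b) - f (x + h *\<^sub>R c) + f x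
      - of_real (h\<^sup>2) * partial_deriv c (partial_deriv b f) x) \<le> e * h\<^sup>2"
proof -
  define m where "m = partial_deriv c (partial_deriv b f) x"
  have s: "smooth (partial_deriv b f)" "smooth (partial_deriv c (partial_deriv b f))"
    using f b c smooth_partial_deriv by blast+
  have "isCont (partial_deriv c (partial_deriv b f)) x"
    using smooth_differentiable[OF s(2)] differentiable_imp_continuous_within by blast
  then obtain d where d: "d > 0" "\<And>y. dist y x < d \<Longrightarrow> norm (partial_deriv c (partial_deriv b f) y - m) < e"
    using \<open>e > 0\<close> unfolding continuous_at_eps_delta m_def dist_norm by blast
  show ?thesis
  proof (intro exI[of _ "d/2"] conjI allI impI)
    show "d/2 > 0" using d by simp
    fix h :: real assume h: "0 < h" "h < d/2"
    have near: "norm (partial_deriv c (partial_deriv b f) (x + s *\<^sub>R b + t *\<^sub>R c) - m) \<le> e"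
      if "0 \<le> s" "s \<le> h" "0 \<le> t" "t \<le> h" for s t
    proof -
      have "norm (s *\<^sub>R b + t *\<^sub>R c) \<le> norm (s *\<^sub>R b) + norm (t *\<^sub>R c)" by (rule norm_triangle_ineq)
      also have "\<dots> = s + t" using that b c by simp
      finally show ?thesis using that h d(2)[of "x + s *\<^sub>R b + t *\<^sub>R c"]
        by (simp add: dist_norm add.assoc less_imp_le)
    qed
    have inner: "norm (partial_deriv b f (x + s *\<^sub>R b + h *\<^sub>R c) - partial_deriv b f (x + s *\<^sub>R b) - of_real h * m) \<le> e * h"
      if "0 \<le> s" "s \<le> h" for s
    proof -
      have "norm ((partial_deriv b f (x + s *\<^sub>R b + h *\<^sub>R c) - of_real h * m)
              - (partial_deriv b f (x + s *\<^sub>R b + 0 *\<^sub>R c) - of_real 0 * m)) \<le> e * h"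
        using h near that
        by (intro vector_mvt_ineq[where g'="\<lambda>t. partial_deriv c (partial_deriv b f) (x + s *\<^sub>R b + t *\<^sub>R c) - m"
              and g="\<lambda>t. partial_deriv b f (x + s *\<^sub>R b + t *\<^sub>R c) - of_real t * m"])
           (auto intro!: derivative_eq_intros smooth_has_vector_derivative_Basis s c)
      then show ?thesis by (simp add: algebra_simps)
    qed
    have "norm ((f ((x + h *\<^sub>R c) + h *\<^sub>R b) - f (x + h *\<^sub>R b) - of_real h * (of_real h * m))
        - (f ((x + h *\<^sub>R c) + 0 *\<^sub>R b) - f (x + 0 *\<^sub>R b) - of_real 0 * (of_real h * m))) \<le> (e * h) * h"
    proof (rule vector_mvt_ineq[where g="\<lambda>s. f ((x + h *\<^sub>R c) + s *\<^sub>R b) - f (x + s *\<^sub>R b) - of_real s * (of_real h * m)"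
         and g'="\<lambda>s. partial_deriv b f ((x + h *\<^sub>R c) + s *\<^sub>R b) - partial_deriv b f (x + s *\<^sub>R b) - of_real h * m"])
      show "norm (partial_deriv b f (x + h *\<^sub>R c + t *\<^sub>R b) - partial_deriv b f (x + t *\<^sub>R b) - of_real h * m) \<le> e * h"
        if "0 \<le> t" "t \<le> h" for t
        using inner[OF that] by (simp add: algebra_simps)
    qed (use h in \<open>auto intro!: derivative_eq_intros smooth_has_vector_derivative_Basis f b\<close>)
    then show "norm (f (x + h *\<^sub>R b + h *\<^sub>R c) - f (x + h *\<^sub>R b) - f (x + h *\<^sub>R c) + f x
      - of_real (h\<^sup>2) * partial_deriv c (partial_deriv b f) x) \<le> e * h\<^sup>2"
      by (simp add: m_def[symmetric] power2_eq_square algebra_simps)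
  qed
qed

lemma partial_deriv_commute:
  assumes f: "smooth f" and b: "b \<in> Basis" and c: "c \<in> Basis"
  shows "partial_deriv b (partial_deriv c f) = partial_deriv c (partial_deriv b f)"
proof
  fix x
  let ?m = "partial_deriv c (partial_deriv b f) x" and ?n = "partial_deriv b (partial_deriv c f) x"
  have "norm (?m - ?n) \<le> 2 * e" if "e > 0" for e
  proof -
    obtain d1 where d1: "d1 > 0" "\<And>h. 0 < h \<Longrightarrow> h < d1 \<Longrightarrow>
       norm (f (x + h *\<^sub>R b + h *\<^sub>R c) - f (x + h *\<^sub>R b) - f (x + h *\<^sub>R c) + f x - of_real (h\<^sup>2) * ?m) \<le> e * h\<^sup>2"
      using mixed_difference_approx[OF f b c \<open>e > 0\<close>, of x] by blast
    obtain d2 where d2: "d2 > 0" "\<And>h. 0 < h \<Longrightarrow> h < d2 \<Longrightarrow>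
       norm (f (x + h *\<^sub>R c + h *\<^sub>R b) - f (x + h *\<^sub>R c) - f (x + h *\<^sub>R b) + f x - of_real (h\<^sup>2) * ?n) \<le> e * h\<^sup>2"
      using mixed_difference_approx[OF f c b \<open>e > 0\<close>, of x] by blast
    define h where "h = min d1 d2 / 2"
    have h: "0 < h" "h < d1" "h < d2" using d1 d2 by (auto simp: h_def)
    let ?D = "f (x + h *\<^sub>R b + h *\<^sub>R c) - f (x + h *\<^sub>R b) - f (x + h *\<^sub>R c) + f x"
    have "of_real (h\<^sup>2) * (?m - ?n) = (?D - of_real (h\<^sup>2) * ?n) - (?D - of_real (h\<^sup>2) * ?m)"
      by (simp add: algebra_simps)
    also have "norm \<dots> \<le> norm (?D - of_real (h\<^sup>2) * ?n) + norm (?D - of_real (h\<^sup>2) * ?m)"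
      by (rule norm_triangle_ineq4)
    also have "\<dots> \<le> e * h\<^sup>2 + e * h\<^sup>2"
    proof (rule add_mono)
      show "norm (?D - of_real (h\<^sup>2) * ?m) \<le> e * h\<^sup>2" using d1(2)[OF h(1,2)] .
      have "?D = f (x + h *\<^sub>R c + h *\<^sub>R b) - f (x + h *\<^sub>R c) - f (x + h *\<^sub>R b) + f x"
        by (simp add: algebra_simps)
      then show "norm (?D - of_real (h\<^sup>2) * ?n) \<le> e * h\<^sup>2" using d2(2)[OF h(1,3)] by (simp only:)
    qed
    finally have "h\<^sup>2 * norm (?m - ?n) \<le> h\<^sup>2 * (2 * e)"
      by (simp only: norm_mult norm_of_real) (simp add: algebra_simps)
    then show ?thesis using h(1) by (simp add: mult_le_cancel_left_pos)
  qed
  note le = this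
  have "norm (?m - ?n) \<le> 0"
  proof (rule field_le_epsilon)
    show "norm (?m - ?n) \<le> 0 + e" if "e > 0" for e
      using le[of "e / 2"] that by simp
  qed
  then show "?n = ?m" by simp
qed

abbreviation pderivs :: "'a::euclidean_space list \<Rightarrow> ('a \<Rightarrow> complex) \<Rightarrow> 'a \<Rightarrow> complex" where
  "pderivs \<equiv> foldr partial_deriv"

lemma smooth_pderivs: "smooth f \<Longrightarrow> set bs \<subseteq> Basis \<Longrightarrow> smooth (pderivs bs f)"
  by (induction bs) (auto intro: smooth_partial_deriv)

lemma pderivs_partial_deriv:
  "smooth f \<Longrightarrow> set bs \<subseteq> Basis \<Longrightarrow> b \<in> Basis \<Longrightarrow>
     pderivs bs (partial_deriv b f) = partial_deriv b (pderivs bs f)"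
  by (induction bs) (auto simp: partial_deriv_commute smooth_pderivs)

text \<open>This makes multi-indices and lists of directions interchangeable; lists are the more
  convenient form for inductions.\<close>

lemma pderivs_perm:
  assumes "smooth f" "set bs \<subseteq> Basis" "mset bs = mset cs"
  shows "pderivs bs f = pderivs cs f"
  using assms(2,3)
proof (induction bs arbitrary: cs)
  case Nil then show ?case by simp
next
  case (Cons b bs)
  then have "b \<in> set cs" by (metis list.set_intros(1) mset_eq_setD)
  then obtain ds es where cs: "cs = ds @ b # es" by (meson split_list)
  have sub: "set cs \<subseteq> Basis" using Cons.prems mset_eq_setD by blast
  have "pderivs (b # bs) f = partial_deriv b (pderivs (ds @ es) f)"
    using Cons.IH[of "ds @ es"] Cons.prems cs by (simp del: foldr_append)
  also have "\<dots> = pderivs cs f"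
    using sub cs assms(1) by (simp add: pderivs_partial_deriv smooth_pderivs)
  finally show ?case .
qed

section \<open>Weighted bounds on derivatives\<close>

text \<open>A single constant bounds all derivatives up to order \<open>n\<close> with the same weight. With \<open>L\<close>
  fixed this describes symbols of order \<open>L\<close> whose derivatives do not improve, and with all \<open>L\<close>
  it describes Schwartz functions; one calculus serves both.\<close>

primrec derivs_le :: "nat \<Rightarrow> real \<Rightarrow> real \<Rightarrow> ('a::euclidean_space \<Rightarrow> complex) \<Rightarrow> bool" where
  "derivs_le 0 L A f \<longleftrightarrow> (\<forall>x. norm (f x) \<le> A * (1 + norm x) powr L)"
| "derivs_le (Suc n) L A f \<longleftrightarrow>
     (\<forall>x. norm (f x) \<le> A * (1 + norm x) powr L) \<and> (\<forall>b\<in>Basis. derivs_le n L A (partial_deriv b f))"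

lemma derivs_leD: "derivs_le n L A f \<Longrightarrow> norm (f x) \<le> A * (1 + norm x) powr L"
  by (cases n) auto

lemma derivs_le_partial_deriv:
  "derivs_le (Suc n) L A f \<Longrightarrow> b \<in> Basis \<Longrightarrow> derivs_le n L A (partial_deriv b f)"
  by simp

lemma derivs_le_nonneg: "derivs_le n L A f \<Longrightarrow> 0 \<le> A"
  using order_trans[OF norm_ge_zero derivs_leD[of n L A f 0]] by simp

lemma derivs_le_SucD: "derivs_le (Suc n) L A f \<Longrightarrow> derivs_le n L A f"
  by (induction n arbitrary: f) auto

lemma derivs_le_antimono: "derivs_le n L A f \<Longrightarrow> m \<le> n \<Longrightarrow> derivs_le m L A f"
  by (induction n) (auto simp: le_Suc_eq simp del: derivs_le.simps dest: derivs_le_SucD)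

lemma weight_mono: "L \<le> L' \<Longrightarrow> (1 + norm x) powr L \<le> (1 + norm x) powr L'"
  by (rule powr_mono) auto

lemma derivs_le_weaken:
  assumes "derivs_le n L A f" "m \<le> n" "L \<le> L'" "A \<le> A'"
  shows "derivs_le m L' A' f"
proof -
  have le: "norm (g x) \<le> A' * (1 + norm x) powr L'" if "norm (g x) \<le> A * (1 + norm x) powr L" for g :: "'a \<Rightarrow> complex" and x
  proof -
    have "A * (1 + norm x) powr L \<le> A' * (1 + norm x) powr L'"
      using derivs_le_nonneg[OF assms(1)] assms(3,4) by (intro mult_mono weight_mono) auto
    with that show ?thesis by linarith
  qed
  have "derivs_le m L A f" using assms derivs_le_antimono by blast
  then show ?thesis
    by (induction m arbitrary: f) (auto intro: le)
qed

lemma derivs_le_add: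
  "smooth f \<Longrightarrow> smooth g \<Longrightarrow> derivs_le n L A f \<Longrightarrow> derivs_le n L B g \<Longrightarrow>
     derivs_le n L (A + B) (\<lambda>x. f x + g x)"
proof (induction n arbitrary: f g)
  case 0
  then show ?case by (auto simp: distrib_right intro: norm_triangle_le add_mono)
next
  case (Suc n)
  have "norm (f x + g x) \<le> (A + B) * (1 + norm x) powr L" for x
    using derivs_leD[OF Suc.prems(3), of x] derivs_leD[OF Suc.prems(4), of x] norm_triangle_ineq[of "f x" "g x"]
    by (simp add: distrib_right)
  with Suc show ?case
    by (simp add: partial_deriv_add_smooth smooth_partial_deriv)
qed

lemma derivs_le_cmult:
  "smooth f \<Longrightarrow> derivs_le n L A f \<Longrightarrow> derivs_le n L (norm c * A) (\<lambda>x. c * f x)"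
proof (induction n arbitrary: f)
  case 0
  then show ?case by (auto simp: norm_mult mult.assoc intro: mult_left_mono)
next
  case (Suc n)
  then show ?case
    by (auto simp: norm_mult mult.assoc partial_deriv_cmult_smooth smooth_partial_deriv intro: mult_left_mono)
qed

lemma derivs_le_diff:
  assumes "smooth f" "smooth g" "derivs_le n L A f" "derivs_le n L B g"
  shows "derivs_le n L (A + B) (\<lambda>x. f x - g x)"
  using derivs_le_add[OF assms(1) smooth_cmult[OF assms(2), of "-1"] assms(3)]
    derivs_le_cmult[OF assms(2,4), of "-1"] by simp

lemma derivs_le_mult:
  "smooth f \<Longrightarrow> smooth g \<Longrightarrow> derivs_le n L A f \<Longrightarrow> derivs_le n K B g \<Longrightarrow>
     derivs_le n (L + K) (2 ^ n * (A * B)) (\<lambda>x. f x * g x)"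
proof (induction n arbitrary: f g)
  case 0
  have "norm (f x * g x) \<le> A * B * (1 + norm x) powr (L + K)" for x
  proof -
    have "norm (f x * g x) \<le> (A * (1 + norm x) powr L) * (B * (1 + norm x) powr K)"
      unfolding norm_mult
      using 0 derivs_leD[of 0 L A f x] derivs_leD[of 0 K B g x] derivs_le_nonneg[of 0 L A f]
      by (intro mult_mono mult_nonneg_nonneg) auto
    then show ?thesis by (simp add: powr_add mult_ac)
  qed
  then show ?case by simp
next
  case (Suc n)
  have A: "A \<ge> 0" "B \<ge> 0" using Suc.prems derivs_le_nonneg by blast+
  have "derivs_le n (L + K) (2 ^ n * (A * B)) (\<lambda>x. f x * g x)"
    using Suc.prems(1,2) derivs_le_SucD[OF Suc.prems(3)] derivs_le_SucD[OF Suc.prems(4)] by (rule Suc.IH)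
  then have 1: "norm (f x * g x) \<le> 2 ^ Suc n * (A * B) * (1 + norm x) powr (L + K)" for x
  proof -
    have "norm (f x * g x) \<le> (2 ^ n * (A * B)) * (1 + norm x) powr (L + K)"
      using \<open>derivs_le n (L + K) (2 ^ n * (A * B)) (\<lambda>x. f x * g x)\<close> by (rule derivs_leD)
    also have "\<dots> \<le> (2 ^ Suc n * (A * B)) * (1 + norm x) powr (L + K)"
      using A by (intro mult_right_mono) auto
    finally show ?thesis .
  qed
  have 2: "derivs_le n (L + K) (2 ^ Suc n * (A * B)) (partial_deriv b (\<lambda>x. f x * g x))" if "b \<in> Basis" for b
  proof -
    have "derivs_le n (L + K) (2 ^ n * (A * B) + 2 ^ n * (A * B))
        (\<lambda>x. f x * partial_deriv b g x + partial_deriv b f x * g x)"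
      using Suc.prems(1,2) derivs_le_SucD[OF Suc.prems(3)] derivs_le_SucD[OF Suc.prems(4)]
        derivs_le_partial_deriv[OF Suc.prems(3) that] derivs_le_partial_deriv[OF Suc.prems(4) that] that
      by (intro derivs_le_add smooth_mult smooth_partial_deriv Suc.IH)
    then show ?thesis
      using Suc.prems(1,2) by (simp add: partial_deriv_mult_smooth mult_ac)
  qed
  from 1 2 show ?case by simp
qed

lemma derivs_le_cnj: "smooth f \<Longrightarrow> derivs_le n L A f \<Longrightarrow> derivs_le n L A (\<lambda>x. cnj (f x))"
  by (induction n arbitrary: f) (auto simp: partial_deriv_cnj_smooth smooth_partial_deriv)

text \<open>Both signs of \<open>L\<close> come from submultiplicativity of the weight \<open>1 + norm x\<close>, for negative
  \<open>L\<close> applied to \<open>x = (x + h) - h\<close>.\<close>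

lemma weight_translate:
  fixes x h :: "'a::real_normed_vector"
  shows "(1 + norm (x + h)) powr L \<le> (1 + norm h) powr \<bar>L\<bar> * (1 + norm x) powr L"
proof (cases "L \<ge> 0")
  case True
  have "1 + norm (x + h) \<le> (1 + norm h) * (1 + norm x)"
  proof -
    have "0 \<le> norm h * norm x" by simp
    moreover have "(1 + norm h) * (1 + norm x) = 1 + norm h + norm x + norm h * norm x"
      by (simp add: algebra_simps)
    ultimately show ?thesis using norm_triangle_ineq[of x h] by linarith
  qed
  then have "(1 + norm (x + h)) powr L \<le> ((1 + norm h) * (1 + norm x)) powr L"
    using True by (intro powr_mono2) auto
  with True show ?thesis by (simp add: powr_mult)
next
  case False
  have "1 + norm x \<le> (1 + norm h) * (1 + norm (x + h))"
  proof -
    have "0 \<le> norm h * norm (x + h)" by simp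
    moreover have "(1 + norm h) * (1 + norm (x + h)) = 1 + norm h + norm (x + h) + norm h * norm (x + h)"
      by (simp add: algebra_simps)
    moreover have "norm x \<le> norm (x + h) + norm h" using norm_triangle_ineq4[of "x + h" h] by simp
    ultimately show ?thesis by linarith
  qed
  then have "(1 + norm x) powr (- L) \<le> ((1 + norm h) * (1 + norm (x + h))) powr (- L)"
    using False by (intro powr_mono2) auto
  then have "(1 + norm x) powr (- L) \<le> (1 + norm h) powr (- L) * (1 + norm (x + h)) powr (- L)"
    by (simp add: powr_mult)
  then have "(1 + norm x) powr (- L) * ((1 + norm x) powr L * (1 + norm (x + h)) powr L)
      \<le> (1 + norm h) powr (- L) * (1 + norm (x + h)) powr (- L) * ((1 + norm x) powr L * (1 + norm (x + h)) powr L)"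
    by (intro mult_right_mono) auto
  moreover have "(1 + norm y) powr (- L) * (1 + norm y) powr L = 1" for y :: 'a
  proof -
    have "1 + norm y > 0" using norm_ge_zero[of y] by linarith
    then show ?thesis by (simp add: powr_add[symmetric])
  qed
  moreover have "a * (b * c) \<le> d * e * (b * c) \<Longrightarrow> a * b = 1 \<Longrightarrow> e * c = 1 \<Longrightarrow> c \<le> d * b"
    for a b c d e :: real
  proof -
    assume *: "a * (b * c) \<le> d * e * (b * c)" "a * b = 1" "e * c = 1"
    have "a * (b * c) = (a * b) * c" "d * e * (b * c) = d * b * (e * c)" by (simp_all add: mult_ac)
    with * show "c \<le> d * b" by simp
  qed
  ultimately have "(1 + norm (x + h)) powr L \<le> (1 + norm h) powr (- L) * (1 + norm x) powr L"
    by blast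
  with False show ?thesis by simp
qed

lemma derivs_le_translate:
  "smooth f \<Longrightarrow> derivs_le n L A f \<Longrightarrow> derivs_le n L (A * (1 + norm h) powr \<bar>L\<bar>) (\<lambda>x. f (x + h))"
proof (induction n arbitrary: f)
  case 0
  have "norm (f (x + h)) \<le> A * (1 + norm h) powr \<bar>L\<bar> * (1 + norm x) powr L" for x
    using derivs_leD[OF 0(2), of "x + h"]
      mult_left_mono[OF weight_translate[of x h L] derivs_le_nonneg[OF 0(2)]] by (simp add: mult.assoc)
  then show ?case by simp
next
  case (Suc n)
  have "norm (f (x + h)) \<le> A * (1 + norm h) powr \<bar>L\<bar> * (1 + norm x) powr L" for x
    using derivs_leD[OF Suc(3), of "x + h"]
      mult_left_mono[OF weight_translate[of x h L] derivs_le_nonneg[OF Suc(3)]] by (simp add: mult.assoc)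
  with Suc show ?case by (simp add: partial_deriv_translate smooth_partial_deriv)
qed

lemma derivs_le_pderivs:
  "derivs_le n L A f \<Longrightarrow> set bs \<subseteq> Basis \<Longrightarrow> length bs \<le> n \<Longrightarrow>
     norm (pderivs bs f x) \<le> A * (1 + norm x) powr L"
proof (induction bs arbitrary: n f rule: rev_induct)
  case Nil then show ?case by (simp add: derivs_leD)
next
  case (snoc b bs)
  then obtain k where n: "n = Suc k" by (cases n) auto
  show ?case using snoc.IH[of k "partial_deriv b f"] snoc.prems n by simp
qed

text \<open>For each \<open>n\<close> there are finitely many derivatives of order at most \<open>n\<close>, so their individual
  constants have a common bound.\<close>

lemma derivs_leI:
  assumes "\<And>bs. set bs \<subseteq> Basis \<Longrightarrow> length bs \<le> n \<Longrightarrow> \<exists>A. \<forall>x. norm (pderivs bs f x) \<le> A * (1 + norm x) powr L"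
  shows "\<exists>A. derivs_le n L A f"
  using assms
proof (induction n arbitrary: f)
  case 0
  then show ?case using 0[of "[]"] by auto
next
  case (Suc n)
  have "\<exists>A. derivs_le n L A (partial_deriv b f)" if "b \<in> Basis" for b
  proof (rule Suc.IH)
    fix bs :: "'a list" assume "set bs \<subseteq> Basis" "length bs \<le> n"
    then show "\<exists>A. \<forall>x. norm (pderivs bs (partial_deriv b f) x) \<le> A * (1 + norm x) powr L"
      using Suc.prems[of "bs @ [b]"] that by simp
  qed
  then obtain A where A: "\<And>b. b \<in> Basis \<Longrightarrow> derivs_le n L (A b) (partial_deriv b f)" by metis
  obtain A0 where A0: "\<And>x. norm (f x) \<le> A0 * (1 + norm x) powr L"
    using Suc.prems[of "[]"] by auto
  have A0': "A0 \<ge> 0" using order.trans[OF norm_ge_zero A0[of 0]] by simp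
  define A' where "A' = A0 + (\<Sum>b\<in>Basis. A b)"
  have nn: "A b \<ge> 0" if "b \<in> Basis" for b using A[OF that] derivs_le_nonneg by blast
  have "A b \<le> A'" if "b \<in> Basis" for b
    unfolding A'_def using member_le_sum[of b Basis A] that nn A0' by auto
  then have "derivs_le n L A' (partial_deriv b f)" if "b \<in> Basis" for b
    using derivs_le_weaken[OF A[OF that]] that by blast
  moreover have "A0 \<le> A'" unfolding A'_def using nn by (simp add: sum_nonneg)
  then have "norm (f x) \<le> A' * (1 + norm x) powr L" for x
    using A0[of x] mult_right_mono[of A0 A' "(1 + norm x) powr L"] by simp
  ultimately show ?case by (intro exI[of _ A']) simp
qed

lemma smooth_inner: "smooth (\<lambda>w. of_real (w \<bullet> b))"
  and partial_deriv_inner: "partial_deriv c (\<lambda>w. of_real (w \<bullet> b)) = (\<lambda>w. of_real (c \<bullet> b))"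
proof -
  have d: "((\<lambda>w. complex_of_real (w \<bullet> b)) has_derivative (\<lambda>v. of_real (v \<bullet> b))) (at w)" for w
    by (auto intro!: derivative_eq_intros)
  show p: "partial_deriv c (\<lambda>w. of_real (w \<bullet> b)) = (\<lambda>w. of_real (c \<bullet> b))" for c
    using partial_deriv_eqI[OF d] by auto
  show "smooth (\<lambda>w. of_real (w \<bullet> b))"
    using d unfolding smooth_iff[of "\<lambda>w. of_real (w \<bullet> b)"] p differentiable_on_def differentiable_def by auto
qed

lemma derivs_le_const: "norm c \<le> A \<Longrightarrow> 0 \<le> L \<Longrightarrow> derivs_le n L A (\<lambda>w. c)"
proof (induction n arbitrary: c)
  case 0
  have "norm c \<le> A * (1 + norm x) powr L" for x :: 'a
    using mult_mono[of "norm c" A 1 "(1 + norm x) powr L"] 0 order.trans[OF norm_ge_zero 0(1)]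
    by (simp add: ge_one_powr_ge_zero)
  then show ?case by simp
next
  case (Suc n)
  have "norm c \<le> A * (1 + norm x) powr L" for x :: 'a
    using mult_mono[of "norm c" A 1 "(1 + norm x) powr L"] Suc order.trans[OF norm_ge_zero Suc(2)]
    by (simp add: ge_one_powr_ge_zero)
  moreover have "0 \<le> A" using Suc.prems norm_ge_zero order.trans by blast
  ultimately show ?case using Suc.IH[of 0] Suc.prems by simp
qed

lemma derivs_le_inner:
  assumes "b \<in> Basis" shows "derivs_le n 1 1 (\<lambda>w. of_real (w \<bullet> b))"
proof -
  have "norm (complex_of_real (x \<bullet> b)) \<le> 1 * (1 + norm x) powr 1" for x
    using Basis_le_norm[OF assms, of x] norm_ge_zero[of x] by simp
  moreover have "derivs_le n 1 1 (\<lambda>w::'a. complex_of_real (c \<bullet> b))" if "c \<in> Basis" for c n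
    using that assms by (intro derivs_le_const) (auto simp: inner_Basis)
  ultimately show ?thesis by (cases n) (auto simp: partial_deriv_inner)
qed

section \<open>Taylor expansion\<close>

text \<open>The homogeneous part of degree \<open>k\<close> of the Taylor expansion of \<open>f\<close> around \<open>z\<close>, as a
  function of the increment \<open>w\<close>. Euler's identity for homogeneous functions yields this
  recursion, which avoids multi-indices and factorials.\<close>

primrec taylor_term :: "nat \<Rightarrow> ('a::euclidean_space \<Rightarrow> complex) \<Rightarrow> 'a \<Rightarrow> 'a \<Rightarrow> complex" where
  "taylor_term 0 f z w = f z"
| "taylor_term (Suc k) f z w =
     inverse (of_nat (Suc k)) * (\<Sum>b\<in>Basis. of_real (w \<bullet> b) * taylor_term k (partial_deriv b f) z w)"

definition taylor_rem :: "nat \<Rightarrow> ('a::euclidean_space \<Rightarrow> complex) \<Rightarrow> 'a \<Rightarrow> 'a \<Rightarrow> complex" where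
  "taylor_rem K f z w = f (w + z) - (\<Sum>k<K. taylor_term k f z w)"

lemma smooth_taylor_term: "smooth f \<Longrightarrow> smooth (taylor_term k f z)"
proof (induction k arbitrary: f)
  case 0
  have "taylor_term 0 f z = (\<lambda>w. f z)" by auto
  then show ?case by simp
next
  case (Suc k)
  have "taylor_term (Suc k) f z = (\<lambda>w. inverse (of_nat (Suc k)) * (\<Sum>b\<in>Basis. of_real (w \<bullet> b) * taylor_term k (partial_deriv b f) z w))"
    by auto
  moreover have "smooth (\<lambda>w. inverse (of_nat (Suc k)) * (\<Sum>b\<in>Basis. of_real (w \<bullet> b) * taylor_term k (partial_deriv b f) z w))"
    using Suc by (intro smooth_cmult smooth_sum smooth_mult smooth_inner Suc.IH smooth_partial_deriv)
  ultimately show ?case by simp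
qed

lemma partial_deriv_taylor_term_0: "partial_deriv c (taylor_term 0 f z) = (\<lambda>w. 0)"
proof -
  have "taylor_term 0 f z = (\<lambda>w. f z)" by auto
  then show ?thesis by simp
qed

text \<open>The direction \<open>c\<close> occurs both in the outer factor and in the inner term; with the symmetry
  of second derivatives, the two contributions add up to \<open>k + 1\<close> copies of the same term.\<close>

lemma partial_deriv_taylor_term:
  "smooth f \<Longrightarrow> c \<in> Basis \<Longrightarrow>
     partial_deriv c (taylor_term (Suc k) f z) = taylor_term k (partial_deriv c f) z"
proof (induction k arbitrary: f)
  case (0 f)
  have eq: "taylor_term (Suc 0) f z = (\<lambda>w. \<Sum>b\<in>Basis. of_real (w \<bullet> b) * partial_deriv b f z)" by auto
  have "partial_deriv c (taylor_term (Suc 0) f z) = (\<lambda>w. \<Sum>b\<in>Basis. of_real (c \<bullet> b) * partial_deriv b f z)"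
    unfolding eq
    by (subst partial_deriv_sum_smooth) (auto simp: partial_deriv_mult_smooth smooth_inner partial_deriv_inner
        intro!: smooth_mult smooth_inner)
  also have "\<dots> = (\<lambda>w. \<Sum>b\<in>Basis. if b = c then partial_deriv b f z else 0)"
    using 0 by (intro ext sum.cong) (auto simp: inner_Basis)
  also have "\<dots> = taylor_term 0 (partial_deriv c f) z" using 0 by auto
  finally show ?case .
next
  case (Suc k f)
  let ?T = "\<lambda>b. taylor_term (Suc k) (partial_deriv b f) z"
  have sm: "smooth (?T b)" if "b \<in> Basis" for b
    using Suc.prems that by (intro smooth_taylor_term smooth_partial_deriv)
  have eq: "taylor_term (Suc (Suc k)) f z = (\<lambda>w. inverse (of_nat (Suc (Suc k))) * (\<Sum>b\<in>Basis. of_real (w \<bullet> b) * ?T b w))"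
    by (intro ext) (rule taylor_term.simps(2))
  have p: "partial_deriv c (\<lambda>w. of_real (w \<bullet> b) * ?T b w)
      = (\<lambda>w. of_real (w \<bullet> b) * taylor_term k (partial_deriv b (partial_deriv c f)) z w + of_real (c \<bullet> b) * ?T b w)"
    if "b \<in> Basis" for b
    using Suc.prems that
    by (subst partial_deriv_mult_smooth)
       (auto simp del: taylor_term.simps simp add: smooth_inner sm partial_deriv_inner Suc.IH smooth_partial_deriv partial_deriv_commute[of f c b])
  have "partial_deriv c (taylor_term (Suc (Suc k)) f z)
      = (\<lambda>w. inverse (of_nat (Suc (Suc k))) * (\<Sum>b\<in>Basis. of_real (w \<bullet> b) * taylor_term k (partial_deriv b (partial_deriv c f)) z w + of_real (c \<bullet> b) * ?T b w))"
    unfolding eq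
    by (subst partial_deriv_cmult_smooth, (intro smooth_sum smooth_mult smooth_inner sm, assumption),
        subst partial_deriv_sum_smooth, (intro smooth_mult smooth_inner sm, assumption)) (simp only: p cong: sum.cong)
  also have "\<dots> = taylor_term (Suc k) (partial_deriv c f) z"
  proof
    fix w
    have "(\<Sum>b\<in>Basis. complex_of_real (c \<bullet> b) * ?T b w) = (\<Sum>b\<in>Basis. if b = c then ?T b w else 0)"
      using Suc.prems by (intro sum.cong) (auto simp: inner_Basis)
    then have 1: "(\<Sum>b\<in>Basis. complex_of_real (c \<bullet> b) * ?T b w) = ?T c w" using Suc.prems by simp
    have 2: "(\<Sum>b\<in>Basis. of_real (w \<bullet> b) * taylor_term k (partial_deriv b (partial_deriv c f)) z w)
       = of_nat (Suc k) * ?T c w" by (simp add: field_simps del: of_nat_Suc)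
    have "inverse (of_nat (Suc (Suc k))) * (of_nat (Suc k) * ?T c w + ?T c w) = ?T c w"
    proof -
      have "of_nat (Suc k) * ?T c w + ?T c w = of_nat (Suc (Suc k)) * ?T c w" by (simp add: algebra_simps)
      then show ?thesis by (metis (no_types, lifting) left_inverse mult.assoc mult_1 of_nat_neq_0)
    qed
    then show "inverse (of_nat (Suc (Suc k))) * (\<Sum>b\<in>Basis. of_real (w \<bullet> b) * taylor_term k (partial_deriv b (partial_deriv c f)) z w + of_real (c \<bullet> b) * ?T b w) = ?T c w"
      by (simp only: sum.distrib 1 2)
  qed
  finally show ?case .
qed

lemma smooth_taylor_rem: "smooth f \<Longrightarrow> smooth (taylor_rem K f z)"
  unfolding taylor_rem_def[abs_def]
  by (intro smooth_diff smooth_translate smooth_sum smooth_taylor_term)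

text \<open>Remainders of derivatives are derivatives of remainders, with one term less. Truncated
  subtraction is right for \<open>K = 0\<close>, where the remainder is the translated function itself.\<close>

lemma partial_deriv_taylor_rem:
  assumes f: "smooth f" and c: "c \<in> Basis"
  shows "partial_deriv c (taylor_rem K f z) = taylor_rem (K - 1) (partial_deriv c f) z"
proof -
  have "partial_deriv c (taylor_rem K f z)
      = (\<lambda>w. partial_deriv c f (w + z) - (\<Sum>k<K. partial_deriv c (taylor_term k f z) w))"
    unfolding taylor_rem_def[abs_def] using f
    by (subst partial_deriv_diff_smooth)
       (auto simp: partial_deriv_translate partial_deriv_sum_smooth smooth_taylor_term intro!: smooth_translate smooth_sum)
  also have "\<dots> = taylor_rem (K - 1) (partial_deriv c f) z"
  proof (cases K)
    case 0 then show ?thesis by (simp add: taylor_rem_def[abs_def])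
  next
    case (Suc K')
    have "(\<Sum>k<K. partial_deriv c (taylor_term k f z) w) = (\<Sum>k<K'. taylor_term k (partial_deriv c f) z w)" for w
      unfolding Suc sum.lessThan_Suc_shift
      using f c by (simp only: partial_deriv_taylor_term partial_deriv_taylor_term_0) simp
    then show ?thesis by (simp add: taylor_rem_def[abs_def] Suc)
  qed
  finally show ?thesis .
qed

lemma taylor_term_Suc_at_0: "taylor_term (Suc k) f z 0 = 0"
  by simp

lemma taylor_rem_at_0: "taylor_rem (Suc K) f z 0 = 0"
  unfolding taylor_rem_def sum.lessThan_Suc_shift by (simp del: taylor_term.simps(2) add: taylor_term_Suc_at_0)

text \<open>By induction on \<open>K\<close>: the remainder vanishes at 0, and its derivatives along the segment
  are remainders of shorter expansions, so the mean value inequality adds one factor \<open>norm w\<close>.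
  Each step also sums over the directions, which gives the power of the dimension.\<close>

lemma taylor_rem_bound:
  fixes f :: "'a::euclidean_space \<Rightarrow> complex"
  assumes "smooth f"
    and "\<And>bs t. set bs \<subseteq> Basis \<Longrightarrow> length bs = K \<Longrightarrow> 0 \<le> t \<Longrightarrow> t \<le> 1 \<Longrightarrow> norm (pderivs bs f (t *\<^sub>R w + z)) \<le> M"
    and "0 \<le> t" "t \<le> 1"
  shows "norm (taylor_rem K f z (t *\<^sub>R w)) \<le> (real DIM('a) * norm w) ^ K * M"
  using assms
proof (induction K arbitrary: f t)
  case 0
  then show ?case using "0.prems"(2)[of "[]" t] by (simp add: taylor_rem_def)
next
  case (Suc K)
  let ?B = "(real DIM('a) * norm w) ^ K * M"
  have M: "0 \<le> M"
  proof -
    obtain b :: 'a where "b \<in> Basis" using nonempty_Basis by blast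
    then show ?thesis
      using Suc.prems(2)[of "replicate (Suc K) b" 0] norm_ge_zero order.trans
      by (metis (no_types, lifting) empty_subsetI insert_subset le_numeral_extra(3) length_replicate set_replicate_Suc zero_le_one)
  qed
  have IH: "norm (taylor_rem K (partial_deriv b f) z (s *\<^sub>R w)) \<le> ?B" if "b \<in> Basis" "0 \<le> s" "s \<le> 1" for b s
  proof (rule Suc.IH)
    show "smooth (partial_deriv b f)" using Suc.prems that smooth_partial_deriv by blast
    fix bs :: "'a list" and t :: real assume "set bs \<subseteq> Basis" "length bs = K" "0 \<le> t" "t \<le> 1"
    then show "norm (pderivs bs (partial_deriv b f) (t *\<^sub>R w + z)) \<le> M"
      using Suc.prems(2)[of "bs @ [b]" t] that by simp
  qed (use that in auto)
  have "norm (taylor_rem (Suc K) f z (0 + t *\<^sub>R w) - taylor_rem (Suc K) f z (0 + 0 *\<^sub>R w))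
     \<le> (\<Sum>b::'a\<in>Basis. norm w * ?B) * t"
  proof (rule vector_mvt_ineq)
    show "((\<lambda>t. taylor_rem (Suc K) f z (0 + t *\<^sub>R w)) has_vector_derivative
        (\<Sum>b\<in>Basis. of_real (w \<bullet> b) * partial_deriv b (taylor_rem (Suc K) f z) (0 + t *\<^sub>R w))) (at t)" for t
      using Suc.prems by (intro smooth_has_vector_derivative smooth_taylor_rem)
    show "norm (\<Sum>b\<in>Basis. of_real (w \<bullet> b) * partial_deriv b (taylor_rem (Suc K) f z) (0 + s *\<^sub>R w))
       \<le> (\<Sum>b::'a\<in>Basis. norm w * ?B)" if "0 \<le> s" "s \<le> t" for s
    proof (rule norm_sum[THEN order_trans], rule sum_mono)
      fix b :: 'a assume b: "b \<in> Basis"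
      show "norm (of_real (w \<bullet> b) * partial_deriv b (taylor_rem (Suc K) f z) (0 + s *\<^sub>R w)) \<le> norm w * ?B"
        unfolding norm_mult
        using b Suc.prems that IH[OF b, of s] Basis_le_norm[OF b, of w]
        by (intro mult_mono) (auto simp: partial_deriv_taylor_rem)
    qed
  qed (use Suc.prems in auto)
  also have "\<dots> \<le> (\<Sum>b::'a\<in>Basis. norm w * ?B) * 1"
    using Suc.prems M by (intro mult_left_mono sum_nonneg mult_nonneg_nonneg) auto
  also have "\<dots> = (real DIM('a) * norm w) ^ Suc K * M" by simp
  finally show ?case by (simp add: taylor_rem_at_0)
qed

text \<open>Differentiability of translation, with quadratic error, as a map into the weighted norms.
  Derivatives of the error term are error terms of derivatives, so only the bound on values
  needs Taylor's formula.\<close>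

lemma derivs_le_translate_expansion:
  fixes f :: "'a::euclidean_space \<Rightarrow> complex"
  assumes "smooth f" "derivs_le (n + 2) L A f" "norm h \<le> 1"
  shows "derivs_le n L ((real DIM('a))\<^sup>2 * 2 powr \<bar>L\<bar> * A * (norm h)\<^sup>2)
    (\<lambda>x. f (x + h) - f x - (\<Sum>b\<in>Basis. of_real (h \<bullet> b) * partial_deriv b f x))"
  using assms(1,2)
proof (induction n arbitrary: f)
  case (0 f)
  have "norm (f (x + h) - f x - (\<Sum>b\<in>Basis. of_real (h \<bullet> b) * partial_deriv b f x))
     \<le> (real DIM('a))\<^sup>2 * 2 powr \<bar>L\<bar> * A * (norm h)\<^sup>2 * (1 + norm x) powr L" for x
  proof -
    have A: "0 \<le> A" using "0.prems" derivs_le_nonneg by blast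
    have "norm (taylor_rem 2 f x (1 *\<^sub>R h)) \<le> (real DIM('a) * norm h)\<^sup>2 * (A * (2 powr \<bar>L\<bar> * (1 + norm x) powr L))"
    proof (rule taylor_rem_bound)
      fix bs :: "'a list" and t :: real assume bs: "set bs \<subseteq> Basis" "length bs = 2" and t: "0 \<le> t" "t \<le> 1"
      have "norm (pderivs bs f (t *\<^sub>R h + x)) \<le> A * (1 + norm (t *\<^sub>R h + x)) powr L"
        using "0.prems" bs by (intro derivs_le_pderivs[of 2]) (simp_all only: add_0 order_refl)
      also have "(1 + norm (t *\<^sub>R h + x)) powr L \<le> (1 + norm (t *\<^sub>R h)) powr \<bar>L\<bar> * (1 + norm x) powr L"
        using weight_translate[of x "t *\<^sub>R h" L] by (simp add: add.commute)
      also have "\<dots> \<le> 2 powr \<bar>L\<bar> * (1 + norm x) powr L"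
        using t assms(3) by (intro mult_right_mono powr_mono2) (auto intro: mult_le_one)
      finally show "norm (pderivs bs f (t *\<^sub>R h + x)) \<le> A * (2 powr \<bar>L\<bar> * (1 + norm x) powr L)"
        using A by (simp add: mult_left_mono)
    qed (use 0 in auto)
    moreover have "taylor_rem 2 f x h = f (x + h) - f x - (\<Sum>b\<in>Basis. of_real (h \<bullet> b) * partial_deriv b f x)"
      by (simp add: taylor_rem_def numeral_2_eq_2 add.commute algebra_simps)
    ultimately show ?thesis by (simp add: power_mult_distrib mult_ac)
  qed
  then show ?case by simp
next
  case (Suc n f)
  let ?g = "\<lambda>f x. f (x + h) - f x - (\<Sum>b\<in>Basis. of_real (h \<bullet> b) * partial_deriv b f x)"
  have "derivs_le (n + 2) L A f" using Suc.prems derivs_le_antimono by (metis add_le_mono1 le_SucI order_refl)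
  then have "derivs_le n L ((real DIM('a))\<^sup>2 * 2 powr \<bar>L\<bar> * A * (norm h)\<^sup>2) (?g f)"
    using Suc.prems by (intro Suc.IH)
  note 1 = derivs_leD[OF this]
  have 2: "partial_deriv c (?g f) = ?g (partial_deriv c f)" if "c \<in> Basis" for c
    using Suc.prems(1) that
    by (simp add: partial_deriv_diff_smooth smooth_diff smooth_translate smooth_sum partial_deriv_translate
           partial_deriv_sum_smooth smooth_cmult partial_deriv_cmult_smooth
           smooth_partial_deriv partial_deriv_commute[OF Suc.prems(1) that])
  have 3: "derivs_le n L ((real DIM('a))\<^sup>2 * 2 powr \<bar>L\<bar> * A * (norm h)\<^sup>2) (?g (partial_deriv c f))" if "c \<in> Basis" for c
    using Suc.prems that by (intro Suc.IH smooth_partial_deriv) auto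
  show ?case unfolding derivs_le.simps(2) using 1 2 3 by simp
qed

section \<open>Schwartz functions and tempered distributions\<close>

lemma basis_list: "distinct (basis_list :: 'a::euclidean_space list)" "set (basis_list :: 'a list) = Basis"
proof -
  have "\<exists>bs :: 'a list. distinct bs \<and> set bs = Basis"
    using finite_distinct_list[OF finite_Basis] by blast
  then have "distinct (basis_list :: 'a list) \<and> set (basis_list :: 'a list) = Basis"
    unfolding basis_list_def by (rule someI_ex)
  then show "distinct (basis_list :: 'a list)" "set (basis_list :: 'a list) = Basis" by auto
qed

definition multi_list :: "('a::euclidean_space \<Rightarrow> nat) \<Rightarrow> 'a list" where
  "multi_list \<alpha> = concat (map (\<lambda>b. replicate (\<alpha> b) b) basis_list)"

lemma multi_deriv_eq_pderivs: "multi_deriv \<alpha> f = pderivs (multi_list \<alpha>) f"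
proof -
  have "foldr (\<lambda>b. partial_deriv b ^^ \<alpha> b) xs f = pderivs (concat (map (\<lambda>b. replicate (\<alpha> b) b) xs)) f" for xs
    by (induction xs) (auto simp: foldr_replicate)
  then show ?thesis by (simp add: multi_deriv_def multi_list_def)
qed

lemma set_multi_list: "set (multi_list \<alpha>) \<subseteq> Basis"
  by (auto simp: multi_list_def basis_list(2) split: if_splits)

lemma length_multi_list: "length (multi_list \<alpha>) = multi_order \<alpha>"
proof -
  have "distinct xs \<Longrightarrow> length (concat (map (\<lambda>b. replicate (\<alpha> b) b) xs)) = sum \<alpha> (set xs)" for xs
    by (induction xs) auto
  from this[OF basis_list(1)] show ?thesis by (simp add: multi_list_def multi_order_def basis_list(2))
qed

lemma mset_multi_list:
  assumes "set bs \<subseteq> Basis" shows "mset (multi_list (count (mset bs))) = mset bs"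
proof (rule multiset_eqI)
  fix c
  have "distinct xs \<Longrightarrow> count (mset (concat (map (\<lambda>b. replicate (\<alpha> b) b) xs))) c = (if c \<in> set xs then \<alpha> c else 0)"
    for xs and \<alpha> :: "'a \<Rightarrow> nat"
    by (induction xs) auto
  note * = this
  have "count (mset (multi_list (count (mset bs)))) c = (if c \<in> Basis then count (mset bs) c else 0)"
    using *[OF basis_list(1), of "count (mset bs)"] unfolding multi_list_def basis_list(2) .
  also have "\<dots> = count (mset bs) c"
    using assms by (auto simp: not_in_iff[symmetric])
  finally show "count (mset (multi_list (count (mset bs)))) c = count (mset bs) c" .
qed

lemma pderivs_eq_multi_deriv:
  assumes "smooth f" "set bs \<subseteq> Basis"
  shows "pderivs bs f = multi_deriv (count (mset bs)) f"
  unfolding multi_deriv_eq_pderivs using assms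
  by (intro pderivs_perm mset_multi_list[symmetric])

lemma schwartz_iff: "schwartz f \<longleftrightarrow> smooth f \<and> (\<forall>n L. \<exists>A. derivs_le n L A f)"
proof (intro iffI conjI allI)
  assume f: "schwartz f"
  then show sm: "smooth f" by (simp add: schwartz_def)
  fix n L
  show "\<exists>A. derivs_le n L A f"
  proof (rule derivs_leI)
    fix bs :: "'a list" assume bs: "set bs \<subseteq> Basis"
    define k where "k = nat \<lceil>- L\<rceil>"
    have k: "- real k \<le> L" unfolding k_def by linarith
    obtain A where A: "\<And>x. (1 + norm x) ^ k * norm (pderivs bs f x) \<le> A"
      using f unfolding schwartz_def pderivs_eq_multi_deriv[OF sm bs] bdd_above_def by blast
    have "norm (pderivs bs f x) \<le> A * (1 + norm x) powr L" for x
    proof -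
      have pos: "0 < 1 + norm x" using norm_ge_zero[of x] by linarith
      have "0 \<le> A" using A[of x] order_trans[OF _ A[of x], of 0] by simp
      have "norm (pderivs bs f x) = ((1 + norm x) ^ k * norm (pderivs bs f x)) * (1 + norm x) powr (- real k)"
        using pos by (simp add: powr_minus powr_realpow field_simps)
      also have "\<dots> \<le> A * (1 + norm x) powr L"
        using A[of x] k \<open>0 \<le> A\<close> by (intro mult_mono weight_mono) auto
      finally show ?thesis .
    qed
    then show "\<exists>A. \<forall>x. norm (pderivs bs f x) \<le> A * (1 + norm x) powr L" by blast
  qed
next
  assume f: "smooth f \<and> (\<forall>n L. \<exists>A. derivs_le n L A f)"
  show "schwartz f"
    unfolding schwartz_def
  proof (intro conjI allI)
    show "smooth f" using f by simp
    fix k :: nat and \<alpha> :: "'a \<Rightarrow> nat"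
    obtain A where A: "derivs_le (multi_order \<alpha>) (- real k) A f" using f by blast
    have "(1 + norm x) ^ k * norm (multi_deriv \<alpha> f x) \<le> A" for x
    proof -
      have pos: "0 < 1 + norm x" using norm_ge_zero[of x] by linarith
      have "norm (multi_deriv \<alpha> f x) \<le> A * (1 + norm x) powr (- real k)"
        unfolding multi_deriv_eq_pderivs
        by (rule derivs_le_pderivs[OF A]) (auto simp: length_multi_list intro: set_multi_list[THEN subsetD])
      then show ?thesis using pos by (simp add: powr_minus powr_realpow field_simps)
    qed
    then show "bdd_above (range (\<lambda>x. (1 + norm x) ^ k * norm (multi_deriv \<alpha> f x)))"
      by (intro bdd_aboveI[of _ A]) auto
  qed
qed

lemma schwartz_smooth: "schwartz f \<Longrightarrow> smooth f" by (simp add: schwartz_def)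

lemma schwartz_derivs_le: "schwartz f \<Longrightarrow> \<exists>A. derivs_le n L A f" by (simp add: schwartz_iff)

text \<open>Symbols of order \<open>L\<close> without gain under differentiation. Anisotropic Shubin symbols,
  monomials, exponentials and Schwartz functions are all of this type, and it is enough for the
  Weyl operator to act on Schwartz functions.\<close>

definition symbol :: "real \<Rightarrow> ('a::euclidean_space \<Rightarrow> complex) \<Rightarrow> bool" where
  "symbol L b \<longleftrightarrow> smooth b \<and> (\<forall>n. \<exists>A. derivs_le n L A b)"

lemma symbol_smooth: "symbol L b \<Longrightarrow> smooth b" by (simp add: symbol_def)

lemma symbol_derivs_le: "symbol L b \<Longrightarrow> \<exists>A. derivs_le n L A b" by (simp add: symbol_def)

lemma symbolI: "smooth b \<Longrightarrow> (\<And>n. \<exists>A. derivs_le n L A b) \<Longrightarrow> symbol L b" by (simp add: symbol_def)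

lemma schwartz_iff_symbol: "schwartz f \<longleftrightarrow> (\<forall>L. symbol L f)"
  by (auto simp: symbol_def schwartz_iff)

lemma schwartz_symbol: "schwartz f \<Longrightarrow> symbol L f"
  by (simp add: schwartz_iff_symbol)

lemma symbol_add:
  assumes f: "symbol L f" and g: "symbol L g" shows "symbol L (\<lambda>x. f x + g x)"
proof (rule symbolI)
  show "smooth (\<lambda>x. f x + g x)" using f g by (intro smooth_add symbol_smooth)
  fix n
  from symbol_derivs_le[OF f] obtain A where A: "derivs_le n L A f" ..
  from symbol_derivs_le[OF g] obtain B where B: "derivs_le n L B g" ..
  show "\<exists>C. derivs_le n L C (\<lambda>x. f x + g x)"
    using derivs_le_add[OF symbol_smooth[OF f] symbol_smooth[OF g] A B] ..
qed

lemma symbol_diff: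
  assumes f: "symbol L f" and g: "symbol L g" shows "symbol L (\<lambda>x. f x - g x)"
proof (rule symbolI)
  show "smooth (\<lambda>x. f x - g x)" using f g by (intro smooth_diff symbol_smooth)
  fix n
  from symbol_derivs_le[OF f] obtain A where A: "derivs_le n L A f" ..
  from symbol_derivs_le[OF g] obtain B where B: "derivs_le n L B g" ..
  show "\<exists>C. derivs_le n L C (\<lambda>x. f x - g x)"
    using derivs_le_diff[OF symbol_smooth[OF f] symbol_smooth[OF g] A B] ..
qed

lemma symbol_mult:
  assumes f: "symbol L f" and g: "symbol K g" shows "symbol (L + K) (\<lambda>x. f x * g x)"
proof (rule symbolI)
  show "smooth (\<lambda>x. f x * g x)" using f g by (intro smooth_mult symbol_smooth)
  fix n
  from symbol_derivs_le[OF f] obtain A where A: "derivs_le n L A f" ..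
  from symbol_derivs_le[OF g] obtain B where B: "derivs_le n K B g" ..
  show "\<exists>C. derivs_le n (L + K) C (\<lambda>x. f x * g x)"
    using derivs_le_mult[OF symbol_smooth[OF f] symbol_smooth[OF g] A B] ..
qed

lemma symbol_cmult:
  assumes f: "symbol L f" shows "symbol L (\<lambda>x. c * f x)"
proof (rule symbolI)
  show "smooth (\<lambda>x. c * f x)" using f by (intro smooth_cmult symbol_smooth)
  fix n
  from symbol_derivs_le[OF f] obtain A where A: "derivs_le n L A f" ..
  show "\<exists>C. derivs_le n L C (\<lambda>x. c * f x)"
    using derivs_le_cmult[OF symbol_smooth[OF f] A] ..
qed

lemma symbol_translate:
  assumes f: "symbol L f" shows "symbol L (\<lambda>x. f (x + h))"
proof (rule symbolI)
  show "smooth (\<lambda>x. f (x + h))" using f by (intro smooth_translate symbol_smooth)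
  fix n
  from symbol_derivs_le[OF f] obtain A where A: "derivs_le n L A f" ..
  show "\<exists>C. derivs_le n L C (\<lambda>x. f (x + h))"
    using derivs_le_translate[OF symbol_smooth[OF f] A] ..
qed

lemma symbol_cnj:
  assumes f: "symbol L f" shows "symbol L (\<lambda>x. cnj (f x))"
proof (rule symbolI)
  show "smooth (\<lambda>x. cnj (f x))" using f by (intro smooth_cnj symbol_smooth)
  fix n
  from symbol_derivs_le[OF f] obtain A where A: "derivs_le n L A f" ..
  show "\<exists>C. derivs_le n L C (\<lambda>x. cnj (f x))"
    using derivs_le_cnj[OF symbol_smooth[OF f] A] ..
qed

lemma symbol_partial_deriv:
  assumes f: "symbol L f" and b: "b \<in> Basis" shows "symbol L (partial_deriv b f)"
proof (rule symbolI)
  show "smooth (partial_deriv b f)" using f b by (intro smooth_partial_deriv symbol_smooth)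
  fix n
  from symbol_derivs_le[OF f] obtain A where A: "derivs_le (Suc n) L A f" ..
  show "\<exists>C. derivs_le n L C (partial_deriv b f)"
    using derivs_le_partial_deriv[OF A b] ..
qed

lemma symbol_mono:
  assumes f: "symbol L f" and L: "L \<le> L'" shows "symbol L' f"
proof (rule symbolI)
  show "smooth f" using f by (rule symbol_smooth)
  fix n
  from symbol_derivs_le[OF f] obtain A where A: "derivs_le n L A f" ..
  show "\<exists>C. derivs_le n L' C f" using derivs_le_weaken[OF A order_refl L order_refl] ..
qed

lemma symbol_const: "0 \<le> L \<Longrightarrow> symbol L (\<lambda>x. c)"
  by (rule symbolI, simp, rule exI, rule derivs_le_const[OF order_refl])

lemma symbol_sum: "(\<And>i. i \<in> I \<Longrightarrow> symbol L (f i)) \<Longrightarrow> 0 \<le> L \<Longrightarrow> symbol L (\<lambda>x. \<Sum>i\<in>I. f i x)"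
  by (induction I rule: infinite_finite_induct) (simp_all add: symbol_const symbol_add)

lemma symbol_inner: "b \<in> Basis \<Longrightarrow> symbol 1 (\<lambda>w. of_real (w \<bullet> b))"
  by (rule symbolI, rule smooth_inner, rule exI, rule derivs_le_inner)

lemma schwartz_add: "schwartz f \<Longrightarrow> schwartz g \<Longrightarrow> schwartz (\<lambda>x. f x + g x)"
  by (simp add: schwartz_iff_symbol symbol_add)

lemma schwartz_cmult: "schwartz f \<Longrightarrow> schwartz (\<lambda>x. c * f x)"
  by (simp add: schwartz_iff_symbol symbol_cmult)

lemma schwartz_diff: "schwartz f \<Longrightarrow> schwartz g \<Longrightarrow> schwartz (\<lambda>x. f x - g x)"
  by (simp add: schwartz_iff_symbol symbol_diff)

lemma schwartz_zero: "schwartz (\<lambda>x. 0)"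
proof -
  have "derivs_le n L 0 (\<lambda>x::'a. 0)" for n L
    by (induction n) simp_all
  then show ?thesis unfolding schwartz_iff using smooth_const by blast
qed

lemma schwartz_sum: "(\<And>i. i \<in> I \<Longrightarrow> schwartz (f i)) \<Longrightarrow> schwartz (\<lambda>x. \<Sum>i\<in>I. f i x)"
  by (induction I rule: infinite_finite_induct) (simp_all add: schwartz_add schwartz_zero)

lemma schwartz_partial_deriv: "schwartz f \<Longrightarrow> b \<in> Basis \<Longrightarrow> schwartz (partial_deriv b f)"
  by (simp add: schwartz_iff_symbol symbol_partial_deriv)

lemma schwartz_translate: "schwartz f \<Longrightarrow> schwartz (\<lambda>x. f (x + h))"
  by (simp add: schwartz_iff_symbol symbol_translate)

lemma symbol_mult_schwartz:
  assumes "symbol L p" "schwartz f" shows "schwartz (\<lambda>x. p x * f x)"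
  unfolding schwartz_iff_symbol
proof
  fix K show "symbol K (\<lambda>x. p x * f x)"
    using symbol_mult[OF assms(1) schwartz_symbol[OF assms(2), of "K - L"]] by simp
qed

lemma schwartz_inner_mult: "b \<in> Basis \<Longrightarrow> schwartz f \<Longrightarrow> schwartz (\<lambda>y. of_real (y \<bullet> b) * f y)"
  by (rule symbol_mult_schwartz[OF symbol_inner])

text \<open>For conjugate linear functionals, a bound by one weighted norm is equivalent to continuity
  in the Frechet topology, and it is the form in which continuity is used.\<close>

definition bounded_functional :: "(('a::euclidean_space \<Rightarrow> complex) \<Rightarrow> complex) \<Rightarrow> bool" where
  "bounded_functional v \<longleftrightarrow>
     (\<forall>f g. schwartz f \<longrightarrow> schwartz g \<longrightarrow> v (\<lambda>x. f x + g x) = v f + v g) \<and>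
     (\<forall>c f. schwartz f \<longrightarrow> v (\<lambda>x. c * f x) = cnj c * v f) \<and>
     (\<exists>N C. 0 \<le> C \<and> (\<forall>f B. schwartz f \<longrightarrow> derivs_le N (- real N) B f \<longrightarrow> norm (v f) \<le> C * B))"

lemma pderivs_diff:
  "smooth f \<Longrightarrow> smooth g \<Longrightarrow> set bs \<subseteq> Basis \<Longrightarrow>
     pderivs bs (\<lambda>x. f x - g x) = (\<lambda>x. pderivs bs f x - pderivs bs g x)"
proof (induction bs)
  case (Cons b bs)
  then show ?case using partial_deriv_diff_smooth[OF smooth_pderivs smooth_pderivs, of f bs g bs b] by simp
qed simp

lemma schwartz_bdd:
  assumes "schwartz f"
  shows "bdd_above (range (\<lambda>x. (1 + norm x) ^ k * norm (multi_deriv \<alpha> f x)))"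
  using assms by (simp add: schwartz_def)

lemma pderivs_zero: "pderivs bs (\<lambda>x. 0) = (\<lambda>x. 0)"
  by (induction bs) auto

text \<open>The weighted norms increase with \<open>N\<close>, so they form a directed family. A finite
  intersection of subbasic sets then contains a ball of one of them around 0. The subbasic balls
  need not be centred at 0, but the triangle inequality leaves room for a smaller ball around 0.\<close>

lemma schwartz_nbhd_zero:
  fixes U :: "('a::euclidean_space \<Rightarrow> complex) set"
  assumes "openin schwartz_topology U" "(\<lambda>x. 0) \<in> U"
  shows "\<exists>N e. 0 < e \<and> (\<forall>f. schwartz f \<longrightarrow> derivs_le N (- real N) e f \<longrightarrow> f \<in> U)"
proof -
  have "generate_topology_on {{g. schwartz g \<and> schwartz_seminorm k \<alpha> (\<lambda>x. g x - f x) < e} | f k (\<alpha>::'a \<Rightarrow> nat) e. schwartz f \<and> 0 < e} U"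
    using assms(1) unfolding schwartz_topology_def openin_topology_generated_by_iff .
  then show ?thesis using assms(2)
  proof (induction rule: generate_topology_on.induct)
    case Empty then show ?case by simp
  next
    case (Int V W)
    then obtain N1 e1 N2 e2 where *: "0 < e1" "\<And>f. schwartz f \<Longrightarrow> derivs_le N1 (- real N1) e1 f \<Longrightarrow> f \<in> V"
      "0 < e2" "\<And>f. schwartz f \<Longrightarrow> derivs_le N2 (- real N2) e2 f \<Longrightarrow> f \<in> W" by blast
    show ?case
    proof (intro exI conjI allI impI)
      show "0 < min e1 e2" using * by simp
      fix f :: "'a \<Rightarrow> complex" assume "schwartz f" "derivs_le (max N1 N2) (- real (max N1 N2)) (min e1 e2) f"
      then have "derivs_le N1 (- real N1) e1 f" "derivs_le N2 (- real N2) e2 f"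
        by (auto elim!: derivs_le_weaken)
      then show "f \<in> V \<inter> W" using * \<open>schwartz f\<close> by blast
    qed
  next
    case (UN K)
    then obtain V where "V \<in> K" "(\<lambda>x. 0) \<in> V" by blast
    then show ?case using UN.IH[of V] by blast
  next
    case (Basis V)
    then obtain f0 k e and \<alpha> :: "'a \<Rightarrow> nat" where V: "V = {g. schwartz g \<and> schwartz_seminorm k \<alpha> (\<lambda>x. g x - f0 x) < e}"
      and f0: "schwartz f0" "0 < e" by blast
    define r where "r = schwartz_seminorm k \<alpha> (\<lambda>x. 0 - f0 x)"
    have r: "r < e" using Basis.prems V unfolding r_def by blast
    have md: "multi_deriv \<alpha> (\<lambda>x. g x - f0 x) x = multi_deriv \<alpha> g x - multi_deriv \<alpha> f0 x" if "schwartz g" for g and x :: 'a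
      using pderivs_diff[OF schwartz_smooth[OF that] schwartz_smooth[OF f0(1)] set_multi_list]
      by (simp add: multi_deriv_eq_pderivs)
    have z: "multi_deriv \<alpha> (\<lambda>x. 0) x = 0" for x :: 'a
      by (simp add: multi_deriv_eq_pderivs pderivs_zero)
    define N where "N = max k (multi_order \<alpha>)"
    show ?case
    proof (intro exI[of _ N] exI[of _ "(e - r) / 2"] conjI allI impI)
      show "0 < (e - r) / 2" using r by simp
      fix g :: "'a \<Rightarrow> complex" assume g: "schwartz g" "derivs_le N (- real N) ((e - r) / 2) g"
      have "schwartz_seminorm k \<alpha> (\<lambda>x. g x - f0 x) \<le> (e - r) / 2 + r"
        unfolding schwartz_seminorm_def
      proof (rule cSUP_least)
        fix x :: 'a
        have pos: "0 < 1 + norm x" using norm_ge_zero[of x] by linarith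
        have "(1 + norm x) ^ k * norm (multi_deriv \<alpha> (\<lambda>x. 0 - f0 x) x) \<le> r"
          unfolding r_def schwartz_seminorm_def
          using schwartz_bdd[OF schwartz_diff[OF schwartz_zero f0(1)], of k \<alpha>] by (intro cSUP_upper) auto
        then have 1: "(1 + norm x) ^ k * norm (multi_deriv \<alpha> f0 x) \<le> r"
          using md[OF schwartz_zero, of x] z[of x] by simp
        have "norm (multi_deriv \<alpha> g x) \<le> (e - r) / 2 * (1 + norm x) powr (- real N)"
          unfolding multi_deriv_eq_pderivs
          by (rule derivs_le_pderivs[OF g(2)])
             (auto simp: length_multi_list N_def intro: set_multi_list[THEN subsetD])
        also have "\<dots> \<le> (e - r) / 2 * (1 + norm x) powr (- real k)"
          using r by (intro mult_left_mono weight_mono) (auto simp: N_def)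
        finally have 2: "(1 + norm x) ^ k * norm (multi_deriv \<alpha> g x) \<le> (e - r) / 2"
          using pos by (simp add: powr_minus powr_realpow field_simps)
        have "(1 + norm x) ^ k * norm (multi_deriv \<alpha> (\<lambda>x. g x - f0 x) x)
           \<le> (1 + norm x) ^ k * (norm (multi_deriv \<alpha> g x) + norm (multi_deriv \<alpha> f0 x))"
          unfolding md[OF g(1)] using pos by (intro mult_left_mono norm_triangle_ineq4) auto
        with 1 2 show "(1 + norm x) ^ k * norm (multi_deriv \<alpha> (\<lambda>x. g x - f0 x) x) \<le> (e - r) / 2 + r"
          unfolding distrib_left by linarith
      qed simp
      moreover have "(e - r) / 2 + r < e" using r by (simp add: field_simps)
      ultimately show "g \<in> V" using g V by simp
    qed
  qed
qed

text \<open>The preimage of the unit ball contains a ball of some weighted norm around 0, and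
  homogeneity turns this into an estimate. A function with vanishing norm is 0 and has to be
  treated separately.\<close>

lemma tempered_imp_bounded_functional:
  fixes u :: "('a::euclidean_space \<Rightarrow> complex) \<Rightarrow> complex"
  assumes "tempered_distribution u" shows "bounded_functional u"
proof -
  have hom: "u (\<lambda>x. c * f x) = cnj c * u f" if "schwartz f" for c f
    using assms that unfolding tempered_distribution_def by blast
  have z: "u (\<lambda>x. 0) = 0" using hom[OF schwartz_zero, of 0] by simp
  let ?U = "{f \<in> topspace schwartz_topology. u f \<in> ball 0 1}"
  have "openin schwartz_topology ?U"
    using assms unfolding tempered_distribution_def
    by (intro openin_continuous_map_preimage) auto
  moreover have "(\<lambda>x. 0) \<in> ?U"
  proof -
    have q: "schwartz_seminorm 0 (\<lambda>_. 0) (\<lambda>x::'a. 0 - 0) < 1"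
      by (simp add: multi_deriv_eq_pderivs pderivs_zero schwartz_seminorm_def)
    have "(\<lambda>x::'a. 0) \<in> topspace schwartz_topology"
      unfolding schwartz_topology_def topology_generated_by_topspace
      by (rule UnionI[of "{g. schwartz g \<and> schwartz_seminorm 0 (\<lambda>\<alpha>. 0) (\<lambda>x. g x - 0) < 1}"],
          intro CollectI exI[of _ "\<lambda>x. 0"] exI[of _ "0::nat"] exI[of _ "\<lambda>_. 0::nat"]
          exI[of _ "1::real"] conjI refl schwartz_zero zero_less_one, use q in \<open>simp add: schwartz_zero\<close>)
    then show ?thesis using z by simp
  qed
  ultimately obtain N e where e: "0 < e" "\<And>f. schwartz f \<Longrightarrow> derivs_le N (- real N) e f \<Longrightarrow> f \<in> ?U"
    using schwartz_nbhd_zero by blast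
  have "norm (u f) \<le> 1 / e * B" if f: "schwartz f" "derivs_le N (- real N) B f" for f B
  proof (cases "B = 0")
    case True
    have "f x = 0" for x using derivs_leD[OF f(2), of x] True by simp
    then have "f = (\<lambda>x. 0)" by auto
    then show ?thesis using z True by simp
  next
    case False
    then have B: "B > 0" using derivs_le_nonneg[OF f(2)] by simp
    have n: "norm (complex_of_real (e / B)) * B = e"
      using B e(1) by (simp add: norm_divide)
    have "derivs_le N (- real N) e (\<lambda>x. of_real (e / B) * f x)"
      using derivs_le_cmult[OF schwartz_smooth[OF f(1)] f(2), of "of_real (e / B)"] unfolding n .
    then have "(\<lambda>x. of_real (e / B) * f x) \<in> ?U" using f(1) e(2) schwartz_cmult by blast
    then have "norm (u (\<lambda>x. of_real (e / B) * f x)) < 1" by simp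
    then have "e / B * norm (u f) < 1"
      unfolding hom[OF f(1)] using B e(1) by (simp add: norm_mult norm_divide)
    then show ?thesis using B e(1) by (simp add: field_simps)
  qed
  moreover have "0 \<le> 1 / e" using e by simp
  ultimately show ?thesis
    using assms unfolding bounded_functional_def tempered_distribution_def by blast
qed

section \<open>Partial derivatives on phase space\<close>

lemma partial_deriv_Pair1: "partial_deriv b (\<lambda>x. a (x, \<xi>)) x = partial_deriv (b, 0) a (x, \<xi>)"
  by (simp add: partial_deriv_def)

lemma partial_deriv_Pair2: "partial_deriv b (\<lambda>\<xi>. a (x, \<xi>)) \<xi> = partial_deriv (0, b) a (x, \<xi>)"
  by (simp add: partial_deriv_def)

lemma pderivs_Pair1: "pderivs bs (\<lambda>x. a (x, \<xi>)) x = pderivs (map (\<lambda>b. (b, 0)) bs) a (x, \<xi>)"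
proof (induction bs arbitrary: x)
  case (Cons b bs)
  have "pderivs bs (\<lambda>x. a (x, \<xi>)) = (\<lambda>x. pderivs (map (\<lambda>b. (b, 0)) bs) a (x, \<xi>))"
    using Cons by auto
  then show ?case by (simp add: partial_deriv_Pair1[where a="pderivs (map (\<lambda>b. (b, 0)) bs) a"])
qed simp

lemma pderivs_Pair2: "pderivs bs (\<lambda>\<xi>. a (x, \<xi>)) \<xi> = pderivs (map (\<lambda>b. (0, b)) bs) a (x, \<xi>)"
proof (induction bs arbitrary: \<xi>)
  case (Cons b bs)
  have "pderivs bs (\<lambda>\<xi>. a (x, \<xi>)) = (\<lambda>\<xi>. pderivs (map (\<lambda>b. (0, b)) bs) a (x, \<xi>))"
    using Cons by auto
  then show ?case by (simp add: partial_deriv_Pair2[where a="pderivs (map (\<lambda>b. (0, b)) bs) a"])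
qed simp

lemma phase_deriv_eq_pderivs:
  "phase_deriv \<alpha> \<beta> a z = pderivs (map (\<lambda>b. (b, 0)) (multi_list \<alpha>) @ map (\<lambda>b. (0, b)) (multi_list \<beta>)) a z"
proof (cases z)
  case (Pair x \<xi>)
  have "multi_deriv \<beta> (\<lambda>\<xi>'. a (x', \<xi>')) \<xi> = pderivs (map (\<lambda>b. (0, b)) (multi_list \<beta>)) a (x', \<xi>)" for x'
    unfolding multi_deriv_eq_pderivs pderivs_Pair2 ..
  then show ?thesis
    unfolding phase_deriv_def Pair multi_deriv_eq_pderivs[of \<alpha>]
    by (simp add: pderivs_Pair1[where a="pderivs (map (\<lambda>b. (0, b)) (multi_list \<beta>)) a"])
qed

text \<open>Every basis vector of the product lies in one of the two factors.\<close>

lemma phase_list_split: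
  fixes bs :: "('a::euclidean_space \<times> 'b::euclidean_space) list"
  assumes "set bs \<subseteq> Basis"
  shows "\<exists>ps qs. set ps \<subseteq> Basis \<and> set qs \<subseteq> Basis \<and>
    mset bs = mset (map (\<lambda>b. (b, 0)) ps @ map (\<lambda>b. (0, b)) qs)"
  using assms
proof (induction bs)
  case Nil
  show ?case by (intro exI[of _ "[]"]) auto
next
  case (Cons c bs)
  then obtain ps qs where *: "set ps \<subseteq> Basis" "set qs \<subseteq> Basis"
    "mset bs = mset (map (\<lambda>b. (b, 0)) ps @ map (\<lambda>b. (0, b)) qs)" by auto
  from Cons.prems have "c \<in> Basis" by simp
  then consider b where "b \<in> Basis" "c = (b, 0)" | b where "b \<in> Basis" "c = (0, b)"
    unfolding Basis_prod_def by blast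
  then show ?case
  proof cases
    case 1 with * show ?thesis by (intro exI[of _ "b # ps"] exI[of _ qs]) auto
  next
    case 2 with * show ?thesis by (intro exI[of _ ps] exI[of _ "b # qs"]) auto
  qed
qed

lemma pderivs_eq_phase_deriv:
  fixes a :: "'a::euclidean_space \<times> 'b::euclidean_space \<Rightarrow> complex"
  assumes "smooth a" "set bs \<subseteq> Basis"
  shows "\<exists>\<alpha> \<beta>. pderivs bs a = phase_deriv \<alpha> \<beta> a \<and> multi_order \<alpha> + multi_order \<beta> = length bs"
proof -
  obtain ps qs where *: "set ps \<subseteq> Basis" "set qs \<subseteq> Basis"
    "mset bs = mset (map (\<lambda>b. (b, 0)) ps @ map (\<lambda>b. (0, b)) qs)"
    using phase_list_split[OF assms(2)] by blast
  let ?ms = "map (\<lambda>b. (b, 0)) (multi_list (count (mset ps))) @ map (\<lambda>b. (0, b)) (multi_list (count (mset qs)))"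
  have m: "mset bs = mset ?ms"
    using *(3) mset_multi_list[OF *(1)] mset_multi_list[OF *(2)] by simp
  have "pderivs bs a = pderivs ?ms a" by (rule pderivs_perm[OF assms m])
  then have "pderivs bs a = phase_deriv (count (mset ps)) (count (mset qs)) a"
    by (auto simp: phase_deriv_eq_pderivs)
  moreover have "length bs = length ?ms" using m by (rule mset_eq_length)
  ultimately show ?thesis by (auto simp: length_multi_list)
qed

section \<open>The anisotropic weight\<close>

lemma mu_ge_1: "1 \<le> mu s z"
  by (cases z) (simp add: mu_def)

lemma norm_fst_snd: "norm (fst z) \<le> norm z" "norm (snd z) \<le> norm z"
  by (cases z; simp add: norm_Pair real_le_rsqrt)+

lemma mu_le:
  assumes "s > 0"
  shows "mu s z \<le> 2 * (1 + norm z) powr max 1 (1 / s)"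
proof -
  obtain x \<xi> where z: "z = (x, \<xi>)" by (cases z)
  have n: "norm x \<le> norm z" "norm \<xi> \<le> norm z" using norm_fst_snd[of z] z by auto
  have "1 + norm x \<le> (1 + norm z) powr 1" using n by (simp add: powr_one)
  also have "\<dots> \<le> (1 + norm z) powr max 1 (1 / s)" by (intro weight_mono) simp
  finally have 1: "1 + norm x \<le> (1 + norm z) powr max 1 (1 / s)" .
  have "norm \<xi> powr (1 / s) \<le> (1 + norm z) powr (1 / s)"
    using n assms by (intro powr_mono2) auto
  also have "\<dots> \<le> (1 + norm z) powr max 1 (1 / s)" by (intro weight_mono) simp
  finally show ?thesis using 1 by (simp add: z mu_def)
qed

text \<open>The norm is subadditive, and the power \<open>1 / s\<close> is so up to the factor \<open>2 powr (1 / s)\<close>,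
  which is needed when \<open>s < 1\<close>. Hence the weight is submultiplicative up to that factor.\<close>

lemma mu_moderate:
  assumes "s > 0"
  shows "mu s z \<le> 2 * 2 powr (1 / s) * mu s (z + w) * (1 + norm w) powr max 1 (1 / s)"
proof -
  obtain x \<xi> y \<eta> where z: "z = (x, \<xi>)" "w = (y, \<eta>)" by (cases z, cases w)
  define p where "p = norm (\<xi> + \<eta>)"
  define q where "q = norm \<eta>"
  define k where "k = (2::real) powr (1 / s)"
  have k: "1 \<le> k" using assms by (simp add: k_def ge_one_powr_ge_zero)
  have "norm \<xi> \<le> p + q" using norm_triangle_ineq4[of "\<xi> + \<eta>" \<eta>] by (simp add: p_def q_def)
  then have "norm \<xi> powr (1 / s) \<le> (2 * max p q) powr (1 / s)"
    using assms by (intro powr_mono2) (auto simp: p_def q_def)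
  also have "\<dots> = k * (max p q) powr (1 / s)"
    by (simp add: powr_mult p_def q_def k_def)
  also have "(max p q) powr (1 / s) \<le> p powr (1 / s) + q powr (1 / s)"
    by (auto simp: max_def)
  finally have 1: "norm \<xi> powr (1 / s) \<le> k * (p powr (1 / s) + q powr (1 / s))"
    using k by (simp add: mult_left_mono)
  have "norm x \<le> norm (x + y) + norm y" using norm_triangle_ineq4[of "x + y" y] by simp
  then have "1 + norm x \<le> 1 * (1 + norm (x + y) + norm y)" by simp
  also have "\<dots> \<le> k * (1 + norm (x + y) + norm y)" using k by (intro mult_right_mono) auto
  finally have "mu s z \<le> k * ((1 + norm (x + y) + p powr (1 / s)) + (norm y + q powr (1 / s)))"
    using 1 by (simp add: z mu_def algebra_simps)
  also have "\<dots> \<le> k * (mu s (z + w) * mu s w)"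
  proof (rule mult_left_mono)
    define P where "P = norm (x + y) + p powr (1 / s)"
    define Q where "Q = norm y + q powr (1 / s)"
    have "0 \<le> P * Q" unfolding P_def Q_def by simp
    moreover have "mu s (z + w) = 1 + P" "mu s w = 1 + Q" by (simp_all add: z mu_def P_def Q_def p_def q_def)
    ultimately show "(1 + norm (x + y) + p powr (1 / s)) + (norm y + q powr (1 / s)) \<le> mu s (z + w) * mu s w"
      unfolding P_def[symmetric] by (simp add: algebra_simps P_def Q_def)
  qed (use k in simp)
  also have "\<dots> \<le> k * (mu s (z + w) * (2 * (1 + norm w) powr max 1 (1 / s)))"
    using k mu_ge_1[of s "z + w"] mu_le[OF assms, of w] by (intro mult_left_mono) auto
  finally show ?thesis by (simp add: k_def mult_ac)
qed

lemma mu_powr_mono: "p \<le> q \<Longrightarrow> mu s z powr p \<le> mu s z powr q"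
  by (rule powr_mono) (simp_all add: mu_ge_1)

lemma order_mono:
  fixes s :: real and j k :: nat
  shows "min 1 s * real (j + k) \<le> real j + s * real k"
proof -
  have "min 1 s * real j \<le> 1 * real j" "min 1 s * real k \<le> s * real k"
    by (intro mult_right_mono; simp)+
  then show ?thesis by (simp add: distrib_left)
qed

text \<open>A position derivative gains one power of the weight and a frequency derivative gains \<open>s\<close>
  powers. Counting \<open>min 1 s\<close> for each loses information but makes the gain a function of the
  number of derivatives alone.\<close>

lemma shubin_pderivs:
  assumes "a \<in> shubin_symbols m s" "set bs \<subseteq> Basis"
  shows "\<exists>C>0. \<forall>z. norm (pderivs bs a z) \<le> C * mu s z powr (m - min 1 s * real (length bs))"
proof -
  have sm: "smooth a" using assms by (simp add: shubin_symbols_def)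
  obtain \<alpha> \<beta> where ab: "pderivs bs a = phase_deriv \<alpha> \<beta> a" "multi_order \<alpha> + multi_order \<beta> = length bs"
    using pderivs_eq_phase_deriv[OF sm assms(2)] by blast
  obtain C where C: "C > 0" "\<And>z. norm (phase_deriv \<alpha> \<beta> a z)
        \<le> C * mu s z powr (m - real (multi_order \<alpha>) - s * real (multi_order \<beta>))"
    using assms unfolding shubin_symbols_def by blast
  have "norm (pderivs bs a z) \<le> C * mu s z powr (m - min 1 s * real (length bs))" for z
  proof -
    have "mu s z powr (m - real (multi_order \<alpha>) - s * real (multi_order \<beta>)) \<le> mu s z powr (m - min 1 s * real (length bs))"
      using order_mono[of s "multi_order \<alpha>" "multi_order \<beta>"] unfolding ab(2)
      by (intro mu_powr_mono) linarith
    then have "C * mu s z powr (m - real (multi_order \<alpha>) - s * real (multi_order \<beta>))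
        \<le> C * mu s z powr (m - min 1 s * real (length bs))"
      using C(1) by (intro mult_left_mono) auto
    with C(2)[of z] show ?thesis unfolding ab(1) by linarith
  qed
  with C show ?thesis by blast
qed

text \<open>The anisotropic weight is at most a power of \<open>1 + norm z\<close>; the derivatives of the symbol
  are even smaller.\<close>

lemma shubin_symbol:
  assumes "s > 0" "a \<in> shubin_symbols m s"
  shows "symbol (max 1 (1 / s) * \<bar>m\<bar>) a"
  unfolding symbol_def
proof (intro conjI allI)
  show "smooth a" using assms by (simp add: shubin_symbols_def)
  fix n show "\<exists>A. derivs_le n (max 1 (1 / s) * \<bar>m\<bar>) A a"
  proof (rule derivs_leI)
    fix bs :: "((real^'a) \<times> (real^'a)) list" assume "set bs \<subseteq> Basis"
    then obtain C where C: "C > 0" "\<And>z. norm (pderivs bs a z) \<le> C * mu s z powr (m - min 1 s * real (length bs))"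
      using shubin_pderivs[OF assms(2)] by blast
    have "norm (pderivs bs a z) \<le> (C * 2 powr \<bar>m\<bar>) * (1 + norm z) powr (max 1 (1 / s) * \<bar>m\<bar>)" for z
    proof -
      have "0 \<le> min 1 s * real (length bs)" using assms by simp
      then have "mu s z powr (m - min 1 s * real (length bs)) \<le> mu s z powr \<bar>m\<bar>"
        by (intro mu_powr_mono) linarith
      also have "\<dots> \<le> (2 * (1 + norm z) powr max 1 (1 / s)) powr \<bar>m\<bar>"
        using mu_le[OF assms(1), of z] mu_ge_1[of s z] by (intro powr_mono2) auto
      also have "\<dots> = 2 powr \<bar>m\<bar> * (1 + norm z) powr (max 1 (1 / s) * \<bar>m\<bar>)"
        by (simp add: powr_mult powr_powr)
      finally have "C * mu s z powr (m - min 1 s * real (length bs)) \<le> C * (2 powr \<bar>m\<bar> * (1 + norm z) powr (max 1 (1 / s) * \<bar>m\<bar>))"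
        using C(1) by (intro mult_left_mono) auto
      with C(2)[of z] show ?thesis unfolding mult.assoc by (rule order_trans)
    qed
    then show "\<exists>A. \<forall>z. norm (pderivs bs a z) \<le> A * (1 + norm z) powr (max 1 (1 / s) * \<bar>m\<bar>)" by blast
  qed
qed

section \<open>Integration over Euclidean space\<close>

lemma lborel_integral_translate:
  fixes g :: "'a::euclidean_space \<Rightarrow> 'b::{banach, second_countable_topology}"
  assumes "g \<in> borel_measurable borel"
  shows "(\<integral>v. g (c + v) \<partial>lborel) = (\<integral>v. g v \<partial>lborel)"
proof -
  have "(\<integral>v. g v \<partial>lborel) = (\<integral>v. g v \<partial>(distr lborel borel ((+) c)))"
    by (simp add: lborel_distr_plus)
  also have "\<dots> = (\<integral>v. g (c + v) \<partial>lborel)"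
    using assms by (subst integral_distr) auto
  finally show ?thesis by simp
qed

lemma lborel_integrable_translate:
  fixes g :: "'a::euclidean_space \<Rightarrow> 'b::{banach, second_countable_topology}"
  assumes "integrable lborel g"
  shows "integrable lborel (\<lambda>v. g (c + v))"
proof -
  have "integrable (distr lborel borel ((+) c)) g"
    using assms by (simp add: lborel_distr_plus)
  moreover have "g \<in> borel_measurable borel" using borel_measurable_integrable[OF assms] by simp
  ultimately show ?thesis by (subst (asm) integrable_distr_eq) auto
qed

lemma lborel_prod_coords:
  fixes h :: "'a::euclidean_space \<Rightarrow> real \<Rightarrow> 'b::{real_normed_field, banach, second_countable_topology}"
  assumes h: "\<And>b. b \<in> Basis \<Longrightarrow> integrable lborel (h b)"
  shows "integrable lborel (\<lambda>x. \<Prod>b\<in>Basis. h b (x \<bullet> b))"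
    and "(\<integral>x. (\<Prod>b\<in>Basis. h b (x \<bullet> b)) \<partial>lborel) = (\<Prod>b\<in>Basis. \<integral>t. h b t \<partial>lborel)"
proof -
  interpret product_sigma_finite "\<lambda>_::'a. lborel :: real measure" by standard
  let ?P = "\<Pi>\<^sub>M b\<in>(Basis::'a set). (lborel :: real measure)"
  let ?T = "\<lambda>f. \<Sum>b\<in>(Basis::'a set). f b *\<^sub>R b"
  let ?g = "\<lambda>x::'a. \<Prod>b\<in>Basis. h b (x \<bullet> b)"
  have hm: "h b \<in> borel_measurable borel" if "b \<in> Basis" for b
    using borel_measurable_integrable[OF h[OF that]] by simp
  have gm: "?g \<in> borel_measurable borel"
    using hm by (intro borel_measurable_prod) (auto intro: measurable_compose[OF _ hm])
  have Tm: "?T \<in> ?P \<rightarrow>\<^sub>M borel" by measurable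
  have eq: "?g (?T f) = (\<Prod>b\<in>Basis. h b (f b))" for f
    by (intro prod.cong refl) (simp add: inner_sum_left inner_Basis if_distrib cong: if_cong)
  have "integrable ?P (\<lambda>f. \<Prod>b\<in>Basis. h b (f b))"
    using h by (intro product_integrable_prod) auto
  then show "integrable lborel ?g"
    unfolding lborel_eq[where 'a='a] using gm Tm by (subst integrable_distr_eq) (simp_all add: eq)
  have "(\<integral>x. ?g x \<partial>lborel) = (\<integral>f. (\<Prod>b\<in>Basis. h b (f b)) \<partial>?P)"
    unfolding lborel_eq[where 'a='a] using gm Tm by (subst integral_distr) (simp_all add: eq)
  also have "\<dots> = (\<Prod>b\<in>Basis. \<integral>t. h b t \<partial>lborel)"
    using h by (intro product_integral_prod) auto
  finally show "(\<integral>x. ?g x \<partial>lborel) = (\<Prod>b\<in>Basis. \<integral>t. h b t \<partial>lborel)" .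
qed

text \<open>An integrable weight. Its exponent is twice the dimension because \<open>(1 + norm x)\<^sup>2\<close>
  dominates \<open>1 + (x \<bullet> b)\<^sup>2\<close> for each coordinate, and the product of the reciprocals of the
  latter is integrable by Fubini.\<close>

abbreviation "wdec \<equiv> (\<lambda>x::'a::euclidean_space. (1 + norm x) powr (- real (2 * DIM('a))))"

lemma integrable_wdec: "integrable lborel (wdec :: 'a::euclidean_space \<Rightarrow> real)"
proof -
  have "integrable lborel (\<lambda>t::real. inverse (1 + t\<^sup>2))"
    using integrable_inverse_1_plus_square by (simp add: set_integrable_def)
  then have i: "integrable lborel (\<lambda>x::'a. \<Prod>b\<in>Basis. inverse (1 + (x \<bullet> b)\<^sup>2))"
    by (intro lborel_prod_coords(1)[where h="\<lambda>b t. inverse (1 + t\<^sup>2)"])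
  have le: "norm (wdec x) \<le> norm (\<Prod>b\<in>Basis. inverse (1 + (x \<bullet> b)\<^sup>2))" for x :: 'a
  proof -
    have pos: "0 < 1 + norm x" using norm_ge_zero[of x] by linarith
    have "(1 + norm x) powr (- real (2 * DIM('a))) = inverse ((1 + norm x) ^ (2 * DIM('a)))"
      using pos by (simp only: powr_minus powr_realpow)
    also have "\<dots> = (\<Prod>b::'a\<in>Basis. inverse ((1 + norm x)\<^sup>2))"
      by (simp add: power_mult power_inverse)
    also have "\<dots> \<le> (\<Prod>b\<in>Basis. inverse (1 + (x \<bullet> b)\<^sup>2))"
    proof (rule prod_mono, intro conjI)
      fix b :: 'a assume b: "b \<in> Basis"
      have "(x \<bullet> b)\<^sup>2 \<le> (norm x)\<^sup>2" using Basis_le_norm[OF b, of x] by (metis abs_ge_zero power2_abs power_mono)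
      moreover have "(1 + norm x)\<^sup>2 = 1 + (norm x)\<^sup>2 + 2 * norm x" by (simp add: power2_sum)
      ultimately have "1 + (x \<bullet> b)\<^sup>2 \<le> (1 + norm x)\<^sup>2" using norm_ge_zero[of x] by linarith
      then show "inverse ((1 + norm x)\<^sup>2) \<le> inverse (1 + (x \<bullet> b)\<^sup>2)"
        by (intro le_imp_inverse_le) (auto intro: add_pos_nonneg)
    qed (use pos in simp)
    finally show "norm ((1 + norm x) powr (- real (2 * DIM('a))))
      \<le> norm (\<Prod>b\<in>Basis. inverse (1 + (x \<bullet> b)\<^sup>2))"
      by (simp add: prod_nonneg)
  qed
  show ?thesis
    by (rule Bochner_Integration.integrable_bound[OF i]) (simp, intro AE_I2 le)
qed

definition wdec_const :: "'a::euclidean_space itself \<Rightarrow> real" where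
  "wdec_const _ = (\<integral>x. wdec (x::'a) \<partial>lborel)"

lemma wdec_const_nonneg: "0 \<le> wdec_const TYPE('a::euclidean_space)"
  unfolding wdec_const_def by (rule integral_nonneg_AE) simp

lemma integral_wdec_bound:
  fixes g :: "'a::euclidean_space \<Rightarrow> complex"
  assumes "g \<in> borel_measurable borel" "\<And>v. norm (g v) \<le> C * wdec (c + v)"
  shows "integrable lborel g" "norm (\<integral>v. g v \<partial>lborel) \<le> C * wdec_const TYPE('a)"
proof -
  have i: "integrable lborel (\<lambda>v. C * wdec (c + v :: 'a))"
    by (intro integrable_mult_right lborel_integrable_translate[OF integrable_wdec])
  show g: "integrable lborel g"
  proof (rule Bochner_Integration.integrable_bound[OF i])
    show "AE v in lborel. norm (g v) \<le> norm (C * wdec (c + v))"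
      using order_trans[OF assms(2) abs_ge_self] by (intro AE_I2) simp
  qed (use assms in simp)
  have "norm (\<integral>v. g v \<partial>lborel) \<le> (\<integral>v. C * wdec (c + v :: 'a) \<partial>lborel)"
    by (rule order_trans[OF integral_norm_bound integral_mono[OF integrable_norm[OF g] i assms(2)]])
  also have "\<dots> = C * wdec_const TYPE('a)"
    using lborel_integral_translate[of "wdec :: 'a \<Rightarrow> real" c] by (simp add: wdec_const_def)
  finally show "norm (\<integral>v. g v \<partial>lborel) \<le> C * wdec_const TYPE('a)" .
qed

section \<open>The Weyl quantization as an iterated integral\<close>

text \<open>The integral in the spatial variable \<open>y = x + v\<close> at a fixed frequency. It converges
  absolutely because \<open>f\<close> decreases rapidly; the remaining integral over \<open>\<xi>\<close> converges absolutely
  because integration by parts makes the inner one decrease in \<open>\<xi>\<close> (\<open>fibre_decay\<close>).\<close>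

definition weyl_fibre ::
    "('a::euclidean_space \<times> 'a \<Rightarrow> complex) \<Rightarrow> ('a \<Rightarrow> complex) \<Rightarrow> 'a \<Rightarrow> 'a \<Rightarrow> complex" where
  "weyl_fibre b f x \<xi> =
     (\<integral>v. exp (- (\<i> * of_real (v \<bullet> \<xi>))) * b (x + (1/2) *\<^sub>R v, \<xi>) * f (x + v) \<partial>lborel)"

text \<open>The Weyl operator without the factor \<open>(2 * pi) powr (- d)\<close>, which would only be carried
  along.\<close>

definition weyl_int ::
    "('a::euclidean_space \<times> 'a \<Rightarrow> complex) \<Rightarrow> ('a \<Rightarrow> complex) \<Rightarrow> 'a \<Rightarrow> complex" where
  "weyl_int b f x = (\<integral>\<xi>. weyl_fibre b f x \<xi> \<partial>lborel)"

text \<open>The midpoint is the mean of \<open>x\<close> and \<open>x + v\<close>. This puts the growth of the symbol in \<open>v\<close> on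
  the argument of \<open>f\<close>, where it is absorbed.\<close>

lemma weight_split:
  fixes x v \<xi> :: "'a::euclidean_space"
  shows "1 + norm (x + (1/2) *\<^sub>R v, \<xi>) \<le> (1 + norm x) * (1 + norm \<xi>) * (1 + norm (x + v))"
proof -
  define P Q R where "P = norm x" "Q = norm \<xi>" "R = norm (x + v)"
  have nn: "0 \<le> P" "0 \<le> Q" "0 \<le> R" by (simp_all add: P_Q_R_def)
  have "x + (1/2) *\<^sub>R v = (1/2) *\<^sub>R x + (1/2) *\<^sub>R (x + v)"
    by (simp add: scaleR_add_right scaleR_add_left[symmetric] add.assoc[symmetric])
  then have "norm (x + (1/2) *\<^sub>R v) \<le> norm ((1/2) *\<^sub>R x) + norm ((1/2) *\<^sub>R (x + v))"
    by (metis norm_triangle_ineq)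
  then have "norm (x + (1/2) *\<^sub>R v) \<le> P / 2 + R / 2" by (simp add: P_Q_R_def)
  then have "1 + norm (x + (1/2) *\<^sub>R v, \<xi>) \<le> 1 + P + R + Q"
    using norm_Pair_le[of "x + (1/2) *\<^sub>R v" \<xi>] nn unfolding P_Q_R_def by linarith
  also have "\<dots> \<le> (1 + P) * (1 + Q) * (1 + R)"
  proof -
    have "0 \<le> P * Q" "0 \<le> P * R" "0 \<le> Q * R" "0 \<le> P * Q * R" using nn by auto
    then show ?thesis by (simp add: algebra_simps)
  qed
  finally show ?thesis unfolding P_Q_R_def .
qed

lemma weyl_integrand_bound:
  fixes b :: "'a::euclidean_space \<times> 'a \<Rightarrow> complex"
  assumes L: "0 \<le> L" and b: "derivs_le 0 L A b" and f: "derivs_le 0 (- (L + real (2 * DIM('a)))) B f"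
  shows "norm (exp (- (\<i> * of_real (v \<bullet> \<xi>))) * b (x + (1/2) *\<^sub>R v, \<xi>) * f (x + v))
     \<le> A * B * (1 + norm x) powr L * (1 + norm \<xi>) powr L * wdec (x + v)"
proof -
  have A: "0 \<le> A" "0 \<le> B" using b f derivs_le_nonneg by blast+
  have "norm (b (x + (1/2) *\<^sub>R v, \<xi>)) \<le> A * (1 + norm (x + (1/2) *\<^sub>R v, \<xi>)) powr L"
    using b by (rule derivs_leD)
  also have "\<dots> \<le> A * ((1 + norm x) * (1 + norm \<xi>) * (1 + norm (x + v))) powr L"
    using A L weight_split[of x v \<xi>] by (intro mult_left_mono powr_mono2) auto
  also have "\<dots> = A * ((1 + norm x) powr L * (1 + norm \<xi>) powr L * (1 + norm (x + v)) powr L)"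
    by (simp add: powr_mult)
  finally have 1: "norm (b (x + (1/2) *\<^sub>R v, \<xi>)) \<le> A * ((1 + norm x) powr L * (1 + norm \<xi>) powr L * (1 + norm (x + v)) powr L)" .
  have "norm (f (x + v)) \<le> B * (1 + norm (x + v)) powr (- (L + real (2 * DIM('a))))"
    using f by (rule derivs_leD)
  also have "- (L + real (2 * DIM('a))) = - L + (- real (2 * DIM('a)))" by simp
  finally have 2: "norm (f (x + v)) \<le> B * ((1 + norm (x + v)) powr (- L) * wdec (x + v))"
    by (simp only: powr_add)
  have n: "norm (exp (- (\<i> * of_real (v \<bullet> \<xi>)))) = 1" by (simp add: norm_exp_eq_Re)
  have p: "(1 + norm (x + v)) powr L * (1 + norm (x + v)) powr (- L) = 1"
  proof -
    have "1 + norm (x + v) > 0" using norm_ge_zero[of "x + v"] by linarith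
    then show ?thesis by (simp add: powr_add[symmetric])
  qed
  have "norm (exp (- (\<i> * of_real (v \<bullet> \<xi>))) * b (x + (1/2) *\<^sub>R v, \<xi>) * f (x + v))
     \<le> (A * ((1 + norm x) powr L * (1 + norm \<xi>) powr L * (1 + norm (x + v)) powr L)) *
        (B * ((1 + norm (x + v)) powr (- L) * wdec (x + v)))"
    unfolding norm_mult n mult_1 by (rule mult_mono[OF 1 2]) (use A in auto)
  also have "\<dots> = A * B * (1 + norm x) powr L * (1 + norm \<xi>) powr L *
      ((1 + norm (x + v)) powr L * (1 + norm (x + v)) powr (- L)) * wdec (x + v)"
    by (simp only: mult_ac)
  finally show ?thesis unfolding p by simp
qed

lemma weyl_integrand_continuous:
  assumes "smooth b" "smooth f"
  shows "continuous_on UNIV (\<lambda>p. exp (- (\<i> * of_real (snd p \<bullet> fst p))) * b (x + (1/2) *\<^sub>R snd p, fst p) * f (x + snd p))"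
proof -
  have "continuous_on UNIV (\<lambda>p. b (x + (1/2) *\<^sub>R snd p, fst p))"
    by (rule continuous_on_compose2[OF smooth_continuous_on[OF assms(1), of UNIV]]) (auto intro!: continuous_intros)
  moreover have "continuous_on UNIV (\<lambda>p::'a\<times>'a. f (x + snd p))"
    by (rule continuous_on_compose2[OF smooth_continuous_on[OF assms(2), of UNIV]]) (auto intro!: continuous_intros)
  ultimately show ?thesis by (auto intro!: continuous_intros)
qed

lemma weyl_integrand_measurable:
  assumes "smooth b" "smooth f"
  shows "(\<lambda>v. exp (- (\<i> * of_real (v \<bullet> \<xi>))) * b (x + (1/2) *\<^sub>R v, \<xi>) * f (x + v)) \<in> borel_measurable borel"
proof (rule borel_measurable_continuous_onI)
  have "continuous_on UNIV (\<lambda>v. (\<xi>, v))" by (auto intro!: continuous_intros)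
  from continuous_on_compose2[OF weyl_integrand_continuous[OF assms] this]
  show "continuous_on UNIV (\<lambda>v. exp (- (\<i> * of_real (v \<bullet> \<xi>))) * b (x + (1/2) *\<^sub>R v, \<xi>) * f (x + v))"
    by simp
qed

lemma weyl_fibre_measurable:
  assumes "smooth b" "smooth f"
  shows "weyl_fibre b f x \<in> borel_measurable borel"
proof -
  have "(\<lambda>p. exp (- (\<i> * of_real (snd p \<bullet> fst p))) * b (x + (1/2) *\<^sub>R snd p, fst p) * f (x + snd p))
      \<in> borel_measurable (lborel \<Otimes>\<^sub>M lborel)"
    unfolding lborel_prod using borel_measurable_continuous_onI[OF weyl_integrand_continuous[OF assms]] by simp
  then have "(\<lambda>\<xi>. \<integral>v. exp (- (\<i> * of_real (v \<bullet> \<xi>))) * b (x + (1/2) *\<^sub>R v, \<xi>) * f (x + v) \<partial>lborel) \<in> borel_measurable lborel"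
    by (intro lborel.borel_measurable_lebesgue_integral) (simp add: case_prod_beta')
  then show ?thesis by (simp add: weyl_fibre_def[abs_def])
qed

lemma weyl_fibre_basic:
  fixes b :: "'a::euclidean_space \<times> 'a \<Rightarrow> complex"
  assumes "0 \<le> L" "smooth b" "smooth f"
    and b: "derivs_le 0 L A b" and f: "derivs_le 0 (- (L + real (2 * DIM('a)))) B f"
  shows "integrable lborel (\<lambda>v. exp (- (\<i> * of_real (v \<bullet> \<xi>))) * b (x + (1/2) *\<^sub>R v, \<xi>) * f (x + v))"
    and "norm (weyl_fibre b f x \<xi>) \<le> wdec_const TYPE('a) * A * B * (1 + norm x) powr L * (1 + norm \<xi>) powr L"
  using integral_wdec_bound[OF weyl_integrand_measurable[OF assms(2,3)] weyl_integrand_bound[OF assms(1) b f]]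
  by (simp_all add: weyl_fibre_def mult_ac)

lemma weyl_fibre_integrable:
  fixes b :: "'a::euclidean_space \<times> 'a \<Rightarrow> complex"
  assumes "symbol L b" "schwartz f"
  shows "integrable lborel (\<lambda>v. exp (- (\<i> * of_real (v \<bullet> \<xi>))) * b (x + (1/2) *\<^sub>R v, \<xi>) * f (x + v))"
proof -
  have "symbol (max 0 L) b" using assms(1) by (rule symbol_mono) simp
  then obtain A B where "derivs_le 0 (max 0 L) A b" "derivs_le 0 (- (max 0 L + real (2 * DIM('a)))) B f"
    using symbol_derivs_le schwartz_derivs_le[OF assms(2)] by meson
  then show ?thesis
    using assms by (intro weyl_fibre_basic(1)[where L="max 0 L"]) (auto intro: symbol_smooth schwartz_smooth)
qed

lemma weyl_fibre_add_left:
  assumes "symbol L b" "symbol L b'" "schwartz f"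
  shows "weyl_fibre (\<lambda>w. b w + b' w) f x \<xi> = weyl_fibre b f x \<xi> + weyl_fibre b' f x \<xi>"
  unfolding weyl_fibre_def
  using weyl_fibre_integrable[OF assms(1,3)] weyl_fibre_integrable[OF assms(2,3)]
  by (subst Bochner_Integration.integral_add[symmetric]) (simp_all add: distrib_left distrib_right)

lemma weyl_fibre_add_right:
  assumes "symbol L b" "schwartz f" "schwartz f'"
  shows "weyl_fibre b (\<lambda>y. f y + f' y) x \<xi> = weyl_fibre b f x \<xi> + weyl_fibre b f' x \<xi>"
  unfolding weyl_fibre_def
  using weyl_fibre_integrable[OF assms(1,2)] weyl_fibre_integrable[OF assms(1,3)]
  by (subst Bochner_Integration.integral_add[symmetric]) (simp_all add: distrib_left distrib_right)

lemma weyl_fibre_cmult: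
  "weyl_fibre (\<lambda>w. c * b w) f x \<xi> = c * weyl_fibre b f x \<xi>"
  "weyl_fibre b (\<lambda>y. c * f y) x \<xi> = c * weyl_fibre b f x \<xi>"
  unfolding weyl_fibre_def by (simp_all flip: integral_mult_right_zero add: mult_ac)

section \<open>First order expansion of bilinear expressions\<close>

text \<open>Expressions like \<open>weyl_int b f x\<close> at a fixed point, as functions of the symbol and of the
  function, are bilinear and bounded in weighted norms. Identities between such expressions can
  then be differentiated with respect to parameters in \<open>b\<close> and \<open>f\<close>, without differentiation
  under an integral sign.\<close>

definition bounded_bilinear_on ::
    "(('a::euclidean_space \<Rightarrow> complex) \<Rightarrow> ('b::euclidean_space \<Rightarrow> complex) \<Rightarrow> complex)
      \<Rightarrow> nat \<Rightarrow> real \<Rightarrow> real \<Rightarrow> real \<Rightarrow> bool" where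
  "bounded_bilinear_on \<Phi> n L M K \<longleftrightarrow> 0 \<le> K \<and>
     (\<forall>b b' f. symbol L b \<longrightarrow> symbol L b' \<longrightarrow> schwartz f \<longrightarrow> \<Phi> (\<lambda>w. b w + b' w) f = \<Phi> b f + \<Phi> b' f) \<and>
     (\<forall>b f f'. symbol L b \<longrightarrow> schwartz f \<longrightarrow> schwartz f' \<longrightarrow> \<Phi> b (\<lambda>y. f y + f' y) = \<Phi> b f + \<Phi> b f') \<and>
     (\<forall>b f c. \<Phi> (\<lambda>w. c * b w) f = c * \<Phi> b f \<and> \<Phi> b (\<lambda>y. c * f y) = c * \<Phi> b f) \<and>
     (\<forall>b f A B. symbol L b \<longrightarrow> schwartz f \<longrightarrow> derivs_le n L A b \<longrightarrow> derivs_le n M B f \<longrightarrow>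
        norm (\<Phi> b f) \<le> K * A * B)"

lemma bounded_bilinear_onD:
  assumes "bounded_bilinear_on \<Phi> n L M K"
  shows "0 \<le> K"
    and "symbol L b \<Longrightarrow> symbol L b' \<Longrightarrow> schwartz f \<Longrightarrow> \<Phi> (\<lambda>w. b w + b' w) f = \<Phi> b f + \<Phi> b' f"
    and "symbol L b \<Longrightarrow> schwartz f \<Longrightarrow> schwartz f' \<Longrightarrow> \<Phi> b (\<lambda>y. f y + f' y) = \<Phi> b f + \<Phi> b f'"
    and "\<Phi> (\<lambda>w. c * b w) f = c * \<Phi> b f" and "\<Phi> b (\<lambda>y. c * f y) = c * \<Phi> b f"
    and "symbol L b \<Longrightarrow> schwartz f \<Longrightarrow> derivs_le n L A b \<Longrightarrow> derivs_le n M B f \<Longrightarrow> norm (\<Phi> b f) \<le> K * A * B"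
  using assms by (simp_all add: bounded_bilinear_on_def)

lemma bilinear_sum:
  assumes "bounded_bilinear_on \<Phi> n L M K" "0 \<le> L"
    and "\<And>i. i \<in> I \<Longrightarrow> symbol L (b i)" "schwartz f"
  shows "\<Phi> (\<lambda>w. \<Sum>i\<in>I. b i w) f = (\<Sum>i\<in>I. \<Phi> (b i) f)"
  using assms(3)
proof (induction I rule: infinite_finite_induct)
  case (insert i I)
  have "\<Phi> (\<lambda>w. b i w + (\<Sum>i\<in>I. b i w)) f = \<Phi> (b i) f + \<Phi> (\<lambda>w. \<Sum>i\<in>I. b i w) f"
    using assms(2,4) insert.prems by (intro bounded_bilinear_onD(2)[OF assms(1)] symbol_sum) auto
  with insert show ?case by simp
next
  case (infinite I)
  have "\<Phi> (\<lambda>w. 0 * 0) f = 0 * \<Phi> (\<lambda>w. 0) f" by (rule bounded_bilinear_onD(4)[OF assms(1)])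
  with infinite show ?case by simp
next
  case empty
  have "\<Phi> (\<lambda>w. 0 * 0) f = 0 * \<Phi> (\<lambda>w. 0) f" by (rule bounded_bilinear_onD(4)[OF assms(1)])
  then show ?case by simp
qed

lemma bilinear_sum_right:
  assumes "bounded_bilinear_on \<Phi> n L M K"
    and "\<And>i. i \<in> I \<Longrightarrow> schwartz (f i)" "symbol L b"
  shows "\<Phi> b (\<lambda>w. \<Sum>i\<in>I. f i w) = (\<Sum>i\<in>I. \<Phi> b (f i))"
  using assms(2)
proof (induction I rule: infinite_finite_induct)
  case (insert i I)
  have "\<Phi> b (\<lambda>w. f i w + (\<Sum>i\<in>I. f i w)) = \<Phi> b (f i) + \<Phi> b (\<lambda>w. \<Sum>i\<in>I. f i w)"
    using assms(3) insert.prems by (intro bounded_bilinear_onD(3)[OF assms(1)] schwartz_sum) auto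
  with insert show ?case by simp
next
  case (infinite I)
  have "\<Phi> b (\<lambda>w. 0 * 0) = 0 * \<Phi> b (\<lambda>w. 0)" by (rule bounded_bilinear_onD(5)[OF assms(1)])
  with infinite show ?case by simp
next
  case empty
  have "\<Phi> b (\<lambda>w. 0 * 0) = 0 * \<Phi> b (\<lambda>w. 0)" by (rule bounded_bilinear_onD(5)[OF assms(1)])
  then show ?case by simp
qed

text \<open>The product rule with a quadratic error term: what remains beside the two first order
  terms are products with the error of one factor, and the product of the two first order
  increments.\<close>

lemma bilinear_first_order:
  assumes \<Phi>: "bounded_bilinear_on \<Phi> n L M K"
    and t: "0 \<le> t" "t \<le> 1"
    and sy: "symbol L b" "symbol L b'" "symbol L b1" and sc: "schwartz f" "schwartz f'" "schwartz f1"
    and b: "derivs_le n L A b" "derivs_le n L (A1 * t) b1" "derivs_le n L (C * t\<^sup>2) (\<lambda>w. b' w - b w - b1 w)"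
    and f: "derivs_le n M B f" "derivs_le n M (B1 * t) f1" "derivs_le n M (D * t\<^sup>2) (\<lambda>y. f' y - f y - f1 y)"
    and nn: "0 \<le> A" "0 \<le> A1" "0 \<le> C" "0 \<le> B" "0 \<le> B1" "0 \<le> D"
  shows "norm (\<Phi> b' f' - \<Phi> b f - (\<Phi> b1 f + \<Phi> b f1)) \<le> K * (C * (B + B1 + D) + A * D + A1 * (B1 + D)) * t\<^sup>2"
proof -
  define R where "R = (\<lambda>w. b' w - b w - b1 w)"
  define S where "S = (\<lambda>y. f' y - f y - f1 y)"
  have sR: "symbol L R" "schwartz S" using sy sc by (auto simp: R_def S_def intro: symbol_diff schwartz_diff)
  note addl = bounded_bilinear_onD(2)[OF \<Phi>] and addr = bounded_bilinear_onD(3)[OF \<Phi>] and bd = bounded_bilinear_onD(6)[OF \<Phi>]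
  have b': "b' = (\<lambda>w. (b w + b1 w) + R w)" and f': "f' = (\<lambda>y. f y + (f1 y + S y))"
    by (auto simp: R_def S_def)
  have 1: "\<Phi> b' f' = \<Phi> b f' + \<Phi> b1 f' + \<Phi> R f'"
    unfolding b' using sy sc sR by (simp add: addl symbol_add)
  have 2: "\<Phi> b f' = \<Phi> b f + (\<Phi> b f1 + \<Phi> b S)"
    unfolding f' using sy sc sR by (simp add: addr schwartz_add)
  have 3: "\<Phi> b1 f' = \<Phi> b1 f + \<Phi> b1 (\<lambda>y. f1 y + S y)"
    unfolding f' using sy sc sR by (intro addr schwartz_add)
  have tt: "t\<^sup>2 \<le> t" "t\<^sup>2 \<le> 1" using t by (auto simp: power2_eq_square intro: mult_left_le_one_le mult_le_one)
  have fS: "derivs_le n M ((B1 + D) * t) (\<lambda>y. f1 y + S y)"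
  proof (rule derivs_le_weaken[OF derivs_le_add[OF _ _ f(2) f(3)[folded S_def]]])
    show "B1 * t + D * t\<^sup>2 \<le> (B1 + D) * t" using tt nn by (simp add: distrib_right mult_left_mono)
  qed (use sc sR schwartz_smooth in auto)
  have fB: "derivs_le n M (B + B1 + D) f'"
  proof (unfold f', rule derivs_le_weaken[OF derivs_le_add[OF _ _ f(1) fS]])
    have "(B1 + D) * t \<le> (B1 + D) * 1" using t nn by (intro mult_left_mono) auto
    then show "B + (B1 + D) * t \<le> B + B1 + D" by simp
  qed (use sc sR schwartz_smooth schwartz_add in auto)
  have "norm (\<Phi> R f') \<le> K * (C * t\<^sup>2) * (B + B1 + D)"
    using sR sc b(3) fB by (intro bd) (auto simp: R_def)
  moreover have "norm (\<Phi> b S) \<le> K * A * (D * t\<^sup>2)"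
    using sy sR b(1) f(3) by (intro bd) (auto simp: S_def)
  moreover have "norm (\<Phi> b1 (\<lambda>y. f1 y + S y)) \<le> K * (A1 * t) * ((B1 + D) * t)"
    using sy sc sR b(2) fS by (intro bd) (auto intro: schwartz_add)
  moreover have eq: "\<Phi> b' f' - \<Phi> b f - (\<Phi> b1 f + \<Phi> b f1) = \<Phi> R f' + \<Phi> b S + \<Phi> b1 (\<lambda>y. f1 y + S y)"
    unfolding 1 2 3 by simp
  moreover have "norm (\<Phi> R f' + \<Phi> b S + \<Phi> b1 (\<lambda>y. f1 y + S y))
     \<le> norm (\<Phi> R f') + norm (\<Phi> b S) + norm (\<Phi> b1 (\<lambda>y. f1 y + S y))"
    by (intro order_trans[OF norm_triangle_ineq] add_mono order_refl norm_triangle_ineq)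
  moreover have "K * (C * t\<^sup>2) * (B + B1 + D) + K * A * (D * t\<^sup>2) + K * (A1 * t) * ((B1 + D) * t)
      = K * (C * (B + B1 + D) + A * D + A1 * (B1 + D)) * t\<^sup>2"
    by (simp add: algebra_simps power2_eq_square)
  ultimately show ?thesis unfolding eq by linarith
qed

text \<open>Differentiability of a family of functions at parameter value 0, with a quadratic error,
  in a weighted norm.\<close>

definition first_order :: "nat \<Rightarrow> real \<Rightarrow> (real \<Rightarrow> 'a::euclidean_space \<Rightarrow> complex) \<Rightarrow> ('a \<Rightarrow> complex) \<Rightarrow> ('a \<Rightarrow> complex) \<Rightarrow> bool" where
  "first_order n L F f f1 \<longleftrightarrow>
     (\<exists>C\<ge>0. \<forall>h. 0 < h \<longrightarrow> h \<le> 1 \<longrightarrow> derivs_le n L (C * h\<^sup>2) (\<lambda>w. F h w - f w - of_real h * f1 w))"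

lemma norm_exp_i: "norm (exp (\<i> * of_real t)) = 1"
  by (simp add: norm_exp_eq_Re)

lemma exp_i_bounds:
  "norm (exp (\<i> * of_real t) - 1) \<le> \<bar>t\<bar>"
  "norm (exp (\<i> * of_real t) - 1 - \<i> * of_real t) \<le> t\<^sup>2"
proof -
  show "norm (exp (\<i> * of_real t) - 1) \<le> \<bar>t\<bar>" using iexp_approx1[of t 0] by simp
  have "norm (exp (\<i> * of_real t) - 1 - \<i> * of_real t) \<le> \<bar>t\<bar>\<^sup>2 / 2"
    using iexp_approx1[of t 1] by (simp add: numeral_2_eq_2 algebra_simps)
  then show "norm (exp (\<i> * of_real t) - 1 - \<i> * of_real t) \<le> t\<^sup>2"
    using zero_le_power2[of t] unfolding power2_abs by linarith
qed

text \<open>If changing both arguments along a parameter \<open>h\<close> multiplies the value by a phase,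
  comparison of the terms of first order in \<open>h\<close> yields an identity. This is how commutation
  relations are derived from invariance under translations.\<close>

lemma bilinear_first_order_identity:
  assumes \<Phi>: "bounded_bilinear_on \<Phi> n L M K"
    and sy: "symbol L b" "\<And>h. symbol L (b' h)" "symbol L bd"
    and sc: "schwartz f" "\<And>h. schwartz (f' h)" "schwartz fd"
    and b: "first_order n L b' b bd" and f: "first_order n M f' f fd"
    and eq: "\<And>h. \<Phi> (b' h) (f' h) = exp (\<i> * of_real (h * l)) * \<Phi> b f"
  shows "\<Phi> bd f + \<Phi> b fd = \<i> * of_real l * \<Phi> b f"
proof -
  obtain C where C: "0 \<le> C" "\<And>h. 0 < h \<Longrightarrow> h \<le> 1 \<Longrightarrow> derivs_le n L (C * h\<^sup>2) (\<lambda>w. b' h w - b w - of_real h * bd w)"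
    using b unfolding first_order_def by blast
  obtain D where D: "0 \<le> D" "\<And>h. 0 < h \<Longrightarrow> h \<le> 1 \<Longrightarrow> derivs_le n M (D * h\<^sup>2) (\<lambda>w. f' h w - f w - of_real h * fd w)"
    using f unfolding first_order_def by blast
  obtain A A1 B B1 where AB: "derivs_le n L A b" "derivs_le n L A1 bd" "derivs_le n M B f" "derivs_le n M B1 fd"
    using symbol_derivs_le[OF sy(1)] symbol_derivs_le[OF sy(3)] schwartz_derivs_le[OF sc(1)] schwartz_derivs_le[OF sc(3)] by meson
  have nn: "0 \<le> A" "0 \<le> A1" "0 \<le> B" "0 \<le> B1" using AB derivs_le_nonneg by blast+
  define X where "X = \<Phi> bd f + \<Phi> b fd - \<i> * of_real l * \<Phi> b f"
  define E where "E = K * (C * (B + B1 + D) + A * D + A1 * (B1 + D)) + l\<^sup>2 * norm (\<Phi> b f)"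
  have E: "h * norm X \<le> E * h\<^sup>2" if h: "0 < h" "h \<le> 1" for h
  proof -
    have hom: "\<Phi> (\<lambda>w. of_real h * bd w) f = of_real h * \<Phi> bd f" "\<Phi> b (\<lambda>y. of_real h * fd y) = of_real h * \<Phi> b fd"
      by (rule bounded_bilinear_onD(4,5)[OF \<Phi>])+
    have "derivs_le n L (A1 * h) (\<lambda>w. of_real h * bd w)" "derivs_le n M (B1 * h) (\<lambda>w. of_real h * fd w)"
      using derivs_le_cmult[OF symbol_smooth[OF sy(3)] AB(2), of "of_real h"]
        derivs_le_cmult[OF schwartz_smooth[OF sc(3)] AB(4), of "of_real h"] h by (simp_all add: mult.commute)
    then have 1: "norm (\<Phi> (b' h) (f' h) - \<Phi> b f - (of_real h * \<Phi> bd f + of_real h * \<Phi> b fd))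
        \<le> K * (C * (B + B1 + D) + A * D + A1 * (B1 + D)) * h\<^sup>2"
      using h C D nn AB sy sc unfolding hom[symmetric]
      by (intro bilinear_first_order[OF \<Phi>]) (auto intro: symbol_cmult schwartz_cmult)
    have 2: "norm ((exp (\<i> * of_real (h * l)) - 1 - \<i> * of_real (h * l)) * \<Phi> b f) \<le> (h * l)\<^sup>2 * norm (\<Phi> b f)"
      unfolding norm_mult by (intro mult_right_mono exp_i_bounds) auto
    have "of_real h * X = (exp (\<i> * of_real (h * l)) - 1 - \<i> * of_real (h * l)) * \<Phi> b f -
       (\<Phi> (b' h) (f' h) - \<Phi> b f - (of_real h * \<Phi> bd f + of_real h * \<Phi> b fd))"
      unfolding eq X_def by (simp add: algebra_simps)
    then have "norm (of_real h * X) \<le> (h * l)\<^sup>2 * norm (\<Phi> b f) + K * (C * (B + B1 + D) + A * D + A1 * (B1 + D)) * h\<^sup>2"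
      using order_trans[OF norm_triangle_ineq4 add_mono[OF 2 1]] by simp
    then show ?thesis using h unfolding norm_mult E_def by (simp add: algebra_simps power_mult_distrib)
  qed
  have "norm X \<le> 0 + e" if "0 < e" for e
  proof -
    define h where "h = min 1 (e / (\<bar>E\<bar> + 1))"
    have h: "0 < h" "h \<le> 1" using that by (auto simp: h_def)
    have "norm X \<le> E * h" using E[OF h] h(1) by (simp add: power2_eq_square mult.commute mult_le_cancel_left_pos)
    also have "\<dots> \<le> \<bar>E\<bar> * (e / (\<bar>E\<bar> + 1))" using h by (intro mult_mono) (auto simp: h_def)
    also have "\<dots> \<le> e" using that by (simp add: field_simps)
    finally show ?thesis by simp
  qed
  then have "norm X \<le> 0" by (rule field_le_epsilon)
  then show ?thesis by (simp add: X_def)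
qed

lemma first_order_translate:
  fixes f :: "'a::euclidean_space \<Rightarrow> complex"
  assumes "symbol L f" "e \<in> Basis" "0 \<le> c" "c \<le> 1"
  shows "first_order n L (\<lambda>h w. f (w + (h * c) *\<^sub>R e)) f (\<lambda>w. of_real c * partial_deriv e f w)"
proof -
  obtain A where A: "derivs_le (n + 2) L A f" using symbol_derivs_le[OF assms(1)] by blast
  define C where "C = (real DIM('a))\<^sup>2 * 2 powr \<bar>L\<bar> * A"
  have nn: "0 \<le> C" using derivs_le_nonneg[OF A] by (simp add: C_def)
  have "derivs_le n L (C * h\<^sup>2) (\<lambda>w. f (w + (h * c) *\<^sub>R e) - f w - of_real h * (of_real c * partial_deriv e f w))"
    if h: "0 < h" "h \<le> 1" for h
  proof -
    have "(\<Sum>b\<in>Basis. complex_of_real (((h * c) *\<^sub>R e) \<bullet> b) * partial_deriv b f x) = of_real h * (of_real c * partial_deriv e f x)" for x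
    proof -
      have "(\<Sum>b\<in>Basis. complex_of_real (((h * c) *\<^sub>R e) \<bullet> b) * partial_deriv b f x)
          = (\<Sum>b\<in>Basis. if b = e then of_real h * (of_real c * partial_deriv b f x) else 0)"
        using assms(2) by (intro sum.cong) (auto simp: inner_Basis)
      then show ?thesis using assms(2) by simp
    qed
    moreover have n: "norm ((h * c) *\<^sub>R e) = h * c" using assms h by simp
    moreover have hc: "h * c \<le> 1" using mult_mono[of h 1 c 1] assms h by simp
    ultimately have "derivs_le n L (C * (h * c)\<^sup>2) (\<lambda>w. f (w + (h * c) *\<^sub>R e) - f w - of_real h * (of_real c * partial_deriv e f w))"
      using derivs_le_translate_expansion[OF symbol_smooth[OF assms(1)] A, of "(h * c) *\<^sub>R e"] by (simp add: C_def)
    moreover have "C * (h * c)\<^sup>2 \<le> C * h\<^sup>2"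
      using nn assms h by (intro mult_left_mono power_mono mult_left_le) auto
    ultimately show ?thesis using derivs_le_weaken by blast
  qed
  with nn show ?thesis unfolding first_order_def by blast
qed

lemma smooth_exp_inner: "smooth (\<lambda>y. exp (\<i> * of_real (y \<bullet> e)))"
  and partial_deriv_exp_inner:
    "partial_deriv c (\<lambda>y. exp (\<i> * of_real (y \<bullet> e))) = (\<lambda>y. \<i> * of_real (c \<bullet> e) * exp (\<i> * of_real (y \<bullet> e)))"
proof -
  have d: "((\<lambda>y. exp (\<i> * complex_of_real (y \<bullet> e))) has_derivative
      (\<lambda>v. \<i> * of_real (v \<bullet> e) * exp (\<i> * of_real (y \<bullet> e)))) (at y)" for y
  proof -
    have "((\<lambda>y. \<i> * complex_of_real (y \<bullet> e)) has_derivative (\<lambda>v. \<i> * of_real (v \<bullet> e))) (at y)"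
      by (auto intro!: derivative_eq_intros)
    from has_derivative_compose[OF this has_field_derivative_imp_has_derivative[OF DERIV_exp]]
    show ?thesis by (simp add: mult_ac)
  qed
  show p: "partial_deriv c (\<lambda>y. exp (\<i> * of_real (y \<bullet> e))) = (\<lambda>y. \<i> * of_real (c \<bullet> e) * exp (\<i> * of_real (y \<bullet> e)))" for c
    using partial_deriv_eqI[OF d] by auto
  have diff: "(\<lambda>y. k * exp (\<i> * complex_of_real (y \<bullet> e))) differentiable_on UNIV" for k
  proof -
    have "(\<lambda>y. exp (\<i> * complex_of_real (y \<bullet> e))) differentiable (at y)" for y
      using d unfolding differentiable_def by blast
    then show ?thesis by (auto simp: differentiable_on_def intro!: differentiable_mult)
  qed
  have pk: "partial_deriv c (\<lambda>y. k * exp (\<i> * of_real (y \<bullet> e))) = (\<lambda>y. (k * (\<i> * of_real (c \<bullet> e))) * exp (\<i> * of_real (y \<bullet> e)))" for c k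
  proof
    fix y
    have "(\<lambda>y. exp (\<i> * complex_of_real (y \<bullet> e))) differentiable (at y)"
      using d unfolding differentiable_def by blast
    then show "partial_deriv c (\<lambda>y. k * exp (\<i> * of_real (y \<bullet> e))) y = (k * (\<i> * of_real (c \<bullet> e))) * exp (\<i> * of_real (y \<bullet> e))"
      by (subst partial_deriv_mult) (simp_all add: p)
  qed
  have "smooth_upto n (\<lambda>y. k * exp (\<i> * of_real (y \<bullet> e)))" for n k
    by (induction n arbitrary: k) (simp_all only: smooth_upto.simps diff pk, simp)
  from this[of _ 1] show "smooth (\<lambda>y. exp (\<i> * of_real (y \<bullet> e)))" by (simp add: smooth_iff_upto)
qed

lemma derivs_le_exp_inner: "derivs_le n 0 ((1 + norm e) ^ n) (\<lambda>y. exp (\<i> * of_real (y \<bullet> e)))"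
proof (induction n)
  case 0
  have "1 + norm x \<noteq> 0" for x :: 'a using norm_ge_zero[of x] by linarith
  then show ?case by (simp add: norm_exp_i)
next
  case (Suc n)
  have "derivs_le n 0 ((1 + norm e) ^ Suc n) (\<lambda>y. \<i> * of_real (c \<bullet> e) * exp (\<i> * of_real (y \<bullet> e)))" if "c \<in> Basis" for c
  proof (rule derivs_le_weaken[OF derivs_le_cmult[OF smooth_exp_inner Suc]])
    have "norm (\<i> * complex_of_real (c \<bullet> e)) \<le> norm e"
      using Basis_le_norm[OF that, of e] by (simp add: norm_mult inner_commute)
    then show "norm (\<i> * complex_of_real (c \<bullet> e)) * (1 + norm e) ^ n \<le> (1 + norm e) ^ Suc n"
      by (auto intro!: mult_right_mono)
  qed auto
  moreover have "norm (exp (\<i> * complex_of_real (x \<bullet> e))) \<le> (1 + norm e) ^ Suc n * (1 + norm x) powr 0" for x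
  proof -
    have "1 + norm x \<noteq> 0" using norm_ge_zero[of x] by linarith
    then show ?thesis using one_le_power[of "1 + norm e" "Suc n"] by (simp add: norm_exp_i)
  qed
  ultimately show ?case by (simp only: derivs_le.simps partial_deriv_exp_inner) blast
qed

lemma symbol_exp_inner: "symbol 0 (\<lambda>y. exp (\<i> * of_real (y \<bullet> e)))"
  by (rule symbolI, rule smooth_exp_inner, rule exI, rule derivs_le_exp_inner)

text \<open>The remainder grows quadratically in \<open>y\<close>, hence the order 2 of the weight. Its first
  derivatives are multiples of \<open>exp (\<i> y) - 1\<close>, and the later ones are bounded; all are
  quadratic in \<open>t\<close> because every derivative brings down a factor \<open>t\<close>.\<close>

lemma derivs_le_exp_remainder:
  assumes e: "e \<in> Basis" and t: "\<bar>t\<bar> \<le> 1"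
  shows "derivs_le n 2 (t\<^sup>2 * 2 ^ n) (\<lambda>y. exp (\<i> * of_real (y \<bullet> (t *\<^sub>R e))) - 1 - \<i> * of_real t * of_real (y \<bullet> e))"
proof -
  let ?E = "\<lambda>y. exp (\<i> * complex_of_real (y \<bullet> (t *\<^sub>R e)))"
  have pos: "1 \<le> 1 + norm x" for x :: 'a by simp
  have sm: "smooth (\<lambda>y. ?E y - 1)" by (intro smooth_diff smooth_exp_inner smooth_const)
  have ine: "\<bar>c \<bullet> e\<bar> \<le> 1" if "c \<in> Basis" for c using e that by (auto simp: inner_Basis)
  have E0: "derivs_le n 1 (\<bar>t\<bar> * 2 ^ n) (\<lambda>y. \<i> * of_real (c \<bullet> (t *\<^sub>R e)) * ?E y)" if c: "c \<in> Basis" for n c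
  proof (rule derivs_le_weaken[OF derivs_le_cmult[OF smooth_exp_inner derivs_le_exp_inner[of n]]])
    have "norm (\<i> * complex_of_real (c \<bullet> (t *\<^sub>R e))) \<le> \<bar>t\<bar>"
      using ine[OF c] by (simp add: norm_mult abs_mult mult_left_le)
    moreover have "(1 + norm (t *\<^sub>R e)) ^ n \<le> 2 ^ n" using t e by (intro power_mono) auto
    ultimately show "norm (\<i> * complex_of_real (c \<bullet> (t *\<^sub>R e))) * (1 + norm (t *\<^sub>R e)) ^ n \<le> \<bar>t\<bar> * 2 ^ n"
      by (intro mult_mono) auto
  qed auto
  have E1: "derivs_le n 1 (\<bar>t\<bar> * 2 ^ n) (\<lambda>y. ?E y - 1)" for n
  proof -
    have "norm (?E x - 1) \<le> (\<bar>t\<bar> * 2 ^ n) * (1 + norm x) powr 1" for x n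
    proof -
      have "norm (?E x - 1) \<le> \<bar>x \<bullet> (t *\<^sub>R e)\<bar>" by (rule exp_i_bounds)
      also have "\<dots> = \<bar>t\<bar> * \<bar>x \<bullet> e\<bar>" by (simp add: abs_mult)
      also have "\<dots> \<le> (\<bar>t\<bar> * 2 ^ n) * (1 + norm x)"
        using Basis_le_norm[OF e, of x] by (intro mult_mono) (auto simp: mult_le_cancel_left1)
      finally show ?thesis using pos[of x] by simp
    qed
    moreover have "derivs_le n 1 (\<bar>t\<bar> * 2 ^ Suc n) (partial_deriv c (\<lambda>y. ?E y - 1))" if "c \<in> Basis" for c n
    proof -
      have "partial_deriv c (\<lambda>y. ?E y - 1) = (\<lambda>y. \<i> * of_real (c \<bullet> (t *\<^sub>R e)) * ?E y)"
        by (subst partial_deriv_diff_smooth) (simp_all only: smooth_exp_inner smooth_const partial_deriv_exp_inner partial_deriv_const diff_zero)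
      then show ?thesis using derivs_le_weaken[OF E0[OF that, of n] order_refl order_refl, of "\<bar>t\<bar> * 2 ^ Suc n"] by simp
    qed
    ultimately show ?thesis by (cases n) (simp_all only: derivs_le.simps, blast+)
  qed
  let ?R = "\<lambda>y. ?E y - 1 - \<i> * of_real t * of_real (y \<bullet> e)"
  have p: "partial_deriv c ?R = (\<lambda>y. \<i> * of_real (c \<bullet> (t *\<^sub>R e)) * (?E y - 1))" for c
  proof -
    have "partial_deriv c ?R = (\<lambda>y. partial_deriv c (\<lambda>y. ?E y - 1) y - partial_deriv c (\<lambda>y. \<i> * of_real t * of_real (y \<bullet> e)) y)"
      by (intro partial_deriv_diff_smooth sm smooth_cmult smooth_inner)
    also have "partial_deriv c (\<lambda>y. \<i> * of_real t * of_real (y \<bullet> e)) = (\<lambda>y. \<i> * of_real t * of_real (c \<bullet> e))"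
      by (subst partial_deriv_cmult_smooth[OF smooth_inner]) (simp only: partial_deriv_inner)
    also have "partial_deriv c (\<lambda>y. ?E y - 1) = (\<lambda>y. \<i> * of_real (c \<bullet> (t *\<^sub>R e)) * ?E y)"
        by (subst partial_deriv_diff_smooth) (simp_all only: smooth_exp_inner smooth_const partial_deriv_exp_inner partial_deriv_const diff_zero)
    finally show ?thesis by (simp add: algebra_simps)
  qed
  have b0: "norm (?R x) \<le> (t\<^sup>2 * 2 ^ n) * (1 + norm x) powr 2" for x n
  proof -
    have "norm (?R x) \<le> (x \<bullet> (t *\<^sub>R e))\<^sup>2"
      using exp_i_bounds(2)[of "x \<bullet> (t *\<^sub>R e)"] by (simp add: mult_ac)
    also have "\<dots> = t\<^sup>2 * \<bar>x \<bullet> e\<bar>\<^sup>2" by (simp add: power_mult_distrib)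
    also have "\<dots> \<le> (t\<^sup>2 * 2 ^ n) * (1 + norm x)\<^sup>2"
      using Basis_le_norm[OF e, of x] by (intro mult_mono power_mono) (auto simp: mult_le_cancel_left1)
    finally show ?thesis by (simp add: powr_numeral)
  qed
  show ?thesis
  proof (cases n)
    case 0 then show ?thesis using b0[of _ 0] by (simp only: derivs_le.simps) blast
  next
    case (Suc k)
    have "derivs_le k 2 (t\<^sup>2 * 2 ^ Suc k) (partial_deriv c ?R)" if c: "c \<in> Basis" for c
      unfolding p
    proof (rule derivs_le_weaken[OF derivs_le_cmult[OF sm E1]])
      have "norm (\<i> * complex_of_real (c \<bullet> (t *\<^sub>R e))) \<le> \<bar>t\<bar>"
        using ine[OF c] by (simp add: norm_mult abs_mult mult_left_le)
      then have "norm (\<i> * complex_of_real (c \<bullet> (t *\<^sub>R e))) * (\<bar>t\<bar> * 2 ^ k) \<le> \<bar>t\<bar> * (\<bar>t\<bar> * 2 ^ Suc k)"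
        by (intro mult_mono) auto
      also have "\<bar>t\<bar> * (\<bar>t\<bar> * 2 ^ Suc k) = t\<^sup>2 * 2 ^ Suc k"
        by (simp only: mult.assoc[symmetric] abs_mult_self_eq power2_eq_square)
      finally show "norm (\<i> * complex_of_real (c \<bullet> (t *\<^sub>R e))) * (\<bar>t\<bar> * 2 ^ k) \<le> t\<^sup>2 * 2 ^ Suc k" .
    qed auto
    then show ?thesis using b0 Suc by (simp only: derivs_le.simps) blast
  qed
qed

text \<open>The loss of two powers of growth in the remainder of the exponential does not matter,
  because a Schwartz function satisfies the bounds of every order.\<close>

lemma first_order_modulate:
  assumes e: "e \<in> Basis" and f: "schwartz f" and s: "\<bar>s\<bar> \<le> 1"
  shows "first_order n M (\<lambda>h y. exp (\<i> * of_real (y \<bullet> ((h * s) *\<^sub>R e))) * f y) f (\<lambda>y. \<i> * of_real s * (of_real (y \<bullet> e) * f y))"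
proof -
  obtain B where B: "derivs_le n (M - 2) B f" using schwartz_derivs_le[OF f] by blast
  have "derivs_le n M ((2 ^ n * 2 ^ n * B) * h\<^sup>2)
      (\<lambda>y. exp (\<i> * of_real (y \<bullet> ((h * s) *\<^sub>R e))) * f y - f y - of_real h * (\<i> * of_real s * (of_real (y \<bullet> e) * f y)))"
    if h: "0 < h" "h \<le> 1" for h
  proof -
    have hs: "\<bar>h * s\<bar> \<le> 1" using h s by (simp add: abs_mult mult_le_one)
    have "derivs_le n (2 + (M - 2)) (2 ^ n * (((h * s)\<^sup>2 * 2 ^ n) * B))
       (\<lambda>y. (exp (\<i> * of_real (y \<bullet> ((h * s) *\<^sub>R e))) - 1 - \<i> * of_real (h * s) * of_real (y \<bullet> e)) * f y)"
      using e hs f B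
      by (intro derivs_le_mult derivs_le_exp_remainder smooth_diff smooth_exp_inner smooth_const smooth_cmult smooth_inner schwartz_smooth)
    moreover have "2 ^ n * (((h * s)\<^sup>2 * 2 ^ n) * B) \<le> (2 ^ n * 2 ^ n * B) * h\<^sup>2"
    proof -
      have "(h * s)\<^sup>2 \<le> h\<^sup>2" using h s by (metis abs_mult abs_of_pos mult_left_le abs_ge_zero power2_le_iff_abs_le power2_abs order_less_imp_le)
      then have "(2 ^ n * 2 ^ n * B) * (h * s)\<^sup>2 \<le> (2 ^ n * 2 ^ n * B) * h\<^sup>2"
        using derivs_le_nonneg[OF B] by (intro mult_left_mono) auto
      then show ?thesis by (simp add: mult_ac)
    qed
    ultimately show ?thesis
      using derivs_le_weaken by (fastforce simp: algebra_simps)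
  qed
  moreover have "0 \<le> 2 ^ n * 2 ^ n * B" using derivs_le_nonneg[OF B] by simp
  ultimately show ?thesis unfolding first_order_def by blast
qed

section \<open>Commutation relations and mapping properties\<close>

lemma Pair_Basis: "e \<in> Basis \<Longrightarrow> (e, 0) \<in> Basis" "e \<in> Basis \<Longrightarrow> (0, e) \<in> Basis"
  by (auto simp: Basis_prod_def)

lemma fibre_bounded_bilinear:
  fixes x :: "'a::euclidean_space"
  assumes L: "0 \<le> L"
  shows "bounded_bilinear_on (\<lambda>b f. weyl_fibre b f x \<xi>) 0 L (- (L + real (2 * DIM('a))))
    (wdec_const TYPE('a) * (1 + norm x) powr L * (1 + norm \<xi>) powr L)"
  unfolding bounded_bilinear_on_def
proof (intro conjI allI impI)
  show "0 \<le> wdec_const TYPE('a) * (1 + norm x) powr L * (1 + norm \<xi>) powr L"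
    using wdec_const_nonneg[where 'a='a] by simp
next
  fix b :: "'a \<times> 'a \<Rightarrow> complex" and f :: "'a \<Rightarrow> complex" and A B
  assume "symbol L b" "schwartz f" "derivs_le 0 L A b" "derivs_le 0 (- (L + real (2 * DIM('a)))) B f"
  then have "norm (weyl_fibre b f x \<xi>) \<le> wdec_const TYPE('a) * A * B * (1 + norm x) powr L * (1 + norm \<xi>) powr L"
    using L by (intro weyl_fibre_basic(2)) (auto intro: symbol_smooth schwartz_smooth)
  then show "norm (weyl_fibre b f x \<xi>) \<le> wdec_const TYPE('a) * (1 + norm x) powr L * (1 + norm \<xi>) powr L * A * B"
    by (simp add: mult_ac)
qed (auto intro: weyl_fibre_add_left weyl_fibre_add_right weyl_fibre_cmult)

text \<open>Substitution of \<open>v + h e\<close> for \<open>v\<close>. The midpoint moves by only half of the shift, whence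
  the factor \<open>1/2\<close>. The factors \<open>1/2\<close> and \<open>1\<close> are left explicit to match
  \<open>first_order_translate\<close>.\<close>

lemma fibre_shift:
  assumes "smooth b" "smooth f"
  shows "weyl_fibre (\<lambda>w. b (w + (h * (1/2)) *\<^sub>R (e, 0))) (\<lambda>y. f (y + (h * 1) *\<^sub>R e)) x \<xi>
    = exp (\<i> * of_real (h * (\<xi> \<bullet> e))) * weyl_fibre b f x \<xi>"
proof -
  define G where "G = (\<lambda>v. exp (- (\<i> * of_real (v \<bullet> \<xi>))) * b (x + (1/2) *\<^sub>R v, \<xi>) * f (x + v))"
  have Gm: "G \<in> borel_measurable borel" unfolding G_def by (rule weyl_integrand_measurable[OF assms])
  have eq: "exp (- (\<i> * of_real (v \<bullet> \<xi>))) * b ((x + (1/2) *\<^sub>R v, \<xi>) + (h * (1/2)) *\<^sub>R (e, 0)) * f ((x + v) + (h * 1) *\<^sub>R e)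
      = exp (\<i> * of_real (h * (\<xi> \<bullet> e))) * G (h *\<^sub>R e + v)" for v
  proof -
    have "exp (- (\<i> * complex_of_real (v \<bullet> \<xi>))) = exp (\<i> * of_real (h * (\<xi> \<bullet> e))) * exp (- (\<i> * of_real ((h *\<^sub>R e + v) \<bullet> \<xi>)))"
      unfolding exp_add[symmetric] by (rule arg_cong[where f=exp]) (simp add: algebra_simps inner_commute)
    moreover have "(x + (1/2) *\<^sub>R v, \<xi>) + (h * (1/2)) *\<^sub>R (e, 0) = (x + (1/2) *\<^sub>R (h *\<^sub>R e + v), \<xi>)"
      by (simp add: scaleR_add_right)
    moreover have "(x + v) + (h * 1) *\<^sub>R e = x + (h *\<^sub>R e + v)" by simp
    ultimately show ?thesis unfolding G_def by (simp only: mult.assoc)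
  qed
  have "weyl_fibre (\<lambda>w. b (w + (h * (1/2)) *\<^sub>R (e, 0))) (\<lambda>y. f (y + (h * 1) *\<^sub>R e)) x \<xi>
     = (\<integral>v. exp (\<i> * of_real (h * (\<xi> \<bullet> e))) * G (h *\<^sub>R e + v) \<partial>lborel)"
    unfolding weyl_fibre_def eq ..
  also have "\<dots> = exp (\<i> * of_real (h * (\<xi> \<bullet> e))) * (\<integral>v. G v \<partial>lborel)"
    unfolding integral_mult_right_zero lborel_integral_translate[OF Gm] ..
  finally show ?thesis unfolding weyl_fibre_def G_def .
qed

text \<open>Integration by parts in the fibre variable, obtained by expanding \<open>fibre_shift\<close> to first
  order: a factor of frequency costs one derivative.\<close>

lemma fibre_frequency:
  fixes b :: "'a::euclidean_space \<times> 'a \<Rightarrow> complex"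
  assumes L: "0 \<le> L" and b: "symbol L b" and f: "schwartz f" and e: "e \<in> Basis"
  shows "\<i> * of_real (\<xi> \<bullet> e) * weyl_fibre b f x \<xi>
    = weyl_fibre (\<lambda>w. of_real (1/2) * partial_deriv (e, 0) b w) f x \<xi> + weyl_fibre b (partial_deriv e f) x \<xi>"
proof -
  have "weyl_fibre (\<lambda>w. of_real (1/2) * partial_deriv (e, 0) b w) f x \<xi> +
      weyl_fibre b (\<lambda>w. of_real 1 * partial_deriv e f w) x \<xi> = \<i> * of_real (\<xi> \<bullet> e) * weyl_fibre b f x \<xi>"
  proof (rule bilinear_first_order_identity[where \<Phi>="\<lambda>b f. weyl_fibre b f x \<xi>" and l="\<xi> \<bullet> e"
        and b'="\<lambda>h w. b (w + (h * (1/2)) *\<^sub>R (e, 0))" and f'="\<lambda>h y. f (y + (h * 1) *\<^sub>R e)"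
        and n=0 and L=L and M="- (L + real (2 * DIM('a)))"
        and bd="\<lambda>w. of_real (1/2) * partial_deriv (e, 0) b w" and fd="\<lambda>w. of_real 1 * partial_deriv e f w"])
    show "bounded_bilinear_on (\<lambda>b f. weyl_fibre b f x \<xi>) 0 L (- (L + real (2 * DIM('a))))
        (wdec_const TYPE('a) * (1 + norm x) powr L * (1 + norm \<xi>) powr L)"
      by (rule fibre_bounded_bilinear[OF L])
    show "first_order 0 L (\<lambda>h w. b (w + (h * (1/2)) *\<^sub>R (e, 0))) b (\<lambda>w. of_real (1/2) * partial_deriv (e, 0) b w)"
      by (rule first_order_translate[OF b]) (use e in \<open>simp_all add: Pair_Basis\<close>)
    show "first_order 0 (- (L + real (2 * DIM('a)))) (\<lambda>h y. f (y + (h * 1) *\<^sub>R e)) f (\<lambda>w. of_real 1 * partial_deriv e f w)"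
      by (rule first_order_translate[OF schwartz_symbol[OF f] e]) simp_all
    show "weyl_fibre (\<lambda>w. b (w + (h * (1/2)) *\<^sub>R (e, 0))) (\<lambda>y. f (y + (h * 1) *\<^sub>R e)) x \<xi>
      = exp (\<i> * of_real (h * (\<xi> \<bullet> e))) * weyl_fibre b f x \<xi>" for h
      by (rule fibre_shift[OF symbol_smooth[OF b] schwartz_smooth[OF f]])
    show "symbol L b" "schwartz f" by fact+
    show "symbol L (\<lambda>w. b (w + (h * (1/2)) *\<^sub>R (e, 0)))" for h
      using b by (rule symbol_translate)
    show "schwartz (\<lambda>y. f (y + (h * 1) *\<^sub>R e))" for h
      using f by (rule schwartz_translate)
    show "symbol L (\<lambda>w. of_real (1/2) * partial_deriv (e, 0) b w)"
      by (intro symbol_cmult symbol_partial_deriv b Pair_Basis e)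
    show "schwartz (\<lambda>w. of_real 1 * partial_deriv e f w)"
      by (intro schwartz_cmult schwartz_partial_deriv f e)
  qed
  then show ?thesis by simp
qed

lemma fibre_pow_bound:
  fixes x \<xi> e :: "'a::euclidean_space"
  assumes L: "0 \<le> L" and e: "e \<in> Basis"
  shows "symbol L b \<Longrightarrow> schwartz f \<Longrightarrow> derivs_le n L A b \<Longrightarrow> derivs_le n (- (L + real (2 * DIM('a)))) B f \<Longrightarrow>
    \<bar>\<xi> \<bullet> e\<bar> ^ n * norm (weyl_fibre b f x \<xi>)
      \<le> 2 ^ n * (wdec_const TYPE('a) * A * B * (1 + norm x) powr L * (1 + norm \<xi>) powr L)"
proof (induction n arbitrary: b f)
  case 0
  then show ?case using weyl_fibre_basic(2)[OF L _ _ 0(3,4)] by (simp add: symbol_smooth schwartz_smooth)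
next
  case (Suc n)
  let ?K = "wdec_const TYPE('a) * A * B * (1 + norm x) powr L * (1 + norm \<xi>) powr L"
  note sm = symbol_smooth[OF Suc.prems(1)] schwartz_smooth[OF Suc.prems(2)]
  have 1: "\<bar>\<xi> \<bullet> e\<bar> ^ n * norm (weyl_fibre (\<lambda>w. of_real (1/2) * partial_deriv (e, 0) b w) f x \<xi>) \<le> 2 ^ n * ?K"
  proof (rule Suc.IH)
    have "derivs_le n L (norm (complex_of_real (1/2)) * A) (\<lambda>w. of_real (1/2) * partial_deriv (e, 0) b w)"
      using Suc.prems(3) e by (intro derivs_le_cmult smooth_partial_deriv sm derivs_le_partial_deriv Pair_Basis)
    then show "derivs_le n L A (\<lambda>w. of_real (1/2) * partial_deriv (e, 0) b w)"
      by (rule derivs_le_weaken) (use derivs_le_nonneg[OF Suc.prems(3)] in auto)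
    show "symbol L (\<lambda>w. of_real (1/2) * partial_deriv (e, 0) b w)"
      by (intro symbol_cmult symbol_partial_deriv Suc.prems Pair_Basis e)
    show "schwartz f" "derivs_le n (- (L + real (2 * DIM('a)))) B f"
      by (fact, rule derivs_le_SucD, fact)
  qed
  have 2: "\<bar>\<xi> \<bullet> e\<bar> ^ n * norm (weyl_fibre b (partial_deriv e f) x \<xi>) \<le> 2 ^ n * ?K"
    using Suc.prems e derivs_le_SucD[OF Suc.prems(3)] derivs_le_partial_deriv[OF Suc.prems(4) e]
    by (intro Suc.IH schwartz_partial_deriv)
  have "\<bar>\<xi> \<bullet> e\<bar> * norm (weyl_fibre b f x \<xi>) = norm (\<i> * of_real (\<xi> \<bullet> e) * weyl_fibre b f x \<xi>)"
    by (simp add: norm_mult)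
  also have "\<dots> \<le> norm (weyl_fibre (\<lambda>w. of_real (1/2) * partial_deriv (e, 0) b w) f x \<xi>) + norm (weyl_fibre b (partial_deriv e f) x \<xi>)"
    unfolding fibre_frequency[OF L Suc.prems(1,2) e] by (rule norm_triangle_ineq)
  finally have "\<bar>\<xi> \<bullet> e\<bar> ^ n * (\<bar>\<xi> \<bullet> e\<bar> * norm (weyl_fibre b f x \<xi>)) \<le> \<bar>\<xi> \<bullet> e\<bar> ^ n *
    (norm (weyl_fibre (\<lambda>w. of_real (1/2) * partial_deriv (e, 0) b w) f x \<xi>) + norm (weyl_fibre b (partial_deriv e f) x \<xi>))"
    by (intro mult_left_mono) auto
  also have "\<dots> \<le> 2 ^ n * ?K + 2 ^ n * ?K" using 1 2 by (simp only: distrib_left add_mono)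
  finally show ?case by (simp add: mult_ac)
qed

lemma max_coordinate:
  fixes x :: "'a::euclidean_space"
  shows "\<exists>e\<in>Basis. norm x \<le> real DIM('a) * \<bar>x \<bullet> e\<bar>"
proof -
  have "finite ((\<lambda>b. \<bar>x \<bullet> b\<bar>) ` Basis)" "(\<lambda>b. \<bar>x \<bullet> b\<bar>) ` Basis \<noteq> {}"
    using nonempty_Basis by (simp, blast)
  from Max_in[OF this] obtain e where e: "e \<in> Basis" "\<bar>x \<bullet> e\<bar> = Max ((\<lambda>b. \<bar>x \<bullet> b\<bar>) ` Basis)"
    by (metis (no_types, lifting) imageE)
  have "norm x \<le> (\<Sum>b\<in>Basis. \<bar>x \<bullet> b\<bar>)" by (rule norm_le_l1)
  also have "\<dots> \<le> (\<Sum>b::'a\<in>Basis. \<bar>x \<bullet> e\<bar>)"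
    unfolding e(2) by (intro sum_mono Max_ge) auto
  finally show ?thesis using e(1) by auto
qed

text \<open>Enough derivatives to gain the integrable weight in frequency on top of the growth \<open>L\<close> of
  the symbol.\<close>

definition weyl_order :: "real \<Rightarrow> 'a::euclidean_space itself \<Rightarrow> nat" where
  "weyl_order L _ = nat \<lceil>L\<rceil> + 2 * DIM('a)"

definition weyl_const :: "real \<Rightarrow> 'a::euclidean_space itself \<Rightarrow> real" where
  "weyl_const L _ = (real DIM('a) + 1) ^ weyl_order L TYPE('a) * (1 + 2 ^ weyl_order L TYPE('a)) * wdec_const TYPE('a)"

lemma weyl_const_nonneg: "0 \<le> weyl_const L TYPE('a::euclidean_space)"
  unfolding weyl_const_def using wdec_const_nonneg[where 'a='a] by simp

text \<open>The frequency has a coordinate \<open>\<xi> \<bullet> e\<close> of size at least \<open>norm \<xi> / DIM('a)\<close>; repeated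
  integration by parts in the direction \<open>e\<close> gains its powers.\<close>

lemma fibre_decay:
  fixes x \<xi> :: "'a::euclidean_space"
  assumes L: "0 \<le> L" and b: "symbol L b" and f: "schwartz f"
    and A: "derivs_le (weyl_order L TYPE('a)) L A b"
    and B: "derivs_le (weyl_order L TYPE('a)) (- (L + real (2 * DIM('a)))) B f"
  shows "norm (weyl_fibre b f x \<xi>) \<le> weyl_const L TYPE('a) * A * B * (1 + norm x) powr L * wdec \<xi>"
proof -
  define n where "n = weyl_order L TYPE('a)"
  define c where "c = wdec_const TYPE('a) * A * B * (1 + norm x) powr L"
  define X where "X = norm (weyl_fibre b f x \<xi>)"
  define d where "d = real DIM('a)"
  have c: "0 \<le> c"
    using derivs_le_nonneg[OF A] derivs_le_nonneg[OF B] wdec_const_nonneg[where 'a='a] by (simp add: c_def)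
  have pos: "0 < 1 + norm \<xi>" using norm_ge_zero[of \<xi>] by linarith
  obtain e :: 'a where e: "e \<in> Basis" "norm \<xi> \<le> d * \<bar>\<xi> \<bullet> e\<bar>" using max_coordinate unfolding d_def by blast
  have "(1 + norm \<xi>) ^ n \<le> (d + 1) ^ n * (1 + \<bar>\<xi> \<bullet> e\<bar> ^ n)"
  proof -
    have "1 + norm \<xi> \<le> (d + 1) * max 1 \<bar>\<xi> \<bullet> e\<bar>"
    proof -
      have "d * \<bar>\<xi> \<bullet> e\<bar> \<le> d * max 1 \<bar>\<xi> \<bullet> e\<bar>" by (intro mult_left_mono) (auto simp: d_def)
      then show ?thesis using e(2) by (simp add: distrib_right)
    qed
    then have "(1 + norm \<xi>) ^ n \<le> ((d + 1) * max 1 \<bar>\<xi> \<bullet> e\<bar>) ^ n" using pos by (intro power_mono) auto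
    also have "\<dots> = (d + 1) ^ n * (max 1 \<bar>\<xi> \<bullet> e\<bar>) ^ n" by (rule power_mult_distrib)
    also have "(max 1 \<bar>\<xi> \<bullet> e\<bar>) ^ n \<le> 1 + \<bar>\<xi> \<bullet> e\<bar> ^ n" by (auto simp: max_def)
    finally show ?thesis by (simp add: d_def mult_left_mono)
  qed
  then have "(1 + norm \<xi>) ^ n * X \<le> (d + 1) ^ n * (1 + \<bar>\<xi> \<bullet> e\<bar> ^ n) * X"
    by (intro mult_right_mono) (auto simp: X_def)
  also have "\<dots> = (d + 1) ^ n * (X + \<bar>\<xi> \<bullet> e\<bar> ^ n * X)" by (simp add: algebra_simps)
  also have "\<dots> \<le> (d + 1) ^ n * (c * (1 + norm \<xi>) powr L + 2 ^ n * (c * (1 + norm \<xi>) powr L))"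
  proof (intro mult_left_mono add_mono)
    show "X \<le> c * (1 + norm \<xi>) powr L"
      using fibre_pow_bound[OF L e(1) b f derivs_le_antimono[OF A] derivs_le_antimono[OF B], of 0 \<xi> x]
      by (simp add: X_def c_def)
    show "\<bar>\<xi> \<bullet> e\<bar> ^ n * X \<le> 2 ^ n * (c * (1 + norm \<xi>) powr L)"
      using fibre_pow_bound[OF L e(1) b f A B, of \<xi> x] by (simp add: X_def c_def n_def)
  qed (simp add: d_def)
  finally have main: "(1 + norm \<xi>) ^ n * X \<le> ((d + 1) ^ n * (1 + 2 ^ n) * c) * (1 + norm \<xi>) powr L"
    by (simp add: algebra_simps)
  have "X = ((1 + norm \<xi>) ^ n * X) * (1 + norm \<xi>) powr (- real n)"
    using pos by (simp add: powr_minus powr_realpow field_simps)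
  also have "\<dots> \<le> (((d + 1) ^ n * (1 + 2 ^ n) * c) * (1 + norm \<xi>) powr L) * (1 + norm \<xi>) powr (- real n)"
    using main by (intro mult_right_mono) auto
  also have "\<dots> = ((d + 1) ^ n * (1 + 2 ^ n) * c) * (1 + norm \<xi>) powr (L - real n)"
    by (simp add: powr_add[symmetric] mult.assoc)
  also have "\<dots> \<le> ((d + 1) ^ n * (1 + 2 ^ n) * c) * wdec \<xi>"
  proof (intro mult_left_mono weight_mono)
    have "L \<le> real (nat \<lceil>L\<rceil>)" by linarith
    then show "L - real n \<le> - real (2 * DIM('a))" by (simp add: n_def weyl_order_def)
  qed (use c in \<open>simp add: d_def\<close>)
  finally show ?thesis by (simp add: X_def c_def n_def d_def weyl_const_def mult_ac)
qed

lemma derivs_le_weyl_window: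
  assumes "derivs_le (weyl_order L TYPE('a::euclidean_space)) (- real (weyl_order L TYPE('a))) B (f :: 'a \<Rightarrow> complex)"
  shows "derivs_le (weyl_order L TYPE('a)) (- (L + real (2 * DIM('a)))) B f"
proof (rule derivs_le_weaken[OF assms])
  have "L \<le> real (nat \<lceil>L\<rceil>)" by linarith
  then show "- real (weyl_order L TYPE('a)) \<le> - (L + real (2 * DIM('a)))" by (simp add: weyl_order_def)
qed auto

lemma weyl_int_basic:
  fixes x :: "'a::euclidean_space"
  assumes L: "0 \<le> L" and b: "symbol L b" and f: "schwartz f"
    and A: "derivs_le (weyl_order L TYPE('a)) L A b"
    and B: "derivs_le (weyl_order L TYPE('a)) (- (L + real (2 * DIM('a)))) B f"
  shows "integrable lborel (weyl_fibre b f x)"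
    and "norm (weyl_int b f x) \<le> weyl_const L TYPE('a) * wdec_const TYPE('a) * (1 + norm x) powr L * A * B"
  using integral_wdec_bound[OF weyl_fibre_measurable[OF symbol_smooth[OF b] schwartz_smooth[OF f]],
      of x "weyl_const L TYPE('a) * A * B * (1 + norm x) powr L" 0]
    fibre_decay[OF L b f A B]
  by (simp_all add: weyl_int_def mult_ac)

lemma weyl_fibre_integrable2:
  fixes b :: "'a::euclidean_space \<times> 'a \<Rightarrow> complex"
  assumes "0 \<le> L" "symbol L b" "schwartz f"
  shows "integrable lborel (weyl_fibre b f x)"
proof -
  obtain A B where "derivs_le (weyl_order L TYPE('a)) L A b"
    "derivs_le (weyl_order L TYPE('a)) (- (L + real (2 * DIM('a)))) B f"
    using symbol_derivs_le[OF assms(2)] schwartz_derivs_le[OF assms(3)] by meson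
  then show ?thesis using assms by (intro weyl_int_basic(1))
qed

lemma weyl_int_bilinear:
  fixes x :: "'a::euclidean_space"
  assumes L: "0 \<le> L"
  shows "bounded_bilinear_on (\<lambda>b f. weyl_int b f x) (weyl_order L TYPE('a)) L (- (L + real (2 * DIM('a))))
    (weyl_const L TYPE('a) * wdec_const TYPE('a) * (1 + norm x) powr L)"
  unfolding bounded_bilinear_on_def
proof (intro conjI allI impI)
  show "0 \<le> weyl_const L TYPE('a) * wdec_const TYPE('a) * (1 + norm x) powr L"
    using wdec_const_nonneg[where 'a='a] weyl_const_nonneg[where 'a='a] by simp
next
  fix b b' :: "'a \<times> 'a \<Rightarrow> complex" and f :: "'a \<Rightarrow> complex" 
  assume a: "symbol L b" "symbol L b'" "schwartz f"
  show "weyl_int (\<lambda>w. b w + b' w) f x = weyl_int b f x + weyl_int b' f x"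
  proof -
    have "weyl_fibre (\<lambda>w. b w + b' w) f x = (\<lambda>\<xi>. weyl_fibre b f x \<xi> + weyl_fibre b' f x \<xi>)"
      by (rule ext, rule weyl_fibre_add_left[OF a])
    then show ?thesis unfolding weyl_int_def
      using weyl_fibre_integrable2[OF L a(1,3)] weyl_fibre_integrable2[OF L a(2,3)] by simp
  qed
next
  fix b :: "'a \<times> 'a \<Rightarrow> complex" and f f' :: "'a \<Rightarrow> complex" 
  assume a: "symbol L b" "schwartz f" "schwartz f'"
  show "weyl_int b (\<lambda>y. f y + f' y) x = weyl_int b f x + weyl_int b f' x"
  proof -
    have "weyl_fibre b (\<lambda>y. f y + f' y) x = (\<lambda>\<xi>. weyl_fibre b f x \<xi> + weyl_fibre b f' x \<xi>)"
      by (rule ext, rule weyl_fibre_add_right[OF a])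
    then show ?thesis unfolding weyl_int_def
      using weyl_fibre_integrable2[OF L a(1,2)] weyl_fibre_integrable2[OF L a(1,3)] by simp
  qed
next
  fix b :: "'a \<times> 'a \<Rightarrow> complex" and f :: "'a \<Rightarrow> complex" and A B
  assume "symbol L b" "schwartz f" "derivs_le (weyl_order L TYPE('a)) L A b"
    "derivs_le (weyl_order L TYPE('a)) (- (L + real (2 * DIM('a)))) B f"
  then show "norm (weyl_int b f x) \<le> weyl_const L TYPE('a) * wdec_const TYPE('a) * (1 + norm x) powr L * A * B"
    using L by (intro weyl_int_basic(2))
qed (simp_all add: weyl_int_def weyl_fibre_cmult)

lemmas weyl_int_add_left = bounded_bilinear_onD(2)[OF weyl_int_bilinear]
  and weyl_int_add_right = bounded_bilinear_onD(3)[OF weyl_int_bilinear]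
  and weyl_int_cmult_left = bounded_bilinear_onD(4)[OF weyl_int_bilinear]
  and weyl_int_cmult_right = bounded_bilinear_onD(5)[OF weyl_int_bilinear]

text \<open>Substitution of \<open>\<xi> + h e\<close> for \<open>\<xi>\<close> in the outer integral. The oscillating factor produces a
  modulation of \<open>f\<close> and a phase at \<open>x\<close>.\<close>

lemma weyl_int_shift:
  assumes "smooth b" "smooth f"
  shows "weyl_int (\<lambda>w. b (w + (h * 1) *\<^sub>R (0, e))) (\<lambda>y. exp (\<i> * of_real (y \<bullet> ((h * (-1)) *\<^sub>R e))) * f y) x
    = exp (\<i> * of_real (h * (- (x \<bullet> e)))) * weyl_int b f x"
proof -
  have *: "weyl_fibre (\<lambda>w. b (w + (h * 1) *\<^sub>R (0, e))) (\<lambda>y. exp (\<i> * of_real (y \<bullet> ((h * (-1)) *\<^sub>R e))) * f y) x \<xi>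
     = exp (\<i> * of_real (h * (- (x \<bullet> e)))) * weyl_fibre b f x (h *\<^sub>R e + \<xi>)" for \<xi>
  proof -
    have "exp (- (\<i> * of_real (v \<bullet> \<xi>))) * b ((x + (1/2) *\<^sub>R v, \<xi>) + (h * 1) *\<^sub>R (0, e)) *
         (exp (\<i> * of_real ((x + v) \<bullet> ((h * (-1)) *\<^sub>R e))) * f (x + v))
       = exp (\<i> * of_real (h * (- (x \<bullet> e)))) *
          (exp (- (\<i> * of_real (v \<bullet> (h *\<^sub>R e + \<xi>)))) * b (x + (1/2) *\<^sub>R v, h *\<^sub>R e + \<xi>) * f (x + v))" for v
    proof -
      have h1: "exp (- (\<i> * complex_of_real (v \<bullet> \<xi>))) * exp (\<i> * of_real ((x + v) \<bullet> ((h * (-1)) *\<^sub>R e)))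
         = exp (\<i> * of_real (h * (- (x \<bullet> e)))) * exp (- (\<i> * of_real (v \<bullet> (h *\<^sub>R e + \<xi>))))"
        unfolding exp_add[symmetric] by (rule arg_cong[where f=exp]) (simp add: algebra_simps inner_add_right inner_add_left)
      have h2: "(x + (1/2) *\<^sub>R v, \<xi>) + (h * 1) *\<^sub>R (0, e) = (x + (1/2) *\<^sub>R v, h *\<^sub>R e + \<xi>)" by simp
      have gen: "E1 * E2 = c * E3 \<Longrightarrow> E1 * u * (E2 * w) = c * (E3 * u * w)" for E1 E2 E3 c u w :: complex
      proof -
        assume "E1 * E2 = c * E3"
        moreover have "E1 * u * (E2 * w) = (E1 * E2) * (u * w)" "c * (E3 * u * w) = (c * E3) * (u * w)"
          by (simp_all only: mult_ac)
        ultimately show ?thesis by simp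
      qed
      show ?thesis unfolding h2 by (rule gen[OF h1])
    qed
    then show ?thesis unfolding weyl_fibre_def by (simp only: integral_mult_right_zero)
  qed
  show ?thesis
    unfolding weyl_int_def * integral_mult_right_zero
      lborel_integral_translate[OF weyl_fibre_measurable[OF assms], of x "h *\<^sub>R e"] ..
qed

text \<open>The first order part of \<open>weyl_int_shift\<close>: the commutator with a coordinate is the
  quantization of a frequency derivative of the symbol.\<close>

lemma weyl_int_position:
  fixes b :: "'a::euclidean_space \<times> 'a \<Rightarrow> complex"
  assumes L: "0 \<le> L" and b: "symbol L b" and f: "schwartz f" and e: "e \<in> Basis"
  shows "of_real (x \<bullet> e) * weyl_int b f x
    = weyl_int b (\<lambda>y. of_real (y \<bullet> e) * f y) x + \<i> * weyl_int (partial_deriv (0, e) b) f x"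
proof -
  have "weyl_int (\<lambda>w. of_real 1 * partial_deriv (0, e) b w) f x +
      weyl_int b (\<lambda>y. \<i> * of_real (-1) * (of_real (y \<bullet> e) * f y)) x = \<i> * of_real (- (x \<bullet> e)) * weyl_int b f x"
  proof (rule bilinear_first_order_identity[where \<Phi>="\<lambda>b f. weyl_int b f x" and l="- (x \<bullet> e)"
        and b'="\<lambda>h w. b (w + (h * 1) *\<^sub>R (0, e))"
        and f'="\<lambda>h y. exp (\<i> * of_real (y \<bullet> ((h * (-1)) *\<^sub>R e))) * f y"
        and n="weyl_order L TYPE('a)" and L=L and M="- (L + real (2 * DIM('a)))"
        and bd="\<lambda>w. of_real 1 * partial_deriv (0, e) b w"
        and fd="\<lambda>y. \<i> * of_real (-1) * (of_real (y \<bullet> e) * f y)"])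
    show "bounded_bilinear_on (\<lambda>b f. weyl_int b f x) (weyl_order L TYPE('a)) L (- (L + real (2 * DIM('a))))
        (weyl_const L TYPE('a) * wdec_const TYPE('a) * (1 + norm x) powr L)"
      by (rule weyl_int_bilinear[OF L])
    show "first_order (weyl_order L TYPE('a)) L (\<lambda>h w. b (w + (h * 1) *\<^sub>R (0, e))) b (\<lambda>w. of_real 1 * partial_deriv (0, e) b w)"
      by (rule first_order_translate[OF b]) (use e in \<open>simp_all add: Pair_Basis\<close>)
    show "first_order (weyl_order L TYPE('a)) (- (L + real (2 * DIM('a)))) (\<lambda>h y. exp (\<i> * of_real (y \<bullet> ((h * (-1)) *\<^sub>R e))) * f y) f
        (\<lambda>y. \<i> * of_real (-1) * (of_real (y \<bullet> e) * f y))"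
      by (rule first_order_modulate[OF e f]) simp
    show "weyl_int (\<lambda>w. b (w + (h * 1) *\<^sub>R (0, e))) (\<lambda>y. exp (\<i> * of_real (y \<bullet> ((h * (-1)) *\<^sub>R e))) * f y) x
      = exp (\<i> * of_real (h * (- (x \<bullet> e)))) * weyl_int b f x" for h
      by (rule weyl_int_shift[OF symbol_smooth[OF b] schwartz_smooth[OF f]])
    show "schwartz (\<lambda>y. exp (\<i> * of_real (y \<bullet> ((h * (-1)) *\<^sub>R e))) * f y)" for h
      by (rule symbol_mult_schwartz[OF symbol_exp_inner f])
    show "schwartz (\<lambda>y. \<i> * of_real (-1) * (of_real (y \<bullet> e) * f y))"
      by (intro schwartz_cmult schwartz_inner_mult e f)
    show "symbol L b" "schwartz f" by fact+
    show "symbol L (\<lambda>w. b (w + (h * 1) *\<^sub>R (0, e)))" for h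
      using b by (rule symbol_translate)
    show "symbol L (\<lambda>w. of_real 1 * partial_deriv (0, e) b w)"
      by (intro symbol_cmult symbol_partial_deriv b Pair_Basis e)
  qed
  then have "weyl_int (partial_deriv (0, e) b) f x + \<i> * of_real (-1) * weyl_int b (\<lambda>y. of_real (y \<bullet> e) * f y) x = \<i> * of_real (- (x \<bullet> e)) * weyl_int b f x"
    unfolding weyl_int_cmult_right[OF L] by simp
  then have "\<i> * (weyl_int (partial_deriv (0, e) b) f x + \<i> * of_real (-1) * weyl_int b (\<lambda>y. of_real (y \<bullet> e) * f y) x)
      = \<i> * (\<i> * of_real (- (x \<bullet> e)) * weyl_int b f x)" by simp
  then show ?thesis by (simp add: algebra_simps)
qed

lemma weyl_int_translate:
  "weyl_int b f (x + h) = weyl_int (\<lambda>w. b (w + (h, 0))) (\<lambda>y. f (y + h)) x"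
  unfolding weyl_int_def weyl_fibre_def by (simp add: algebra_simps)

lemma derivs_le_zero: "derivs_le n L 0 (\<lambda>x. 0)"
  by (induction n) simp_all

lemma derivs_le_sum:
  "finite I \<Longrightarrow> (\<And>i. i \<in> I \<Longrightarrow> smooth (f i)) \<Longrightarrow> (\<And>i. i \<in> I \<Longrightarrow> derivs_le n L (A i) (f i)) \<Longrightarrow>
     derivs_le n L (\<Sum>i\<in>I. A i) (\<lambda>x. \<Sum>i\<in>I. f i x)"
  by (induction I rule: finite_induct) (simp_all add: derivs_le_zero derivs_le_add smooth_sum)

lemma derivs_le_gradient:
  fixes f :: "'a::euclidean_space \<Rightarrow> complex"
  assumes f: "smooth f" and A: "derivs_le (Suc n) L A f"
  shows "derivs_le n L (real DIM('a) * A * norm h) (\<lambda>w. \<Sum>c\<in>Basis. of_real (h \<bullet> c) * partial_deriv c f w)"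
proof -
  have "derivs_le n L (\<Sum>c::'a\<in>Basis. norm h * A) (\<lambda>w. \<Sum>c\<in>Basis. of_real (h \<bullet> c) * partial_deriv c f w)"
  proof (rule derivs_le_sum)
    fix c :: 'a assume c: "c \<in> Basis"
    show "smooth (\<lambda>w. of_real (h \<bullet> c) * partial_deriv c f w)" by (intro smooth_cmult smooth_partial_deriv f c)
    have "derivs_le n L (norm (complex_of_real (h \<bullet> c)) * A) (\<lambda>w. of_real (h \<bullet> c) * partial_deriv c f w)"
      by (intro derivs_le_cmult smooth_partial_deriv f c derivs_le_partial_deriv[OF A])
    then show "derivs_le n L (norm h * A) (\<lambda>w. of_real (h \<bullet> c) * partial_deriv c f w)"
      by (rule derivs_le_weaken) (use Basis_le_norm[OF c, of h] derivs_le_nonneg[OF A] in \<open>auto intro: mult_right_mono\<close>)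
  qed auto
  then show ?thesis by (simp add: mult_ac)
qed

lemma has_derivative_quadratic:
  fixes F :: "'a::euclidean_space \<Rightarrow> complex"
  assumes "linear F'" and "\<And>h. norm h \<le> 1 \<Longrightarrow> norm (F (x + h) - F x - F' h) \<le> C * (norm h)\<^sup>2"
  shows "(F has_derivative F') (at x)"
proof (rule has_derivativeI_sandwich[where e=1 and H="\<lambda>y. C * norm (y - x)"])
  show "bounded_linear F'" using assms(1) by (simp add: linear_conv_bounded_linear)
  show "norm (F y - F x - F' (y - x)) / norm (y - x) \<le> C * norm (y - x)" if "y \<noteq> x" "dist y x < 1" for y
    using assms(2)[of "y - x"] that by (simp add: dist_norm divide_le_eq power2_eq_square mult.assoc)
  have "((\<lambda>y. C * norm (y - x)) \<longlongrightarrow> C * norm (x - x)) (at x)" by (intro tendsto_intros)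
  then show "((\<lambda>y. C * norm (y - x)) \<longlongrightarrow> 0) (at x)" by simp
qed simp

text \<open>Translation of the operator translates the symbol and the function, and both translations
  are differentiable in the weighted norms that bound the bilinear expression.\<close>

lemma weyl_int_has_derivative:
  fixes b :: "'a::euclidean_space \<times> 'a \<Rightarrow> complex"
  assumes L: "0 \<le> L" and b: "symbol L b" and f: "schwartz f"
  shows "(weyl_int b f has_derivative (\<lambda>h. (\<Sum>c\<in>Basis. of_real ((h, 0) \<bullet> c) * weyl_int (partial_deriv c b) f x)
     + (\<Sum>c\<in>Basis. of_real (h \<bullet> c) * weyl_int b (partial_deriv c f) x))) (at x)"
proof -
  define n where "n = weyl_order L TYPE('a)"
  define M where "M = - (L + real (2 * DIM('a)))"
  define K where "K = weyl_const L TYPE('a) * wdec_const TYPE('a) * (1 + norm x) powr L"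
  note \<Phi> = weyl_int_bilinear[OF L, of x, folded n_def M_def K_def]
  obtain A B where AB: "derivs_le (n + 2) L A b" "derivs_le (n + 2) M B f"
    using symbol_derivs_le[OF b] schwartz_derivs_le[OF f] by meson
  note nn = derivs_le_nonneg[OF AB(1)] derivs_le_nonneg[OF AB(2)]
  define A1 where "A1 = real DIM('a \<times> 'a) * A"
  define B1 where "B1 = real DIM('a) * B"
  define C where "C = (real DIM('a \<times> 'a))\<^sup>2 * 2 powr \<bar>L\<bar> * A"
  define D where "D = (real DIM('a))\<^sup>2 * 2 powr \<bar>M\<bar> * B"
  let ?F' = "\<lambda>h. (\<Sum>c\<in>Basis. of_real ((h, 0) \<bullet> c) * weyl_int (partial_deriv c b) f x)
     + (\<Sum>c\<in>Basis. of_real (h \<bullet> c) * weyl_int b (partial_deriv c f) x)"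
  show ?thesis
  proof (rule has_derivative_quadratic)
    show "linear ?F'"
    proof (rule linearI)
      fix h k :: 'a and r :: real
      have "(h + k, 0::'a) = (h, 0) + (k, 0)" "(r *\<^sub>R h, 0::'a) = r *\<^sub>R (h, 0)" by simp_all
      then show "?F' (h + k) = ?F' h + ?F' k" "?F' (r *\<^sub>R h) = r *\<^sub>R ?F' h"
        by (simp_all only: inner_add_left inner_scaleR_left of_real_add of_real_mult distrib_right sum.distrib
            scaleR_conv_of_real mult.assoc distrib_left sum_distrib_left add_ac)
    qed
    fix h :: 'a assume h: "norm h \<le> 1"
    have h0: "norm (h, 0::'a) = norm h" by (simp add: norm_Pair)
    let ?b1 = "\<lambda>w. \<Sum>c\<in>Basis. of_real ((h, 0) \<bullet> c) * partial_deriv c b w"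
    let ?f1 = "\<lambda>w. \<Sum>c\<in>Basis. of_real (h \<bullet> c) * partial_deriv c f w"
    have sb: "symbol L ?b1" using L b by (intro symbol_sum symbol_cmult symbol_partial_deriv)
    have sf: "schwartz ?f1" using f by (intro schwartz_sum schwartz_cmult schwartz_partial_deriv)
    have "norm (weyl_int (\<lambda>w. b (w + (h, 0))) (\<lambda>y. f (y + h)) x - weyl_int b f x - (weyl_int ?b1 f x + weyl_int b ?f1 x))
       \<le> K * (C * (B + B1 + D) + A * D + A1 * (B1 + D)) * (norm h)\<^sup>2"
    proof (rule bilinear_first_order[OF \<Phi>])
      show "derivs_le n L (C * (norm h)\<^sup>2) (\<lambda>w. b (w + (h, 0)) - b w - ?b1 w)"
        using derivs_le_translate_expansion[OF symbol_smooth[OF b] AB(1), of "(h, 0)"] h h0 by (simp add: C_def)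
      show "derivs_le n M (D * (norm h)\<^sup>2) (\<lambda>y. f (y + h) - f y - ?f1 y)"
        using derivs_le_translate_expansion[OF schwartz_smooth[OF f] AB(2) h] by (simp add: D_def)
      show "derivs_le n L (A1 * norm h) ?b1"
        using derivs_le_gradient[OF symbol_smooth[OF b] derivs_le_antimono[OF AB(1)], of n "(h, 0)"] h0 by (simp add: A1_def)
      show "derivs_le n M (B1 * norm h) ?f1"
        using derivs_le_gradient[OF schwartz_smooth[OF f] derivs_le_antimono[OF AB(2)], of n h] by (simp add: B1_def)
      show "derivs_le n L A b" "derivs_le n M B f" using AB derivs_le_antimono by (metis le_add1)+
    qed (use h b f sb sf nn in \<open>auto intro: symbol_translate schwartz_translate simp: A1_def B1_def C_def D_def\<close>)
    moreover have "weyl_int ?b1 f x = (\<Sum>c\<in>Basis. of_real ((h, 0) \<bullet> c) * weyl_int (partial_deriv c b) f x)"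
      using L b f by (subst bilinear_sum[OF \<Phi> L]) (auto intro: symbol_cmult symbol_partial_deriv simp: weyl_int_cmult_left[OF L])
    moreover have "weyl_int b ?f1 x = (\<Sum>c\<in>Basis. of_real (h \<bullet> c) * weyl_int b (partial_deriv c f) x)"
      using L b f by (subst bilinear_sum_right[OF \<Phi>]) (auto intro: schwartz_cmult schwartz_partial_deriv simp: weyl_int_cmult_right[OF L])
    ultimately show "norm (weyl_int b f (x + h) - weyl_int b f x - ?F' h)
       \<le> K * (C * (B + B1 + D) + A * D + A1 * (B1 + D)) * (norm h)\<^sup>2"
      unfolding weyl_int_translate by simp
  qed
qed

lemma partial_deriv_weyl_int:
  fixes b :: "'a::euclidean_space \<times> 'a \<Rightarrow> complex"
  assumes L: "0 \<le> L" and b: "symbol L b" and f: "schwartz f" and e: "e \<in> Basis"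
  shows "partial_deriv e (weyl_int b f) = (\<lambda>x. weyl_int (partial_deriv (e, 0) b) f x + weyl_int b (partial_deriv e f) x)"
proof
  fix x
  have eb: "(e, 0::'a) \<in> Basis" using e by (rule Pair_Basis)
  have "(\<Sum>c\<in>Basis. of_real ((e, 0::'a) \<bullet> c) * weyl_int (partial_deriv c b) f x)
     = (\<Sum>c\<in>Basis. if c = (e, 0) then weyl_int (partial_deriv c b) f x else 0)"
  proof (intro sum.cong refl)
    fix c :: "'a \<times> 'a" assume "c \<in> Basis"
    then have "(e, 0) \<bullet> c = (if c = (e, 0) then 1 else 0)"
      using inner_Basis[OF Pair_Basis(1)[OF e], of c] by (cases "c = (e, 0)") auto
    then show "of_real ((e, 0) \<bullet> c) * weyl_int (partial_deriv c b) f x = (if c = (e, 0) then weyl_int (partial_deriv c b) f x else 0)"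
      by simp
  qed
  moreover have "(\<Sum>c\<in>Basis. of_real (e \<bullet> c) * weyl_int b (partial_deriv c f) x)
     = (\<Sum>c\<in>Basis. if c = e then weyl_int b (partial_deriv c f) x else 0)"
    using e by (intro sum.cong) (auto simp: inner_Basis)
  ultimately show "partial_deriv e (weyl_int b f) x = weyl_int (partial_deriv (e, 0) b) f x + weyl_int b (partial_deriv e f) x"
    using partial_deriv_eqI[OF weyl_int_has_derivative[OF L b f], of e x] e eb by simp
qed

lemma smooth_weyl_int:
  assumes L: "0 \<le> L" and b: "symbol L b" and f: "schwartz f"
  shows "smooth (weyl_int b f)"
proof -
  have "symbol L b \<Longrightarrow> schwartz f \<Longrightarrow> smooth_upto n (weyl_int b f)" for n b and f :: "'a \<Rightarrow> complex"
  proof (induction n arbitrary: b f)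
    case 0
    then show ?case using weyl_int_has_derivative[OF L 0] by (auto simp: differentiable_on_def differentiable_def)
  next
    case (Suc n)
    have "weyl_int b f differentiable_on UNIV"
      using weyl_int_has_derivative[OF L Suc.prems] by (auto simp: differentiable_on_def differentiable_def)
    with Suc L show ?case
      by (simp add: partial_deriv_weyl_int smooth_upto_add symbol_partial_deriv schwartz_partial_deriv Pair_Basis)
  qed
  with b f show ?thesis by (simp add: smooth_iff_upto)
qed

text \<open>By \<open>weyl_int_position\<close>, a factor of position is traded for a weight on the function and a
  frequency derivative of the symbol. Neither raises the order of the symbol, so the induction
  stays at the same \<open>L\<close>.\<close>

lemma weyl_int_decay:
  assumes L: "0 \<le> L"
  shows "\<exists>N C. 0 \<le> C \<and> (\<forall>(b :: 'a::euclidean_space \<times> 'a \<Rightarrow> complex) f A B x. symbol L b \<longrightarrow> schwartz f \<longrightarrow> derivs_le N L A b \<longrightarrow>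
     derivs_le N (- real N) B f \<longrightarrow> (1 + norm x) ^ k * norm (weyl_int b f x) \<le> C * A * B * (1 + norm x) powr L)"
proof (induction k)
  case 0
  show ?case
  proof (intro exI conjI allI impI)
    show "0 \<le> weyl_const L TYPE('a) * wdec_const TYPE('a)"
      using wdec_const_nonneg[where 'a='a] weyl_const_nonneg[where 'a='a] by simp
    fix b :: "'a \<times> 'a \<Rightarrow> complex" and f :: "'a \<Rightarrow> complex" and A B and x :: 'a
    assume "symbol L b" "schwartz f" "derivs_le (weyl_order L TYPE('a)) L A b"
      "derivs_le (weyl_order L TYPE('a)) (- real (weyl_order L TYPE('a))) B f"
    then show "(1 + norm x) ^ 0 * norm (weyl_int b f x) \<le> (weyl_const L TYPE('a) * wdec_const TYPE('a)) * A * B * (1 + norm x) powr L"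
      using weyl_int_basic(2)[OF L _ _ _ derivs_le_weyl_window] by (simp add: mult_ac)
  qed
next
  case (Suc k)
  then obtain N C where C: "0 \<le> C" and *: "\<And>(b :: 'a \<times> 'a \<Rightarrow> complex) f A B x. symbol L b \<Longrightarrow> schwartz f \<Longrightarrow> derivs_le N L A b \<Longrightarrow>
     derivs_le N (- real N) B f \<Longrightarrow> (1 + norm x) ^ k * norm (weyl_int b f x) \<le> C * A * B * (1 + norm x) powr L"
    by blast
  define d where "d = real DIM('a)"
  show ?case
  proof (intro exI[of _ "Suc N"] exI[of _ "C * (1 + d * (2 ^ N + 1))"] conjI allI impI)
    show "0 \<le> C * (1 + d * (2 ^ N + 1))" using C by (simp add: d_def)
    fix b :: "'a \<times> 'a \<Rightarrow> complex" and f :: "'a \<Rightarrow> complex" and A B and x :: 'a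
    assume b: "symbol L b" and f: "schwartz f" and A: "derivs_le (Suc N) L A b" and B: "derivs_le (Suc N) (- real (Suc N)) B f"
    define W where "W = A * B * (1 + norm x) powr L"
    have pos: "0 \<le> 1 + norm x" by simp
    have BN: "derivs_le N (- real N) B f" using B by (rule derivs_le_weaken) auto
    have 1: "(1 + norm x) ^ k * norm (weyl_int b f x) \<le> C * W"
      using *[OF b f derivs_le_SucD[OF A] BN, of x] by (simp add: W_def mult_ac)
    have 2: "(1 + norm x) ^ k * norm (of_real (x \<bullet> e) * weyl_int b f x) \<le> C * (2 ^ N + 1) * W" if e: "e \<in> Basis" for e
    proof -
      have "derivs_le N (1 + (- real (Suc N))) (2 ^ N * (1 * B)) (\<lambda>y. of_real (y \<bullet> e) * f y)"
        by (intro derivs_le_mult smooth_inner schwartz_smooth f derivs_le_inner e derivs_le_SucD[OF B])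
      then have y: "derivs_le N (- real N) (2 ^ N * B) (\<lambda>y. of_real (y \<bullet> e) * f y)" by simp
      have "(1 + norm x) ^ k * norm (weyl_int b (\<lambda>y. of_real (y \<bullet> e) * f y) x) \<le> C * A * (2 ^ N * B) * (1 + norm x) powr L"
        by (rule *[OF b schwartz_inner_mult[OF e f] derivs_le_SucD[OF A] y])
      moreover have "(1 + norm x) ^ k * norm (weyl_int (partial_deriv (0, e) b) f x) \<le> C * A * B * (1 + norm x) powr L"
        using e b A by (intro * f BN symbol_partial_deriv Pair_Basis derivs_le_partial_deriv)
      moreover have "norm (of_real (x \<bullet> e) * weyl_int b f x)
         \<le> norm (weyl_int b (\<lambda>y. of_real (y \<bullet> e) * f y) x) + norm (weyl_int (partial_deriv (0, e) b) f x)"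
        unfolding weyl_int_position[OF L b f e] using norm_triangle_ineq[of _ "\<i> * weyl_int (partial_deriv (0, e) b) f x"]
        by (simp add: norm_mult)
      then have "(1 + norm x) ^ k * norm (of_real (x \<bullet> e) * weyl_int b f x) \<le> (1 + norm x) ^ k *
          (norm (weyl_int b (\<lambda>y. of_real (y \<bullet> e) * f y) x) + norm (weyl_int (partial_deriv (0, e) b) f x))"
        by (intro mult_left_mono) auto
      ultimately show ?thesis by (simp add: W_def algebra_simps)
    qed
    have "norm x * norm (weyl_int b f x) \<le> (\<Sum>e\<in>Basis. \<bar>x \<bullet> e\<bar>) * norm (weyl_int b f x)"
      by (intro mult_right_mono norm_le_l1) auto
    also have "\<dots> = (\<Sum>e\<in>Basis. norm (of_real (x \<bullet> e) * weyl_int b f x))"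
      by (simp add: norm_mult sum_distrib_right)
    finally have "(1 + norm x) ^ k * (norm x * norm (weyl_int b f x))
        \<le> (1 + norm x) ^ k * (\<Sum>e\<in>Basis. norm (of_real (x \<bullet> e) * weyl_int b f x))"
      by (intro mult_left_mono) auto
    also have "\<dots> = (\<Sum>e\<in>Basis. (1 + norm x) ^ k * norm (of_real (x \<bullet> e) * weyl_int b f x))"
      by (rule sum_distrib_left)
    also have "\<dots> \<le> (\<Sum>e::'a\<in>Basis. C * (2 ^ N + 1) * W)" using 2 by (intro sum_mono) auto
    finally have "(1 + norm x) ^ k * (norm x * norm (weyl_int b f x)) \<le> d * (C * (2 ^ N + 1) * W)" by (simp add: d_def)
    with 1 have "(1 + norm x) ^ k * norm (weyl_int b f x) + (1 + norm x) ^ k * (norm x * norm (weyl_int b f x))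
        \<le> C * W + d * (C * (2 ^ N + 1) * W)" by (rule add_mono)
    then show "(1 + norm x) ^ Suc k * norm (weyl_int b f x) \<le> (C * (1 + d * (2 ^ N + 1))) * A * B * (1 + norm x) powr L"
      by (simp add: W_def algebra_simps)
  qed
qed

text \<open>Induction on \<open>n\<close>, since differentiation of the operator distributes over symbol and
  function by the previous lemmas. The estimate is uniform in the symbol; this is needed for the
  Taylor remainders, which vary with the point of expansion.\<close>

lemma weyl_int_derivs_le:
  assumes L: "0 \<le> L"
  shows "\<exists>N C. 0 \<le> C \<and> (\<forall>(b :: 'a::euclidean_space \<times> 'a \<Rightarrow> complex) f A B. symbol L b \<longrightarrow> schwartz f \<longrightarrow> derivs_le N L A b \<longrightarrow>
     derivs_le N (- real N) B f \<longrightarrow> derivs_le n (- real k) (C * A * B) (weyl_int b f))"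
proof (induction n)
  case 0
  obtain N C where C: "0 \<le> C" and *: "\<And>(b :: 'a \<times> 'a \<Rightarrow> complex) f A B x. symbol L b \<Longrightarrow> schwartz f \<Longrightarrow> derivs_le N L A b \<Longrightarrow>
     derivs_le N (- real N) B f \<Longrightarrow> (1 + norm x) ^ (k + nat \<lceil>L\<rceil>) * norm (weyl_int b f x) \<le> C * A * B * (1 + norm x) powr L"
    using weyl_int_decay[OF L, of "k + nat \<lceil>L\<rceil>", where 'a='a] by blast
  have "derivs_le 0 (- real k) (C * A * B) (weyl_int b f)"
    if b: "symbol L b" and f: "schwartz f" and A: "derivs_le N L A b" and B: "derivs_le N (- real N) B f" for b :: "'a \<times> 'a \<Rightarrow> complex" and f A B
  proof -
    have "norm (weyl_int b f x) \<le> C * A * B * (1 + norm x) powr (- real k)" for x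
    proof -
      have pos: "0 < 1 + norm x" using norm_ge_zero[of x] by linarith
      define j where "j = k + nat \<lceil>L\<rceil>"
      have "norm (weyl_int b f x) = ((1 + norm x) ^ j * norm (weyl_int b f x)) * (1 + norm x) powr (- real j)"
        using pos by (simp add: powr_minus powr_realpow field_simps)
      also have "\<dots> \<le> (C * A * B * (1 + norm x) powr L) * (1 + norm x) powr (- real j)"
        using *[OF b f A B, of x] by (intro mult_right_mono) (auto simp: j_def)
      also have "\<dots> = C * A * B * (1 + norm x) powr (L - real j)"
        by (simp add: powr_add[symmetric] mult.assoc)
      also have "\<dots> \<le> C * A * B * (1 + norm x) powr (- real k)"
      proof (intro mult_left_mono weight_mono)
        have "L \<le> real (nat \<lceil>L\<rceil>)" by linarith
        then show "L - real j \<le> - real k" by (simp add: j_def)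
      qed (use C derivs_le_nonneg[OF A] derivs_le_nonneg[OF B] in simp)
      finally show ?thesis .
    qed
    then show ?thesis by simp
  qed
  with C show ?case by blast
next
  case (Suc n)
  then obtain N C where C: "0 \<le> C" and *: "\<And>(b :: 'a \<times> 'a \<Rightarrow> complex) f A B. symbol L b \<Longrightarrow> schwartz f \<Longrightarrow> derivs_le N L A b \<Longrightarrow>
     derivs_le N (- real N) B f \<Longrightarrow> derivs_le n (- real k) (C * A * B) (weyl_int b f)"
    by blast
  show ?case
  proof (intro exI[of _ "Suc N"] exI[of _ "2 * C"] conjI allI impI)
    show "0 \<le> 2 * C" using C by simp
    fix b :: "'a \<times> 'a \<Rightarrow> complex" and f :: "'a \<Rightarrow> complex" and A B
    assume b: "symbol L b" and f: "schwartz f" and A: "derivs_le (Suc N) L A b" and B: "derivs_le (Suc N) (- real (Suc N)) B f"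
    have BN: "derivs_le N (- real N) B f" using B by (rule derivs_le_weaken) auto
    have BN': "derivs_le N (- real N) B (partial_deriv e f)" if "e \<in> Basis" for e
      using derivs_le_partial_deriv[OF B that] by (rule derivs_le_weaken) auto
    have nn: "0 \<le> C * A * B" using C derivs_le_nonneg[OF A] derivs_le_nonneg[OF B] by simp
    have "derivs_le n (- real k) (C * A * B) (weyl_int b f)" by (rule *[OF b f derivs_le_SucD[OF A] BN])
    then have 0: "norm (weyl_int b f x) \<le> 2 * C * A * B * (1 + norm x) powr (- real k)" for x
      by (rule derivs_leD[OF derivs_le_weaken[OF _ order_refl order_refl]]) (use nn in \<open>simp add: mult_ac\<close>)
    have 1: "derivs_le n (- real k) (2 * C * A * B) (partial_deriv e (weyl_int b f))" if e: "e \<in> Basis" for e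
    proof -
      have "derivs_le n (- real k) (C * A * B + C * A * B) (\<lambda>x. weyl_int (partial_deriv (e, 0) b) f x + weyl_int b (partial_deriv e f) x)"
        using b f A BN BN'[OF e] e L derivs_le_SucD[OF A] derivs_le_partial_deriv[OF A Pair_Basis(1)[OF e]]
        by (intro derivs_le_add smooth_weyl_int[OF L] * symbol_partial_deriv schwartz_partial_deriv Pair_Basis)
      then show ?thesis unfolding partial_deriv_weyl_int[OF L b f e] by (simp add: mult_ac)
    qed
    show "derivs_le (Suc n) (- real k) (2 * C * A * B) (weyl_int b f)"
      unfolding derivs_le.simps using 0 1 by blast
  qed
qed

lemma schwartz_weyl_int:
  fixes b :: "'a::euclidean_space \<times> 'a \<Rightarrow> complex"
  assumes L: "0 \<le> L" and b: "symbol L b" and f: "schwartz f"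
  shows "schwartz (weyl_int b f)"
  unfolding schwartz_iff
proof (intro conjI allI)
  show "smooth (weyl_int b f)" by (rule smooth_weyl_int[OF assms])
  fix n :: nat and K :: real
  obtain N C where *: "\<And>(b :: 'a \<times> 'a \<Rightarrow> complex) f A B. symbol L b \<Longrightarrow> schwartz f \<Longrightarrow> derivs_le N L A b \<Longrightarrow>
     derivs_le N (- real N) B f \<Longrightarrow> derivs_le n (- real (nat \<lceil>-K\<rceil>)) (C * A * B) (weyl_int b f)"
    using weyl_int_derivs_le[OF L, of n "nat \<lceil>-K\<rceil>", where 'a='a] by blast
  obtain A B where "derivs_le N L A b" "derivs_le N (- real N) B f"
    using symbol_derivs_le[OF b] schwartz_derivs_le[OF f] by meson
  from *[OF b f this] have "derivs_le n (- real (nat \<lceil>-K\<rceil>)) (C * A * B) (weyl_int b f)" .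
  moreover have "- real (nat \<lceil>-K\<rceil>) \<le> K" by linarith
  ultimately show "\<exists>A. derivs_le n K A (weyl_int b f)" using derivs_le_weaken by blast
qed

section \<open>Multiplication of the symbol by a coordinate\<close>

text \<open>The position part of the symbol is evaluated at the midpoint, which is the mean of the two
  end points. So a position coordinate in the symbol becomes the symmetrised product of
  operators.\<close>

lemma weyl_int_position_symbol:
  fixes b :: "'a::euclidean_space \<times> 'a \<Rightarrow> complex"
  assumes L: "0 \<le> L" and b: "symbol L b" and f: "schwartz f" and e: "e \<in> Basis"
  shows "weyl_int (\<lambda>w. of_real (w \<bullet> (e, 0)) * b w) f x
    = of_real (1/2) * (of_real (x \<bullet> e) * weyl_int b f x + weyl_int b (\<lambda>y. of_real (y \<bullet> e) * f y) x)"
proof -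
  have yf: "schwartz (\<lambda>y. of_real (y \<bullet> e) * f y)" by (rule schwartz_inner_mult[OF e f])
  have *: "weyl_fibre (\<lambda>w. of_real (w \<bullet> (e, 0)) * b w) f x \<xi>
     = of_real (1/2) * (of_real (x \<bullet> e) * weyl_fibre b f x \<xi> + weyl_fibre b (\<lambda>y. of_real (y \<bullet> e) * f y) x \<xi>)" for \<xi>
  proof -
    let ?G = "\<lambda>v. exp (- (\<i> * of_real (v \<bullet> \<xi>))) * b (x + (1/2) *\<^sub>R v, \<xi>) * f (x + v)"
    let ?H = "\<lambda>v. exp (- (\<i> * of_real (v \<bullet> \<xi>))) * b (x + (1/2) *\<^sub>R v, \<xi>) * (of_real ((x + v) \<bullet> e) * f (x + v))"
    have eq: "exp (- (\<i> * of_real (v \<bullet> \<xi>))) * (of_real ((x + (1/2) *\<^sub>R v, \<xi>) \<bullet> (e, 0)) * b (x + (1/2) *\<^sub>R v, \<xi>)) * f (x + v)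
       = of_real (1/2) * (of_real (x \<bullet> e) * ?G v + ?H v)" for v
      by (simp add: inner_add_left algebra_simps)
    have "weyl_fibre (\<lambda>w. of_real (w \<bullet> (e, 0)) * b w) f x \<xi> = (\<integral>v. of_real (1/2) * (of_real (x \<bullet> e) * ?G v + ?H v) \<partial>lborel)"
      unfolding weyl_fibre_def eq ..
    also have "\<dots> = of_real (1/2) * (of_real (x \<bullet> e) * (\<integral>v. ?G v \<partial>lborel) + (\<integral>v. ?H v \<partial>lborel))"
      unfolding integral_mult_right_zero
      using weyl_fibre_integrable[OF b f, of \<xi> x] weyl_fibre_integrable[OF b yf, of \<xi> x]
      by (subst Bochner_Integration.integral_add) (simp_all add: integrable_mult_right)
    finally show ?thesis unfolding weyl_fibre_def .
  qed
  have "weyl_int (\<lambda>w. of_real (w \<bullet> (e, 0)) * b w) f x = (\<integral>\<xi>. of_real (1/2) *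
      (of_real (x \<bullet> e) * weyl_fibre b f x \<xi> + weyl_fibre b (\<lambda>y. of_real (y \<bullet> e) * f y) x \<xi>) \<partial>lborel)"
    unfolding weyl_int_def * ..
  also have "\<dots> = of_real (1/2) * (of_real (x \<bullet> e) * weyl_int b f x + weyl_int b (\<lambda>y. of_real (y \<bullet> e) * f y) x)"
    unfolding integral_mult_right_zero weyl_int_def
    using weyl_fibre_integrable2[OF L b f, of x] weyl_fibre_integrable2[OF L b yf, of x]
    by (subst Bochner_Integration.integral_add) (simp_all add: integrable_mult_right)
  finally show ?thesis .
qed

text \<open>The analogous symmetrisation for a frequency coordinate, which acts as \<open>- \<i>\<close> times the
  derivative. The halves arise from \<open>fibre_frequency\<close>, whose right-hand side has the symbol
  differentiated with the factor \<open>1/2\<close>.\<close>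

lemma weyl_int_frequency_symbol:
  fixes b :: "'a::euclidean_space \<times> 'a \<Rightarrow> complex"
  assumes L: "0 \<le> L" and b: "symbol L b" and f: "schwartz f" and e: "e \<in> Basis"
  shows "weyl_int (\<lambda>w. of_real (w \<bullet> (0, e)) * b w) f x
    = - \<i> * of_real (1/2) * (partial_deriv e (weyl_int b f) x + weyl_int b (partial_deriv e f) x)"
proof -
  have b': "symbol L (\<lambda>w. of_real (1/2) * partial_deriv (e, 0) b w)"
    by (intro symbol_cmult symbol_partial_deriv b Pair_Basis e)
  have f': "schwartz (partial_deriv e f)" by (rule schwartz_partial_deriv[OF f e])
  have *: "weyl_fibre (\<lambda>w. of_real (w \<bullet> (0, e)) * b w) f x \<xi>
     = - \<i> * (weyl_fibre (\<lambda>w. of_real (1/2) * partial_deriv (e, 0) b w) f x \<xi> + weyl_fibre b (partial_deriv e f) x \<xi>)" for \<xi>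
  proof -
    have "weyl_fibre (\<lambda>w. of_real (w \<bullet> (0, e)) * b w) f x \<xi> = of_real (\<xi> \<bullet> e) * weyl_fibre b f x \<xi>"
      unfolding weyl_fibre_def integral_mult_right_zero[symmetric] by (simp add: mult_ac)
    also have "\<dots> = - \<i> * (\<i> * of_real (\<xi> \<bullet> e) * weyl_fibre b f x \<xi>)" by (simp add: mult.assoc[symmetric])
    finally show ?thesis unfolding fibre_frequency[OF L b f e] .
  qed
  have "weyl_int (\<lambda>w. of_real (w \<bullet> (0, e)) * b w) f x = - \<i> *
      (weyl_int (\<lambda>w. of_real (1/2) * partial_deriv (e, 0) b w) f x + weyl_int b (partial_deriv e f) x)"
    unfolding weyl_int_def * integral_mult_right_zero
    using weyl_fibre_integrable2[OF L b' f, of x] weyl_fibre_integrable2[OF L b f', of x]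
    by (subst Bochner_Integration.integral_add) simp_all
  then show ?thesis
    unfolding weyl_int_cmult_left[OF L] partial_deriv_weyl_int[OF L b f e] by (simp add: algebra_simps)
qed

section \<open>Fourier inversion\<close>

text \<open>The characteristic function of the standard normal distribution.\<close>

lemma gauss_1d:
  fixes s :: real
  shows "integrable lborel (\<lambda>t. exp (- (\<i> * of_real (s * t))) * complex_of_real (exp (- (t\<^sup>2 / 2))))"
    and "(\<integral>t. exp (- (\<i> * of_real (s * t))) * complex_of_real (exp (- (t\<^sup>2 / 2))) \<partial>lborel)
      = of_real (sqrt (2 * pi) * exp (- (s\<^sup>2 / 2)))"
proof -
  have eq: "exp (- (\<i> * of_real (s * t))) * complex_of_real (exp (- (t\<^sup>2 / 2)))
     = of_real (sqrt (2 * pi)) * (std_normal_density t *\<^sub>R iexp (- s * t))" for t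
    by (simp add: std_normal_density_def scaleR_conv_of_real)
  have i: "integrable lborel (\<lambda>t. std_normal_density t *\<^sub>R iexp (- s * t))"
  proof (rule Bochner_Integration.integrable_bound)
    show "integrable lborel (\<lambda>t. std_normal_density t)" using integrable_normal_density[of 1 0] by simp
  qed (auto intro!: AE_I2 simp: norm_exp_eq_Re)
  then show "integrable lborel (\<lambda>t. exp (- (\<i> * of_real (s * t))) * complex_of_real (exp (- (t\<^sup>2 / 2))))"
    unfolding eq by (rule integrable_mult_right)
  have "(\<integral>t. std_normal_density t *\<^sub>R iexp (- s * t) \<partial>lborel) = char std_normal_distribution (- s)"
    unfolding char_def by (subst integral_density) auto
  also have "\<dots> = of_real (exp (- (s\<^sup>2 / 2)))" by (simp add: char_std_normal_distribution)
  finally show "(\<integral>t. exp (- (\<i> * of_real (s * t))) * complex_of_real (exp (- (t\<^sup>2 / 2))) \<partial>lborel)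
      = of_real (sqrt (2 * pi) * exp (- (s\<^sup>2 / 2)))"
    unfolding eq integral_mult_right_zero by simp
qed

lemma gauss_fourier:
  fixes u :: "'a::euclidean_space"
  shows "integrable lborel (\<lambda>\<xi>. exp (- (\<i> * of_real (u \<bullet> \<xi>))) * complex_of_real (exp (- ((norm \<xi>)\<^sup>2 / 2))))"
    and "(\<integral>\<xi>. exp (- (\<i> * of_real (u \<bullet> \<xi>))) * complex_of_real (exp (- ((norm \<xi>)\<^sup>2 / 2))) \<partial>lborel)
      = of_real (sqrt (2 * pi) ^ DIM('a) * exp (- ((norm u)\<^sup>2 / 2)))"
proof -
  let ?h = "\<lambda>b t. exp (- (\<i> * of_real ((u \<bullet> b) * t))) * complex_of_real (exp (- (t\<^sup>2 / 2)))"
  have sq: "(norm x)\<^sup>2 = (\<Sum>b\<in>Basis. (x \<bullet> b)\<^sup>2)" for x :: 'a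
    unfolding power2_norm_eq_inner by (subst euclidean_inner) (simp add: power2_eq_square)
  have eq: "exp (- (\<i> * of_real (u \<bullet> \<xi>))) * complex_of_real (exp (- ((norm \<xi>)\<^sup>2 / 2))) = (\<Prod>b\<in>Basis. ?h b (\<xi> \<bullet> b))" for \<xi>
  proof -
    have "exp (- (\<i> * complex_of_real (u \<bullet> \<xi>))) = (\<Prod>b\<in>Basis. exp (- (\<i> * of_real ((u \<bullet> b) * (\<xi> \<bullet> b)))))"
      by (subst euclidean_inner) (simp add: exp_sum[symmetric] sum_distrib_left sum_negf)
    moreover have "complex_of_real (exp (- ((norm \<xi>)\<^sup>2 / 2))) = (\<Prod>b\<in>Basis. complex_of_real (exp (- ((\<xi> \<bullet> b)\<^sup>2 / 2))))"
      unfolding sq of_real_prod[symmetric] by (simp add: exp_sum[symmetric] sum_divide_distrib sum_negf)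
    ultimately show ?thesis by (simp add: prod.distrib)
  qed
  show "integrable lborel (\<lambda>\<xi>. exp (- (\<i> * of_real (u \<bullet> \<xi>))) * complex_of_real (exp (- ((norm \<xi>)\<^sup>2 / 2))))"
    unfolding eq by (rule lborel_prod_coords(1)[where h="?h"]) (rule gauss_1d(1))
  have "(\<integral>\<xi>. exp (- (\<i> * of_real (u \<bullet> \<xi>))) * complex_of_real (exp (- ((norm \<xi>)\<^sup>2 / 2))) \<partial>lborel) = (\<Prod>b\<in>Basis. \<integral>t. ?h b t \<partial>lborel)"
    unfolding eq by (rule lborel_prod_coords(2)[where h="?h"]) (rule gauss_1d(1))
  also have "\<dots> = (\<Prod>b\<in>Basis. of_real (sqrt (2 * pi) * exp (- ((u \<bullet> b)\<^sup>2 / 2))))"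
    by (intro prod.cong refl gauss_1d(2))
  also have "\<dots> = of_real (sqrt (2 * pi) ^ DIM('a) * exp (- ((norm u)\<^sup>2 / 2)))"
    unfolding sq of_real_prod[symmetric] by (simp add: prod.distrib exp_sum[symmetric] sum_divide_distrib sum_negf)
  finally show "(\<integral>\<xi>. exp (- (\<i> * of_real (u \<bullet> \<xi>))) * complex_of_real (exp (- ((norm \<xi>)\<^sup>2 / 2))) \<partial>lborel)
      = of_real (sqrt (2 * pi) ^ DIM('a) * exp (- ((norm u)\<^sup>2 / 2)))" .
qed

lemma lborel_integral_scale:
  fixes g :: "'a::euclidean_space \<Rightarrow> complex"
  assumes "g \<in> borel_measurable borel" "c > 0"
  shows "(\<integral>v. g v \<partial>lborel) = of_real (c ^ DIM('a)) * (\<integral>v. g (c *\<^sub>R v) \<partial>lborel)"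
proof -
  have "(\<integral>v. g v \<partial>lborel) = (\<integral>v. g v \<partial>(density (distr lborel borel (\<lambda>x. 0 + c *\<^sub>R x)) (\<lambda>_. \<bar>c\<bar> ^ DIM('a))))"
    using lborel_affine[of c "0::'a"] assms(2) by simp
  also have "\<dots> = (\<integral>v. (\<bar>c\<bar> ^ DIM('a)) *\<^sub>R g v \<partial>(distr lborel borel (\<lambda>x. 0 + c *\<^sub>R x)))"
    using assms by (subst integral_density) auto
  also have "\<dots> = (\<integral>v. (\<bar>c\<bar> ^ DIM('a)) *\<^sub>R g (0 + c *\<^sub>R v) \<partial>lborel)"
    using assms by (subst integral_distr) auto
  finally show ?thesis using assms(2) by (simp add: scaleR_conv_of_real)
qed

lemma lborel_integrable_scale:
  fixes g :: "'a::euclidean_space \<Rightarrow> complex"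
  assumes g: "integrable lborel g" and c: "c > 0"
  shows "integrable lborel (\<lambda>v. g (c *\<^sub>R v))"
proof -
  have gm: "g \<in> borel_measurable borel" using borel_measurable_integrable[OF g] by simp
  have "integrable (density (distr lborel borel (\<lambda>x. 0 + c *\<^sub>R x)) (\<lambda>_. \<bar>c\<bar> ^ DIM('a))) g"
    using lborel_affine[of c "0::'a"] c g by simp
  then have "integrable (distr lborel borel (\<lambda>x. 0 + c *\<^sub>R x)) (\<lambda>v. (\<bar>c\<bar> ^ DIM('a)) *\<^sub>R g v)"
    using gm by (subst (asm) integrable_density) auto
  then have "integrable lborel (\<lambda>v. (\<bar>c\<bar> ^ DIM('a)) *\<^sub>R g (0 + c *\<^sub>R v))"
    using gm by (subst (asm) integrable_distr_eq) auto
  then have "integrable lborel (\<lambda>v. inverse (c ^ DIM('a)) *\<^sub>R ((\<bar>c\<bar> ^ DIM('a)) *\<^sub>R g (0 + c *\<^sub>R v)))"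
    by (rule integrable_scaleR_right)
  then show ?thesis using c by simp
qed

text \<open>Fourier inversion by Gaussian regularisation. A factor \<open>exp (- (\<epsilon> norm \<xi>)\<^sup>2 / 2)\<close> permits
  to exchange the integrals, and the Gaussian integral over \<open>\<xi>\<close> yields an approximate identity.
  Dominated convergence applies on both sides as \<open>\<epsilon>\<close> tends to 0.\<close>

lemma weyl_int_one:
  fixes f :: "'a::euclidean_space \<Rightarrow> complex"
  assumes f: "schwartz f"
  shows "weyl_int (\<lambda>w. 1) f x = of_real ((2 * pi) ^ DIM('a)) * f x"
proof -
  let ?E = "\<lambda>\<xi>::'a. complex_of_real (exp (- ((norm \<xi>)\<^sup>2 / 2)))"
  let ?g = "weyl_fibre (\<lambda>w. 1) f x"
  define q where "q = sqrt (2 * pi) ^ DIM('a)"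
  have q0: "q > 0" by (simp add: q_def)
  have one: "symbol 0 (\<lambda>w::'a\<times>'a. 1)" by (rule symbol_const) simp
  have gi: "integrable lborel ?g" by (rule weyl_fibre_integrable2[OF order_refl one f])
  have gm: "?g \<in> borel_measurable borel" by (rule weyl_fibre_measurable[OF smooth_const schwartz_smooth[OF f]])
  have Ei: "integrable lborel ?E" using gauss_fourier(1)[of 0] by simp
  have Em: "?E \<in> borel_measurable borel" by (intro borel_measurable_continuous_onI continuous_intros) auto
  have EI: "(\<integral>\<xi>. ?E \<xi> \<partial>lborel) = of_real q" using gauss_fourier(2)[of 0] by (simp add: q_def)
  have fm: "f \<in> borel_measurable borel" by (rule smooth_measurable[OF schwartz_smooth[OF f]])
  have fgi: "integrable lborel (\<lambda>v. exp (- (\<i> * of_real (v \<bullet> \<xi>))) * f (x + v))" for \<xi>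
    using weyl_fibre_integrable[OF one f, of \<xi> x] by simp
  have fi: "integrable lborel (\<lambda>v. f (x + v))" using fgi[of 0] by simp
  obtain B where B: "derivs_le 0 0 B f" using schwartz_derivs_le[OF f] by blast
  have B': "norm (f y) \<le> B" for y
  proof -
    have "1 + norm y \<noteq> 0" using norm_ge_zero[of y] by linarith
    then show ?thesis using derivs_leD[OF B, of y] by simp
  qed
  define \<epsilon> where "\<epsilon> n = inverse (real (Suc n))" for n
  have \<epsilon>: "\<epsilon> n > 0" for n by (simp add: \<epsilon>_def)
  have \<epsilon>0: "\<epsilon> \<longlonglongrightarrow> 0" unfolding \<epsilon>_def by (rule LIMSEQ_inverse_real_of_nat)
  have J: "(\<integral>\<xi>. ?E (\<epsilon> n *\<^sub>R \<xi>) * ?g \<xi> \<partial>lborel) = of_real q * (\<integral>v. ?E v * f (x + \<epsilon> n *\<^sub>R v) \<partial>lborel)" for n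
  proof -
    let ?c = "\<epsilon> n"
    let ?F = "\<lambda>\<xi> v. ?E (?c *\<^sub>R \<xi>) * (exp (- (\<i> * of_real (v \<bullet> \<xi>))) * f (x + v))"
    have Esc: "integrable lborel (\<lambda>\<xi>. ?E (?c *\<^sub>R \<xi>))" by (rule lborel_integrable_scale[OF Ei \<epsilon>])
    have fc: "continuous_on UNIV (\<lambda>p::'a\<times>'a. f (x + snd p))"
      by (rule continuous_on_compose2[OF smooth_continuous_on[OF schwartz_smooth[OF f], of UNIV]]) (auto intro!: continuous_intros)
    have Fint: "integrable (lborel \<Otimes>\<^sub>M lborel) (\<lambda>(\<xi>, v). ?F \<xi> v)"
    proof (rule lborel_pair.Fubini_integrable)
      have "(\<lambda>p. ?F (fst p) (snd p)) \<in> borel_measurable borel"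
        using fc by (intro borel_measurable_continuous_onI) (auto intro!: continuous_intros)
      then show "(\<lambda>(\<xi>, v). ?F \<xi> v) \<in> borel_measurable (lborel \<Otimes>\<^sub>M lborel)"
        unfolding lborel_prod by (simp add: case_prod_beta')
      have nF: "(\<integral>v. norm (?F \<xi> v) \<partial>lborel) = norm (?E (?c *\<^sub>R \<xi>)) * (\<integral>v. norm (f (x + v)) \<partial>lborel)" for \<xi>
        by (simp add: norm_mult norm_exp_eq_Re)
      show "integrable lborel (\<lambda>\<xi>. \<integral>v. norm (case (\<xi>, v) of (\<xi>, v) \<Rightarrow> ?F \<xi> v) \<partial>lborel)"
        unfolding prod.case nF by (intro integrable_mult_left integrable_norm Esc)
      show "AE \<xi> in lborel. integrable lborel (\<lambda>v. case (\<xi>, v) of (\<xi>, v) \<Rightarrow> ?F \<xi> v)"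
        using fgi by (intro AE_I2) (simp add: integrable_mult_right)
    qed
    have "(\<integral>\<xi>. ?E (?c *\<^sub>R \<xi>) * ?g \<xi> \<partial>lborel) = (\<integral>\<xi>. (\<integral>v. ?F \<xi> v \<partial>lborel) \<partial>lborel)"
      by (simp add: weyl_fibre_def)
    also have "\<dots> = (\<integral>v. (\<integral>\<xi>. ?F \<xi> v \<partial>lborel) \<partial>lborel)"
      by (rule lborel_pair.Fubini_integral[symmetric, OF Fint])
    also have "\<dots> = (\<integral>v. of_real q * inverse (of_real (?c ^ DIM('a))) * (?E (inverse ?c *\<^sub>R v) * f (x + v)) \<partial>lborel)"
    proof (intro Bochner_Integration.integral_cong refl)
      fix v
      let ?k = "\<lambda>\<xi>. exp (- (\<i> * of_real ((inverse ?c *\<^sub>R v) \<bullet> \<xi>))) * ?E \<xi>"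
      have km: "?k \<in> borel_measurable borel" by (intro borel_measurable_continuous_onI continuous_intros) auto
      have "of_real (?c ^ DIM('a)) * (\<integral>\<xi>. ?k (?c *\<^sub>R \<xi>) \<partial>lborel) = of_real (q * exp (- ((norm (inverse ?c *\<^sub>R v))\<^sup>2 / 2)))"
        using lborel_integral_scale[OF km \<epsilon>[of n]] gauss_fourier(2)[of "inverse ?c *\<^sub>R v"] by (simp add: q_def)
      moreover have "?k (?c *\<^sub>R \<xi>) = exp (- (\<i> * of_real (v \<bullet> \<xi>))) * ?E (?c *\<^sub>R \<xi>)" for \<xi>
      proof -
        have "(inverse ?c *\<^sub>R v) \<bullet> (?c *\<^sub>R \<xi>) = v \<bullet> \<xi>" using \<epsilon>[of n] by simp
        then show ?thesis by (simp only:)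
      qed
      ultimately have k: "of_real (?c ^ DIM('a)) * (\<integral>\<xi>. exp (- (\<i> * of_real (v \<bullet> \<xi>))) * ?E (?c *\<^sub>R \<xi>) \<partial>lborel) = of_real q * ?E (inverse ?c *\<^sub>R v)"
        by simp
      have "complex_of_real (?c ^ DIM('a)) \<noteq> 0" using \<epsilon>[of n] by simp
      with k have k': "(\<integral>\<xi>. exp (- (\<i> * of_real (v \<bullet> \<xi>))) * ?E (?c *\<^sub>R \<xi>) \<partial>lborel) = of_real q * inverse (of_real (?c ^ DIM('a))) * ?E (inverse ?c *\<^sub>R v)"
        by (simp add: field_simps)
      have "(\<integral>\<xi>. ?F \<xi> v \<partial>lborel) = (\<integral>\<xi>. f (x + v) * (exp (- (\<i> * of_real (v \<bullet> \<xi>))) * ?E (?c *\<^sub>R \<xi>)) \<partial>lborel)"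
        by (intro Bochner_Integration.integral_cong refl) (simp only: mult_ac)
      also have "\<dots> = f (x + v) * (\<integral>\<xi>. exp (- (\<i> * of_real (v \<bullet> \<xi>))) * ?E (?c *\<^sub>R \<xi>) \<partial>lborel)"
        by (rule integral_mult_right_zero)
      finally show "(\<integral>\<xi>. ?F \<xi> v \<partial>lborel) = of_real q * inverse (of_real (?c ^ DIM('a))) * (?E (inverse ?c *\<^sub>R v) * f (x + v))"
        unfolding k' by (simp only: mult_ac)
    qed
    also have "\<dots> = of_real q * inverse (of_real (?c ^ DIM('a))) * (\<integral>v. ?E (inverse ?c *\<^sub>R v) * f (x + v) \<partial>lborel)"
      by (rule integral_mult_right_zero)
    also have "(\<integral>v. ?E (inverse ?c *\<^sub>R v) * f (x + v) \<partial>lborel) = of_real (?c ^ DIM('a)) * (\<integral>v. ?E v * f (x + ?c *\<^sub>R v) \<partial>lborel)"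
    proof -
      have "continuous_on UNIV (\<lambda>v::'a. f (x + v))"
        by (rule continuous_on_compose2[OF smooth_continuous_on[OF schwartz_smooth[OF f], of UNIV]]) (auto intro!: continuous_intros)
      then have "(\<lambda>v. ?E (inverse ?c *\<^sub>R v) * f (x + v)) \<in> borel_measurable borel"
        by (intro borel_measurable_continuous_onI continuous_intros) auto
      from lborel_integral_scale[OF this \<epsilon>[of n]] show ?thesis using \<epsilon>[of n] by simp
    qed
    finally show ?thesis using \<epsilon>[of n] by (simp add: field_simps)
  qed
  have lim1: "(\<lambda>n. \<integral>\<xi>. ?E (\<epsilon> n *\<^sub>R \<xi>) * ?g \<xi> \<partial>lborel) \<longlonglongrightarrow> (\<integral>\<xi>. ?E (0 *\<^sub>R \<xi>) * ?g \<xi> \<partial>lborel)"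
  proof (rule integral_dominated_convergence[where w="\<lambda>\<xi>. norm (?g \<xi>)"])
    show "integrable lborel (\<lambda>\<xi>. norm (?g \<xi>))" using gi by (rule integrable_norm)
    show "AE \<xi> in lborel. (\<lambda>n. ?E (\<epsilon> n *\<^sub>R \<xi>) * ?g \<xi>) \<longlonglongrightarrow> ?E (0 *\<^sub>R \<xi>) * ?g \<xi>"
      by (intro AE_I2 tendsto_intros \<epsilon>0) auto
    show "AE \<xi> in lborel. norm (?E (\<epsilon> n *\<^sub>R \<xi>) * ?g \<xi>) \<le> norm (?g \<xi>)" for n
      by (intro AE_I2) (simp add: norm_mult mult_left_le_one_le)
    have "(\<lambda>\<xi>. ?E (c *\<^sub>R \<xi>)) \<in> borel_measurable borel" for c
      by (intro borel_measurable_continuous_onI continuous_intros) auto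
    with gm show "(\<lambda>\<xi>. ?E (0 *\<^sub>R \<xi>) * ?g \<xi>) \<in> borel_measurable lborel"
      "(\<lambda>\<xi>. ?E (\<epsilon> n *\<^sub>R \<xi>) * ?g \<xi>) \<in> borel_measurable lborel" for n
      by (simp_all only: borel_measurable_times measurable_lborel2 measurable_lborel1)
  qed
  have fcont: "continuous_on UNIV (\<lambda>v::'a. f (x + c *\<^sub>R v))" for c
    by (rule continuous_on_compose2[OF smooth_continuous_on[OF schwartz_smooth[OF f], of UNIV]]) (auto intro!: continuous_intros)
  have lim2: "(\<lambda>n. \<integral>v. ?E v * f (x + \<epsilon> n *\<^sub>R v) \<partial>lborel) \<longlonglongrightarrow> (\<integral>v. ?E v * f (x + 0 *\<^sub>R v) \<partial>lborel)"
  proof (rule integral_dominated_convergence[where w="\<lambda>v. B * norm (?E v)"])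
    show "integrable lborel (\<lambda>v. B * norm (?E v))" using Ei by (intro integrable_mult_right integrable_norm)
    have "isCont f y" for y using smooth_differentiable[OF schwartz_smooth[OF f], of y] differentiable_imp_continuous_within by blast
    then show "AE v in lborel. (\<lambda>n. ?E v * f (x + \<epsilon> n *\<^sub>R v)) \<longlonglongrightarrow> ?E v * f (x + 0 *\<^sub>R v)"
      by (intro AE_I2 tendsto_mult tendsto_const isCont_tendsto_compose[where g=f] tendsto_add tendsto_scaleR \<epsilon>0)
    show "AE v in lborel. norm (?E v * f (x + \<epsilon> n *\<^sub>R v)) \<le> B * norm (?E v)" for n
      using B' by (intro AE_I2) (simp add: norm_mult mult.commute mult_right_mono)
    have "(\<lambda>v. ?E v * f (x + c *\<^sub>R v)) \<in> borel_measurable borel" for c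
      using fcont by (intro borel_measurable_continuous_onI continuous_intros) auto
    then show "(\<lambda>v. ?E v * f (x + 0 *\<^sub>R v)) \<in> borel_measurable lborel"
      "(\<lambda>v. ?E v * f (x + \<epsilon> n *\<^sub>R v)) \<in> borel_measurable lborel" for n
      by (simp_all only: measurable_lborel2 measurable_lborel1)
  qed
  have "(\<lambda>n. of_real q * (\<integral>v. ?E v * f (x + \<epsilon> n *\<^sub>R v) \<partial>lborel)) \<longlonglongrightarrow> of_real q * (\<integral>v. ?E v * f (x + 0 *\<^sub>R v) \<partial>lborel)"
    by (intro tendsto_mult tendsto_const lim2)
  then have "(\<integral>\<xi>. ?E (0 *\<^sub>R \<xi>) * ?g \<xi> \<partial>lborel) = of_real q * (\<integral>v. ?E v * f (x + 0 *\<^sub>R v) \<partial>lborel)"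
    using lim1 unfolding J by (rule LIMSEQ_unique[rotated])
  then have "weyl_int (\<lambda>w. 1) f x = of_real q * (of_real q * f x)"
    unfolding weyl_int_def scaleR_zero_left add_0_right integral_mult_left_zero EI by simp
  also have "\<dots> = of_real (q * q) * f x" by simp
  also have "q * q = (sqrt (2 * pi) * sqrt (2 * pi)) ^ DIM('a)"
    unfolding q_def by (rule power_mult_distrib[symmetric])
  also have "sqrt (2 * pi) * sqrt (2 * pi) = 2 * pi" by (rule real_sqrt_mult_self[THEN trans]) simp
  finally show ?thesis .
qed

section \<open>The oscillatory integral\<close>

lemma tensor_has_derivative:
  fixes f g :: "'a::euclidean_space \<Rightarrow> complex"
  assumes "smooth f" "smooth g"
  shows "(\<lambda>p. f (fst p) * g (snd p)) differentiable (at p)"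
proof -
  have "(\<lambda>p. f (fst p)) differentiable (at p)" "(\<lambda>p::'a\<times>'a. g (snd p)) differentiable (at p)"
    using has_derivative_compose[OF has_derivative_fst[OF has_derivative_ident] smooth_has_derivative[OF assms(1)]]
      has_derivative_compose[OF has_derivative_snd[OF has_derivative_ident] smooth_has_derivative[OF assms(2)]]
    unfolding differentiable_def by blast+
  then show ?thesis by (rule differentiable_mult)
qed

lemma tensor_pderivs:
  fixes f g :: "'a::euclidean_space \<Rightarrow> complex"
  assumes "schwartz f" "schwartz g" "set bs \<subseteq> Basis"
  shows "\<exists>f' g'. schwartz f' \<and> schwartz g' \<and> pderivs bs (\<lambda>p. f (fst p) * g (snd p)) = (\<lambda>p. f' (fst p) * g' (snd p))"
  using assms(3)
proof (induction bs)
  case Nil then show ?case using assms by auto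
next
  case (Cons c bs)
  then obtain f' g' where *: "schwartz f'" "schwartz g'" "pderivs bs (\<lambda>p. f (fst p) * g (snd p)) = (\<lambda>p. f' (fst p) * g' (snd p))"
    by auto
  from Cons.prems have "c \<in> Basis" by simp
  then consider b where "b \<in> Basis" "c = (b, 0)" | b where "b \<in> Basis" "c = (0, b)"
    unfolding Basis_prod_def by blast
  then show ?case
  proof cases
    case 1
    have "partial_deriv c (\<lambda>p. f' (fst p) * g' (snd p)) p = partial_deriv b f' (fst p) * g' (snd p)" for p
    proof -
      have "partial_deriv c (\<lambda>p. f' (fst p) * g' (snd p)) (fst p, snd p) = partial_deriv b (\<lambda>x. f' x * g' (snd p)) (fst p)"
        unfolding 1(2) partial_deriv_Pair1[symmetric] by simp
      also have "\<dots> = partial_deriv b f' (fst p) * g' (snd p)"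
        by (subst partial_deriv_mult) (auto intro: smooth_differentiable schwartz_smooth *)
      finally show ?thesis by simp
    qed
    with * show ?thesis using schwartz_partial_deriv[OF *(1) 1(1)] by (intro exI[of _ "partial_deriv b f'"] exI[of _ g']) auto
  next
    case 2
    have "partial_deriv c (\<lambda>p. f' (fst p) * g' (snd p)) p = f' (fst p) * partial_deriv b g' (snd p)" for p
    proof -
      have "partial_deriv c (\<lambda>p. f' (fst p) * g' (snd p)) (fst p, snd p) = partial_deriv b (\<lambda>x. f' (fst p) * g' x) (snd p)"
        unfolding 2(2) partial_deriv_Pair2[symmetric] by simp
      also have "\<dots> = f' (fst p) * partial_deriv b g' (snd p)"
        by (subst partial_deriv_mult) (auto intro: smooth_differentiable schwartz_smooth *)
      finally show ?thesis by simp
    qed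
    with * show ?thesis using schwartz_partial_deriv[OF *(2) 2(1)] by (intro exI[of _ f'] exI[of _ "partial_deriv b g'"]) auto
  qed
qed

lemma schwartz_tensor:
  fixes f g :: "'a::euclidean_space \<Rightarrow> complex"
  assumes f: "schwartz f" and g: "schwartz g"
  shows "schwartz (\<lambda>p. f (fst p) * g (snd p))"
  unfolding schwartz_iff
proof (intro conjI allI)
  show "smooth (\<lambda>p. f (fst p) * g (snd p))"
    unfolding smooth_def
  proof (intro allI impI)
    fix bs :: "('a \<times> 'a) list" assume "set bs \<subseteq> Basis"
    from tensor_pderivs[OF f g this] obtain f' g' where *: "schwartz f'" "schwartz g'"
      "pderivs bs (\<lambda>p. f (fst p) * g (snd p)) = (\<lambda>p. f' (fst p) * g' (snd p))" by blast
    show "pderivs bs (\<lambda>p. f (fst p) * g (snd p)) differentiable_on UNIV"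
      unfolding *(3) differentiable_on_def using tensor_has_derivative[OF schwartz_smooth[OF *(1)] schwartz_smooth[OF *(2)]] by blast
  qed
  fix n :: nat and L :: real
  show "\<exists>A. derivs_le n L A (\<lambda>p. f (fst p) * g (snd p))"
  proof (rule derivs_leI)
    fix bs :: "('a \<times> 'a) list" assume "set bs \<subseteq> Basis"
    from tensor_pderivs[OF f g this] obtain f' g' where *: "schwartz f'" "schwartz g'"
      "pderivs bs (\<lambda>p. f (fst p) * g (snd p)) = (\<lambda>p. f' (fst p) * g' (snd p))" by blast
    define K where "K = - \<bar>L\<bar>"
    obtain A B where AB: "derivs_le 0 K A f'" "derivs_le 0 K B g'"
      using schwartz_derivs_le[OF *(1)] schwartz_derivs_le[OF *(2)] by meson
    have nn: "0 \<le> A" "0 \<le> B" using AB derivs_le_nonneg by blast+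
    have "norm (f' (fst p) * g' (snd p)) \<le> (A * B) * (1 + norm p) powr L" for p
    proof -
      have pos: "0 < 1 + norm p" "0 < 1 + norm (fst p)" "0 < 1 + norm (snd p)"
        using norm_ge_zero[of p] norm_ge_zero[of "fst p"] norm_ge_zero[of "snd p"] by linarith+
      have "norm p \<le> norm (fst p) + norm (snd p)" using norm_Pair_le[of "fst p" "snd p"] by simp
      moreover have "0 \<le> norm (fst p) * norm (snd p)" by simp
      moreover have "(1 + norm (fst p)) * (1 + norm (snd p)) = 1 + norm (fst p) + norm (snd p) + norm (fst p) * norm (snd p)"
        by (simp add: algebra_simps)
      ultimately have le: "1 + norm p \<le> (1 + norm (fst p)) * (1 + norm (snd p))" by linarith
      have "norm (f' (fst p) * g' (snd p)) \<le> (A * (1 + norm (fst p)) powr K) * (B * (1 + norm (snd p)) powr K)"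
        unfolding norm_mult using nn by (intro mult_mono derivs_leD[OF AB(1)] derivs_leD[OF AB(2)]) auto
      also have "\<dots> = (A * B) * ((1 + norm (fst p)) * (1 + norm (snd p))) powr K"
        by (simp add: powr_mult mult_ac)
      also have "\<dots> \<le> (A * B) * (1 + norm p) powr K"
        using le pos nn by (intro mult_left_mono powr_mono2') (auto simp: K_def)
      also have "\<dots> \<le> (A * B) * (1 + norm p) powr L"
        using nn by (intro mult_left_mono weight_mono) (auto simp: K_def)
      finally show ?thesis .
    qed
    then show "\<exists>A. \<forall>p. norm (pderivs bs (\<lambda>p. f (fst p) * g (snd p)) p) \<le> A * (1 + norm p) powr L"
      unfolding *(3) by blast
  qed
qed

text \<open>A test function that does not vanish at some point is translated and normalised there. Any
  such cut-off determines the value of the oscillatory integral uniquely.\<close>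

lemma cutoff_exists:
  fixes \<phi> :: "'a::euclidean_space \<Rightarrow> complex"
  assumes "schwartz \<phi>" "\<phi> \<noteq> (\<lambda>_. 0)"
  shows "\<exists>\<psi> :: 'a \<times> 'a \<Rightarrow> complex. schwartz \<psi> \<and> \<psi> 0 = 1"
proof -
  obtain y where y: "\<phi> y \<noteq> 0" using assms(2) by auto
  have "schwartz (\<lambda>p. inverse (\<phi> y * \<phi> y) * (\<phi> (fst p + y) * \<phi> (snd p + y)))"
    by (intro schwartz_cmult schwartz_tensor[of "\<lambda>x. \<phi> (x + y)" "\<lambda>x. \<phi> (x + y)"] schwartz_translate assms)
  with y show ?thesis by (intro exI[of _ "\<lambda>p. inverse (\<phi> y * \<phi> y) * (\<phi> (fst p + y) * \<phi> (snd p + y))"]) (simp add: field_simps)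
qed

lemma scaled_affine_has_derivative:
  fixes x :: "'a::euclidean_space"
  shows "((\<lambda>w::'a\<times>'a. (\<epsilon> *\<^sub>R (2 *\<^sub>R fst w - x), \<epsilon> *\<^sub>R snd w)) has_derivative (\<lambda>v. ((2 * \<epsilon>) *\<^sub>R fst v, \<epsilon> *\<^sub>R snd v))) (at w)"
  by (auto intro!: derivative_eq_intros)

text \<open>The cut-off \<open>\<psi> (\<epsilon> z)\<close> acts on the variable \<open>y = 2 m - x\<close>, where \<open>m\<close> is the midpoint at
  which the Weyl symbol is evaluated. Its distance to 1 is \<open>O(\<epsilon> norm w)\<close> by the mean value
  inequality, and each derivative carries a factor \<open>\<epsilon>\<close>. So it tends to 1 at the rate \<open>\<epsilon>\<close>, in
  norms with one additional power of growth.\<close>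

lemma scaled_cutoff:
  fixes \<psi> :: "'a::euclidean_space \<times> 'a \<Rightarrow> complex" and x :: 'a
  assumes \<psi>: "schwartz \<psi>" "\<psi> 0 = 1"
  shows "smooth (\<lambda>w. \<psi> (\<epsilon> *\<^sub>R (2 *\<^sub>R fst w - x), \<epsilon> *\<^sub>R snd w))"
    and "0 \<le> \<epsilon> \<Longrightarrow> \<epsilon> \<le> 1 \<Longrightarrow> symbol 0 (\<lambda>w. \<psi> (\<epsilon> *\<^sub>R (2 *\<^sub>R fst w - x), \<epsilon> *\<^sub>R snd w))"
    and "\<exists>C\<ge>0. \<forall>\<epsilon>. 0 \<le> \<epsilon> \<longrightarrow> \<epsilon> \<le> 1 \<longrightarrow> derivs_le n 1 (C * \<epsilon>) (\<lambda>w. \<psi> (\<epsilon> *\<^sub>R (2 *\<^sub>R fst w - x), \<epsilon> *\<^sub>R snd w) - 1)"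
proof -
  define T where "T \<epsilon> = (\<lambda>w::'a\<times>'a. (\<epsilon> *\<^sub>R (2 *\<^sub>R fst w - x), \<epsilon> *\<^sub>R snd w))" for \<epsilon>
  define T' where "T' \<epsilon> = (\<lambda>v::'a\<times>'a. ((2 * \<epsilon>) *\<^sub>R fst v, \<epsilon> *\<^sub>R snd v))" for \<epsilon> :: real
  define c where "c \<epsilon> b = (if snd (b::'a\<times>'a) = 0 then 2 * \<epsilon> else \<epsilon>)" for \<epsilon> :: real and b
  have T: "(T \<epsilon> has_derivative T' \<epsilon>) (at w)" for \<epsilon> w
    unfolding T_def T'_def by (rule scaled_affine_has_derivative)
  have c: "T' \<epsilon> b = c \<epsilon> b *\<^sub>R b" if "b \<in> Basis" for \<epsilon> b
    using that by (auto simp: T'_def c_def Basis_prod_def)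
  have c2: "\<bar>c \<epsilon> b\<bar> \<le> 2 * \<epsilon>" if "0 \<le> \<epsilon>" for \<epsilon> b using that by (auto simp: c_def)
  have smT: "smooth (\<lambda>w. f (T \<epsilon> w))" if "smooth f" for f \<epsilon>
    by (rule smooth_affine[OF that T c])
  show "smooth (\<lambda>w. \<psi> (\<epsilon> *\<^sub>R (2 *\<^sub>R fst w - x), \<epsilon> *\<^sub>R snd w))"
    using smT[OF schwartz_smooth[OF \<psi>(1)]] by (simp add: T_def)
  have pT: "partial_deriv b (\<lambda>w. f (T \<epsilon> w)) = (\<lambda>w. of_real (c \<epsilon> b) * partial_deriv b f (T \<epsilon> w))"
    if "smooth f" "b \<in> Basis" for f \<epsilon> b
    by (rule partial_deriv_affine_smooth[OF that(1) T c[OF that(2)]])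
  have dT: "smooth f \<Longrightarrow> derivs_le n 0 B f \<Longrightarrow> 0 \<le> \<epsilon> \<Longrightarrow> \<epsilon> \<le> 1 \<Longrightarrow> derivs_le n 0 (2 ^ n * B) (\<lambda>w. f (T \<epsilon> w))" for f n B \<epsilon>
  proof (induction n arbitrary: f)
    case 0
    have nz: "1 + norm w \<noteq> 0" for w :: "'a\<times>'a" using norm_ge_zero[of w] by linarith
    have "norm (f (T \<epsilon> w)) \<le> B" for w using derivs_leD[OF 0(2), of "T \<epsilon> w"] nz[of "T \<epsilon> w"] by simp
    then show ?case using nz by (simp del: split_paired_All)
  next
    case (Suc n)
    have nz: "1 + norm w \<noteq> 0" for w :: "'a\<times>'a" using norm_ge_zero[of w] by linarith
    have B: "0 \<le> B" using derivs_le_nonneg[OF Suc.prems(2)] .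
    have "norm (f (T \<epsilon> w)) \<le> 2 ^ Suc n * B * (1 + norm w) powr 0" for w
    proof -
      have "norm (f (T \<epsilon> w)) \<le> B" using derivs_leD[OF Suc.prems(2), of "T \<epsilon> w"] nz[of "T \<epsilon> w"] by simp
      also have "B \<le> 2 ^ Suc n * B" using B one_le_power[of "2::real" "Suc n"] by (simp add: mult_le_cancel_right1)
      finally show ?thesis using nz[of w] by simp
    qed
    moreover have "derivs_le n 0 (2 ^ Suc n * B) (partial_deriv b (\<lambda>w. f (T \<epsilon> w)))" if b: "b \<in> Basis" for b
    proof -
      have "derivs_le n 0 (norm (complex_of_real (c \<epsilon> b)) * (2 ^ n * B)) (\<lambda>w. of_real (c \<epsilon> b) * partial_deriv b f (T \<epsilon> w))"
        using Suc.prems b by (intro derivs_le_cmult smT Suc.IH smooth_partial_deriv derivs_le_partial_deriv)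
      moreover have "norm (complex_of_real (c \<epsilon> b)) * (2 ^ n * B) \<le> 2 ^ Suc n * B"
        using c2[OF Suc.prems(3), of b] Suc.prems(4) B mult_right_mono[of "\<bar>c \<epsilon> b\<bar>" 2 "2 ^ n * B"] by simp
      ultimately show ?thesis unfolding pT[OF Suc.prems(1) b] using derivs_le_weaken by blast
    qed
    ultimately show ?case unfolding derivs_le.simps by blast
  qed
  show "symbol 0 (\<lambda>w. \<psi> (\<epsilon> *\<^sub>R (2 *\<^sub>R fst w - x), \<epsilon> *\<^sub>R snd w))" if e: "0 \<le> \<epsilon>" "\<epsilon> \<le> 1"
  proof (rule symbolI)
    show "smooth (\<lambda>w. \<psi> (\<epsilon> *\<^sub>R (2 *\<^sub>R fst w - x), \<epsilon> *\<^sub>R snd w))"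
      using smT[OF schwartz_smooth[OF \<psi>(1)]] by (simp add: T_def)
    fix n
    obtain B where "derivs_le n 0 B \<psi>" using schwartz_derivs_le[OF \<psi>(1)] by blast
    from dT[OF schwartz_smooth[OF \<psi>(1)] this e]
    show "\<exists>A. derivs_le n 0 A (\<lambda>w. \<psi> (\<epsilon> *\<^sub>R (2 *\<^sub>R fst w - x), \<epsilon> *\<^sub>R snd w))" unfolding T_def by blast
  qed
  obtain B where B: "derivs_le (Suc n) 0 B \<psi>" using schwartz_derivs_le[OF \<psi>(1)] by blast
  have B0: "0 \<le> B" using derivs_le_nonneg[OF B] .
  define C where "C = real DIM('a\<times>'a) * (2 * (2 + norm x)) * B + 2 * 2 ^ n * B"
  have C0: "0 \<le> C" using B0 by (simp add: C_def)
  have "derivs_le n 1 (C * \<epsilon>) (\<lambda>w. \<psi> (T \<epsilon> w) - 1)" if e: "0 \<le> \<epsilon>" "\<epsilon> \<le> 1" for \<epsilon>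
  proof -
    have nz: "1 + norm w \<noteq> 0" for w :: "'a\<times>'a" using norm_ge_zero[of w] by linarith
    have b0: "norm (\<psi> (T \<epsilon> w) - 1) \<le> C * \<epsilon> * (1 + norm w) powr 1" for w
    proof -
      have "norm (taylor_rem 1 \<psi> 0 (1 *\<^sub>R T \<epsilon> w)) \<le> (real DIM('a\<times>'a) * norm (T \<epsilon> w)) ^ 1 * B"
      proof (rule taylor_rem_bound[OF schwartz_smooth[OF \<psi>(1)]])
        fix bs :: "('a\<times>'a) list" and t :: real assume "set bs \<subseteq> Basis" "length bs = 1"
        then have "norm (pderivs bs \<psi> (t *\<^sub>R T \<epsilon> w + 0)) \<le> B * (1 + norm (t *\<^sub>R T \<epsilon> w + 0)) powr 0"
          by (intro derivs_le_pderivs[OF B]) auto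
        then show "norm (pderivs bs \<psi> (t *\<^sub>R T \<epsilon> w + 0)) \<le> B" using nz[of "t *\<^sub>R T \<epsilon> w + 0"] by simp
      qed auto
      then have "norm (\<psi> (T \<epsilon> w) - 1) \<le> real DIM('a\<times>'a) * norm (T \<epsilon> w) * B"
        using \<psi>(2) by (simp add: taylor_rem_def)
      moreover have "norm (T \<epsilon> w) \<le> \<epsilon> * (2 * ((2 + norm x) * (1 + norm w)))"
      proof -
        have "norm (T \<epsilon> w) \<le> norm (\<epsilon> *\<^sub>R (2 *\<^sub>R fst w - x)) + norm (\<epsilon> *\<^sub>R snd w)"
          unfolding T_def by (rule norm_Pair_le)
        also have "\<dots> = \<epsilon> * (norm (2 *\<^sub>R fst w - x) + norm (snd w))" using e by (simp add: distrib_left)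
        also have "norm (2 *\<^sub>R fst w - x) \<le> 2 * norm (fst w) + norm x"
          using norm_triangle_ineq4[of "2 *\<^sub>R fst w" x] by simp
        finally have "norm (T \<epsilon> w) \<le> \<epsilon> * (2 * norm (fst w) + norm x + norm (snd w))"
          using e by (simp add: mult_left_mono)
        also have "\<dots> \<le> \<epsilon> * (3 * norm w + norm x)"
          using norm_fst_snd[of w] e by (intro mult_left_mono) auto
        also have "\<dots> \<le> \<epsilon> * (2 * ((2 + norm x) * (1 + norm w)))"
        proof (intro mult_left_mono)
          have "0 \<le> norm x * norm w" by simp
          then show "3 * norm w + norm x \<le> 2 * ((2 + norm x) * (1 + norm w))"
            using norm_ge_zero[of x] norm_ge_zero[of w] by (simp add: algebra_simps)
        qed (use e in simp)
        finally show ?thesis .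
      qed
      then have "real DIM('a\<times>'a) * norm (T \<epsilon> w) * B \<le> real DIM('a\<times>'a) * (\<epsilon> * (2 * ((2 + norm x) * (1 + norm w)))) * B"
        using B0 by (intro mult_right_mono mult_left_mono) auto
      ultimately have "norm (\<psi> (T \<epsilon> w) - 1) \<le> real DIM('a\<times>'a) * (\<epsilon> * (2 * ((2 + norm x) * (1 + norm w)))) * B"
        by linarith
      also have "\<dots> = (real DIM('a\<times>'a) * (2 * (2 + norm x)) * B) * \<epsilon> * (1 + norm w)" by (simp only: mult_ac)
      also have "\<dots> \<le> C * \<epsilon> * (1 + norm w)"
        using e B0 by (intro mult_right_mono) (simp_all add: C_def)
      finally show ?thesis by (simp add: powr_one)
    qed
    have "derivs_le k 1 (C * \<epsilon>) (partial_deriv b (\<lambda>w. \<psi> (T \<epsilon> w) - 1))" if b: "b \<in> Basis" and k: "k \<le> n" for b k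
    proof -
      have "partial_deriv b (\<lambda>w. \<psi> (T \<epsilon> w) - 1) = (\<lambda>w. of_real (c \<epsilon> b) * partial_deriv b \<psi> (T \<epsilon> w))"
        by (subst partial_deriv_diff_smooth) (simp_all add: smT schwartz_smooth \<psi> pT b)
      moreover have "derivs_le n 0 (norm (complex_of_real (c \<epsilon> b)) * (2 ^ n * B)) (\<lambda>w. of_real (c \<epsilon> b) * partial_deriv b \<psi> (T \<epsilon> w))"
        using e b B by (intro derivs_le_cmult smT dT smooth_partial_deriv schwartz_smooth \<psi>(1) derivs_le_partial_deriv)
      moreover have "norm (complex_of_real (c \<epsilon> b)) * (2 ^ n * B) \<le> C * \<epsilon>"
      proof -
        have "norm (complex_of_real (c \<epsilon> b)) * (2 ^ n * B) \<le> (2 * \<epsilon>) * (2 ^ n * B)"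
          using c2[OF e(1), of b] B0 by (intro mult_right_mono) auto
        also have "\<dots> = (2 * 2 ^ n * B) * \<epsilon>" by (simp add: mult_ac)
        also have "\<dots> \<le> C * \<epsilon>" using e B0 by (intro mult_right_mono) (simp_all add: C_def)
        finally show ?thesis .
      qed
      ultimately show ?thesis using derivs_le_weaken[of n 0 _ _ k 1 "C * \<epsilon>"] k by simp
    qed
    note pd = this
    show ?thesis
    proof (cases n)
      case 0 show ?thesis unfolding 0 derivs_le.simps by (intro allI b0)
    next
      case (Suc k)
      show ?thesis unfolding Suc derivs_le.simps by (intro conjI allI ballI b0 pd) (simp_all add: Suc)
    qed
  qed
  with C0 show "\<exists>C\<ge>0. \<forall>\<epsilon>. 0 \<le> \<epsilon> \<longrightarrow> \<epsilon> \<le> 1 \<longrightarrow> derivs_le n 1 (C * \<epsilon>) (\<lambda>w. \<psi> (\<epsilon> *\<^sub>R (2 *\<^sub>R fst w - x), \<epsilon> *\<^sub>R snd w) - 1)"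
    unfolding T_def by blast
qed

text \<open>With the cut-off the integrand is absolutely integrable, so Fubini turns the double
  integral into the iterated one, after the substitution \<open>y = x + v\<close>.\<close>

lemma regularized_integral:
  fixes a :: "'a::euclidean_space \<times> 'a \<Rightarrow> complex"
  assumes L: "0 \<le> L" and a: "symbol L a" and f: "schwartz f" and \<psi>: "schwartz \<psi>" and e: "0 < \<epsilon>" "\<epsilon> \<le> 1"
  shows "(\<integral>z. \<psi> (\<epsilon> *\<^sub>R z) * (case z of (y, \<xi>) \<Rightarrow> exp (\<i> * of_real ((x - y) \<bullet> \<xi>)) * a ((x + y) /\<^sub>R 2, \<xi>) * f y) \<partial>lborel)
    = weyl_int (\<lambda>w. \<psi> (\<epsilon> *\<^sub>R (2 *\<^sub>R fst w - x), \<epsilon> *\<^sub>R snd w) * a w) f x"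
proof -
  define F where "F = (\<lambda>(y, \<xi>). \<psi> (\<epsilon> *\<^sub>R y, \<epsilon> *\<^sub>R \<xi>) * (exp (\<i> * of_real ((x - y) \<bullet> \<xi>)) * a ((x + y) /\<^sub>R 2, \<xi>) * f y))"
  have F: "(\<lambda>z. \<psi> (\<epsilon> *\<^sub>R z) * (case z of (y, \<xi>) \<Rightarrow> exp (\<i> * of_real ((x - y) \<bullet> \<xi>)) * a ((x + y) /\<^sub>R 2, \<xi>) * f y)) = F"
    by (auto simp: F_def fun_eq_iff)
  have cont: "continuous_on UNIV F"
  proof -
    have 1: "continuous_on UNIV (\<lambda>p::'a\<times>'a. \<psi> (\<epsilon> *\<^sub>R fst p, \<epsilon> *\<^sub>R snd p))"
      by (rule continuous_on_compose2[OF smooth_continuous_on[OF schwartz_smooth[OF \<psi>], of UNIV]]) (auto intro!: continuous_intros)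
    have 2: "continuous_on UNIV (\<lambda>p::'a\<times>'a. a ((x + fst p) /\<^sub>R 2, snd p))"
      by (rule continuous_on_compose2[OF smooth_continuous_on[OF symbol_smooth[OF a], of UNIV]]) (auto intro!: continuous_intros)
    have 3: "continuous_on UNIV (\<lambda>p::'a\<times>'a. f (fst p))"
      by (rule continuous_on_compose2[OF smooth_continuous_on[OF schwartz_smooth[OF f], of UNIV]]) (auto intro!: continuous_intros)
    show ?thesis unfolding F_def case_prod_beta' by (intro continuous_intros 1 2 3)
  qed
  have Fm: "F \<in> borel_measurable borel" by (rule borel_measurable_continuous_onI[OF cont])
  define p where "p = real (2 * DIM('a \<times> 'a))"
  obtain A where A: "derivs_le 0 L A a" using symbol_derivs_le[OF a] by blast
  obtain B where B: "derivs_le 0 0 B f" using schwartz_derivs_le[OF f] by blast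
  obtain C where C: "derivs_le 0 (- (L + p)) C \<psi>" using schwartz_derivs_le[OF \<psi>] by blast
  note nn = derivs_le_nonneg[OF A] derivs_le_nonneg[OF B] derivs_le_nonneg[OF C]
  have bound: "norm (F z) \<le> (C * \<epsilon> powr (- (L + p)) * (A * (1 + norm x) powr L) * B) * (1 + norm (0 + z)) powr (- p)" for z
  proof -
    obtain y \<xi> where z: "z = (y, \<xi>)" by (cases z)
    have pos: "0 < 1 + norm z" "0 < 1 + norm x" using norm_ge_zero[of z] norm_ge_zero[of x] by linarith+
    have yn: "1 + norm y \<noteq> 0" using norm_ge_zero[of y] by linarith
    have "norm (\<psi> (\<epsilon> *\<^sub>R z)) \<le> C * (1 + norm (\<epsilon> *\<^sub>R z)) powr (- (L + p))" by (rule derivs_leD[OF C])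
    also have "\<dots> \<le> C * (\<epsilon> * (1 + norm z)) powr (- (L + p))"
    proof (intro mult_left_mono powr_mono2')
      show "0 < \<epsilon> * (1 + norm z)" using e pos by simp
      show "\<epsilon> * (1 + norm z) \<le> 1 + norm (\<epsilon> *\<^sub>R z)" using e by (simp add: distrib_left)
    qed (use nn L in \<open>auto simp: p_def\<close>)
    also have "\<dots> = C * \<epsilon> powr (- (L + p)) * (1 + norm z) powr (- (L + p))"
      using e pos by (simp add: powr_mult)
    finally have 1: "norm (\<psi> (\<epsilon> *\<^sub>R z)) \<le> C * \<epsilon> powr (- (L + p)) * (1 + norm z) powr (- (L + p))" .
    have "norm ((x + y) /\<^sub>R 2, \<xi>) \<le> norm x + norm z"
    proof -
      have "((x + y) /\<^sub>R 2, \<xi>) = (x /\<^sub>R 2, 0) + (y /\<^sub>R 2, \<xi>)" by (simp add: scaleR_add_right)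
      then have "norm ((x + y) /\<^sub>R 2, \<xi>) \<le> norm (x /\<^sub>R 2, 0::'a) + norm (y /\<^sub>R 2, \<xi>)" by (metis norm_triangle_ineq)
      moreover have "norm (x /\<^sub>R 2, 0::'a) \<le> norm x" by (simp add: norm_Pair)
      moreover have "norm (y /\<^sub>R 2, \<xi>) \<le> norm (y, \<xi>)"
        unfolding norm_Pair by (intro real_sqrt_le_mono add_right_mono power_mono) auto
      ultimately show ?thesis unfolding z by linarith
    qed
    moreover have "0 \<le> norm x * norm z" by simp
    moreover have "(1 + norm x) * (1 + norm z) = 1 + norm x + norm z + norm x * norm z" by (simp add: algebra_simps)
    ultimately have le: "1 + norm ((x + y) /\<^sub>R 2, \<xi>) \<le> (1 + norm x) * (1 + norm z)" by linarith
    have "norm (a ((x + y) /\<^sub>R 2, \<xi>)) \<le> A * (1 + norm ((x + y) /\<^sub>R 2, \<xi>)) powr L" by (rule derivs_leD[OF A])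
    also have "\<dots> \<le> A * ((1 + norm x) * (1 + norm z)) powr L"
      using le nn L by (intro mult_left_mono powr_mono2) auto
    also have "\<dots> = A * (1 + norm x) powr L * (1 + norm z) powr L" using pos by (simp add: powr_mult)
    finally have 2: "norm (a ((x + y) /\<^sub>R 2, \<xi>)) \<le> A * (1 + norm x) powr L * (1 + norm z) powr L" .
    have 3: "norm (f y) \<le> B" using derivs_leD[OF B, of y] yn by simp
    have "norm (F z) = norm (\<psi> (\<epsilon> *\<^sub>R z)) * norm (a ((x + y) /\<^sub>R 2, \<xi>)) * norm (f y)"
      by (simp add: F_def z norm_mult norm_exp_i)
    also have "\<dots> \<le> (C * \<epsilon> powr (- (L + p)) * (1 + norm z) powr (- (L + p))) * (A * (1 + norm x) powr L * (1 + norm z) powr L) * B"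
      using 1 2 3 nn by (intro mult_mono mult_nonneg_nonneg) auto
    also have "\<dots> = (C * \<epsilon> powr (- (L + p)) * (A * (1 + norm x) powr L) * B) * ((1 + norm z) powr (- (L + p)) * (1 + norm z) powr L)"
      by (simp only: mult_ac)
    also have "(1 + norm z) powr (- (L + p)) * (1 + norm z) powr L = (1 + norm (0 + z)) powr (- p)"
      by (simp add: powr_add[symmetric])
    finally show ?thesis .
  qed
  have Fi: "integrable lborel F"
    using integral_wdec_bound(1)[OF Fm, of "C * \<epsilon> powr (- (L + p)) * (A * (1 + norm x) powr L) * B" 0] bound
    unfolding p_def by blast
  have "(\<integral>z. F z \<partial>lborel) = (\<integral>z. (case z of (y, \<xi>) \<Rightarrow> F (y, \<xi>)) \<partial>(lborel \<Otimes>\<^sub>M lborel))"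
    unfolding lborel_prod by simp
  also have "\<dots> = (\<integral>\<xi>. (\<integral>y. F (y, \<xi>) \<partial>lborel) \<partial>lborel)"
    using Fi by (intro lborel_pair.integral_snd[symmetric]) (simp add: lborel_prod)
  also have "\<dots> = (\<integral>\<xi>. weyl_fibre (\<lambda>w. \<psi> (\<epsilon> *\<^sub>R (2 *\<^sub>R fst w - x), \<epsilon> *\<^sub>R snd w) * a w) f x \<xi> \<partial>lborel)"
  proof (intro Bochner_Integration.integral_cong refl)
    fix \<xi>
    have "continuous_on UNIV (\<lambda>y. F (y, \<xi>))"
      by (rule continuous_on_compose2[OF cont]) (auto intro!: continuous_intros)
    then have meas: "(\<lambda>y. F (y, \<xi>)) \<in> borel_measurable borel" by (rule borel_measurable_continuous_onI)
    have Fv: "F (x + v, \<xi>) = exp (- (\<i> * of_real (v \<bullet> \<xi>))) *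
        (\<psi> (\<epsilon> *\<^sub>R (2 *\<^sub>R fst (x + (1/2) *\<^sub>R v, \<xi>) - x), \<epsilon> *\<^sub>R snd (x + (1/2) *\<^sub>R v, \<xi>)) * a (x + (1/2) *\<^sub>R v, \<xi>)) * f (x + v)" for v
    proof -
      have h: "(x + (x + v)) /\<^sub>R 2 = x + (1/2) *\<^sub>R v"
        by (simp add: scaleR_add_right scaleR_add_left[symmetric] add.assoc[symmetric])
      have k: "2 *\<^sub>R (x + (1/2) *\<^sub>R v) - x = x + v" by (simp add: scaleR_add_right scaleR_2)
      have "exp (\<i> * complex_of_real ((x - (x + v)) \<bullet> \<xi>)) = exp (- (\<i> * of_real (v \<bullet> \<xi>)))" by simp
      then show ?thesis unfolding F_def prod.case fst_conv snd_conv h k by (simp only: mult_ac)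
    qed
    from lborel_integral_translate[OF meas, of x]
    have "(\<integral>y. F (y, \<xi>) \<partial>lborel) = (\<integral>v. F (x + v, \<xi>) \<partial>lborel)" by simp
    also have "\<dots> = weyl_fibre (\<lambda>w. \<psi> (\<epsilon> *\<^sub>R (2 *\<^sub>R fst w - x), \<epsilon> *\<^sub>R snd w) * a w) f x \<xi>"
      unfolding weyl_fibre_def Fv ..
    finally show "(\<integral>y. F (y, \<xi>) \<partial>lborel) = weyl_fibre (\<lambda>w. \<psi> (\<epsilon> *\<^sub>R (2 *\<^sub>R fst w - x), \<epsilon> *\<^sub>R snd w) * a w) f x \<xi>" .
  qed
  finally show ?thesis unfolding F weyl_int_def .
qed

text \<open>The difference is the quantization of the symbol \<open>(\<psi>\<^sub>\<epsilon> - 1) a\<close>, which has order \<open>1 + L\<close>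
  and tends to 0 like \<open>\<epsilon>\<close>.\<close>

lemma oscillatory_limit:
  fixes a :: "'a::euclidean_space \<times> 'a \<Rightarrow> complex"
  assumes L: "0 \<le> L" and a: "symbol L a" and f: "schwartz f" and \<psi>: "schwartz \<psi>" "\<psi> 0 = 1"
  shows "((\<lambda>\<epsilon>. \<integral>z. \<psi> (\<epsilon> *\<^sub>R z) * (case z of (y, \<xi>) \<Rightarrow> exp (\<i> * of_real ((x - y) \<bullet> \<xi>)) * a ((x + y) /\<^sub>R 2, \<xi>) * f y) \<partial>lborel)
    \<longlongrightarrow> weyl_int a f x) (at_right 0)"
proof -
  have L1: "0 \<le> 1 + L" using L by simp
  have a1: "symbol (1 + L) a" using a by (rule symbol_mono) simp
  define n where "n = weyl_order (1 + L) TYPE('a)"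
  obtain C where C: "0 \<le> C" "\<And>\<epsilon>. 0 \<le> \<epsilon> \<Longrightarrow> \<epsilon> \<le> 1 \<Longrightarrow> derivs_le n 1 (C * \<epsilon>) (\<lambda>w. \<psi> (\<epsilon> *\<^sub>R (2 *\<^sub>R fst w - x), \<epsilon> *\<^sub>R snd w) - 1)"
    using scaled_cutoff(3)[OF \<psi>, of n x] by blast
  obtain A where A: "derivs_le n L A a" using symbol_derivs_le[OF a] by blast
  obtain B where B: "derivs_le n (- ((1 + L) + real (2 * DIM('a)))) B f" using schwartz_derivs_le[OF f] by blast
  define K where "K = weyl_const (1 + L) TYPE('a) * wdec_const TYPE('a) * (1 + norm x) powr (1 + L)"
  let ?I = "\<lambda>\<epsilon>. \<integral>z. \<psi> (\<epsilon> *\<^sub>R z) * (case z of (y, \<xi>) \<Rightarrow> exp (\<i> * of_real ((x - y) \<bullet> \<xi>)) * a ((x + y) /\<^sub>R 2, \<xi>) * f y) \<partial>lborel"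
  have bound: "norm (?I \<epsilon> - weyl_int a f x) \<le> (K * (2 ^ n * (C * A)) * B) * \<epsilon>" if e: "0 < \<epsilon>" "\<epsilon> \<le> 1" for \<epsilon>
  proof -
    let ?s = "\<lambda>w. \<psi> (\<epsilon> *\<^sub>R (2 *\<^sub>R fst w - x), \<epsilon> *\<^sub>R snd w)"
    have s1: "symbol 0 ?s" using scaled_cutoff(2)[OF \<psi>] e by simp
    then have s: "symbol 1 (\<lambda>w. ?s w - 1)" by (intro symbol_diff symbol_const) (auto intro: symbol_mono)
    have d: "symbol (1 + L) (\<lambda>w. (?s w - 1) * a w)" by (rule symbol_mult[OF s a])
    have "?I \<epsilon> = weyl_int (\<lambda>w. ?s w * a w) f x" by (rule regularized_integral[OF L a f \<psi>(1) e])
    also have "(\<lambda>w. ?s w * a w) = (\<lambda>w. a w + (?s w - 1) * a w)" by (simp add: algebra_simps)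
    also have "weyl_int (\<lambda>w. a w + (?s w - 1) * a w) f x = weyl_int a f x + weyl_int (\<lambda>w. (?s w - 1) * a w) f x"
      by (rule weyl_int_add_left[OF L1 a1 d f])
    finally have eq: "?I \<epsilon> - weyl_int a f x = weyl_int (\<lambda>w. (?s w - 1) * a w) f x" by simp
    have "derivs_le n (1 + L) (2 ^ n * ((C * \<epsilon>) * A)) (\<lambda>w. (?s w - 1) * a w)"
      using e by (intro derivs_le_mult symbol_smooth[OF s] symbol_smooth[OF a] C(2) A) auto
    from weyl_int_basic(2)[OF L1 d f this[unfolded n_def] B[unfolded n_def], of x]
    show ?thesis unfolding eq K_def n_def by (simp add: mult_ac)
  qed
  have "((\<lambda>\<epsilon>. ?I \<epsilon> - weyl_int a f x) \<longlongrightarrow> 0) (at_right 0)"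
  proof (rule Lim_null_comparison)
    show "\<forall>\<^sub>F \<epsilon> in at_right 0. norm (?I \<epsilon> - weyl_int a f x) \<le> (K * (2 ^ n * (C * A)) * B) * \<epsilon>"
      using bound by (intro eventually_at_rightI[of 0 1]) auto
    have "((\<lambda>\<epsilon>. (K * (2 ^ n * (C * A)) * B) * \<epsilon>) \<longlongrightarrow> (K * (2 ^ n * (C * A)) * B) * 0) (at_right 0)"
      by (intro tendsto_intros)
    then show "((\<lambda>\<epsilon>. (K * (2 ^ n * (C * A)) * B) * \<epsilon>) \<longlongrightarrow> 0) (at_right 0)" by simp
  qed
  then show ?thesis by (simp add: LIM_zero_iff)
qed

lemma weyl_op_eq:
  fixes a :: "(real^'d) \<times> (real^'d) \<Rightarrow> complex" and \<phi> :: "real^'d \<Rightarrow> complex"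
  assumes L: "0 \<le> L" and a: "symbol L a" and f: "schwartz f" and \<phi>: "schwartz \<phi>" "\<phi> \<noteq> (\<lambda>_. 0)"
  shows "weyl_op a f = (\<lambda>x. of_real ((2 * pi) powr (- real CARD('d))) * weyl_int a f x)"
proof
  fix x
  let ?F = "\<lambda>(y, \<xi>). exp (\<i> * of_real ((x - y) \<bullet> \<xi>)) * a ((x + y) /\<^sub>R 2, \<xi>) * f y"
  obtain \<psi> :: "(real^'d) \<times> (real^'d) \<Rightarrow> complex" where \<psi>: "schwartz \<psi>" "\<psi> 0 = 1"
    using cutoff_exists[OF \<phi>] by blast
  have "oscillatory_integral ?F = weyl_int a f x"
    unfolding oscillatory_integral_def
  proof (rule the_equality)
    show "\<forall>\<psi>. schwartz \<psi> \<longrightarrow> \<psi> 0 = 1 \<longrightarrow> ((\<lambda>\<epsilon>. \<integral>z. \<psi> (\<epsilon> *\<^sub>R z) * ?F z \<partial>lborel) \<longlongrightarrow> weyl_int a f x) (at_right 0)"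
      using oscillatory_limit[OF L a f] by blast
    fix l assume "\<forall>\<psi>. schwartz \<psi> \<longrightarrow> \<psi> 0 = 1 \<longrightarrow> ((\<lambda>\<epsilon>. \<integral>z. \<psi> (\<epsilon> *\<^sub>R z) * ?F z \<partial>lborel) \<longlongrightarrow> l) (at_right 0)"
    then have "((\<lambda>\<epsilon>. \<integral>z. \<psi> (\<epsilon> *\<^sub>R z) * ?F z \<partial>lborel) \<longlongrightarrow> l) (at_right 0)" using \<psi> by blast
    from tendsto_unique[OF trivial_limit_at_right_real this oscillatory_limit[OF L a f \<psi>]]
    show "l = weyl_int a f x" .
  qed
  then show "weyl_op a f x = of_real ((2 * pi) powr (- real CARD('d))) * weyl_int a f x"
    unfolding weyl_op_def by simp
qed

section \<open>Time-frequency shifts\<close>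

definition phase_shift :: "(real^'d) \<times> (real^'d) \<Rightarrow> (real^'d \<Rightarrow> complex) \<Rightarrow> real^'d \<Rightarrow> complex" where
  "phase_shift z f = modulation (snd z) (translation (fst z) f)"

lemma phase_shift_apply: "phase_shift z f y = exp (\<i> * of_real (y \<bullet> snd z)) * f (y - fst z)"
  by (simp add: phase_shift_def modulation_def translation_def)

lemma phase_shift_schwartz:
  assumes "schwartz f" shows "schwartz (phase_shift z f)"
proof -
  have "phase_shift z f = (\<lambda>y. exp (\<i> * of_real (y \<bullet> snd z)) * f (y + (- fst z)))"
    by (rule ext) (simp add: phase_shift_apply)
  then show ?thesis
    using symbol_mult_schwartz[OF symbol_exp_inner[of "snd z"] schwartz_translate[OF assms, of "- fst z"]] by simp
qed

text \<open>Modulation by \<open>\<xi>\<close> loses \<open>n\<close> powers of \<open>norm \<xi>\<close> in the derivatives up to order \<open>n\<close>, and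
  translation loses \<open>\<bar>L\<bar>\<close> powers in the weight.\<close>

lemma phase_shift_derivs_le:
  fixes f :: "real^'d \<Rightarrow> complex"
  assumes f: "smooth f" and B: "derivs_le n L B f"
  shows "derivs_le n L (2 ^ n * B * (1 + norm z) powr (real n + \<bar>L\<bar>)) (phase_shift z f)"
proof -
  have eq: "phase_shift z f = (\<lambda>y. exp (\<i> * of_real (y \<bullet> snd z)) * f (y + (- fst z)))"
    by (rule ext) (simp add: phase_shift_apply)
  have "derivs_le n (0 + L) (2 ^ n * ((1 + norm (snd z)) ^ n * (B * (1 + norm (- fst z)) powr \<bar>L\<bar>))) (phase_shift z f)"
    unfolding eq using f B
    by (intro derivs_le_mult smooth_exp_inner smooth_translate derivs_le_exp_inner derivs_le_translate)
  then show ?thesis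
  proof (rule derivs_le_weaken)
    have pos: "0 < 1 + norm z" using norm_ge_zero[of z] by linarith
    have "(1 + norm (snd z)) ^ n * (B * (1 + norm (- fst z)) powr \<bar>L\<bar>) \<le> (1 + norm z) ^ n * (B * (1 + norm z) powr \<bar>L\<bar>)"
      using norm_fst_snd[of z] derivs_le_nonneg[OF B]
      by (intro mult_mono power_mono powr_mono2 mult_nonneg_nonneg) auto
    also have "\<dots> = B * (1 + norm z) powr (real n + \<bar>L\<bar>)"
      using pos by (simp add: powr_add powr_realpow)
    finally show "2 ^ n * ((1 + norm (snd z)) ^ n * (B * (1 + norm (- fst z)) powr \<bar>L\<bar>)) \<le> 2 ^ n * B * (1 + norm z) powr (real n + \<bar>L\<bar>)"
      by (simp add: mult.assoc)
  qed auto
qed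

text \<open>Covariance of the Weyl quantization, by substitution in both integrals. It holds exactly
  because the symbol is evaluated at the midpoint.\<close>

lemma weyl_int_phase_shift:
  fixes b :: "(real^'d) \<times> (real^'d) \<Rightarrow> complex"
  assumes b: "smooth b" and f: "smooth f"
  shows "weyl_int b (phase_shift z f) = phase_shift z (weyl_int (\<lambda>w. b (w + z)) f)"
proof
  fix x
  obtain x0 \<xi>0 where z: "z = (x0, \<xi>0)" by (cases z)
  let ?G = "weyl_fibre (\<lambda>w. b (w + z)) f (x - x0)"
  have *: "weyl_fibre b (phase_shift z f) x \<xi> = exp (\<i> * of_real (x \<bullet> \<xi>0)) * ?G (- \<xi>0 + \<xi>)" for \<xi>
  proof -
    have "exp (- (\<i> * of_real (v \<bullet> \<xi>))) * b (x + (1/2) *\<^sub>R v, \<xi>) * phase_shift z f (x + v)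
       = exp (\<i> * of_real (x \<bullet> \<xi>0)) * (exp (- (\<i> * of_real (v \<bullet> (- \<xi>0 + \<xi>)))) *
           b ((x - x0 + (1/2) *\<^sub>R v, - \<xi>0 + \<xi>) + z) * f (x - x0 + v))" for v
    proof -
      have h1: "exp (- (\<i> * complex_of_real (v \<bullet> \<xi>))) * exp (\<i> * of_real ((x + v) \<bullet> \<xi>0))
         = exp (\<i> * of_real (x \<bullet> \<xi>0)) * exp (- (\<i> * of_real (v \<bullet> (- \<xi>0 + \<xi>))))"
        unfolding exp_add[symmetric] by (rule arg_cong[where f=exp]) (simp add: algebra_simps)
      have h2: "(x - x0 + (1/2) *\<^sub>R v, - \<xi>0 + \<xi>) + z = (x + (1/2) *\<^sub>R v, \<xi>)" by (simp add: z)
      have h3: "phase_shift z f (x + v) = exp (\<i> * of_real ((x + v) \<bullet> \<xi>0)) * f (x - x0 + v)"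
        by (simp add: phase_shift_apply z algebra_simps)
      have gen: "E1 * E2 = c * E3 \<Longrightarrow> E1 * u * (E2 * w) = c * (E3 * u * w)" for E1 E2 E3 c u w :: complex
      proof -
        assume "E1 * E2 = c * E3"
        moreover have "E1 * u * (E2 * w) = (E1 * E2) * (u * w)" "c * (E3 * u * w) = (c * E3) * (u * w)"
          by (simp_all only: mult_ac)
        ultimately show ?thesis by simp
      qed
      show ?thesis unfolding h2 h3 by (rule gen[OF h1])
    qed
    then show ?thesis unfolding weyl_fibre_def by (simp only: integral_mult_right_zero)
  qed
  have "weyl_int b (phase_shift z f) x = exp (\<i> * of_real (x \<bullet> \<xi>0)) * (\<integral>\<xi>. ?G (- \<xi>0 + \<xi>) \<partial>lborel)"
    unfolding weyl_int_def * integral_mult_right_zero ..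
  also have "(\<integral>\<xi>. ?G (- \<xi>0 + \<xi>) \<partial>lborel) = (\<integral>\<xi>. ?G \<xi> \<partial>lborel)"
    by (rule lborel_integral_translate[OF weyl_fibre_measurable[OF smooth_translate[OF b] f]])
  finally show "weyl_int b (phase_shift z f) x = phase_shift z (weyl_int (\<lambda>w. b (w + z)) f) x"
    unfolding phase_shift_apply[of z "weyl_int (\<lambda>w. b (w + z)) f" x] by (simp only: weyl_int_def z fst_conv snd_conv)
qed

section \<open>Functionals on time-frequency shifts\<close>

lemma bounded_functionalD:
  assumes "bounded_functional v"
  shows "schwartz f \<Longrightarrow> schwartz g \<Longrightarrow> v (\<lambda>x. f x + g x) = v f + v g"
    and "schwartz f \<Longrightarrow> v (\<lambda>x. c * f x) = cnj c * v f"
  using assms unfolding bounded_functional_def by blast+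

lemma bounded_functional_sum:
  assumes v: "bounded_functional v"
  shows "(\<And>i. i \<in> I \<Longrightarrow> schwartz (f i)) \<Longrightarrow> v (\<lambda>x. \<Sum>i\<in>I. f i x) = (\<Sum>i\<in>I. v (f i))"
proof (induction I rule: infinite_finite_induct)
  case (insert i I)
  then show ?case using bounded_functionalD(1)[OF v, of "f i" "\<lambda>x. \<Sum>i\<in>I. f i x"] by (simp add: schwartz_sum)
next
  case (infinite I)
  then show ?case using bounded_functionalD(2)[OF v schwartz_zero, of 0] by simp
next
  case empty
  then show ?case using bounded_functionalD(2)[OF v schwartz_zero, of 0] by simp
qed

lemma phase_shift_add: "phase_shift z (\<lambda>x. f x + g x) = (\<lambda>x. phase_shift z f x + phase_shift z g x)"
  and phase_shift_cmult: "phase_shift z (\<lambda>x. c * f x) = (\<lambda>x. c * phase_shift z f x)"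
  by (rule ext, simp add: phase_shift_apply algebra_simps)+

text \<open>Time-frequency shifts are polynomially bounded in the weighted norms. This gives the
  polynomial a priori bound on short-time Fourier transforms.\<close>

lemma phase_shift_functional:
  fixes v :: "(real^'d \<Rightarrow> complex) \<Rightarrow> complex"
  assumes v: "bounded_functional v"
  shows "bounded_functional (\<lambda>f. v (phase_shift z f))"
    and "\<exists>N C P. 0 \<le> C \<and> 0 \<le> P \<and> (\<forall>f B z. schwartz f \<longrightarrow> derivs_le N (- real N) B f \<longrightarrow>
       norm (v (phase_shift z f)) \<le> C * B * (1 + norm z) powr P)"
proof -
  obtain N C where C: "0 \<le> C" "\<And>f B. schwartz f \<Longrightarrow> derivs_le N (- real N) B f \<Longrightarrow> norm (v f) \<le> C * B"
    using v unfolding bounded_functional_def by blast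
  have bound: "norm (v (phase_shift z f)) \<le> (C * 2 ^ N) * B * (1 + norm z) powr (real N + \<bar>- real N\<bar>)"
    if "schwartz f" "derivs_le N (- real N) B f" for f B z
    using C(2)[OF phase_shift_schwartz[OF that(1)] phase_shift_derivs_le[OF schwartz_smooth[OF that(1)] that(2)], of z]
    by (simp add: mult_ac)
  show "\<exists>N C P. 0 \<le> C \<and> 0 \<le> P \<and> (\<forall>f B z. schwartz f \<longrightarrow> derivs_le N (- real N) B f \<longrightarrow>
       norm (v (phase_shift z f)) \<le> C * B * (1 + norm z) powr P)"
    using bound C(1) by (intro exI[of _ N] exI[of _ "C * 2 ^ N"] exI[of _ "real N + \<bar>- real N\<bar>"] conjI allI impI) auto
  show "bounded_functional (\<lambda>f. v (phase_shift z f))"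
    unfolding bounded_functional_def
  proof (intro conjI allI impI)
    fix f g :: "real^'d \<Rightarrow> complex" assume "schwartz f" "schwartz g"
    then show "v (phase_shift z (\<lambda>x. f x + g x)) = v (phase_shift z f) + v (phase_shift z g)"
      unfolding phase_shift_add by (intro bounded_functionalD(1)[OF v] phase_shift_schwartz)
  next
    fix c and f :: "real^'d \<Rightarrow> complex" assume "schwartz f"
    then show "v (phase_shift z (\<lambda>x. c * f x)) = cnj c * v (phase_shift z f)"
      unfolding phase_shift_cmult by (intro bounded_functionalD(2)[OF v] phase_shift_schwartz)
  next
    show "\<exists>N C. 0 \<le> C \<and> (\<forall>f B. schwartz f \<longrightarrow> derivs_le N (- real N) B f \<longrightarrow> norm (v (phase_shift z f)) \<le> C * B)"
    proof (intro exI[of _ N] exI[of _ "(C * 2 ^ N) * (1 + norm z) powr (real N + \<bar>- real N\<bar>)"] conjI allI impI)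
      show "0 \<le> (C * 2 ^ N) * (1 + norm z) powr (real N + \<bar>- real N\<bar>)" using C(1) by simp
      fix f :: "real^'d \<Rightarrow> complex" and B assume "schwartz f" "derivs_le N (- real N) B f"
      from bound[OF this, of z]
      show "norm (v (phase_shift z f)) \<le> (C * 2 ^ N) * (1 + norm z) powr (real N + \<bar>- real N\<bar>) * B"
        by (simp add: mult_ac)
    qed
  qed
qed

lemma weyl_dist_bounded_functional:
  fixes a :: "(real^'d) \<times> (real^'d) \<Rightarrow> complex" and \<phi> :: "real^'d \<Rightarrow> complex"
  assumes L: "0 \<le> L" and a: "symbol L a" and u: "bounded_functional u" and \<phi>: "schwartz \<phi>" "\<phi> \<noteq> (\<lambda>_. 0)"
  shows "bounded_functional (weyl_dist a u)"
proof -
  let ?b = "\<lambda>z. cnj (a z)"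
  let ?c = "complex_of_real ((2 * pi) powr (- real CARD('d)))"
  have b: "symbol L ?b" using a by (rule symbol_cnj)
  have op: "weyl_op ?b f = (\<lambda>x. ?c * weyl_int ?b f x)" if "schwartz f" for f
    by (rule weyl_op_eq[OF L b that \<phi>])
  have sc: "schwartz (weyl_int ?b f)" if "schwartz f" for f by (rule schwartz_weyl_int[OF L b that])
  have eq: "weyl_dist a u f = cnj ?c * u (weyl_int ?b f)" if "schwartz f" for f
    unfolding weyl_dist_def op[OF that] by (rule bounded_functionalD(2)[OF u sc[OF that]])
  obtain N C where C: "0 \<le> C" "\<And>f B. schwartz f \<Longrightarrow> derivs_le N (- real N) B f \<Longrightarrow> norm (u f) \<le> C * B"
    using u unfolding bounded_functional_def by blast
  obtain N' C' where C': "0 \<le> C'" "\<And>(b :: (real^'d) \<times> (real^'d) \<Rightarrow> complex) f A B. symbol L b \<Longrightarrow> schwartz f \<Longrightarrow> derivs_le N' L A b \<Longrightarrow>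
     derivs_le N' (- real N') B f \<Longrightarrow> derivs_le N (- real N) (C' * A * B) (weyl_int b f)"
    using weyl_int_derivs_le[OF L, of N N, where 'a="real^'d"] by blast
  obtain A where A: "derivs_le N' L A ?b" using symbol_derivs_le[OF b] by blast
  show ?thesis
    unfolding bounded_functional_def
  proof (intro conjI allI impI)
    fix f g :: "real^'d \<Rightarrow> complex" assume f: "schwartz f" and g: "schwartz g"
    have "weyl_int ?b (\<lambda>x. f x + g x) = (\<lambda>x. weyl_int ?b f x + weyl_int ?b g x)"
      by (rule ext, rule weyl_int_add_right[OF L b f g])
    then show "weyl_dist a u (\<lambda>x. f x + g x) = weyl_dist a u f + weyl_dist a u g"
      unfolding eq[OF f] eq[OF g] eq[OF schwartz_add[OF f g]]
      using bounded_functionalD(1)[OF u sc[OF f] sc[OF g]] by (simp add: distrib_left)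
  next
    fix c and f :: "real^'d \<Rightarrow> complex" assume f: "schwartz f"
    have "weyl_int ?b (\<lambda>x. c * f x) = (\<lambda>x. c * weyl_int ?b f x)"
      by (rule ext, rule weyl_int_cmult_right[OF L])
    then show "weyl_dist a u (\<lambda>x. c * f x) = cnj c * weyl_dist a u f"
      unfolding eq[OF f] eq[OF schwartz_cmult[OF f]]
      using bounded_functionalD(2)[OF u sc[OF f], of c] by simp
  next
    show "\<exists>N C. 0 \<le> C \<and> (\<forall>f B. schwartz f \<longrightarrow> derivs_le N (- real N) B f \<longrightarrow> norm (weyl_dist a u f) \<le> C * B)"
    proof (intro exI[of _ N'] exI[of _ "norm ?c * (C * (C' * A))"] conjI allI impI)
      show "0 \<le> norm ?c * (C * (C' * A))" using C(1) C'(1) derivs_le_nonneg[OF A] by simp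
      fix f :: "real^'d \<Rightarrow> complex" and B assume f: "schwartz f" and B: "derivs_le N' (- real N') B f"
      have "norm (u (weyl_int ?b f)) \<le> C * (C' * A * B)"
        by (rule C(2)[OF sc[OF f] C'(2)[OF b f A B]])
      then have "norm ?c * norm (u (weyl_int ?b f)) \<le> norm ?c * (C * (C' * A * B))" by (rule mult_left_mono) simp
      then show "norm (weyl_dist a u f) \<le> norm ?c * (C * (C' * A)) * B"
        unfolding eq[OF f] norm_mult complex_mod_cnj by (simp only: mult_ac)
    qed
  qed
qed

section \<open>Rapid decay along anisotropic dilations\<close>

definition dilate :: "real \<Rightarrow> real \<Rightarrow> (real^'d) \<times> (real^'d) \<Rightarrow> (real^'d) \<times> (real^'d)" where
  "dilate s t z = (t *\<^sub>R fst z, t powr s *\<^sub>R snd z)"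

text \<open>The condition on \<open>U\<close> in the definition of the wave front set, with the window \<open>\<psi>\<close> and
  restricted to \<open>t \<ge> 1\<close>; the values for \<open>t < 1\<close> are bounded for every tempered distribution.\<close>

definition rapid_decay :: "real \<Rightarrow> ((real^'d \<Rightarrow> complex) \<Rightarrow> complex) \<Rightarrow> (real^'d \<Rightarrow> complex) \<Rightarrow> ((real^'d) \<times> (real^'d)) set \<Rightarrow> bool" where
  "rapid_decay s v \<psi> U \<longleftrightarrow> (\<forall>N::nat. \<exists>B. \<forall>z\<in>U. \<forall>t\<ge>1. norm (v (phase_shift (dilate s t z) \<psi>)) \<le> B * t powr (- real N))"

lemma dilate_bound:
  assumes s: "0 < s" and t: "1 \<le> t"
  shows "1 + norm (dilate s t z) \<le> (1 + 2 * norm z) * t powr max 1 s"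
proof -
  have tk: "1 \<le> t powr max 1 s" "t \<le> t powr max 1 s" "t powr s \<le> t powr max 1 s"
    using t powr_mono[of 1 "max 1 s" t] by (auto intro!: ge_one_powr_ge_zero powr_mono)
  have "norm (dilate s t z) \<le> norm (t *\<^sub>R fst z) + norm (t powr s *\<^sub>R snd z)"
    unfolding dilate_def by (rule norm_Pair_le)
  also have "\<dots> = t * norm (fst z) + t powr s * norm (snd z)" using t by simp
  also have "\<dots> \<le> t powr max 1 s * norm z + t powr max 1 s * norm z"
    using tk t norm_fst_snd[of z] by (intro add_mono mult_mono) auto
  finally show ?thesis using tk by (simp add: algebra_simps)
qed

lemma dilate_weight_bound:
  assumes s: "0 < s" and t: "1 \<le> t" and z: "z \<in> ball z0 r" "r \<le> 1" and P: "0 \<le> P"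
  shows "(1 + norm (dilate s t z)) powr P \<le> (1 + 2 * (norm z0 + 1)) powr P * t powr (max 1 s * P)"
proof -
  have "norm z \<le> norm z0 + norm (z0 - z)" using norm_triangle_ineq4[of z0 "z0 - z"] by simp
  moreover have "norm (z0 - z) < 1" using z by (simp add: dist_norm)
  ultimately have "(1 + 2 * norm z) * t powr max 1 s \<le> (1 + 2 * (norm z0 + 1)) * t powr max 1 s"
    by (intro mult_right_mono) auto
  then have "1 + norm (dilate s t z) \<le> (1 + 2 * (norm z0 + 1)) * t powr max 1 s"
    using dilate_bound[OF s t, of z] by linarith
  then have "(1 + norm (dilate s t z)) powr P \<le> ((1 + 2 * (norm z0 + 1)) * t powr max 1 s) powr P"
    using P by (intro powr_mono2) auto
  also have "\<dots> = (1 + 2 * (norm z0 + 1)) powr P * t powr (max 1 s * P)" by (simp add: powr_mult powr_powr)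
  finally show ?thesis .
qed

text \<open>The terms of the Taylor expansion replace the window by other functions, obtained from it
  by differentiation and multiplication with coordinates. Bounds have to be proved for all of
  them together.\<close>

inductive window_class :: "(real^'d \<Rightarrow> complex) \<Rightarrow> (real^'d \<Rightarrow> complex) \<Rightarrow> bool" for \<phi> where
  base: "window_class \<phi> \<phi>"
| add: "window_class \<phi> f \<Longrightarrow> window_class \<phi> g \<Longrightarrow> window_class \<phi> (\<lambda>x. f x + g x)"
| cmult: "window_class \<phi> f \<Longrightarrow> window_class \<phi> (\<lambda>x. c * f x)"
| deriv: "window_class \<phi> f \<Longrightarrow> e \<in> Basis \<Longrightarrow> window_class \<phi> (partial_deriv e f)"
| coord: "window_class \<phi> f \<Longrightarrow> e \<in> Basis \<Longrightarrow> window_class \<phi> (\<lambda>y. of_real (y \<bullet> e) * f y)"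

lemma window_class_schwartz: "window_class \<phi> f \<Longrightarrow> schwartz \<phi> \<Longrightarrow> schwartz f"
  by (induction rule: window_class.induct)
     (simp_all add: schwartz_add schwartz_cmult schwartz_partial_deriv schwartz_inner_mult)

primrec monomial :: "'a::euclidean_space list \<Rightarrow> 'a \<Rightarrow> complex" where
  "monomial [] w = 1"
| "monomial (b # bs) w = of_real (w \<bullet> b) * monomial bs w"

lemma monomial_symbol: "set bs \<subseteq> Basis \<Longrightarrow> symbol (real (length bs)) (monomial bs)"
proof (induction bs)
  case Nil
  have "monomial [] = (\<lambda>w. 1)" by (rule ext) simp
  then show ?case by (simp add: symbol_const)
next
  case (Cons b bs)
  have "monomial (b # bs) = (\<lambda>w. of_real (w \<bullet> b) * monomial bs w)" by (rule ext) simp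
  then show ?case using symbol_mult[OF symbol_inner[of b] Cons.IH] Cons.prems by simp
qed

text \<open>A coordinate in the symbol is a symmetrised product with multiplication by a coordinate or
  with a derivative. Hence the Weyl operator of a monomial is a differential operator with
  polynomial coefficients, and the one of the constant 1 is a multiple of the identity.\<close>

lemma window_class_weyl:
  fixes \<phi> :: "real^'d \<Rightarrow> complex"
  assumes \<phi>: "schwartz \<phi>" and bs: "set bs \<subseteq> Basis"
  shows "window_class \<phi> f \<Longrightarrow> window_class \<phi> (weyl_int (monomial bs) f)"
  using bs
proof (induction bs arbitrary: f)
  case Nil
  have m: "monomial [] = (\<lambda>w :: (real^'d) \<times> (real^'d). 1)" by (rule ext) simp
  have W: "weyl_int (monomial []) f = (\<lambda>x. of_real ((2 * pi) ^ DIM(real^'d)) * f x)"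
    unfolding m by (rule ext, rule weyl_int_one[OF window_class_schwartz[OF Nil.prems(1) \<phi>]])
  show ?case unfolding W by (rule window_class.cmult[OF Nil.prems(1)])
next
  case (Cons c bs)
  have f: "schwartz f" by (rule window_class_schwartz[OF Cons.prems(1) \<phi>])
  have m: "symbol (real (length bs)) (monomial bs)" using Cons.prems by (intro monomial_symbol) simp
  have eq: "monomial (c # bs) = (\<lambda>w. of_real (w \<bullet> c) * monomial bs w)" by (rule ext) simp
  have W: "window_class \<phi> (weyl_int (monomial bs) f)" using Cons by simp
  from Cons.prems have "c \<in> Basis" by simp
  then consider e where "e \<in> Basis" "c = (e, 0)" | e where "e \<in> Basis" "c = (0, e)"
    unfolding Basis_prod_def by blast
  then show ?case
  proof cases
    case 1
    have "weyl_int (monomial (c # bs)) f = (\<lambda>x. of_real (1/2) * (of_real (x \<bullet> e) * weyl_int (monomial bs) f x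
        + weyl_int (monomial bs) (\<lambda>y. of_real (y \<bullet> e) * f y) x))"
      unfolding 1(2) eq[unfolded 1(2)] by (rule ext, rule weyl_int_position_symbol[OF _ m f 1(1)]) simp
    moreover have "window_class \<phi> (weyl_int (monomial bs) (\<lambda>y. of_real (y \<bullet> e) * f y))"
      using Cons.prems by (intro Cons.IH window_class.coord 1(1)) auto
    ultimately show ?thesis using W 1(1) by (simp only:) (intro window_class.cmult window_class.add window_class.coord)
  next
    case 2
    have "weyl_int (monomial (c # bs)) f = (\<lambda>x. - \<i> * of_real (1/2) * (partial_deriv e (weyl_int (monomial bs) f) x
        + weyl_int (monomial bs) (partial_deriv e f) x))"
      unfolding 2(2) eq[unfolded 2(2)] by (rule ext, rule weyl_int_frequency_symbol[OF _ m f 2(1)]) simp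
    moreover have "window_class \<phi> (weyl_int (monomial bs) (partial_deriv e f))"
      using Cons.prems by (intro Cons.IH window_class.deriv 2(1)) auto
    ultimately show ?thesis using W 2(1) by (simp only:) (intro window_class.cmult window_class.add window_class.deriv)
  qed
qed

text \<open>Here \<open>\<psi>'\<close> is a derivative or a coordinate multiple of \<open>\<psi>\<close>. Up to the error \<open>\<rho> h\<close>, which is
  quadratic in \<open>h\<close>, \<open>h \<psi>'\<close> is the difference of \<open>\<psi>\<close> and its shift by \<open>h E\<close>. Division by \<open>h\<close>
  leaves an error of size \<open>h\<close> times a power \<open>t powr Q\<close> from the growth of \<open>v\<close>. The step \<open>h\<close> is
  therefore taken to be a high negative power of \<open>t\<close>; the rapid decay of \<open>v\<close> at \<open>\<psi>\<close> survives
  division by it. The shift leaves the ball of radius \<open>r\<close>, but not a slightly larger one.\<close>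

lemma rapid_decay_difference_quotient:
  fixes v :: "(real^'d \<Rightarrow> complex) \<Rightarrow> complex" and E z0 :: "(real^'d) \<times> (real^'d)"
  assumes v: "bounded_functional v" and s: "0 < s"
    and \<rho>: "\<And>h. schwartz (\<rho> h)"
    and \<rho>b: "\<And>n. \<exists>C\<ge>0. \<forall>h. 0 < h \<longrightarrow> h \<le> 1 \<longrightarrow> derivs_le n (- real n) (C * h\<^sup>2) (\<rho> h)"
    and E: "norm E \<le> 1"
    and ineq: "\<And>h z. 0 < h \<Longrightarrow> h * norm (v (phase_shift z \<psi>')) \<le> norm (v (phase_shift z (\<rho> h)))
        + norm (v (phase_shift (z + h *\<^sub>R E) \<psi>)) + norm (v (phase_shift z \<psi>))"
    and dec: "\<And>r. r < r0 \<Longrightarrow> rapid_decay s v \<psi> (ball z0 r)"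
    and r0: "r0 \<le> 1" and r: "r < r0"
  shows "rapid_decay s v \<psi>' (ball z0 r)"
proof (cases "0 < r")
  case False
  then have e: "ball z0 r = {}" by simp
  show ?thesis unfolding rapid_decay_def e by simp
next
  case True
  define r' where "r' = (r + r0) / 2"
  define \<delta> where "\<delta> = (r0 - r) / 2"
  have \<delta>: "0 < \<delta>" "\<delta> \<le> 1" "r + \<delta> = r'" "r' < r0" "r \<le> r'" using r r0 True by (auto simp: \<delta>_def r'_def field_simps)
  obtain N0 C0 P where P: "0 \<le> C0" "0 \<le> P" "\<And>f B z. schwartz f \<Longrightarrow> derivs_le N0 (- real N0) B f \<Longrightarrow>
       norm (v (phase_shift z f)) \<le> C0 * B * (1 + norm z) powr P"
    using phase_shift_functional(2)[OF v] by blast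
  obtain C where C: "0 \<le> C" "\<And>h. 0 < h \<Longrightarrow> h \<le> 1 \<Longrightarrow> derivs_le N0 (- real N0) (C * h\<^sup>2) (\<rho> h)"
    using \<rho>b by blast
  define D where "D = 1 + 2 * (norm z0 + 1)"
  define Q where "Q = max 1 s * P"
  define K where "K = C0 * C * D powr P"
  have K: "0 \<le> K" using P C by (simp add: K_def)
  show ?thesis
    unfolding rapid_decay_def
  proof
    fix N :: nat
    define q where "q = N + nat \<lceil>Q\<rceil>"
    have q: "Q - real q \<le> - real N" unfolding q_def by linarith
    obtain B where B: "\<And>z t. z \<in> ball z0 r' \<Longrightarrow> 1 \<le> t \<Longrightarrow> norm (v (phase_shift (dilate s t z) \<psi>)) \<le> B * t powr (- real (N + q))"
      using dec[OF \<delta>(4)] unfolding rapid_decay_def by blast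
    have "norm (v (phase_shift (dilate s t z) \<psi>')) \<le> (K * \<delta> + 2 * B / \<delta>) * t powr (- real N)"
      if z: "z \<in> ball z0 r" and t: "1 \<le> t" for z t
    proof -
      have t0: "0 < t" using t by simp
      \<comment> \<open>The factor \<open>\<delta>\<close> keeps the shifted point in the ball of radius \<open>r'\<close>.\<close>
      define h where "h = \<delta> * t powr (- real q)"
      have tq: "t powr (- real q) \<le> 1" using t powr_mono[of "- real q" 0 t] by simp
      have h: "0 < h" "h \<le> \<delta>" using \<delta> t0 tq by (auto simp: h_def mult_left_le)
      have h1: "h \<le> 1" using h \<delta> by linarith
      let ?Z = "dilate s t z"
      have Zb: "(1 + norm ?Z) powr P \<le> D powr P * t powr Q"
        using dilate_weight_bound[OF s t z _ P(2)] r r0 by (simp add: D_def Q_def)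
      have 1: "norm (v (phase_shift ?Z (\<rho> h))) \<le> K * h\<^sup>2 * t powr Q"
      proof -
        have "norm (v (phase_shift ?Z (\<rho> h))) \<le> C0 * (C * h\<^sup>2) * (1 + norm ?Z) powr P"
          by (rule P(3)[OF \<rho> C(2)[OF h(1) h1]])
        also have "\<dots> \<le> C0 * (C * h\<^sup>2) * (D powr P * t powr Q)"
          using Zb P C by (intro mult_left_mono) auto
        finally show ?thesis by (simp add: K_def mult_ac)
      qed
      have 2: "norm (v (phase_shift (?Z + h *\<^sub>R E) \<psi>)) \<le> B * t powr (- real (N + q))"
      proof -
        \<comment> \<open>Since \<open>t \<ge> 1\<close>, undoing the dilation does not enlarge the shift.\<close>
        define z' where "z' = z + ((h / t) *\<^sub>R fst E, (h / t powr s) *\<^sub>R snd E)"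
        have "?Z + h *\<^sub>R E = dilate s t z'"
          using t0 by (cases E) (simp add: dilate_def z'_def scaleR_add_right)
        moreover have "norm ((h / t) *\<^sub>R fst E, (h / t powr s) *\<^sub>R snd E) \<le> norm (h *\<^sub>R fst E, h *\<^sub>R snd E)"
        proof -
          have a: "h / t \<le> h" using h t by (simp add: divide_le_eq mult_le_cancel_left1)
          have "1 \<le> t powr s" using t s by (intro ge_one_powr_ge_zero) auto
          then have b: "h / t powr s \<le> h" using h by (simp add: divide_le_eq mult_le_cancel_left1)
          show ?thesis unfolding norm_Pair norm_scaleR
            using a b h t0 by (intro real_sqrt_le_mono add_mono power_mono mult_right_mono) auto
        qed
        moreover have "norm (h *\<^sub>R fst E, h *\<^sub>R snd E) = h * norm E"
        proof -
          have "(h *\<^sub>R fst E, h *\<^sub>R snd E) = h *\<^sub>R E" by (cases E) simp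
          then show ?thesis using h by simp
        qed
        moreover have "h * norm E \<le> \<delta>" using h E mult_mono[of h \<delta> "norm E" 1] \<delta> by simp
        ultimately have eq: "?Z + h *\<^sub>R E = dilate s t z'" and "norm (z' - z) \<le> \<delta>"
          by (simp_all add: z'_def)
        then have "dist z0 z' < r'"
          using z dist_triangle[of z0 z' z] \<delta>(3) by (simp add: dist_norm norm_minus_commute)
        then show ?thesis unfolding eq using B[of z' t] t by simp
      qed
      have 3: "norm (v (phase_shift ?Z \<psi>)) \<le> B * t powr (- real (N + q))"
        using B[of z t] z t \<delta>(5) by simp
      have "h * norm (v (phase_shift ?Z \<psi>')) \<le> K * h\<^sup>2 * t powr Q + 2 * B * t powr (- real (N + q))"
        using ineq[OF h(1), of ?Z] 1 2 3 by linarith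
      also have "2 * B * t powr (- real (N + q)) = h * (2 * B / \<delta> * t powr (- real N))"
        using \<delta>(1) by (simp add: h_def powr_add[symmetric] add.commute mult_ac)
      finally have "h * norm (v (phase_shift ?Z \<psi>')) \<le> h * (K * h * t powr Q + 2 * B / \<delta> * t powr (- real N))"
        by (simp add: algebra_simps power2_eq_square)
      then have 4: "norm (v (phase_shift ?Z \<psi>')) \<le> K * h * t powr Q + 2 * B / \<delta> * t powr (- real N)"
        using h(1) by (simp add: mult_le_cancel_left_pos)
      have "K * h * t powr Q = K * \<delta> * t powr (Q - real q)"
        by (simp add: h_def powr_diff powr_minus field_simps)
      also have "\<dots> \<le> K * \<delta> * t powr (- real N)"
        using K \<delta> t q by (intro mult_left_mono powr_mono) auto
      finally show ?thesis using 4 by (simp add: distrib_right)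
    qed
    then show "\<exists>B. \<forall>z\<in>ball z0 r. \<forall>t\<ge>1. norm (v (phase_shift (dilate s t z) \<psi>')) \<le> B * t powr (- real N)" by blast
  qed
qed

text \<open>A difference quotient for the derivative compares time-frequency shifts by \<open>z\<close> and by \<open>z +
  h (e, 0)\<close>.\<close>

lemma rapid_decay_partial_deriv:
  fixes v :: "(real^'d \<Rightarrow> complex) \<Rightarrow> complex"
  assumes v: "bounded_functional v" and s: "0 < s" and \<psi>: "schwartz \<psi>" and e: "e \<in> Basis"
    and dec: "\<And>r. r < r0 \<Longrightarrow> rapid_decay s v \<psi> (ball z0 r)" and r0: "r0 \<le> 1" "r < r0"
  shows "rapid_decay s v (partial_deriv e \<psi>) (ball z0 r)"
proof -
  define \<rho> where "\<rho> h = (\<lambda>y. (\<psi> (y + - (h *\<^sub>R e)) - \<psi> y) + of_real h * partial_deriv e \<psi> y)" for h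
  have d\<psi>: "schwartz (partial_deriv e \<psi>)" by (rule schwartz_partial_deriv[OF \<psi> e])
  show ?thesis
  proof (rule rapid_decay_difference_quotient[OF v s _ _ _ _ dec r0, where \<rho>=\<rho> and E="(e, 0)"])
    show "schwartz (\<rho> h)" for h
      unfolding \<rho>_def by (intro schwartz_add schwartz_diff schwartz_translate schwartz_cmult \<psi> d\<psi>)
    show "\<exists>C\<ge>0. \<forall>h. 0 < h \<longrightarrow> h \<le> 1 \<longrightarrow> derivs_le n (- real n) (C * h\<^sup>2) (\<rho> h)" for n
    proof -
      obtain A where A: "derivs_le (n + 2) (- real n) A \<psi>" using schwartz_derivs_le[OF \<psi>] by blast
      let ?C = "(real DIM(real^'d))\<^sup>2 * 2 powr \<bar>- real n\<bar> * A"
      have "derivs_le n (- real n) (?C * h\<^sup>2) (\<rho> h)" if h: "0 < h" "h \<le> 1" for h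
      proof -
        have "(\<Sum>b\<in>Basis. complex_of_real ((- (h *\<^sub>R e)) \<bullet> b) * partial_deriv b \<psi> y) = - of_real h * partial_deriv e \<psi> y" for y
        proof -
          have "(\<Sum>b\<in>Basis. complex_of_real ((- (h *\<^sub>R e)) \<bullet> b) * partial_deriv b \<psi> y)
            = (\<Sum>b\<in>Basis. if b = e then - of_real h * partial_deriv b \<psi> y else 0)"
            using e by (intro sum.cong) (auto simp: inner_Basis)
          then show ?thesis using e by simp
        qed
        then have "(\<lambda>y. \<psi> (y + - (h *\<^sub>R e)) - \<psi> y - (\<Sum>b\<in>Basis. complex_of_real ((- (h *\<^sub>R e)) \<bullet> b) * partial_deriv b \<psi> y)) = \<rho> h"
          unfolding \<rho>_def by (intro ext) simp
        then show ?thesis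
          using derivs_le_translate_expansion[OF schwartz_smooth[OF \<psi>] A, of "- (h *\<^sub>R e)"] h e by simp
      qed
      moreover have "0 \<le> ?C" using derivs_le_nonneg[OF A] by simp
      ultimately show ?thesis by blast
    qed
    show "norm (e, 0::real^'d) \<le> 1" using e by (simp add: norm_Pair)
    fix h :: real and z :: "(real^'d) \<times> (real^'d)" assume h: "0 < h"
    note l = phase_shift_functional(1)[OF v, of z]
    let ?l = "\<lambda>f. v (phase_shift z f)"
    have "phase_shift z (\<lambda>y. \<psi> (y + - (h *\<^sub>R e))) = phase_shift (z + h *\<^sub>R (e, 0)) \<psi>"
      by (rule ext) (simp add: phase_shift_apply algebra_simps)
    then have 1: "?l (\<lambda>y. \<psi> (y + - (h *\<^sub>R e))) = v (phase_shift (z + h *\<^sub>R (e, 0)) \<psi>)" by simp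
    have eq: "(\<lambda>y. of_real h * partial_deriv e \<psi> y) = (\<lambda>y. \<rho> h y + (\<psi> y + (-1) * \<psi> (y + - (h *\<^sub>R e))))"
      by (rule ext) (simp add: \<rho>_def)
    have sc: "schwartz (\<rho> h)" "schwartz (\<lambda>y. (-1) * \<psi> (y + - (h *\<^sub>R e)))" "schwartz (\<lambda>y. \<psi> (y + - (h *\<^sub>R e)))"
      unfolding \<rho>_def by (intro schwartz_add schwartz_diff schwartz_translate schwartz_cmult \<psi> d\<psi>)+
    have "of_real h * ?l (partial_deriv e \<psi>) = ?l (\<lambda>y. of_real h * partial_deriv e \<psi> y)"
      using bounded_functionalD(2)[OF l d\<psi>, of "of_real h"] by simp
    also have "\<dots> = ?l (\<rho> h) + (?l \<psi> + ?l (\<lambda>y. (-1) * \<psi> (y + - (h *\<^sub>R e))))"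
      unfolding eq bounded_functionalD(1)[OF l sc(1) schwartz_add[OF \<psi> sc(2)]] bounded_functionalD(1)[OF l \<psi> sc(2)] ..
    also have "?l (\<lambda>y. (-1) * \<psi> (y + - (h *\<^sub>R e))) = - v (phase_shift (z + h *\<^sub>R (e, 0)) \<psi>)"
      using bounded_functionalD(2)[OF l sc(3), of "-1"] 1 by simp
    finally have "norm (of_real h * ?l (partial_deriv e \<psi>)) = norm (?l (\<rho> h) + (?l \<psi> + - v (phase_shift (z + h *\<^sub>R (e, 0)) \<psi>)))" by simp
    also have "\<dots> \<le> norm (?l (\<rho> h)) + (norm (?l \<psi>) + norm (v (phase_shift (z + h *\<^sub>R (e, 0)) \<psi>)))"
      using norm_triangle_ineq[of "?l (\<rho> h)" "?l \<psi> + - v (phase_shift (z + h *\<^sub>R (e, 0)) \<psi>)"]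
        norm_triangle_ineq[of "?l \<psi>" "- v (phase_shift (z + h *\<^sub>R (e, 0)) \<psi>)"] by simp
    finally show "h * norm (v (phase_shift z (partial_deriv e \<psi>))) \<le> norm (v (phase_shift z (\<rho> h)))
        + norm (v (phase_shift (z + h *\<^sub>R (e, 0)) \<psi>)) + norm (v (phase_shift z \<psi>))"
      using h by (simp add: norm_mult)
  qed
qed

text \<open>A modulation by \<open>h e\<close> is \<open>1 + \<i> h (y \<bullet> e)\<close> to first order. It turns the shift by \<open>z\<close> into
  the one by \<open>z + h (0, e)\<close> times a phase, which disappears in norms.\<close>

lemma rapid_decay_coordinate:
  fixes v :: "(real^'d \<Rightarrow> complex) \<Rightarrow> complex"
  assumes v: "bounded_functional v" and s: "0 < s" and \<psi>: "schwartz \<psi>" and e: "e \<in> Basis"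
    and dec: "\<And>r. r < r0 \<Longrightarrow> rapid_decay s v \<psi> (ball z0 r)" and r0: "r0 \<le> 1" "r < r0"
  shows "rapid_decay s v (\<lambda>y. of_real (y \<bullet> e) * \<psi> y) (ball z0 r)"
proof -
  let ?m = "\<lambda>h y. exp (\<i> * of_real (y \<bullet> ((h * 1) *\<^sub>R e))) * \<psi> y"
  define \<rho> where "\<rho> h = (\<lambda>y. ?m h y - \<psi> y - of_real h * (\<i> * of_real 1 * (of_real (y \<bullet> e) * \<psi> y)))" for h
  have y\<psi>: "schwartz (\<lambda>y. of_real (y \<bullet> e) * \<psi> y)" by (rule schwartz_inner_mult[OF e \<psi>])
  have m: "schwartz (?m h)" for h by (rule symbol_mult_schwartz[OF symbol_exp_inner \<psi>])
  have sr: "schwartz (\<rho> h)" for h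
    unfolding \<rho>_def by (intro schwartz_diff schwartz_cmult m \<psi> y\<psi>)
  show ?thesis
  proof (rule rapid_decay_difference_quotient[OF v s sr _ _ _ dec r0, where E="(0, e)"])
    show "\<exists>C\<ge>0. \<forall>h. 0 < h \<longrightarrow> h \<le> 1 \<longrightarrow> derivs_le n (- real n) (C * h\<^sup>2) (\<rho> h)" for n
      using first_order_modulate[OF e \<psi>, of 1 n "- real n"] unfolding first_order_def \<rho>_def by simp
    show "norm (0::real^'d, e) \<le> 1" using e by (simp add: norm_Pair)
    fix h :: real and z :: "(real^'d) \<times> (real^'d)" assume h: "0 < h"
    note l = phase_shift_functional(1)[OF v, of z]
    let ?l = "\<lambda>f. v (phase_shift z f)"
    let ?c = "exp (\<i> * complex_of_real (- (h * (fst z \<bullet> e))))"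
    have "phase_shift z (?m h) = (\<lambda>y. ?c * phase_shift (z + h *\<^sub>R (0, e)) \<psi> y)"
    proof
      fix y
      have "exp (\<i> * complex_of_real (y \<bullet> snd z)) * exp (\<i> * of_real ((y - fst z) \<bullet> ((h * 1) *\<^sub>R e)))
         = ?c * exp (\<i> * of_real (y \<bullet> (snd z + h *\<^sub>R e)))"
        unfolding exp_add[symmetric] by (rule arg_cong[where f=exp]) (simp add: algebra_simps inner_diff_left)
      then show "phase_shift z (?m h) y = ?c * phase_shift (z + h *\<^sub>R (0, e)) \<psi> y"
        by (simp add: phase_shift_apply mult.assoc[symmetric])
    qed
    then have 1: "norm (?l (?m h)) = norm (v (phase_shift (z + h *\<^sub>R (0, e)) \<psi>))"
      using bounded_functionalD(2)[OF v phase_shift_schwartz[OF \<psi>, of "z + h *\<^sub>R (0, e)"], of ?c]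
      by (simp only: norm_mult complex_mod_cnj norm_exp_i mult_1)
    let ?ih = "of_real h * \<i>"
    have eq: "(\<lambda>y. ?ih * (of_real (y \<bullet> e) * \<psi> y)) = (\<lambda>y. ?m h y + ((-1) * \<psi> y + (-1) * \<rho> h y))"
      by (rule ext) (simp add: \<rho>_def)
    have sc: "schwartz (\<lambda>y. (-1) * \<psi> y)" "schwartz (\<lambda>y. (-1) * \<rho> h y)"
      by (intro schwartz_cmult sr \<psi>)+
    have "cnj ?ih * ?l (\<lambda>y. of_real (y \<bullet> e) * \<psi> y) = ?l (\<lambda>y. ?ih * (of_real (y \<bullet> e) * \<psi> y))"
      by (rule bounded_functionalD(2)[OF l y\<psi>, symmetric])
    also have "\<dots> = ?l (?m h) + (?l (\<lambda>y. (-1) * \<psi> y) + ?l (\<lambda>y. (-1) * \<rho> h y))"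
      unfolding eq bounded_functionalD(1)[OF l m schwartz_add[OF sc]] bounded_functionalD(1)[OF l sc] ..
    also have "?l (\<lambda>y. (-1) * \<psi> y) = - ?l \<psi>" using bounded_functionalD(2)[OF l \<psi>, of "-1"] by simp
    also have "?l (\<lambda>y. (-1) * \<rho> h y) = - ?l (\<rho> h)" using bounded_functionalD(2)[OF l sr, of "-1"] by simp
    finally have "norm (cnj ?ih * ?l (\<lambda>y. of_real (y \<bullet> e) * \<psi> y)) = norm (?l (?m h) + (- ?l \<psi> + - ?l (\<rho> h)))" by simp
    also have "\<dots> \<le> norm (?l (?m h)) + (norm (?l \<psi>) + norm (?l (\<rho> h)))"
      using norm_triangle_ineq[of "?l (?m h)" "- ?l \<psi> + - ?l (\<rho> h)"] norm_triangle_ineq[of "- ?l \<psi>" "- ?l (\<rho> h)"] by simp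
    finally show "h * norm (v (phase_shift z (\<lambda>y. of_real (y \<bullet> e) * \<psi> y))) \<le> norm (v (phase_shift z (\<rho> h)))
        + norm (v (phase_shift (z + h *\<^sub>R (0, e)) \<psi>)) + norm (v (phase_shift z \<psi>))"
      using h 1 by (simp add: norm_mult)
  qed
qed

text \<open>Differentiation and multiplication shrink the neighbourhood, so the induction is over the
  statement for all radii below \<open>r0\<close>; in this form nothing is lost.\<close>

lemma rapid_decay_window_class:
  fixes v :: "(real^'d \<Rightarrow> complex) \<Rightarrow> complex"
  assumes v: "bounded_functional v" and s: "0 < s" and \<phi>: "schwartz \<phi>"
    and dec: "\<And>r. r < r0 \<Longrightarrow> rapid_decay s v \<phi> (ball z0 r)" and r0: "r0 \<le> 1"
    and f: "window_class \<phi> f"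
  shows "\<forall>r<r0. rapid_decay s v f (ball z0 r)"
  using f
proof (induction rule: window_class.induct)
  case base then show ?case using dec by blast
next
  case (add f g)
  note sc = window_class_schwartz[OF add.hyps(1) \<phi>] window_class_schwartz[OF add.hyps(2) \<phi>]
  show ?case
  proof (intro allI impI)
    fix r assume r: "r < r0"
    show "rapid_decay s v (\<lambda>x. f x + g x) (ball z0 r)"
      unfolding rapid_decay_def
    proof
      fix N
      obtain B1 where B1: "\<And>z t. z \<in> ball z0 r \<Longrightarrow> 1 \<le> t \<Longrightarrow> norm (v (phase_shift (dilate s t z) f)) \<le> B1 * t powr (- real N)"
        using add.IH(1) r unfolding rapid_decay_def by blast
      obtain B2 where B2: "\<And>z t. z \<in> ball z0 r \<Longrightarrow> 1 \<le> t \<Longrightarrow> norm (v (phase_shift (dilate s t z) g)) \<le> B2 * t powr (- real N)"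
        using add.IH(2) r unfolding rapid_decay_def by blast
      have "norm (v (phase_shift (dilate s t z) (\<lambda>x. f x + g x))) \<le> (B1 + B2) * t powr (- real N)"
        if "z \<in> ball z0 r" "1 \<le> t" for z t
        unfolding bounded_functionalD(1)[OF phase_shift_functional(1)[OF v] sc]
        using norm_triangle_ineq[of "v (phase_shift (dilate s t z) f)" "v (phase_shift (dilate s t z) g)"] B1[OF that] B2[OF that]
        by (simp add: distrib_right)
      then show "\<exists>B. \<forall>z\<in>ball z0 r. \<forall>t\<ge>1. norm (v (phase_shift (dilate s t z) (\<lambda>x. f x + g x))) \<le> B * t powr (- real N)"
        by blast
    qed
  qed
next
  case (cmult f c)
  note sc = window_class_schwartz[OF cmult.hyps(1) \<phi>]
  show ?case
  proof (intro allI impI)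
    fix r assume r: "r < r0"
    show "rapid_decay s v (\<lambda>x. c * f x) (ball z0 r)"
      unfolding rapid_decay_def
    proof
      fix N
      obtain B1 where B1: "\<And>z t. z \<in> ball z0 r \<Longrightarrow> 1 \<le> t \<Longrightarrow> norm (v (phase_shift (dilate s t z) f)) \<le> B1 * t powr (- real N)"
        using cmult.IH r unfolding rapid_decay_def by blast
      have "norm (v (phase_shift (dilate s t z) (\<lambda>x. c * f x))) \<le> (norm c * B1) * t powr (- real N)"
        if "z \<in> ball z0 r" "1 \<le> t" for z t
        unfolding bounded_functionalD(2)[OF phase_shift_functional(1)[OF v] sc] norm_mult complex_mod_cnj
        using mult_left_mono[OF B1[OF that], of "norm c"] by (simp add: mult.assoc)
      then show "\<exists>B. \<forall>z\<in>ball z0 r. \<forall>t\<ge>1. norm (v (phase_shift (dilate s t z) (\<lambda>x. c * f x))) \<le> B * t powr (- real N)"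
        by blast
    qed
  qed
next
  case (deriv f e)
  then show ?case using rapid_decay_partial_deriv[OF v s window_class_schwartz[OF _ \<phi>] _ _ r0] by blast
next
  case (coord f e)
  then show ?case using rapid_decay_coordinate[OF v s window_class_schwartz[OF _ \<phi>] _ _ r0] by blast
qed

section \<open>Geometry of anisotropic cones\<close>

definition aniso_sum :: "real \<Rightarrow> real \<Rightarrow> (real^'d) \<times> (real^'d) \<Rightarrow> real" where
  "aniso_sum s l z = l powr (- 2) * (norm (fst z))\<^sup>2 + l powr (- 2 * s) * (norm (snd z))\<^sup>2"

lemma aniso_sum_strict_antimono:
  assumes s: "0 < s" and z: "z \<noteq> 0" and l: "0 < l" "l < l'"
  shows "aniso_sum s l' z < aniso_sum s l z"
proof -
  have 1: "l' powr (- 2) < l powr (- 2)" using l by (intro powr_less_mono2_neg) auto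
  have 2: "l' powr (- 2 * s) < l powr (- 2 * s)" using l s by (intro powr_less_mono2_neg) auto
  have "fst z \<noteq> 0 \<or> snd z \<noteq> 0" using z by (auto simp: prod_eq_iff)
  then show ?thesis
  proof
    assume "fst z \<noteq> 0"
    then show ?thesis unfolding aniso_sum_def
      using 1 2 by (intro add_less_le_mono mult_strict_right_mono mult_right_mono) auto
  next
    assume "snd z \<noteq> 0"
    then show ?thesis unfolding aniso_sum_def
      using 1 2 by (intro add_le_less_mono mult_strict_right_mono mult_right_mono) auto
  qed
qed

text \<open>The sum is strictly decreasing in \<open>l\<close>, at least 1 when one of its summands is, and at most
  \<open>1/2\<close> when both quotients \<open>norm x / l\<close> and \<open>norm \<xi> / l powr s\<close> are at most \<open>1/2\<close>.\<close>

lemma lambda_s_exists: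
  assumes s: "0 < s" and z: "z \<noteq> 0"
  shows "\<exists>!l. 0 < l \<and> aniso_sum s l z = 1"
proof -
  define p where "p = norm (fst z)"
  define q where "q = norm (snd z)"
  have nz: "p > 0 \<or> q > 0" using z by (auto simp: p_def q_def prod_eq_iff)
  have F: "aniso_sum s l z = l powr (- 2) * p\<^sup>2 + l powr (- 2 * s) * q\<^sup>2" for l
    by (simp add: aniso_sum_def p_def q_def)
  have pp: "l powr (- 2) * p\<^sup>2 = (p / l)\<^sup>2" if "0 < l" for l
    using that by (simp add: powr_minus powr_numeral power_divide divide_simps)
  have qq: "l powr (- 2 * s) * q\<^sup>2 = (q / l powr s)\<^sup>2" if "0 < l" for l
  proof -
    have "l powr (- 2 * s) = inverse ((l powr s)\<^sup>2)"
      using that by (simp add: powr_minus power2_eq_square powr_add[symmetric])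
    then show ?thesis by (simp add: power_divide divide_simps)
  qed
  have p0: "0 \<le> p" "0 \<le> q" by (simp_all add: p_def q_def)
  have "\<exists>l1. 0 < l1 \<and> 1 \<le> aniso_sum s l1 z"
  proof (cases "p > 0")
    case True
    then show ?thesis unfolding F using pp[of p] by (intro exI[of _ p]) auto
  next
    case False
    then have q: "q > 0" using nz by simp
    then have "(q powr (1 / s)) powr s = q" using s by (simp add: powr_powr)
    then show ?thesis unfolding F using qq[of "q powr (1 / s)"] q by (intro exI[of _ "q powr (1 / s)"]) auto
  qed
  then obtain l1 where l1: "0 < l1" "1 \<le> aniso_sum s l1 z" by blast
  define l2 where "l2 = max l1 (max (2 * p) ((2 * q) powr (1 / s)))"
  have l2: "0 < l2" "l1 \<le> l2" using l1 by (auto simp: l2_def)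
  have "p / l2 \<le> 1/2" using l2(1) by (simp add: divide_le_eq l2_def)
  then have a: "(p / l2)\<^sup>2 \<le> (1/2)\<^sup>2" using p0 l2 by (intro power_mono) auto
  have "2 * q = ((2 * q) powr (1 / s)) powr s" using s p0 by (simp add: powr_powr)
  also have "\<dots> \<le> l2 powr s" using s by (intro powr_mono2) (auto simp: l2_def)
  finally have "q / l2 powr s \<le> 1/2" using l2(1) by (simp add: divide_le_eq)
  then have b: "(q / l2 powr s)\<^sup>2 \<le> (1/2)\<^sup>2" using p0 l2 by (intro power_mono) auto
  have "(1/2::real)\<^sup>2 + (1/2)\<^sup>2 \<le> 1" by (simp add: power2_eq_square)
  then have "aniso_sum s l2 z \<le> 1" unfolding F pp[OF l2(1)] qq[OF l2(1)] using a b by linarith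
  moreover have "continuous_on {l1..l2} (\<lambda>l. aniso_sum s l z)"
    unfolding F using l1(1) by (auto intro!: continuous_intros)
  ultimately obtain l where l: "l1 \<le> l" "l \<le> l2" "aniso_sum s l z = 1"
    using IVT2'[of "\<lambda>l. aniso_sum s l z" l2 1 l1] l1(2) l2(2) by auto
  show ?thesis
  proof (rule ex1I[of _ l])
    show "0 < l \<and> aniso_sum s l z = 1" using l l1 by simp
    fix l' assume "0 < l' \<and> aniso_sum s l' z = 1"
    then show "l' = l"
      using aniso_sum_strict_antimono[OF s z, of l l'] aniso_sum_strict_antimono[OF s z, of l' l] l l1
      by (cases l l' rule: linorder_cases) auto
  qed
qed

lemma lambda_s:
  assumes s: "0 < s" and z: "z \<noteq> 0"
  shows "0 < lambda_s s z" "aniso_sum s (lambda_s s z) z = 1"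
    and "0 < l \<Longrightarrow> aniso_sum s l z = 1 \<Longrightarrow> lambda_s s z = l"
proof -
  have eq: "lambda_s s z = (THE l. 0 < l \<and> aniso_sum s l z = 1)"
    by (cases z) (simp add: lambda_s_def aniso_sum_def)
  from theI'[OF lambda_s_exists[OF s z]]
  show "0 < lambda_s s z" "aniso_sum s (lambda_s s z) z = 1" unfolding eq by blast+
  show "0 < l \<Longrightarrow> aniso_sum s l z = 1 \<Longrightarrow> lambda_s s z = l"
    unfolding eq using lambda_s_exists[OF s z] by (intro the1_equality) auto
qed

text \<open>The sum is invariant when both arguments are dilated, and its solution is unique.\<close>

lemma lambda_s_dilate:
  assumes s: "0 < s" and z: "z \<noteq> 0" and t: "0 < t"
  shows "lambda_s s (dilate s t z) = t * lambda_s s z" "dilate s t z \<noteq> 0"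
proof -
  show nz: "dilate s t z \<noteq> 0" using z t by (auto simp: dilate_def prod_eq_iff)
  note l = lambda_s[OF s z]
  have "(t powr s)\<^sup>2 = t powr (2 * s)" using t by (simp add: power2_eq_square powr_add[symmetric])
  then have eq: "aniso_sum s (t * lambda_s s z) (dilate s t z) = aniso_sum s (lambda_s s z) z"
    using t l(1) unfolding aniso_sum_def dilate_def fst_conv snd_conv norm_scaleR
    by (simp add: powr_mult power_mult_distrib powr_minus powr_numeral field_simps)
  show "lambda_s s (dilate s t z) = t * lambda_s s z"
    by (rule lambda_s(3)[OF s nz]) (simp_all add: l(1) t eq l(2))
qed

lemma sphere_proj_dilate:
  assumes s: "0 < s" and z: "z \<noteq> 0" and t: "0 < t"
  shows "sphere_proj s (dilate s t z) = sphere_proj s z"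
proof -
  have eq: "sphere_proj s w = (lambda_s s w powr (- 1) *\<^sub>R fst w, lambda_s s w powr (- s) *\<^sub>R snd w)" for w :: "(real^'a) \<times> (real^'a)"
    by (cases w) (simp add: sphere_proj_def)
  note l = lambda_s(1)[OF s z]
  show ?thesis
    unfolding eq lambda_s_dilate(1)[OF s z t] using l t
    by (simp add: dilate_def powr_mult powr_minus)
qed

text \<open>By monotonicity, \<open>lambda_s s z\<close> lies between two numbers as soon as the sums at these
  numbers lie on the two sides of 1. This is an open condition on \<open>z\<close>.\<close>

lemma sphere_proj_isCont:
  fixes z0 :: "(real^'d) \<times> (real^'d)"
  assumes s: "0 < s" and z0: "z0 \<noteq> 0"
  shows "isCont (sphere_proj s) z0"
proof -
  note l0 = lambda_s[OF s z0]
  have cont: "isCont (\<lambda>z. aniso_sum s l z) z0" for l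
    unfolding aniso_sum_def by (intro continuous_intros)
  have nz: "\<forall>\<^sub>F z in nhds z0. z \<noteq> 0"
    using z0 by (intro t1_space_nhds) auto
  have "isCont (lambda_s s) z0"
    unfolding isCont_def
  proof (rule order_tendstoI)
    fix b assume b: "b < lambda_s s z0"
    define c where "c = max b (lambda_s s z0 / 2)"
    have c: "0 < c" "b \<le> c" "c < lambda_s s z0" using b l0(1) by (auto simp: c_def)
    have "1 < aniso_sum s c z0" using aniso_sum_strict_antimono[OF s z0 c(1,3)] l0(2) by simp
    then have "\<forall>\<^sub>F z in at z0. 1 < aniso_sum s c z"
      using cont[of c] unfolding isCont_def by (rule order_tendstoD(1)[rotated])
    moreover have "\<forall>\<^sub>F z in at z0. z \<noteq> 0" using nz by (simp add: eventually_at_filter eventually_mono)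
    ultimately show "\<forall>\<^sub>F z in at z0. b < lambda_s s z"
    proof eventually_elim
      case (elim z)
      have "c < lambda_s s z"
      proof (rule ccontr)
        assume "\<not> c < lambda_s s z"
        then have "lambda_s s z < c \<or> lambda_s s z = c" by auto
        then show False using aniso_sum_strict_antimono[OF s elim(2) lambda_s(1)[OF s elim(2)], of c] lambda_s(2)[OF s elim(2)] elim(1) by auto
      qed
      with c show ?case by simp
    qed
  next
    fix c assume c: "lambda_s s z0 < c"
    have "aniso_sum s c z0 < 1" using aniso_sum_strict_antimono[OF s z0 l0(1) c] l0(2) by simp
    then have "\<forall>\<^sub>F z in at z0. aniso_sum s c z < 1"
      using cont[of c] unfolding isCont_def by (rule order_tendstoD(2)[rotated])
    moreover have "\<forall>\<^sub>F z in at z0. z \<noteq> 0" using nz by (simp add: eventually_at_filter eventually_mono)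
    ultimately show "\<forall>\<^sub>F z in at z0. lambda_s s z < c"
    proof eventually_elim
      case (elim z)
      show ?case
      proof (rule ccontr)
        assume "\<not> lambda_s s z < c"
        then have "c < lambda_s s z \<or> lambda_s s z = c" by auto
        then show False using aniso_sum_strict_antimono[OF s elim(2), of c "lambda_s s z"] lambda_s(2)[OF s elim(2)] elim(1) c l0(1) by auto
      qed
    qed
  qed
  then have "isCont (\<lambda>w. (lambda_s s w powr (- 1) *\<^sub>R fst w, lambda_s s w powr (- s) *\<^sub>R snd w)) z0"
    using l0(1) by (intro continuous_intros) auto
  moreover have eq: "sphere_proj s = (\<lambda>w. (lambda_s s w powr (- 1) *\<^sub>R fst w, lambda_s s w powr (- s) *\<^sub>R snd w))"
    by (rule ext) (simp add: sphere_proj_def case_prod_beta')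
  ultimately show ?thesis unfolding eq by blast
qed

definition aniso_norm :: "real \<Rightarrow> (real^'d) \<times> (real^'d) \<Rightarrow> real" where
  "aniso_norm s z = norm (fst z) + norm (snd z) powr (1 / s)"

lemma mu_aniso_norm: "mu s z = 1 + aniso_norm s z"
  by (cases z) (simp add: mu_def aniso_norm_def)

lemma aniso_norm_dilate:
  assumes "0 < s" "0 < t" shows "aniso_norm s (dilate s t z) = t * aniso_norm s z"
proof -
  have "(t powr s * norm (snd z)) powr (1 / s) = t * norm (snd z) powr (1 / s)"
    using assms by (simp add: powr_mult powr_powr)
  then show ?thesis using assms by (simp add: aniso_norm_def dilate_def distrib_left)
qed

text \<open>The cones are invariant under dilations and their sections are open. So the dilates of a
  small ball around \<open>z0\<close> stay in a given cone, and on them the weight is comparable to \<open>t\<close>,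
  because the quantity \<open>aniso_norm\<close> is homogeneous and bounded away from 0 on the ball.\<close>

lemma cone_neighbourhood:
  fixes z0 :: "(real^'d) \<times> (real^'d)"
  assumes s: "0 < s" and z0: "z0 \<noteq> 0" and \<epsilon>: "0 < \<epsilon>"
  shows "\<exists>r T m0 M. 0 < r \<and> r \<le> 1 \<and> 1 \<le> T \<and> 0 < m0 \<and> 0 < M \<and>
    (\<forall>z\<in>ball z0 r. \<forall>t\<ge>T. dilate s t z \<in> aniso_cone s (sphere_proj s z0) \<epsilon> \<and> R \<le> aniso_norm s (dilate s t z)
       \<and> t * m0 \<le> mu s (dilate s t z) \<and> mu s (dilate s t z) \<le> t * M)"
proof -
  define g where "g = aniso_norm s z0"
  have g0: "0 < g"
    using z0 by (cases "fst z0 = 0"; cases "snd z0 = 0")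
      (auto simp: g_def aniso_norm_def prod_eq_iff intro!: add_pos_nonneg)
  have gl: "(aniso_norm s \<longlongrightarrow> g) (at z0)"
    unfolding aniso_norm_def[abs_def] g_def aniso_norm_def using s
    by (intro tendsto_add tendsto_norm tendsto_fst tendsto_snd tendsto_ident_at tendsto_powr' tendsto_const) auto
  have sl: "((\<lambda>z. norm (sphere_proj s z0 - sphere_proj s z)) \<longlongrightarrow> 0) (at z0)"
  proof -
    have "((\<lambda>z. norm (sphere_proj s z0 - sphere_proj s z)) \<longlongrightarrow> norm (sphere_proj s z0 - sphere_proj s z0)) (at z0)"
      using sphere_proj_isCont[OF s z0] unfolding isCont_def by (intro tendsto_intros)
    then show ?thesis by simp
  qed
  have "\<forall>\<^sub>F z in at z0. g / 2 < aniso_norm s z \<and> aniso_norm s z < 2 * g \<and> norm (sphere_proj s z0 - sphere_proj s z) < \<epsilon> \<and> z \<noteq> 0"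
    using g0 \<epsilon> z0
    by (intro eventually_conj order_tendstoD[OF gl] order_tendstoD(2)[OF sl] eventually_neq_at_within) auto
  then obtain d where d: "d > 0" "\<And>z. z \<noteq> z0 \<Longrightarrow> dist z z0 < d \<Longrightarrow> g / 2 < aniso_norm s z \<and> aniso_norm s z < 2 * g
      \<and> norm (sphere_proj s z0 - sphere_proj s z) < \<epsilon> \<and> z \<noteq> 0"
    unfolding eventually_at by blast
  have near: "g / 2 < aniso_norm s z \<and> aniso_norm s z < 2 * g \<and> norm (sphere_proj s z0 - sphere_proj s z) < \<epsilon> \<and> z \<noteq> 0"
    if "z \<in> ball z0 (min d 1)" for z
    using d(2)[of z] that g0 z0 \<epsilon> by (cases "z = z0") (auto simp: g_def dist_commute)
  define T where "T = max 1 (2 * R / g)"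
  show ?thesis
  proof (rule exI[of _ "min d 1"], rule exI[of _ T], rule exI[of _ "g / 2"], rule exI[of _ "1 + 2 * g"],
      intro conjI ballI allI impI)
    show "0 < min d 1" "min d 1 \<le> 1" "1 \<le> T" "0 < g / 2" "0 < 1 + 2 * g" using d(1) g0 by (auto simp: T_def)
    fix z t assume z: "z \<in> ball z0 (min d 1)" and t: "T \<le> t"
    have t1: "1 \<le> t" "0 < t" using t by (auto simp: T_def)
    note n = near[OF z]
    show "dilate s t z \<in> aniso_cone s (sphere_proj s z0) \<epsilon>"
    proof -
      have nz: "z \<noteq> 0" using n by blast
      show ?thesis
        using n unfolding aniso_cone_def by (simp add: lambda_s_dilate(2)[OF s nz t1(2)] sphere_proj_dilate[OF s nz t1(2)])
    qed
    have "2 * R / g \<le> t" using t by (simp add: T_def)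
    then have "R \<le> t * (g / 2)" using g0 by (simp add: divide_le_eq mult.commute)
    also have "\<dots> \<le> t * aniso_norm s z" using n t1 by (intro mult_left_mono) auto
    finally show "R \<le> aniso_norm s (dilate s t z)" by (simp add: aniso_norm_dilate s t1)
    have "t * (g / 2) \<le> t * aniso_norm s z" using n t1 by (intro mult_left_mono) auto
    moreover have mu: "mu s (dilate s t z) = 1 + t * aniso_norm s z" by (simp add: mu_aniso_norm aniso_norm_dilate s t1)
    ultimately show "t * (g / 2) \<le> mu s (dilate s t z)" by linarith
    have "t * aniso_norm s z \<le> t * (2 * g)" using n t1 by (intro mult_left_mono) auto
    then show "mu s (dilate s t z) \<le> t * (1 + 2 * g)"
      unfolding mu distrib_left using t1 by linarith
  qed
qed

section \<open>Taylor expansion of the quantized symbol\<close>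

definition basis_lists :: "nat \<Rightarrow> 'a::euclidean_space list set" where
  "basis_lists k = {bs. set bs \<subseteq> Basis \<and> length bs = k}"

lemma finite_basis_lists: "finite (basis_lists k)"
  unfolding basis_lists_def by (rule finite_lists_length_eq) simp

lemma basis_lists_0: "basis_lists 0 = {[]}"
  by (auto simp: basis_lists_def)

lemma sum_basis_lists_Suc:
  fixes g :: "'a::euclidean_space list \<Rightarrow> complex"
  shows "(\<Sum>bs\<in>basis_lists (Suc k). g bs) = (\<Sum>b\<in>Basis. \<Sum>bs\<in>basis_lists k. g (b # bs))"
proof -
  have eq: "basis_lists (Suc k) = (\<lambda>(b, bs). b # bs) ` ((Basis :: 'a set) \<times> basis_lists k)"
    by (auto simp: basis_lists_def image_iff length_Suc_conv)
  have "inj_on (\<lambda>(b, bs). b # bs) ((Basis :: 'a set) \<times> basis_lists k)" by (auto simp: inj_on_def)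
  then show ?thesis
    unfolding eq by (subst sum.reindex) (auto simp: sum.cartesian_product case_prod_beta')
qed

text \<open>Summing over lists of directions instead of multi-indices counts each multi-index with its
  multinomial coefficient, which turns \<open>1 / \<alpha>!\<close> into \<open>1 / k!\<close>.\<close>

lemma taylor_term_monomial:
  fixes f :: "'a::euclidean_space \<Rightarrow> complex"
  shows "smooth f \<Longrightarrow> taylor_term k f z w = (\<Sum>bs\<in>basis_lists k. inverse (fact k) * pderivs bs f z * monomial bs w)"
proof (induction k arbitrary: f)
  case 0 then show ?case by (simp add: basis_lists_0)
next
  case (Suc k)
  have "taylor_term (Suc k) f z w = inverse (of_nat (Suc k)) * (\<Sum>b\<in>Basis. of_real (w \<bullet> b) *
      (\<Sum>bs\<in>basis_lists k. inverse (fact k) * pderivs bs (partial_deriv b f) z * monomial bs w))"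
    using Suc by (simp add: smooth_partial_deriv)
  also have "\<dots> = (\<Sum>b\<in>Basis. \<Sum>bs\<in>basis_lists k. inverse (fact (Suc k)) * pderivs (b # bs) f z * monomial (b # bs) w)"
    unfolding sum_distrib_left
  proof (intro sum.cong refl)
    fix b :: 'a and bs :: "'a list" assume b: "b \<in> Basis" and bs: "bs \<in> basis_lists k"
    have "pderivs bs (partial_deriv b f) = pderivs (b # bs) f"
      using pderivs_partial_deriv[OF Suc.prems _ b] bs by (simp add: basis_lists_def)
    then show "inverse (of_nat (Suc k)) * (of_real (w \<bullet> b) * (inverse (fact k) * pderivs bs (partial_deriv b f) z * monomial bs w))
       = inverse (fact (Suc k)) * pderivs (b # bs) f z * monomial (b # bs) w"
      by (simp add: fact_Suc mult_ac del: of_nat_Suc)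
  qed
  also have "\<dots> = (\<Sum>bs\<in>basis_lists (Suc k). inverse (fact (Suc k)) * pderivs bs f z * monomial bs w)"
    by (rule sum_basis_lists_Suc[symmetric])
  finally show ?case .
qed

lemma weyl_int_taylor:
  fixes b :: "'a::euclidean_space \<times> 'a \<Rightarrow> complex"
  assumes L: "0 \<le> L" and K: "real K \<le> L" and b: "smooth b" and R: "symbol L (taylor_rem K b z)" and f: "schwartz f"
  shows "weyl_int (\<lambda>w. b (w + z)) f = (\<lambda>x. (\<Sum>k<K. \<Sum>bs\<in>basis_lists k. (inverse (fact k) * pderivs bs b z) * weyl_int (monomial bs) f x)
    + weyl_int (taylor_rem K b z) f x)"
proof
  fix x
  have m: "symbol L (monomial bs)" if "k < K" "bs \<in> basis_lists k" for k and bs :: "('a \<times> 'a) list"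
    using that K by (intro symbol_mono[OF monomial_symbol]) (auto simp: basis_lists_def)
  have m1: "symbol L (\<lambda>w. inverse (fact k) * pderivs bs b z * monomial bs w)" if "k < K" "bs \<in> basis_lists k" for k and bs :: "('a \<times> 'a) list"
    by (rule symbol_cmult[OF m[OF that]])
  have m2: "symbol L (\<lambda>w. \<Sum>bs\<in>basis_lists k. inverse (fact k) * pderivs bs b z * monomial bs w)" if "k < K" for k
    by (rule symbol_sum[OF m1[OF that] L])
  have m3: "symbol L (\<lambda>w. \<Sum>k<K. \<Sum>bs\<in>basis_lists k. inverse (fact k) * pderivs bs b z * monomial bs w)"
    by (rule symbol_sum[OF m2 L]) simp
  have "(\<lambda>w. b (w + z)) = (\<lambda>w. (\<Sum>k<K. \<Sum>bs\<in>basis_lists k. inverse (fact k) * pderivs bs b z * monomial bs w) + taylor_rem K b z w)"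
    by (rule ext) (simp add: taylor_rem_def taylor_term_monomial[OF b])
  then have "weyl_int (\<lambda>w. b (w + z)) f x
     = weyl_int (\<lambda>w. \<Sum>k<K. \<Sum>bs\<in>basis_lists k. inverse (fact k) * pderivs bs b z * monomial bs w) f x + weyl_int (taylor_rem K b z) f x"
    using weyl_int_add_left[OF L m3 R f] by simp
  also have "weyl_int (\<lambda>w. \<Sum>k<K. \<Sum>bs\<in>basis_lists k. inverse (fact k) * pderivs bs b z * monomial bs w) f x
     = (\<Sum>k<K. weyl_int (\<lambda>w. \<Sum>bs\<in>basis_lists k. inverse (fact k) * pderivs bs b z * monomial bs w) f x)"
    by (rule bilinear_sum[OF weyl_int_bilinear[OF L] L m2 f]) simp
  also have "\<dots> = (\<Sum>k<K. \<Sum>bs\<in>basis_lists k. (inverse (fact k) * pderivs bs b z) * weyl_int (monomial bs) f x)"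
  proof (intro sum.cong refl)
    fix k assume "k \<in> {..<K}"
    then have k: "k < K" by simp
    have "weyl_int (\<lambda>w. \<Sum>bs\<in>basis_lists k. inverse (fact k) * pderivs bs b z * monomial bs w) f x
       = (\<Sum>bs\<in>basis_lists k. weyl_int (\<lambda>w. inverse (fact k) * pderivs bs b z * monomial bs w) f x)"
      by (rule bilinear_sum[OF weyl_int_bilinear[OF L] L m1[OF k] f])
    then show "weyl_int (\<lambda>w. \<Sum>bs\<in>basis_lists k. inverse (fact k) * pderivs bs b z * monomial bs w) f x
       = (\<Sum>bs\<in>basis_lists k. (inverse (fact k) * pderivs bs b z) * weyl_int (monomial bs) f x)"
      unfolding weyl_int_cmult_left[OF L] .
  qed
  finally show "weyl_int (\<lambda>w. b (w + z)) f x = (\<Sum>k<K. \<Sum>bs\<in>basis_lists k. (inverse (fact k) * pderivs bs b z) * weyl_int (monomial bs) f x)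
    + weyl_int (taylor_rem K b z) f x" .
qed

lemma pderivs_cnj:
  "smooth f \<Longrightarrow> set bs \<subseteq> Basis \<Longrightarrow> pderivs bs (\<lambda>x. cnj (f x)) = (\<lambda>x. cnj (pderivs bs f x))"
  by (induction bs) (simp_all add: partial_deriv_cnj_smooth smooth_pderivs)

text \<open>Taylor's formula bounds the remainder by derivatives of order \<open>K\<close> at intermediate points
  \<open>z + t w\<close>, which are as small as a negative power of \<open>mu s\<close> at these points; moderateness
  moves the weight to \<open>z\<close>, at the price of a power of \<open>1 + norm w\<close>. Derivatives of the remainder
  are shorter remainders of derivatives, so the induction runs over remainders \<open>J\<close> of \<open>pderivs
  bs b\<close> with \<open>length bs + J \<ge> K\<close>. Once \<open>J = 0\<close>, the derivatives of the symbol have the required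
  decay by themselves.\<close>

lemma taylor_rem_shubin:
  fixes b :: "(real^'d) \<times> (real^'d) \<Rightarrow> complex"
  assumes s: "0 < s" and b: "smooth b"
    and bd: "\<And>bs. set bs \<subseteq> Basis \<Longrightarrow> \<exists>C>0. \<forall>z. norm (pderivs bs b z) \<le> C * mu s z powr (m - min 1 s * real (length bs))"
    and p: "0 \<le> min 1 s * real K - m"
  shows "\<exists>C\<ge>0. \<forall>z. derivs_le n (real K + max 1 (1 / s) * (min 1 s * real K - m)) (C * mu s z powr (m - min 1 s * real K)) (taylor_rem K b z)"
proof -
  define c where "c = min 1 s"
  define p where "p = c * real K - m"
  define Lr where "Lr = real K + max 1 (1 / s) * p"
  define k where "k = 2 * 2 powr (1 / s)"
  define d where "d = real DIM((real^'d) \<times> (real^'d))"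
  have c: "0 < c" using s by (simp add: c_def)
  have p0: "0 \<le> p" using p by (simp add: p_def c_def)
  have k0: "0 < k" by (simp add: k_def)
  have base: "\<exists>C\<ge>0. \<forall>z w. norm (taylor_rem J (pderivs bs b) z w) \<le> C * mu s z powr (- p) * (1 + norm w) powr Lr"
    if bs: "set bs \<subseteq> Basis" and J: "J \<le> K" "K \<le> length bs + J" for bs J
  proof -
    have "\<exists>C. \<forall>cs\<in>basis_lists J. 0 < C cs \<and> (\<forall>z. norm (pderivs (cs @ bs) b z) \<le> C cs * mu s z powr (m - c * real (length (cs @ bs))))"
    proof (intro bchoice ballI)
      fix cs :: "((real^'d) \<times> (real^'d)) list" assume "cs \<in> basis_lists J"
      then have "set (cs @ bs) \<subseteq> Basis" using bs by (simp add: basis_lists_def)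
      from bd[OF this] show "\<exists>C. 0 < C \<and> (\<forall>z. norm (pderivs (cs @ bs) b z) \<le> C * mu s z powr (m - c * real (length (cs @ bs))))"
        unfolding c_def .
    qed
    then obtain C where C: "\<And>cs. cs \<in> basis_lists J \<Longrightarrow> 0 < C cs"
      "\<And>cs z. cs \<in> basis_lists J \<Longrightarrow> norm (pderivs (cs @ bs) b z) \<le> C cs * mu s z powr (m - c * real (length (cs @ bs)))" by blast
    define S where "S = (\<Sum>cs\<in>basis_lists J. C cs)"
    have S: "C cs \<le> S" if "cs \<in> basis_lists J" for cs
      unfolding S_def using finite_basis_lists that C(1) by (intro member_le_sum) (auto intro: less_imp_le)
    have S0: "0 \<le> S" unfolding S_def using C(1) by (intro sum_nonneg) (auto intro: less_imp_le)
    have "norm (taylor_rem J (pderivs bs b) z w) \<le> (d ^ J * S * k powr p) * mu s z powr (- p) * (1 + norm w) powr Lr" for z w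
    proof -
      have w1: "0 < 1 + norm w" using norm_ge_zero[of w] by linarith
      have mz: "0 < mu s z" using mu_ge_1[of s z] by linarith
      define Mx where "Mx = S * (k powr p * mu s z powr (- p) * (1 + norm w) powr (max 1 (1 / s) * p))"
      have Mx0: "0 \<le> Mx" using S0 by (simp add: Mx_def)
      have "norm (taylor_rem J (pderivs bs b) z (1 *\<^sub>R w)) \<le> (d * norm w) ^ J * Mx"
        unfolding d_def
      proof (rule taylor_rem_bound)
        show "smooth (pderivs bs b)" using b bs by (rule smooth_pderivs)
        fix cs :: "((real^'d) \<times> (real^'d)) list" and t :: real assume cs: "set cs \<subseteq> Basis" "length cs = J" and t: "0 \<le> t" "t \<le> 1"
        define y where "y = t *\<^sub>R w + z"
        have my: "1 \<le> mu s y" by (rule mu_ge_1)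
        have cs': "cs \<in> basis_lists J" using cs by (simp add: basis_lists_def)
        have "norm (pderivs cs (pderivs bs b) y) \<le> C cs * mu s y powr (m - c * real (length (cs @ bs)))"
          using C(2)[OF cs', of y] by simp
        also have "\<dots> \<le> S * mu s y powr (- p)"
        proof (intro mult_mono mu_powr_mono)
          have "real K \<le> real (length (cs @ bs))" using J cs by simp
          then have "c * real K \<le> c * real (length (cs @ bs))" using c by (intro mult_left_mono) auto
          then show "m - c * real (length (cs @ bs)) \<le> - p" by (simp add: p_def)
        qed (use S[OF cs'] S0 in auto)
        also have "mu s y powr (- p) \<le> k powr p * mu s z powr (- p) * (1 + norm w) powr (max 1 (1 / s) * p)"
        proof -
          have "mu s z \<le> k * mu s (z + t *\<^sub>R w) * (1 + norm (t *\<^sub>R w)) powr max 1 (1 / s)"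
            unfolding k_def by (rule mu_moderate[OF s])
          also have "z + t *\<^sub>R w = y" by (simp add: y_def)
          also have "(1 + norm (t *\<^sub>R w)) powr max 1 (1 / s) \<le> (1 + norm w) powr max 1 (1 / s)"
            using t by (intro powr_mono2) (auto simp: mult_left_le_one_le)
          finally have "mu s z \<le> k * mu s y * (1 + norm w) powr max 1 (1 / s)"
            using k0 my by (simp add: mult_left_mono)
          then have "mu s z powr p \<le> (k * mu s y * (1 + norm w) powr max 1 (1 / s)) powr p"
            using p0 mz by (intro powr_mono2) auto
          also have "\<dots> = k powr p * mu s y powr p * (1 + norm w) powr (max 1 (1 / s) * p)"
            using k0 my by (simp add: powr_mult powr_powr)
          finally have "mu s z powr p \<le> k powr p * mu s y powr p * (1 + norm w) powr (max 1 (1 / s) * p)" .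
          then have "mu s z powr p * (mu s y powr (- p) * mu s z powr (- p))
            \<le> (k powr p * mu s y powr p * (1 + norm w) powr (max 1 (1 / s) * p)) * (mu s y powr (- p) * mu s z powr (- p))"
            by (intro mult_right_mono) auto
          moreover have "mu s z powr p * mu s z powr (- p) = 1" "mu s y powr p * mu s y powr (- p) = 1"
            using mz my by (simp_all add: powr_add[symmetric])
          moreover have "A * A' = 1 \<Longrightarrow> E * E' = 1 \<Longrightarrow> A * (E' * A') \<le> (q * E * W) * (E' * A') \<Longrightarrow> E' \<le> q * A' * W" for A A' E E' q W :: real
          proof -
            assume *: "A * A' = 1" "E * E' = 1" "A * (E' * A') \<le> (q * E * W) * (E' * A')"
            have "A * (E' * A') = (A * A') * E'" "(q * E * W) * (E' * A') = (E * E') * (q * A' * W)" by (simp_all only: mult_ac)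
            with * show ?thesis by simp
          qed
          ultimately show ?thesis by blast
        qed
        finally show "norm (pderivs cs (pderivs bs b) (t *\<^sub>R w + z)) \<le> Mx"
          using S0 by (simp add: Mx_def y_def mult_left_mono)
      qed auto
      also have "(d * norm w) ^ J * Mx \<le> (d ^ J * (1 + norm w) powr real K) * Mx"
      proof (intro mult_right_mono Mx0)
        have "norm w ^ J \<le> (1 + norm w) ^ J" by (intro power_mono) auto
        also have "\<dots> = (1 + norm w) powr real J" using w1 by (simp add: powr_realpow)
        also have "\<dots> \<le> (1 + norm w) powr real K" using J by (intro weight_mono) simp
        finally show "(d * norm w) ^ J \<le> d ^ J * (1 + norm w) powr real K"
          by (simp add: power_mult_distrib d_def mult_left_mono)
      qed
      also have "\<dots> = (d ^ J * S * k powr p) * mu s z powr (- p) * ((1 + norm w) powr real K * (1 + norm w) powr (max 1 (1 / s) * p))"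
        by (simp only: Mx_def mult_ac)
      also have "(1 + norm w) powr real K * (1 + norm w) powr (max 1 (1 / s) * p) = (1 + norm w) powr Lr"
        by (simp add: Lr_def powr_add)
      finally show ?thesis by simp
    qed
    moreover have "0 \<le> d ^ J * S * k powr p" using S0 by (simp add: d_def)
    ultimately show ?thesis by blast
  qed
  have "set bs \<subseteq> Basis \<Longrightarrow> J \<le> K \<Longrightarrow> K \<le> length bs + J \<Longrightarrow>
     \<exists>C\<ge>0. \<forall>z. derivs_le n Lr (C * mu s z powr (- p)) (taylor_rem J (pderivs bs b) z)" for bs J
  proof (induction n arbitrary: bs J)
    case 0
    from base[OF 0] show ?case by (auto simp del: split_paired_All)
  next
    case (Suc n)
    from base[OF Suc.prems] obtain C0 where C0: "0 \<le> C0"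
      "\<And>z w. norm (taylor_rem J (pderivs bs b) z w) \<le> C0 * mu s z powr (- p) * (1 + norm w) powr Lr" by blast
    have sm: "smooth (pderivs bs b)" using b Suc.prems(1) by (rule smooth_pderivs)
    have "\<exists>C. \<forall>e\<in>(Basis :: ((real^'d) \<times> (real^'d)) set). 0 \<le> C e \<and> (\<forall>z. derivs_le n Lr (C e * mu s z powr (- p)) (partial_deriv e (taylor_rem J (pderivs bs b) z)))"
    proof (intro bchoice ballI)
      fix e :: "(real^'d) \<times> (real^'d)" assume e: "e \<in> Basis"
      have "\<exists>C\<ge>0. \<forall>z. derivs_le n Lr (C * mu s z powr (- p)) (taylor_rem (J - 1) (pderivs (e # bs) b) z)"
        using Suc.prems e by (intro Suc.IH) auto
      then show "\<exists>C. 0 \<le> C \<and> (\<forall>z. derivs_le n Lr (C * mu s z powr (- p)) (partial_deriv e (taylor_rem J (pderivs bs b) z)))"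
        using partial_deriv_taylor_rem[OF sm e] by simp
    qed
    then obtain C where C: "\<And>e. e \<in> Basis \<Longrightarrow> 0 \<le> C e"
      "\<And>e z. e \<in> Basis \<Longrightarrow> derivs_le n Lr (C e * mu s z powr (- p)) (partial_deriv e (taylor_rem J (pderivs bs b) z))" by blast
    define S where "S = C0 + (\<Sum>e\<in>Basis. C e)"
    have S: "C0 \<le> S" "\<And>e. e \<in> Basis \<Longrightarrow> C e \<le> S" "0 \<le> S"
    proof -
      have nn: "0 \<le> (\<Sum>e\<in>Basis. C e)" using C(1) by (intro sum_nonneg) auto
      show "C0 \<le> S" "0 \<le> S" using nn C0(1) by (auto simp: S_def)
      fix e :: "(real^'d) \<times> (real^'d)" assume "e \<in> Basis"
      then have "C e \<le> (\<Sum>e\<in>Basis. C e)" using C(1) by (intro member_le_sum) auto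
      then show "C e \<le> S" using C0(1) by (simp add: S_def)
    qed
    have "derivs_le (Suc n) Lr (S * mu s z powr (- p)) (taylor_rem J (pderivs bs b) z)" for z
      unfolding derivs_le.simps
    proof (intro conjI allI ballI)
      fix w :: "(real^'d) \<times> (real^'d)"
      have "C0 * mu s z powr (- p) * (1 + norm w) powr Lr \<le> S * mu s z powr (- p) * (1 + norm w) powr Lr"
        using S by (intro mult_right_mono) auto
      with C0(2)[of z w] show "norm (taylor_rem J (pderivs bs b) z w) \<le> S * mu s z powr (- p) * (1 + norm w) powr Lr" by linarith
    next
      fix e :: "(real^'d) \<times> (real^'d)" assume e: "e \<in> Basis"
      show "derivs_le n Lr (S * mu s z powr (- p)) (partial_deriv e (taylor_rem J (pderivs bs b) z))"
        by (rule derivs_le_weaken[OF C(2)[OF e, of z] order_refl order_refl]) (use S(2)[OF e] in \<open>auto intro: mult_right_mono\<close>)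
    qed
    with S(3) show ?case by blast
  qed
  from this[of "[]" K] show ?thesis by (simp add: Lr_def p_def c_def)
qed

text \<open>Covariance and the Taylor expansion, transported to \<open>u\<close>. The symbol is conjugated in the
  adjoint operator, and the conjugate linear action of \<open>u\<close> conjugates the Taylor coefficients
  back.\<close>

lemma weyl_dist_expansion:
  fixes a :: "(real^'d) \<times> (real^'d) \<Rightarrow> complex" and \<phi> :: "real^'d \<Rightarrow> complex"
  assumes L: "0 \<le> L" and K: "real K \<le> L" and a: "symbol L a" and R: "symbol L (taylor_rem K (\<lambda>w. cnj (a w)) z)"
    and u: "bounded_functional u" and f: "schwartz f" and \<phi>: "schwartz \<phi>" "\<phi> \<noteq> (\<lambda>_. 0)"
  shows "weyl_dist a u (phase_shift z f) = of_real ((2 * pi) powr (- real CARD('d))) *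
    ((\<Sum>k<K. \<Sum>bs\<in>basis_lists k. inverse (fact k) * pderivs bs a z * u (phase_shift z (weyl_int (monomial bs) f)))
      + u (phase_shift z (weyl_int (taylor_rem K (\<lambda>w. cnj (a w)) z) f)))"
proof -
  let ?b = "\<lambda>w. cnj (a w)"
  let ?c = "complex_of_real ((2 * pi) powr (- real CARD('d)))"
  let ?l = "\<lambda>f. u (phase_shift z f)"
  note l = phase_shift_functional(1)[OF u, of z]
  have b: "symbol L ?b" using a by (rule symbol_cnj)
  have W: "schwartz (weyl_int (monomial bs) f)" if "bs \<in> basis_lists k" for k bs
    using that by (intro schwartz_weyl_int[OF _ monomial_symbol f]) (auto simp: basis_lists_def)
  let ?c1 = "\<lambda>k bs. inverse (fact k) * pderivs bs ?b z"
  have W1: "schwartz (\<lambda>x. ?c1 k bs * weyl_int (monomial bs) f x)" if "bs \<in> basis_lists k" for k bs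
    by (rule schwartz_cmult[OF W[OF that]])
  have W2: "schwartz (\<lambda>x. \<Sum>bs\<in>basis_lists k. ?c1 k bs * weyl_int (monomial bs) f x)" for k
    by (rule schwartz_sum[OF W1])
  have W3: "schwartz (\<lambda>x. \<Sum>k<K. \<Sum>bs\<in>basis_lists k. ?c1 k bs * weyl_int (monomial bs) f x)"
    by (rule schwartz_sum[OF W2])
  have WR: "schwartz (weyl_int (taylor_rem K ?b z) f)" by (rule schwartz_weyl_int[OF L R f])
  have "weyl_dist a u (phase_shift z f) = u (\<lambda>x. ?c * weyl_int ?b (phase_shift z f) x)"
    unfolding weyl_dist_def weyl_op_eq[OF L b phase_shift_schwartz[OF f] \<phi>] ..
  also have "\<dots> = ?c * u (weyl_int ?b (phase_shift z f))"
    using bounded_functionalD(2)[OF u schwartz_weyl_int[OF L b phase_shift_schwartz[OF f]], of ?c] by simp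
  also have "u (weyl_int ?b (phase_shift z f)) = ?l (weyl_int (\<lambda>w. ?b (w + z)) f)"
    unfolding weyl_int_phase_shift[OF symbol_smooth[OF b] schwartz_smooth[OF f]] ..
  also have "\<dots> = ?l (\<lambda>x. \<Sum>k<K. \<Sum>bs\<in>basis_lists k. ?c1 k bs * weyl_int (monomial bs) f x) + ?l (weyl_int (taylor_rem K ?b z) f)"
    unfolding weyl_int_taylor[OF L K symbol_smooth[OF b] R f] by (rule bounded_functionalD(1)[OF l W3 WR])
  also have "?l (\<lambda>x. \<Sum>k<K. \<Sum>bs\<in>basis_lists k. ?c1 k bs * weyl_int (monomial bs) f x)
     = (\<Sum>k<K. ?l (\<lambda>x. \<Sum>bs\<in>basis_lists k. ?c1 k bs * weyl_int (monomial bs) f x))"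
    by (rule bounded_functional_sum[OF l W2])
  also have "\<dots> = (\<Sum>k<K. \<Sum>bs\<in>basis_lists k. inverse (fact k) * pderivs bs a z * ?l (weyl_int (monomial bs) f))"
  proof (intro sum.cong refl)
    fix k
    have "?l (\<lambda>x. \<Sum>bs\<in>basis_lists k. ?c1 k bs * weyl_int (monomial bs) f x)
       = (\<Sum>bs\<in>basis_lists k. ?l (\<lambda>x. ?c1 k bs * weyl_int (monomial bs) f x))"
      by (rule bounded_functional_sum[OF l W1])
    also have "\<dots> = (\<Sum>bs\<in>basis_lists k. inverse (fact k) * pderivs bs a z * ?l (weyl_int (monomial bs) f))"
    proof (intro sum.cong refl)
      fix bs :: "((real^'d) \<times> (real^'d)) list" assume bs: "bs \<in> basis_lists k"
      have "pderivs bs ?b z = cnj (pderivs bs a z)"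
        using pderivs_cnj[OF symbol_smooth[OF a], of bs] bs by (simp add: basis_lists_def)
      then show "?l (\<lambda>x. ?c1 k bs * weyl_int (monomial bs) f x) = inverse (fact k) * pderivs bs a z * ?l (weyl_int (monomial bs) f)"
        using bounded_functionalD(2)[OF l W[OF bs], of "?c1 k bs"] by simp
    qed
    finally show "?l (\<lambda>x. \<Sum>bs\<in>basis_lists k. ?c1 k bs * weyl_int (monomial bs) f x)
       = (\<Sum>bs\<in>basis_lists k. inverse (fact k) * pderivs bs a z * ?l (weyl_int (monomial bs) f))" .
  qed
  finally show ?thesis .
qed

text \<open>The term of order 0 is \<open>a z\<close> times the value of \<open>u\<close> at the shifted function itself, by
  Fourier inversion. The expansion is solved for it.\<close>

lemma weyl_dist_expansion_bound:
  fixes a :: "(real^'d) \<times> (real^'d) \<Rightarrow> complex" and \<phi> :: "real^'d \<Rightarrow> complex"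
  assumes L: "0 \<le> L" and K: "real (Suc K) \<le> L" and a: "symbol L a" and R: "symbol L (taylor_rem (Suc K) (\<lambda>w. cnj (a w)) z)"
    and u: "bounded_functional u" and f: "schwartz f" and \<phi>: "schwartz \<phi>" "\<phi> \<noteq> (\<lambda>_. 0)"
  shows "norm (a z) * norm (u (phase_shift z f)) \<le> (2 * pi) ^ CARD('d) * norm (weyl_dist a u (phase_shift z f))
     + (\<Sum>k<K. \<Sum>bs\<in>basis_lists (Suc k). norm (pderivs bs a z) * norm (u (phase_shift z (weyl_int (monomial bs) f))))
     + norm (u (phase_shift z (weyl_int (taylor_rem (Suc K) (\<lambda>w. cnj (a w)) z) f)))"
proof -
  define c where "c = (2 * pi) ^ CARD('d)"
  have c1: "1 \<le> c" unfolding c_def using pi_gt3 by (intro one_le_power) simp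
  have cc: "(2 * pi) powr (- real CARD('d)) = inverse c"
    by (simp add: c_def powr_minus powr_realpow)
  let ?V = "weyl_dist a u (phase_shift z f)"
  let ?X = "\<lambda>bs. u (phase_shift z (weyl_int (monomial bs) f))"
  let ?r = "u (phase_shift z (weyl_int (taylor_rem (Suc K) (\<lambda>w. cnj (a w)) z) f))"
  let ?S = "\<Sum>k<K. \<Sum>bs\<in>basis_lists (Suc k). inverse (fact (Suc k)) * pderivs bs a z * ?X bs"
  have X0: "?X [] = of_real c * u (phase_shift z f)"
  proof -
    have m: "monomial [] = (\<lambda>w :: (real^'d) \<times> (real^'d). 1)" by (rule ext) simp
    have "weyl_int (monomial []) f = (\<lambda>x. of_real c * f x)"
      unfolding m c_def using weyl_int_one[OF f] by (intro ext) simp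
    then show ?thesis using bounded_functionalD(2)[OF phase_shift_functional(1)[OF u] f, of z "of_real c"] by simp
  qed
  have "(\<Sum>k<Suc K. \<Sum>bs\<in>basis_lists k. inverse (fact k) * pderivs bs a z * ?X bs) = a z * ?X [] + ?S"
    unfolding sum.lessThan_Suc_shift by (simp add: basis_lists_0 del: fact_Suc)
  then have "?V = of_real (inverse c) * (a z * ?X [] + ?S + ?r)"
    using weyl_dist_expansion[OF L K a R u f \<phi>] unfolding cc by simp
  then have "of_real c * ?V = a z * (of_real c * u (phase_shift z f)) + ?S + ?r"
    unfolding X0 using c1 by (simp add: mult.assoc[symmetric])
  then have "of_real c * (a z * u (phase_shift z f)) = of_real c * ?V - ?S - ?r"
    by (simp add: algebra_simps)
  then have "norm (of_real c * (a z * u (phase_shift z f))) \<le> norm (of_real c * ?V) + norm ?S + norm ?r"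
    using norm_triangle_ineq4[of "of_real c * ?V - ?S" ?r] norm_triangle_ineq4[of "of_real c * ?V" ?S] by simp
  moreover have "norm ?S \<le> (\<Sum>k<K. \<Sum>bs\<in>basis_lists (Suc k). norm (pderivs bs a z) * norm (?X bs))"
  proof (intro sum_norm_le)
    fix k bs
    have "norm (inverse (fact (Suc k)) :: complex) \<le> 1"
      using fact_ge_1[of "Suc k", where 'a=real] by (simp add: norm_inverse inverse_le_1_iff del: fact_Suc)
    then show "norm (inverse (fact (Suc k)) * pderivs bs a z * ?X bs) \<le> norm (pderivs bs a z) * norm (?X bs)"
      unfolding norm_mult by (intro mult_right_mono mult_left_le_one_le) auto
  qed
  moreover have "norm (a z) * norm (u (phase_shift z f)) \<le> norm (of_real c * (a z * u (phase_shift z f)))"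
    using mult_right_mono[OF c1, of "norm (a z) * norm (u (phase_shift z f))"] c1 by (simp add: norm_mult)
  moreover have "norm (of_real c * ?V) = c * norm ?V" using c1 by (simp add: norm_mult)
  ultimately show ?thesis unfolding c_def[symmetric] by linarith
qed

section \<open>Elliptic regularity\<close>

text \<open>In \<open>weyl_dist_expansion_bound\<close> at the point \<open>dilate s t z\<close>, each intermediate term
  contains a derivative of \<open>a\<close>, which is smaller than \<open>a\<close> by a factor \<open>t powr (- min 1 s)\<close>, and
  a value of \<open>u\<close> at a function of the window class, for which the exponent \<open>q\<close> is available. All
  terms are written as multiples of \<open>norm (a (dilate s t z))\<close>, which cancels in the end. The set
  on which the bounds hold does not shrink, so the step can be iterated arbitrarily often.\<close>

lemma elliptic_gain:
  fixes u :: "(real^'d \<Rightarrow> complex) \<Rightarrow> complex" and a :: "(real^'d) \<times> (real^'d) \<Rightarrow> complex"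
    and \<phi> :: "real^'d \<Rightarrow> complex"
  assumes s: "0 < s" and u: "bounded_functional u" and a: "a \<in> shubin_symbols m s"
    and \<phi>: "schwartz \<phi>" "\<phi> \<noteq> (\<lambda>_. 0)" and r1: "r \<le> 1" and T: "1 \<le> T" and m0: "0 < m0" and M: "0 < M" and A0: "0 < A0"
    and mu: "\<And>z t. z \<in> ball z0 r \<Longrightarrow> T \<le> t \<Longrightarrow> t * m0 \<le> mu s (dilate s t z) \<and> mu s (dilate s t z) \<le> t * M"
    and ell: "\<And>z t. z \<in> ball z0 r \<Longrightarrow> T \<le> t \<Longrightarrow> A0 * mu s (dilate s t z) powr m1 \<le> norm (a (dilate s t z))"
    and der: "\<And>bs. set bs \<subseteq> Basis \<Longrightarrow> \<exists>C>0. \<forall>z\<in>ball z0 r. \<forall>t\<ge>T. norm (pderivs bs a (dilate s t z))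
        \<le> C * norm (a (dilate s t z)) * mu s (dilate s t z) powr (- min 1 s * real (length bs))"
    and dec: "rapid_decay s (weyl_dist a u) f (ball z0 r)"
    and f: "window_class \<phi> f"
    and hyp: "\<And>g. window_class \<phi> g \<Longrightarrow> \<exists>B. \<forall>z\<in>ball z0 r. \<forall>t\<ge>T. norm (u (phase_shift (dilate s t z) g)) \<le> B * t powr q"
  shows "\<exists>B. \<forall>z\<in>ball z0 r. \<forall>t\<ge>T. norm (u (phase_shift (dilate s t z) f)) \<le> B * t powr (q - min 1 s)"
proof -
  define c where "c = min 1 s"
  have c: "0 < c" using s by (simp add: c_def)
  define \<tau> where "\<tau> = q - c"
  define \<kappa> where "\<kappa> = max 1 (1 / s)"
  have \<kappa>: "1 \<le> \<kappa>" by (simp add: \<kappa>_def)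
  have fs: "schwartz f" by (rule window_class_schwartz[OF f \<phi>(1)])
  obtain N0 C0 P where P: "0 \<le> C0" "0 \<le> P" "\<And>f B z. schwartz f \<Longrightarrow> derivs_le N0 (- real N0) B f \<Longrightarrow>
       norm (u (phase_shift z f)) \<le> C0 * B * (1 + norm z) powr P"
    using phase_shift_functional(2)[OF u] by blast
  define D where "D = 1 + 2 * (norm z0 + 1)"
  define Q where "Q = max 1 s * P"
  have Zb: "(1 + norm (dilate s t z)) powr P \<le> D powr P * t powr Q" if z: "z \<in> ball z0 r" and t: "T \<le> t" for z t
    using dilate_weight_bound[OF s _ z r1 P(2)] t T by (simp add: D_def Q_def)
  \<comment> \<open>The number of terms of the expansion: large enough for the remainder to beat the growth of the
    functional and of the inverse of the symbol.\<close>
  define K where "K = nat \<lceil>(\<bar>m1\<bar> + \<bar>m\<bar> + \<bar>Q - \<tau>\<bar>) / c\<rceil>"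
  define p where "p = c * real (Suc K) - m"
  have pbig: "\<bar>m1\<bar> + \<bar>Q - \<tau>\<bar> \<le> p"
  proof -
    have "(\<bar>m1\<bar> + \<bar>m\<bar> + \<bar>Q - \<tau>\<bar>) / c \<le> real (Suc K)" unfolding K_def by linarith
    then have "\<bar>m1\<bar> + \<bar>m\<bar> + \<bar>Q - \<tau>\<bar> \<le> c * real (Suc K)" using c by (simp add: divide_le_eq mult.commute)
    then show ?thesis by (simp add: p_def)
  qed
  have p0: "0 \<le> p" using pbig by linarith
  define L0 where "L0 = \<kappa> * \<bar>m\<bar>"
  define Lr where "Lr = real (Suc K) + \<kappa> * p"
  define L where "L = L0 + Lr"
  have L0: "0 \<le> L0" "0 \<le> Lr" using \<kappa> p0 by (auto simp: L0_def Lr_def)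
  have L: "0 \<le> L" "L0 \<le> L" "Lr \<le> L" "real (Suc K) \<le> L" using L0 \<kappa> p0 by (auto simp: L_def Lr_def)
  let ?b = "\<lambda>w. cnj (a w)"
  have aL: "symbol L a"
    using shubin_symbol[OF s a] L(2) unfolding L0_def \<kappa>_def by (rule symbol_mono)
  have asm: "smooth a" by (rule symbol_smooth[OF aL])
  have bsm: "smooth ?b" by (rule smooth_cnj[OF asm])
  have bd: "\<exists>C>0. \<forall>z. norm (pderivs bs ?b z) \<le> C * mu s z powr (m - min 1 s * real (length bs))" if "set bs \<subseteq> Basis" for bs
    using shubin_pderivs[OF a that] unfolding pderivs_cnj[OF asm that] complex_mod_cnj .
  have rem: "\<exists>C\<ge>0. \<forall>z. derivs_le n Lr (C * mu s z powr (- p)) (taylor_rem (Suc K) ?b z)" for n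
    using taylor_rem_shubin[OF s bsm bd, where K="Suc K" and n=n] p0 unfolding Lr_def p_def \<kappa>_def c_def by simp
  have remL: "symbol Lr (taylor_rem (Suc K) ?b z)" for z
    using rem smooth_taylor_rem[OF bsm] by (intro symbolI) blast+
  obtain Nw Cw where Cw: "0 \<le> Cw" "\<And>(b :: (real^'d) \<times> (real^'d) \<Rightarrow> complex) f A B. symbol Lr b \<Longrightarrow> schwartz f \<Longrightarrow> derivs_le Nw Lr A b \<Longrightarrow>
     derivs_le Nw (- real Nw) B f \<Longrightarrow> derivs_le N0 (- real N0) (Cw * A * B) (weyl_int b f)"
    using weyl_int_derivs_le[OF L0(2), of N0 N0, where 'a="real^'d"] by blast
  obtain Cr where Cr: "0 \<le> Cr" "\<And>z. derivs_le Nw Lr (Cr * mu s z powr (- p)) (taylor_rem (Suc K) ?b z)"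
    using rem by blast
  obtain Bf where Bf: "derivs_le Nw (- real Nw) Bf f" using schwartz_derivs_le[OF fs] by blast
  note Bf0 = derivs_le_nonneg[OF Bf]
  have Rb: "norm (u (phase_shift (dilate s t z) (weyl_int (taylor_rem (Suc K) ?b (dilate s t z)) f)))
      \<le> (C0 * Cw * Cr * Bf * D powr P * m0 powr (- p)) * t powr (Q - p)" if z: "z \<in> ball z0 r" and t: "T \<le> t" for z t
  proof -
    let ?Z = "dilate s t z"
    have t0: "0 < t" using t T by simp
    have "norm (u (phase_shift ?Z (weyl_int (taylor_rem (Suc K) ?b ?Z) f)))
       \<le> C0 * (Cw * (Cr * mu s ?Z powr (- p)) * Bf) * (1 + norm ?Z) powr P"
      by (rule P(3)[OF schwartz_weyl_int[OF L0(2) remL fs] Cw(2)[OF remL fs Cr(2) Bf]])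
    also have "\<dots> \<le> C0 * (Cw * (Cr * (t * m0) powr (- p)) * Bf) * (D powr P * t powr Q)"
    proof (intro mult_mono mult_nonneg_nonneg Zb[OF z t] order_refl)
      show "mu s ?Z powr (- p) \<le> (t * m0) powr (- p)"
        using mu[OF z t] t0 m0 p0 by (intro powr_mono2') auto
    qed (use P Cw Cr Bf0 in auto)
    also have "\<dots> = (C0 * Cw * Cr * Bf * D powr P * m0 powr (- p)) * (t powr Q * t powr (- p))"
      using t0 m0 by (simp add: powr_mult mult_ac)
    also have "t powr Q * t powr (- p) = t powr (Q - p)" by (simp add: powr_add[symmetric])
    finally show ?thesis .
  qed
  define N where "N = nat \<lceil>\<bar>m1\<bar> + \<bar>\<tau>\<bar>\<rceil>"
  have N: "\<bar>m1\<bar> - real N \<le> \<tau>" unfolding N_def by linarith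
  obtain Bv where Bv: "\<And>z t. z \<in> ball z0 r \<Longrightarrow> 1 \<le> t \<Longrightarrow> norm (weyl_dist a u (phase_shift (dilate s t z) f)) \<le> Bv * t powr (- real N)"
    using dec unfolding rapid_decay_def by blast
  have terms: "\<exists>B\<ge>0. \<forall>z\<in>ball z0 r. \<forall>t\<ge>T. norm (pderivs bs a (dilate s t z)) * norm (u (phase_shift (dilate s t z) (weyl_int (monomial bs) f)))
      \<le> norm (a (dilate s t z)) * (B * t powr \<tau>)" if bs: "bs \<in> basis_lists (Suc k)" for k bs
  proof -
    have sb: "set bs \<subseteq> Basis" "length bs = Suc k" using bs by (auto simp: basis_lists_def)
    obtain C where C: "0 < C" "\<And>z t. z \<in> ball z0 r \<Longrightarrow> T \<le> t \<Longrightarrow> norm (pderivs bs a (dilate s t z))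
        \<le> C * norm (a (dilate s t z)) * mu s (dilate s t z) powr (- c * real (length bs))"
      using der[OF sb(1)] unfolding c_def by blast
    obtain B where B: "\<And>z t. z \<in> ball z0 r \<Longrightarrow> T \<le> t \<Longrightarrow> norm (u (phase_shift (dilate s t z) (weyl_int (monomial bs) f))) \<le> B * t powr q"
      using hyp[OF window_class_weyl[OF \<phi>(1) sb(1) f]] by blast
    have "norm (pderivs bs a (dilate s t z)) * norm (u (phase_shift (dilate s t z) (weyl_int (monomial bs) f)))
      \<le> norm (a (dilate s t z)) * ((C * m0 powr (- c) * \<bar>B\<bar>) * t powr \<tau>)" if z: "z \<in> ball z0 r" and t: "T \<le> t" for z t
    proof -
      let ?Z = "dilate s t z"
      have t0: "0 < t" using t T by simp
      have "mu s ?Z powr (- c * real (length bs)) \<le> mu s ?Z powr (- c)"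
        using c sb(2) by (intro mu_powr_mono) (simp add: mult_le_cancel_left1)
      also have "\<dots> \<le> (t * m0) powr (- c)" using mu[OF z t] t0 m0 c by (intro powr_mono2') auto
      also have "\<dots> = t powr (- c) * m0 powr (- c)" using t0 m0 by (simp add: powr_mult)
      finally have "C * norm (a ?Z) * mu s ?Z powr (- c * real (length bs)) \<le> C * norm (a ?Z) * (t powr (- c) * m0 powr (- c))"
        using C(1) by (intro mult_left_mono) auto
      with C(2)[OF z t] have 1: "norm (pderivs bs a ?Z) \<le> C * norm (a ?Z) * (t powr (- c) * m0 powr (- c))" by linarith
      have "B * t powr q \<le> \<bar>B\<bar> * t powr q" by (intro mult_right_mono) auto
      with B[OF z t] have 2: "norm (u (phase_shift ?Z (weyl_int (monomial bs) f))) \<le> \<bar>B\<bar> * t powr q" by linarith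
      have "norm (pderivs bs a ?Z) * norm (u (phase_shift ?Z (weyl_int (monomial bs) f)))
         \<le> (C * norm (a ?Z) * (t powr (- c) * m0 powr (- c))) * (\<bar>B\<bar> * t powr q)"
        using C(1) by (intro mult_mono 1 2) auto
      also have "\<dots> = norm (a ?Z) * ((C * m0 powr (- c) * \<bar>B\<bar>) * (t powr q * t powr (- c)))" by (simp only: mult_ac)
      also have "t powr q * t powr (- c) = t powr \<tau>" by (simp add: powr_add[symmetric] \<tau>_def)
      finally show ?thesis .
    qed
    moreover have "0 \<le> C * m0 powr (- c) * \<bar>B\<bar>" using C(1) by simp
    ultimately show ?thesis by blast
  qed
  define cB where "cB bs = (SOME B. 0 \<le> B \<and> (\<forall>z\<in>ball z0 r. \<forall>t\<ge>T. norm (pderivs bs a (dilate s t z)) * norm (u (phase_shift (dilate s t z) (weyl_int (monomial bs) f)))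
      \<le> norm (a (dilate s t z)) * (B * t powr \<tau>)))" for bs
  have cB: "norm (pderivs bs a (dilate s t z)) * norm (u (phase_shift (dilate s t z) (weyl_int (monomial bs) f)))
      \<le> norm (a (dilate s t z)) * (cB bs * t powr \<tau>)" if "bs \<in> basis_lists (Suc k)" "z \<in> ball z0 r" "T \<le> t" for k bs z t
    using someI_ex[OF terms[OF that(1), unfolded Bex_def]] that(2,3) unfolding cB_def by blast
  define S where "S = (\<Sum>k<K. \<Sum>bs\<in>basis_lists (Suc k). cB bs)"
  define d where "d = (2 * pi) ^ CARD('d)"
  define KR where "KR = C0 * Cw * Cr * Bf * D powr P * m0 powr (- p)"
  define KI where "KI = M powr \<bar>m1\<bar> / A0"
  have KI0: "0 \<le> KI" using A0 by (simp add: KI_def)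
  have KR0: "0 \<le> KR" using P Cw Cr Bf0 by (simp add: KR_def)
  have "norm (u (phase_shift (dilate s t z) f)) \<le> (KI * (d * \<bar>Bv\<bar>) + S + KI * KR) * t powr \<tau>"
    if z: "z \<in> ball z0 r" and t: "T \<le> t" for z t
  proof -
    let ?Z = "dilate s t z"
    have t1: "1 \<le> t" "0 < t" using t T by auto
    have muZ: "1 \<le> mu s ?Z" by (rule mu_ge_1)
    have apos: "0 < norm (a ?Z)"
    proof -
      have "0 < A0 * mu s ?Z powr m1" using A0 muZ by simp
      then show ?thesis using ell[OF z t] by linarith
    qed
    \<comment> \<open>The inverse of the symbol grows at most like a power of \<open>t\<close>. Hence terms without a factor \<open>a\<close> may be
      multiplied by the right-hand side.\<close>
    have inv: "1 \<le> norm (a ?Z) * (KI * t powr \<bar>m1\<bar>)"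
    proof -
      have "mu s ?Z powr (- m1) \<le> mu s ?Z powr \<bar>m1\<bar>" by (intro mu_powr_mono) simp
      also have "\<dots> \<le> (t * M) powr \<bar>m1\<bar>" using mu[OF z t] muZ by (intro powr_mono2) auto
      also have "\<dots> = A0 * (KI * t powr \<bar>m1\<bar>)" using t1 M A0 by (simp add: powr_mult KI_def)
      finally have "mu s ?Z powr m1 * mu s ?Z powr (- m1) \<le> mu s ?Z powr m1 * (A0 * (KI * t powr \<bar>m1\<bar>))"
        by (intro mult_left_mono) auto
      moreover have "mu s ?Z powr m1 * mu s ?Z powr (- m1) = 1" using muZ by (simp add: powr_add[symmetric])
      moreover have "mu s ?Z powr m1 * (A0 * (KI * t powr \<bar>m1\<bar>)) = (A0 * mu s ?Z powr m1) * (KI * t powr \<bar>m1\<bar>)" by (simp only: mult_ac)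
      moreover have "(A0 * mu s ?Z powr m1) * (KI * t powr \<bar>m1\<bar>) \<le> norm (a ?Z) * (KI * t powr \<bar>m1\<bar>)"
        using ell[OF z t] KI0 by (intro mult_right_mono) auto
      ultimately show ?thesis by linarith
    qed
    have weak: "X \<le> norm (a ?Z) * ((KI * Y) * t powr \<tau>)" if "X \<le> Y * t powr e" "0 \<le> Y" "\<bar>m1\<bar> + e \<le> \<tau>" for X Y e
    proof -
      have "X \<le> (Y * t powr e) * 1" using that(1) by simp
      also have "\<dots> \<le> (Y * t powr e) * (norm (a ?Z) * (KI * t powr \<bar>m1\<bar>))"
        using inv that(2) by (intro mult_left_mono) auto
      also have "\<dots> = (norm (a ?Z) * (KI * Y)) * (t powr \<bar>m1\<bar> * t powr e)" by (simp only: mult_ac)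
      also have "t powr \<bar>m1\<bar> * t powr e = t powr (\<bar>m1\<bar> + e)" by (rule powr_add[symmetric])
      also have "(norm (a ?Z) * (KI * Y)) * t powr (\<bar>m1\<bar> + e) \<le> (norm (a ?Z) * (KI * Y)) * t powr \<tau>"
        using that t1 KI0 by (intro mult_left_mono powr_mono) auto
      finally show ?thesis by (simp add: mult.assoc)
    qed
    have 1: "d * norm (weyl_dist a u (phase_shift ?Z f)) \<le> norm (a ?Z) * ((KI * (d * \<bar>Bv\<bar>)) * t powr \<tau>)"
    proof (rule weak)
      have d0: "0 \<le> d" by (simp add: d_def)
      have "Bv * t powr (- real N) \<le> \<bar>Bv\<bar> * t powr (- real N)" by (intro mult_right_mono) auto
      with Bv[OF z t1(1)] have "norm (weyl_dist a u (phase_shift ?Z f)) \<le> \<bar>Bv\<bar> * t powr (- real N)" by linarith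
      then show "d * norm (weyl_dist a u (phase_shift ?Z f)) \<le> (d * \<bar>Bv\<bar>) * t powr (- real N)"
        using d0 by (simp add: mult.assoc mult_left_mono)
      show "0 \<le> d * \<bar>Bv\<bar>" using d0 by simp
      show "\<bar>m1\<bar> + - real N \<le> \<tau>" using N by simp
    qed
    have 2: "(\<Sum>k<K. \<Sum>bs\<in>basis_lists (Suc k). norm (pderivs bs a ?Z) * norm (u (phase_shift ?Z (weyl_int (monomial bs) f))))
       \<le> norm (a ?Z) * (S * t powr \<tau>)"
      unfolding S_def sum_distrib_left sum_distrib_right by (intro sum_mono cB z t)
    have 3: "norm (u (phase_shift ?Z (weyl_int (taylor_rem (Suc K) ?b ?Z) f))) \<le> norm (a ?Z) * ((KI * KR) * t powr \<tau>)"
    proof (rule weak)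
      show "norm (u (phase_shift ?Z (weyl_int (taylor_rem (Suc K) ?b ?Z) f))) \<le> KR * t powr (Q - p)"
        using Rb[OF z t] by (simp add: KR_def)
      show "\<bar>m1\<bar> + (Q - p) \<le> \<tau>" using pbig by linarith
    qed (rule KR0)
    have "norm (a ?Z) * norm (u (phase_shift ?Z f)) \<le> d * norm (weyl_dist a u (phase_shift ?Z f))
     + (\<Sum>k<K. \<Sum>bs\<in>basis_lists (Suc k). norm (pderivs bs a ?Z) * norm (u (phase_shift ?Z (weyl_int (monomial bs) f))))
     + norm (u (phase_shift ?Z (weyl_int (taylor_rem (Suc K) ?b ?Z) f)))"
      unfolding d_def by (rule weyl_dist_expansion_bound[OF L(1,4) aL symbol_mono[OF remL L(3)] u fs \<phi>])
    also have "\<dots> \<le> norm (a ?Z) * ((KI * (d * \<bar>Bv\<bar>)) * t powr \<tau>) + norm (a ?Z) * (S * t powr \<tau>) + norm (a ?Z) * ((KI * KR) * t powr \<tau>)"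
      by (intro add_mono 1 2 3)
    also have "\<dots> = norm (a ?Z) * ((KI * (d * \<bar>Bv\<bar>) + S + KI * KR) * t powr \<tau>)" by (simp add: algebra_simps)
    finally show ?thesis using apos by (simp add: mult_le_cancel_left_pos)
  qed
  then show ?thesis unfolding \<tau>_def c_def by blast
qed

theorem theorem6p4:
  fixes s m m1 :: real
    and u :: "(real^'d \<Rightarrow> complex) \<Rightarrow> complex"
    and a :: "(real^'d) \<times> (real^'d) \<Rightarrow> complex"
    and \<phi> :: "real^'d \<Rightarrow> complex"
  assumes "s > 0"
    and "schwartz \<phi>" and "\<phi> \<noteq> (\<lambda>_. 0)"
    and "tempered_distribution u"
    and "a \<in> shubin_symbols m s"
    and "m1 \<le> m"
  shows "gabor_WF \<phi> s u \<subseteq> gabor_WF \<phi> s (weyl_dist a u) \<union> char_set s m1 a"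
proof
  fix z0 assume z0: "z0 \<in> gabor_WF \<phi> s u"
  note s = assms(1) and \<phi> = assms(2,3) and a = assms(5)
  define v where "v = weyl_dist a u"
  have nz: "z0 \<noteq> 0" using z0 by (simp add: gabor_WF_def)
  have ub: "bounded_functional u" by (rule tempered_imp_bounded_functional[OF assms(4)])
  have aS: "symbol (max 1 (1 / s) * \<bar>m\<bar>) a" by (rule shubin_symbol[OF s a])
  have vb: "bounded_functional v" unfolding v_def
    by (rule weyl_dist_bounded_functional[OF _ aS ub \<phi>]) simp
  have asm: "smooth a" by (rule symbol_smooth[OF aS])
  define c0 where "c0 = (2 * pi) powr (- real CARD('d) / 2)"
  have c0: "0 < c0" by (simp add: c0_def)
  have st: "norm (stft \<phi> w (t *\<^sub>R x, t powr s *\<^sub>R \<xi>)) = c0 * norm (w (phase_shift (dilate s t (x, \<xi>)) \<phi>))" for w t x \<xi>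
    by (simp add: stft_def phase_shift_def dilate_def norm_mult c0_def)
  show "z0 \<in> gabor_WF \<phi> s (weyl_dist a u) \<union> char_set s m1 a"
  proof (rule ccontr)
    assume "z0 \<notin> gabor_WF \<phi> s (weyl_dist a u) \<union> char_set s m1 a"
    then have nwf: "z0 \<notin> gabor_WF \<phi> s v" and nch: "noncharacteristic s m1 a z0"
      using nz by (auto simp: v_def char_set_def)
    from nwf nz obtain U where U: "open U" "z0 \<in> U"
      "\<And>N::real. 0 \<le> N \<Longrightarrow> \<exists>B. \<forall>(x, \<xi>)\<in>U. \<forall>t>0. t powr N * norm (stft \<phi> v (t *\<^sub>R x, t powr s *\<^sub>R \<xi>)) \<le> B"
      unfolding gabor_WF_def by blast
    from nch obtain \<epsilon> C R where ch: "\<epsilon> > 0" "C > 0" "R > 0"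
       "\<forall>(x, \<xi>) \<in> aniso_cone s (sphere_proj s z0) \<epsilon>. norm x + norm \<xi> powr (1 / s) \<ge> R \<longrightarrow>
          norm (a (x, \<xi>)) \<ge> C * mu s (x, \<xi>) powr m1"
       "\<forall>\<alpha> \<beta>. \<exists>C'>0. \<forall>(x, \<xi>) \<in> aniso_cone s (sphere_proj s z0) \<epsilon>.
          norm x + norm \<xi> powr (1 / s) \<ge> R \<longrightarrow>
          norm (phase_deriv \<alpha> \<beta> a (x, \<xi>))
            \<le> C' * norm (a (x, \<xi>)) * mu s (x, \<xi>) powr
                (- real (multi_order \<alpha>) - s * real (multi_order \<beta>))"
      unfolding noncharacteristic_def by blast
    obtain r0 T m0 M where geo: "0 < r0" "r0 \<le> 1" "1 \<le> T" "0 < m0" "0 < M"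
      "\<And>z t. z \<in> ball z0 r0 \<Longrightarrow> T \<le> t \<Longrightarrow> dilate s t z \<in> aniso_cone s (sphere_proj s z0) \<epsilon> \<and> R \<le> aniso_norm s (dilate s t z)
       \<and> t * m0 \<le> mu s (dilate s t z) \<and> mu s (dilate s t z) \<le> t * M"
      using cone_neighbourhood[OF s nz ch(1), of R] by blast
    obtain r1 where r1: "0 < r1" "ball z0 r1 \<subseteq> U" using U(1,2) openE by blast
    \<comment> \<open>Passing from \<open>\<phi>\<close> to the window class shrinks the neighbourhood, hence two radii.\<close>
    define r2 where "r2 = min r0 r1"
    define r where "r = r2 / 2"
    have r: "0 < r" "r < r2" "r2 \<le> 1" "r \<le> 1" "r \<le> r0" using geo(1,2) r1(1) by (auto simp: r_def r2_def)
    have sub: "ball z0 r \<subseteq> ball z0 r0" using r by auto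
    have decay: "rapid_decay s v \<phi> (ball z0 r')" if "r' < r2" for r'
      unfolding rapid_decay_def
    proof
      fix N :: nat
      obtain B where B: "\<forall>(x, \<xi>)\<in>U. \<forall>t>0. t powr real N * norm (stft \<phi> v (t *\<^sub>R x, t powr s *\<^sub>R \<xi>)) \<le> B"
        using U(3)[of "real N"] by auto
      have "norm (v (phase_shift (dilate s t z) \<phi>)) \<le> (B / c0) * t powr (- real N)" if z: "z \<in> ball z0 r'" and t: "1 \<le> t" for z t
      proof -
        obtain x \<xi> where zz: "z = (x, \<xi>)" by (cases z)
        have "z \<in> U" using z \<open>r' < r2\<close> r1(2) by (auto simp: r2_def)
        then have "t powr real N * (c0 * norm (v (phase_shift (dilate s t z) \<phi>))) \<le> B"
          using B t unfolding st[symmetric] zz by force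
        then have "(t powr real N * (c0 * norm (v (phase_shift (dilate s t z) \<phi>)))) * (t powr (- real N) / c0) \<le> B * (t powr (- real N) / c0)"
          using c0 by (intro mult_right_mono) auto
        moreover have "t powr real N * t powr (- real N) = 1" using t by (simp add: powr_add[symmetric])
        moreover have "E * E' = 1 \<Longrightarrow> (E * (c0 * X)) * (E' / c0) = X" for E E' X :: real
          using c0 by (simp add: mult_ac)
        ultimately show ?thesis by simp
      qed
      then show "\<exists>B. \<forall>z\<in>ball z0 r'. \<forall>t\<ge>1. norm (v (phase_shift (dilate s t z) \<phi>)) \<le> B * t powr (- real N)" by blast
    qed
    have decW: "rapid_decay s v f (ball z0 r)" if "window_class \<phi> f" for f
      using rapid_decay_window_class[OF vb s \<phi>(1) decay r(3) that] r(2) by blast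
    have ell: "C * mu s (dilate s t z) powr m1 \<le> norm (a (dilate s t z))" if "z \<in> ball z0 r" "T \<le> t" for z t
    proof -
      obtain x \<xi> where e: "dilate s t z = (x, \<xi>)" by (cases "dilate s t z")
      have "(x, \<xi>) \<in> aniso_cone s (sphere_proj s z0) \<epsilon>" "R \<le> norm x + norm \<xi> powr (1 / s)"
        using geo(6)[of z t] that sub e by (auto simp: aniso_norm_def)
      then show ?thesis using ch(4) unfolding e by blast
    qed
    have der: "\<exists>C>0. \<forall>z\<in>ball z0 r. \<forall>t\<ge>T. norm (pderivs bs a (dilate s t z))
        \<le> C * norm (a (dilate s t z)) * mu s (dilate s t z) powr (- min 1 s * real (length bs))" if bs: "set bs \<subseteq> Basis" for bs
    proof -
      obtain \<alpha> \<beta> where ab: "pderivs bs a = phase_deriv \<alpha> \<beta> a" "multi_order \<alpha> + multi_order \<beta> = length bs"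
        using pderivs_eq_phase_deriv[OF asm bs] by blast
      obtain C' where C': "C' > 0" "\<forall>(x, \<xi>) \<in> aniso_cone s (sphere_proj s z0) \<epsilon>.
          norm x + norm \<xi> powr (1 / s) \<ge> R \<longrightarrow> norm (phase_deriv \<alpha> \<beta> a (x, \<xi>))
            \<le> C' * norm (a (x, \<xi>)) * mu s (x, \<xi>) powr (- real (multi_order \<alpha>) - s * real (multi_order \<beta>))"
        using ch(5) by blast
      have "norm (pderivs bs a (dilate s t z)) \<le> C' * norm (a (dilate s t z)) * mu s (dilate s t z) powr (- min 1 s * real (length bs))"
        if "z \<in> ball z0 r" "T \<le> t" for z t
      proof -
        obtain x \<xi> where e: "dilate s t z = (x, \<xi>)" by (cases "dilate s t z")
        have "(x, \<xi>) \<in> aniso_cone s (sphere_proj s z0) \<epsilon>" "R \<le> norm x + norm \<xi> powr (1 / s)"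
          using geo(6)[of z t] that sub e by (auto simp: aniso_norm_def)
        then have "norm (phase_deriv \<alpha> \<beta> a (x, \<xi>))
            \<le> C' * norm (a (x, \<xi>)) * mu s (x, \<xi>) powr (- real (multi_order \<alpha>) - s * real (multi_order \<beta>))"
          using C'(2) by blast
        also have "\<dots> \<le> C' * norm (a (x, \<xi>)) * mu s (x, \<xi>) powr (- min 1 s * real (length bs))"
          using C'(1) order_mono[of s "multi_order \<alpha>" "multi_order \<beta>"] unfolding ab(2)
          by (intro mult_left_mono mu_powr_mono) simp_all
        finally show ?thesis unfolding e ab(1) .
      qed
      with C'(1) show ?thesis by blast
    qed
    have mu: "t * m0 \<le> mu s (dilate s t z) \<and> mu s (dilate s t z) \<le> t * M" if "z \<in> ball z0 r" "T \<le> t" for z t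
      using geo(6)[of z t] that sub by blast
    obtain N0 C0 P where P: "0 \<le> C0" "0 \<le> P" "\<And>f B z. schwartz f \<Longrightarrow> derivs_le N0 (- real N0) B f \<Longrightarrow>
         norm (u (phase_shift z f)) \<le> C0 * B * (1 + norm z) powr P"
      using phase_shift_functional(2)[OF ub] by blast
    define D where "D = 1 + 2 * (norm z0 + 1)"
    define Q where "Q = max 1 s * P"
    have nb: "norm z \<le> norm z0 + 1" if "z \<in> ball z0 r" for z
    proof -
      have "norm z \<le> norm z0 + norm (z0 - z)" using norm_triangle_ineq4[of z0 "z0 - z"] by simp
      moreover have "norm (z0 - z) < 1" using that r by (simp add: dist_norm)
      ultimately show ?thesis by linarith
    qed
    have Zb: "(1 + norm (dilate s t z)) powr P \<le> D powr P * t powr Q" if z: "z \<in> ball z0 r" and t1: "1 \<le> t" for z t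
      using dilate_weight_bound[OF s t1 z r(4) P(2)] by (simp add: D_def Q_def)
    \<comment> \<open>The exponent decreases by \<open>min 1 s\<close> in each step, simultaneously for the whole window class.\<close>
    have boot: "\<forall>f. window_class \<phi> f \<longrightarrow> (\<exists>B. \<forall>z\<in>ball z0 r. \<forall>t\<ge>T. norm (u (phase_shift (dilate s t z) f)) \<le> B * t powr (Q - min 1 s * real j))" for j
    proof (induction j)
      case 0
      show ?case
      proof (intro allI impI)
        fix f assume "window_class \<phi> f"
        then have f: "schwartz f" using \<phi>(1) by (rule window_class_schwartz)
        obtain B where B: "derivs_le N0 (- real N0) B f" using schwartz_derivs_le[OF f] by blast
        have "norm (u (phase_shift (dilate s t z) f)) \<le> (C0 * B * D powr P) * t powr (Q - min 1 s * real 0)"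
          if z: "z \<in> ball z0 r" and t: "T \<le> t" for z t
        proof -
          have t1: "1 \<le> t" using t geo(3) by simp
          have "norm (u (phase_shift (dilate s t z) f)) \<le> C0 * B * (1 + norm (dilate s t z)) powr P" by (rule P(3)[OF f B])
          also have "\<dots> \<le> C0 * B * (D powr P * t powr Q)"
            using P(1) derivs_le_nonneg[OF B] by (intro mult_left_mono Zb[OF z t1]) auto
          finally show ?thesis by (simp add: mult.assoc)
        qed
        then show "\<exists>B. \<forall>z\<in>ball z0 r. \<forall>t\<ge>T. norm (u (phase_shift (dilate s t z) f)) \<le> B * t powr (Q - min 1 s * real 0)" by blast
      qed
    next
      case (Suc j)
      show ?case
      proof (intro allI impI)
        fix f assume f: "window_class \<phi> f"
        have "\<exists>B. \<forall>z\<in>ball z0 r. \<forall>t\<ge>T. norm (u (phase_shift (dilate s t z) f)) \<le> B * t powr ((Q - min 1 s * real j) - min 1 s)"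
          by (rule elliptic_gain[OF s ub a \<phi> r(4) geo(3,4,5) ch(2) mu ell der decW[OF f, unfolded v_def] f]) (use Suc in blast)+
        then show "\<exists>B. \<forall>z\<in>ball z0 r. \<forall>t\<ge>T. norm (u (phase_shift (dilate s t z) f)) \<le> B * t powr (Q - min 1 s * real (Suc j))"
          by (simp add: algebra_simps)
      qed
    qed
    have "\<exists>B. \<forall>(x, \<xi>)\<in>ball z0 r. \<forall>t>0. t powr N * norm (stft \<phi> u (t *\<^sub>R x, t powr s *\<^sub>R \<xi>)) \<le> B" if N: "0 \<le> N" for N :: real
    proof -
      define j where "j = nat \<lceil>(N + \<bar>Q\<bar>) / min 1 s\<rceil>"
      have "(N + \<bar>Q\<bar>) / min 1 s \<le> real j" unfolding j_def by linarith
      then have j: "Q - min 1 s * real j \<le> - N" using s by (simp add: divide_le_eq mult.commute)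
      obtain B where B: "\<And>z t. z \<in> ball z0 r \<Longrightarrow> T \<le> t \<Longrightarrow> norm (u (phase_shift (dilate s t z) \<phi>)) \<le> B * t powr (Q - min 1 s * real j)"
        using boot[of j] window_class.base by blast
      obtain B0 where B0: "derivs_le N0 (- real N0) B0 \<phi>" using schwartz_derivs_le[OF \<phi>(1)] by blast
      define E where "E = 1 + (T + T powr s) * (norm z0 + 1)"
      define B1 where "B1 = T powr N * (C0 * B0 * E powr P)"
      have "t powr N * (c0 * norm (u (phase_shift (dilate s t z) \<phi>))) \<le> c0 * (\<bar>B\<bar> + B1)" if z: "z \<in> ball z0 r" and t: "0 < t" for z t
      proof -
        have B10: "0 \<le> B1" using P(1) derivs_le_nonneg[OF B0] by (simp add: B1_def)
        have "t powr N * norm (u (phase_shift (dilate s t z) \<phi>)) \<le> \<bar>B\<bar> + B1"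
        \<comment> \<open>For \<open>t < T\<close> the dilated points stay in a bounded set.\<close>
        proof (cases "T \<le> t")
          case True
          then have t1: "1 \<le> t" using geo(3) by simp
          have "B * t powr (Q - min 1 s * real j) \<le> \<bar>B\<bar> * t powr (- N)"
            using j t1 by (intro mult_mono powr_mono) auto
          with B[OF z True] have "norm (u (phase_shift (dilate s t z) \<phi>)) \<le> \<bar>B\<bar> * t powr (- N)" by linarith
          then have "t powr N * norm (u (phase_shift (dilate s t z) \<phi>)) \<le> t powr N * (\<bar>B\<bar> * t powr (- N))"
            by (intro mult_left_mono) auto
          also have "\<dots> = \<bar>B\<bar> * (t powr N * t powr (- N))" by (simp only: mult_ac)
          also have "t powr N * t powr (- N) = 1" using t by (simp add: powr_add[symmetric])
          finally show ?thesis using B10 by simp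
        next
          case False
          have "norm (dilate s t z) \<le> norm (t *\<^sub>R fst z) + norm (t powr s *\<^sub>R snd z)"
            unfolding dilate_def by (rule norm_Pair_le)
          also have "\<dots> = t * norm (fst z) + t powr s * norm (snd z)" using t by simp
          also have "\<dots> \<le> T * (norm z0 + 1) + T powr s * (norm z0 + 1)"
            using False t s norm_fst_snd[of z] nb[OF z] by (intro add_mono mult_mono powr_mono2) auto
          finally have "1 + norm (dilate s t z) \<le> E" by (simp add: E_def distrib_right)
          then have "(1 + norm (dilate s t z)) powr P \<le> E powr P" using P(2) by (intro powr_mono2) auto
          then have "C0 * B0 * (1 + norm (dilate s t z)) powr P \<le> C0 * B0 * E powr P"
            using P(1) derivs_le_nonneg[OF B0] by (intro mult_left_mono) auto
          then have le: "norm (u (phase_shift (dilate s t z) \<phi>)) \<le> C0 * B0 * E powr P"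
            using P(3)[OF \<phi>(1) B0, of "dilate s t z"] by linarith
          have "t powr N \<le> T powr N" using t False N by (intro powr_mono2) auto
          then have "t powr N * norm (u (phase_shift (dilate s t z) \<phi>)) \<le> B1"
            unfolding B1_def by (intro mult_mono le) auto
          then show ?thesis by simp
        qed
        then have "c0 * (t powr N * norm (u (phase_shift (dilate s t z) \<phi>))) \<le> c0 * (\<bar>B\<bar> + B1)"
          using c0 by (intro mult_left_mono) auto
        then show ?thesis by (simp only: mult_ac)
      qed
      then show ?thesis unfolding st by (intro exI[of _ "c0 * (\<bar>B\<bar> + B1)"]) auto
    qed
    then have "z0 \<notin> gabor_WF \<phi> s u"
      unfolding gabor_WF_def using r(1) by (auto intro!: exI[of _ "ball z0 r"])
    with z0 show False by contradiction
  qed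
qed

end
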